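(* Let $N\ge 2$, let $\mathcal{F}$ be a torsion free sheaf on $\mathbf{P}^N$, let $H$ be a hyperplane in $\mathbf{P}^N$, and let $\mathbf{b}=[b_1,\dots,b_n]$ be an ordered sequence of integers, $b_1\ge\dots\ge b_n$. Then $\mathcal{F}\simeq\bigoplus_{i=1}^n\mathcal{O}_{\mathbf{P}^N}(b_i)$ if and only if $\mathcal{F}_H\simeq\bigoplus_{i=1}^n\mathcal{O}_H(b_i)$ and either one of the following conditions holds: i) $N=2$ and $H^1(\mathcal{F}(t))=0$ for every $t\le -b_n$; ii) $N\ge 3$ and $H^1(\mathcal{F}(t))=0$ for every $t\ll 0$.
   Context: $\mathbf{P}^N$ is the projective space of dimension $N$ over an algebraically closed field of characteristic $0$; sheaves are coherent. $\mathcal{F}_H$ denotes the restriction of $\mathcal{F}$ to $H\simeq\mathbf{P}^{N-1}$, regarded as a sheaf on $H$. *)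

theory Defs
  imports "HOL-Computational_Algebra.Polynomial" "HOL-Analysis.Abstract_Topology"
    "HOL-Algebra.Free_Abelian_Groups" "HOL-Algebra.Generated_Groups" "HOL-Algebra.Module"
begin

section \<open>Projective space with its Zariski topology\<close>

text \<open>
  Projective varieties over an algebraically closed field are treated classically, as sets of closed
  points with the sheaf of regular functions (as in Serre's FAC).  A polynomial ring in
  countably many variables serves all \<open>N\<close> at once: a vector of \<open>k^(N+1)\<close> is a function vanishing
  above \<open>N\<close>, so the variables with index above \<open>N\<close> evaluate to \<open>0\<close>.
\<close>

type_synonym 'k coords = "nat \<Rightarrow> 'k"
type_synonym 'k point = "'k coords set"
type_synonym 'k func = "'k coords \<Rightarrow> 'k"
type_synonym 'k mpoly = "(nat \<Rightarrow>\<^sub>0 nat) \<Rightarrow>\<^sub>0 'k"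

definition mpoly_eval :: "'k::field mpoly \<Rightarrow> 'k coords \<Rightarrow> 'k" where
  "mpoly_eval P x = (\<Sum>m\<in>Poly_Mapping.keys P. Poly_Mapping.lookup P m *
      (\<Prod>i\<in>Poly_Mapping.keys m. x i ^ Poly_Mapping.lookup m i))"

definition homogeneous :: "nat \<Rightarrow> 'k::field mpoly \<Rightarrow> bool" where
  "homogeneous d P \<longleftrightarrow> (\<forall>m\<in>Poly_Mapping.keys P. (\<Sum>i\<in>Poly_Mapping.keys m. Poly_Mapping.lookup m i) = d)"

text \<open>
  A point is an orbit of \<open>k^*\<close> on the nonzero vectors (so it does not contain the zero vector), and
  the punctured affine cone over a set \<open>U\<close> of points is just \<open>\<Union>U\<close>.
\<close>

definition proj_point :: "'k::field coords \<Rightarrow> 'k point" where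
  "proj_point v = {(\<lambda>i. c * v i) |c. c \<noteq> 0}"

definition proj_space :: "nat \<Rightarrow> 'k::field point set" where
  "proj_space N = {proj_point v |v. (\<forall>i>N. v i = 0) \<and> (\<exists>i\<le>N. v i \<noteq> 0)}"

definition hyperplane :: "nat \<Rightarrow> 'k::field point set \<Rightarrow> bool" where
  "hyperplane N H \<longleftrightarrow> (\<exists>a :: 'k coords. (\<exists>i\<le>N. a i \<noteq> 0) \<and>
      H = {p \<in> proj_space N. \<forall>v\<in>p. (\<Sum>i\<le>N. a i * v i) = 0})"

definition basic_open :: "'k::field point set \<Rightarrow> 'k mpoly \<Rightarrow> 'k point set" where
  "basic_open X P = {p \<in> X. \<forall>v\<in>p. mpoly_eval P v \<noteq> 0}"

definition zariski :: "'k::field point set \<Rightarrow> 'k point topology" where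
  "zariski X = topology_generated_by {basic_open X P |P d. homogeneous d P}"

abbreviation zopen :: "'k::field point set \<Rightarrow> 'k point set \<Rightarrow> bool" where
  "zopen X U \<equiv> openin (zariski X) U"


section \<open>Sheaves of modules\<close>

text \<open>\<open>res F U V\<close> restricts sections from \<open>U\<close> to \<open>V\<close>; only open sets with \<open>V \<subseteq> U\<close> are relevant.\<close>

record ('k, 'm) mod_sheaf =
  sects :: "'k point set \<Rightarrow> ('k func, 'm) module"
  res :: "'k point set \<Rightarrow> 'k point set \<Rightarrow> 'm \<Rightarrow> 'm"

abbreviation sec :: "('k, 'm) mod_sheaf \<Rightarrow> 'k point set \<Rightarrow> 'm set" where
  "sec F U \<equiv> carrier (sects F U)"

text \<open>
  \<open>O_X(b)\<close>: its sections over \<open>U\<close> are the functions on the punctured cone over \<open>U\<close> that are locally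
  quotients \<open>P/Q\<close> of homogeneous polynomials with \<open>deg P - deg Q = b\<close>.  For \<open>b = 0\<close> these are the
  regular functions on \<open>U\<close>, pulled back to the cone.  The fields \<open>mult\<close> and \<open>one\<close> are only
  meaningful for \<open>b = 0\<close>, where they make \<open>O_X\<close> a sheaf of rings.
\<close>

definition twisting_sections :: "'k::field point set \<Rightarrow> int \<Rightarrow> 'k point set \<Rightarrow> 'k func set" where
  "twisting_sections X b U = {f \<in> extensional (\<Union>U). \<forall>p\<in>U. \<exists>V d e P Q.
      zopen X V \<and> p \<in> V \<and> V \<subseteq> U \<and> homogeneous d P \<and> homogeneous e Q \<and> int d - int e = b \<and>
      (\<forall>v\<in>\<Union>V. mpoly_eval Q v \<noteq> 0 \<and> f v = mpoly_eval P v / mpoly_eval Q v)}"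

definition twisting_sheaf :: "'k::field point set \<Rightarrow> int \<Rightarrow> ('k, 'k func) mod_sheaf" where
  "twisting_sheaf X b =
    \<lparr>sects = (\<lambda>U. \<lparr>carrier = twisting_sections X b U,
        monoid.mult = (\<lambda>f g. \<lambda>v\<in>\<Union>U. f v * g v), one = (\<lambda>v\<in>\<Union>U. 1),
        zero = (\<lambda>v\<in>\<Union>U. 0), add = (\<lambda>f g. \<lambda>v\<in>\<Union>U. f v + g v),
        smult = (\<lambda>f g. \<lambda>v\<in>\<Union>U. f v * g v)\<rparr>),
     res = (\<lambda>U V f. restrict f (\<Union>V))\<rparr>"

abbreviation structure_sheaf :: "'k::field point set \<Rightarrow> ('k, 'k func) mod_sheaf" where
  "structure_sheaf X \<equiv> twisting_sheaf X 0"

definition sheaf_of_modules :: "'k::field point set \<Rightarrow> ('k, 'm) mod_sheaf \<Rightarrow> bool" where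
  "sheaf_of_modules X F \<longleftrightarrow>
    (\<forall>U. zopen X U \<longrightarrow> Module.module (sects (structure_sheaf X) U) (sects F U)) \<and>
    (\<forall>U V. zopen X U \<and> zopen X V \<and> V \<subseteq> U \<longrightarrow>
      (\<forall>s\<in>sec F U. res F U V s \<in> sec F V) \<and>
      (\<forall>s\<in>sec F U. \<forall>t\<in>sec F U.
        res F U V (s \<oplus>\<^bsub>sects F U\<^esub> t) = res F U V s \<oplus>\<^bsub>sects F V\<^esub> res F U V t) \<and>
      (\<forall>a\<in>sec (structure_sheaf X) U. \<forall>s\<in>sec F U.
        res F U V (a \<odot>\<^bsub>sects F U\<^esub> s) =
          res (structure_sheaf X) U V a \<odot>\<^bsub>sects F V\<^esub> res F U V s)) \<and>
    (\<forall>U. zopen X U \<longrightarrow> (\<forall>s\<in>sec F U. res F U U s = s)) \<and>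
    (\<forall>U V W. zopen X U \<and> zopen X V \<and> zopen X W \<and> W \<subseteq> V \<and> V \<subseteq> U \<longrightarrow>
      (\<forall>s\<in>sec F U. res F V W (res F U V s) = res F U W s)) \<and>
    (\<forall>\<C> s. (\<forall>V\<in>\<C>. zopen X V \<and> s V \<in> sec F V) \<and>
      (\<forall>V\<in>\<C>. \<forall>W\<in>\<C>. res F V (V \<inter> W) (s V) = res F W (V \<inter> W) (s W)) \<longrightarrow>
      (\<exists>!t. t \<in> sec F (\<Union>\<C>) \<and> (\<forall>V\<in>\<C>. res F (\<Union>\<C>) V t = s V)))"

definition sheaf_iso :: "'k::field point set \<Rightarrow> ('k, 'm) mod_sheaf \<Rightarrow> ('k, 'n) mod_sheaf \<Rightarrow> bool" where
  "sheaf_iso X F G \<longleftrightarrow> (\<exists>\<phi>.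
    (\<forall>U. zopen X U \<longrightarrow>
      bij_betw (\<phi> U) (sec F U) (sec G U) \<and>
      (\<forall>s\<in>sec F U. \<forall>t\<in>sec F U. \<phi> U (s \<oplus>\<^bsub>sects F U\<^esub> t) = \<phi> U s \<oplus>\<^bsub>sects G U\<^esub> \<phi> U t) \<and>
      (\<forall>a\<in>sec (structure_sheaf X) U. \<forall>s\<in>sec F U.
        \<phi> U (a \<odot>\<^bsub>sects F U\<^esub> s) = a \<odot>\<^bsub>sects G U\<^esub> \<phi> U s)) \<and>
    (\<forall>U V. zopen X U \<and> zopen X V \<and> V \<subseteq> U \<longrightarrow>
      (\<forall>s\<in>sec F U. \<phi> V (res F U V s) = res G U V (\<phi> U s))))"

definition sum_of_twists :: "'k::field point set \<Rightarrow> int list \<Rightarrow> ('k, nat \<Rightarrow> 'k func) mod_sheaf" where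
  "sum_of_twists X bs =
    \<lparr>sects = (\<lambda>U. \<lparr>carrier = (\<Pi>\<^sub>E i\<in>{..<length bs}. sec (twisting_sheaf X (bs ! i)) U),
        monoid.mult = undefined, one = undefined,
        zero = (\<lambda>i\<in>{..<length bs}. \<zero>\<^bsub>sects (twisting_sheaf X (bs ! i)) U\<^esub>),
        add = (\<lambda>s t. \<lambda>i\<in>{..<length bs}. s i \<oplus>\<^bsub>sects (twisting_sheaf X (bs ! i)) U\<^esub> t i),
        smult = (\<lambda>a s. \<lambda>i\<in>{..<length bs}. a \<odot>\<^bsub>sects (twisting_sheaf X (bs ! i)) U\<^esub> s i)\<rparr>),
     res = (\<lambda>U V s. \<lambda>i\<in>{..<length bs}. res (twisting_sheaf X (bs ! i)) U V (s i))\<rparr>"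


section \<open>Coherence\<close>

definition linear_comb ::
  "'k::field point set \<Rightarrow> ('k, 'm) mod_sheaf \<Rightarrow> nat \<Rightarrow> 'k point set \<Rightarrow> (nat \<Rightarrow> 'k func) \<Rightarrow> (nat \<Rightarrow> 'm) \<Rightarrow> 'm" where
  "linear_comb X F n U a s = finsum (sects F U) (\<lambda>i. a i \<odot>\<^bsub>sects F U\<^esub> s i) {..<n}"

text \<open>\<open>F|_U\<close> is locally generated, as a sheaf, by finitely many sections.\<close>

definition finite_type_on :: "'k::field point set \<Rightarrow> 'k point set \<Rightarrow> ('k, 'm) mod_sheaf \<Rightarrow> bool" where
  "finite_type_on X U F \<longleftrightarrow> (\<forall>p\<in>U. \<exists>V n s.
    zopen X V \<and> p \<in> V \<and> V \<subseteq> U \<and> (\<forall>i<n. s i \<in> sec F V) \<and>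
    (\<forall>W t q. zopen X W \<and> W \<subseteq> V \<and> t \<in> sec F W \<and> q \<in> W \<longrightarrow>
      (\<exists>W' a. zopen X W' \<and> q \<in> W' \<and> W' \<subseteq> W \<and> (\<forall>i<n. a i \<in> sec (structure_sheaf X) W') \<and>
        res F W W' t = linear_comb X F n W' a (\<lambda>i. res F V W' (s i)))))"

text \<open>The kernel of the map \<open>O_U^n \<rightarrow> F|_U\<close> given by sections \<open>s 0, ..., s (n-1)\<close> over \<open>U\<close>.\<close>

definition relation_sheaf :: "'k::field point set \<Rightarrow> ('k, 'm) mod_sheaf \<Rightarrow> 'k point set \<Rightarrow> nat \<Rightarrow>
    (nat \<Rightarrow> 'm) \<Rightarrow> ('k, nat \<Rightarrow> 'k func) mod_sheaf" where
  "relation_sheaf X F U n s =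
    \<lparr>sects = (\<lambda>W. (sects (sum_of_twists X (replicate n 0)) W)
        \<lparr>carrier := {a \<in> sec (sum_of_twists X (replicate n 0)) W.
            linear_comb X F n W a (\<lambda>i. res F U W (s i)) = \<zero>\<^bsub>sects F W\<^esub>}\<rparr>),
     res = res (sum_of_twists X (replicate n 0))\<rparr>"

definition coherent :: "'k::field point set \<Rightarrow> ('k, 'm) mod_sheaf \<Rightarrow> bool" where
  "coherent X F \<longleftrightarrow> sheaf_of_modules X F \<and> finite_type_on X X F \<and>
    (\<forall>U n s. zopen X U \<and> (\<forall>i<n. s i \<in> sec F U) \<longrightarrow> finite_type_on X U (relation_sheaf X F U n s))"


section \<open>Stalks and torsion\<close>

definition germ :: "'k::field point set \<Rightarrow> ('k, 'm) mod_sheaf \<Rightarrow> 'k point \<Rightarrow> 'k point set \<Rightarrow> 'm \<Rightarrow>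
    ('k point set \<times> 'm) set" where
  "germ X F p U s = {(V, t). zopen X V \<and> p \<in> V \<and> t \<in> sec F V \<and>
    (\<exists>W. zopen X W \<and> p \<in> W \<and> W \<subseteq> U \<inter> V \<and> res F U W s = res F V W t)}"

text \<open>
  The operations are those induced by representatives.  \<open>stalk X (structure_sheaf X) p\<close> is the local
  ring; for other sheaves \<open>mult\<close> and \<open>one\<close> carry no meaning.
\<close>

definition stalk :: "'k::field point set \<Rightarrow> ('k, 'm) mod_sheaf \<Rightarrow> 'k point \<Rightarrow>
    (('k point set \<times> 'k func) set, ('k point set \<times> 'm) set) module" where
  "stalk X F p =
    \<lparr>carrier = {germ X F p U s |U s. zopen X U \<and> p \<in> U \<and> s \<in> sec F U},
     monoid.mult = (\<lambda>A B. \<Union>(U, s)\<in>A. \<Union>(V, t)\<in>B.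
        germ X F p (U \<inter> V) (res F U (U \<inter> V) s \<otimes>\<^bsub>sects F (U \<inter> V)\<^esub> res F V (U \<inter> V) t)),
     one = germ X F p X \<one>\<^bsub>sects F X\<^esub>,
     zero = germ X F p X \<zero>\<^bsub>sects F X\<^esub>,
     add = (\<lambda>A B. \<Union>(U, s)\<in>A. \<Union>(V, t)\<in>B.
        germ X F p (U \<inter> V) (res F U (U \<inter> V) s \<oplus>\<^bsub>sects F (U \<inter> V)\<^esub> res F V (U \<inter> V) t)),
     smult = (\<lambda>A B. \<Union>(U, a)\<in>A. \<Union>(V, t)\<in>B.
        germ X F p (U \<inter> V)
          (res (structure_sheaf X) U (U \<inter> V) a \<odot>\<^bsub>sects F (U \<inter> V)\<^esub> res F V (U \<inter> V) t))\<rparr>"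

definition torsion_free :: "'k::field point set \<Rightarrow> ('k, 'm) mod_sheaf \<Rightarrow> bool" where
  "torsion_free X F \<longleftrightarrow> (\<forall>p\<in>X. \<forall>a\<in>carrier (stalk X (structure_sheaf X) p). \<forall>m\<in>carrier (stalk X F p).
    a \<odot>\<^bsub>stalk X F p\<^esub> m = \<zero>\<^bsub>stalk X F p\<^esub> \<longrightarrow>
    a = \<zero>\<^bsub>stalk X (structure_sheaf X) p\<^esub> \<or> m = \<zero>\<^bsub>stalk X F p\<^esub>)"


section \<open>Tensor products, twists and restriction\<close>

text \<open>
  The tensor product over \<open>R\<close> of an \<open>R\<close>-module \<open>M\<close> with an \<open>S\<close>-module \<open>N\<close>, which is an \<open>R\<close>-module via
  \<open>\<rho> : R \<rightarrow> S\<close>, as an \<open>S\<close>-module: the free abelian group on \<open>M \<times> N\<close> modulo the usual relations.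
\<close>

definition tensor_relations :: "('r, 'x) ring_scheme \<Rightarrow> ('r \<Rightarrow> 's) \<Rightarrow> ('r, 'm) module \<Rightarrow> ('s, 'n) module \<Rightarrow>
    ('m \<times> 'n \<Rightarrow>\<^sub>0 int) set" where
  "tensor_relations R \<rho> M N = generate (free_Abelian_group (carrier M \<times> carrier N))
    ({frag_of (x \<oplus>\<^bsub>M\<^esub> y, z) - frag_of (x, z) - frag_of (y, z) |x y z.
        x \<in> carrier M \<and> y \<in> carrier M \<and> z \<in> carrier N} \<union>
     {frag_of (x, y \<oplus>\<^bsub>N\<^esub> z) - frag_of (x, y) - frag_of (x, z) |x y z.
        x \<in> carrier M \<and> y \<in> carrier N \<and> z \<in> carrier N} \<union>
     {frag_of (a \<odot>\<^bsub>M\<^esub> x, z) - frag_of (x, \<rho> a \<odot>\<^bsub>N\<^esub> z) |a x z.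
        a \<in> carrier R \<and> x \<in> carrier M \<and> z \<in> carrier N})"

definition pure_tensor :: "('r, 'x) ring_scheme \<Rightarrow> ('r \<Rightarrow> 's) \<Rightarrow> ('r, 'm) module \<Rightarrow> ('s, 'n) module \<Rightarrow>
    'm \<Rightarrow> 'n \<Rightarrow> ('m \<times> 'n \<Rightarrow>\<^sub>0 int) set" where
  "pure_tensor R \<rho> M N x z =
    tensor_relations R \<rho> M N #>\<^bsub>free_Abelian_group (carrier M \<times> carrier N)\<^esub> frag_of (x, z)"

definition tensor_module :: "('r, 'x) ring_scheme \<Rightarrow> ('r \<Rightarrow> 's) \<Rightarrow> ('r, 'm) module \<Rightarrow> ('s, 'n) module \<Rightarrow>
    ('s, ('m \<times> 'n \<Rightarrow>\<^sub>0 int) set) module" where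
  "tensor_module R \<rho> M N =
    (let G = free_Abelian_group (carrier M \<times> carrier N); K = tensor_relations R \<rho> M N in
     \<lparr>carrier = carrier (G Mod K), monoid.mult = undefined, one = undefined,
      zero = \<one>\<^bsub>G Mod K\<^esub>, add = monoid.mult (G Mod K),
      smult = (\<lambda>a T. \<Union>c\<in>T. K #>\<^bsub>G\<^esub> frag_extend (\<lambda>(x, z). frag_of (x, a \<odot>\<^bsub>N\<^esub> z)) c)\<rparr>)"

text \<open>The restriction map \<open>O_{X,p} \<rightarrow> O_{Y,p}\<close> of local rings for a subvariety \<open>Y\<close> of \<open>X\<close>.\<close>

definition germ_restriction :: "'k::field point set \<Rightarrow> 'k point set \<Rightarrow> 'k point \<Rightarrow>
    ('k point set \<times> 'k func) set \<Rightarrow> ('k point set \<times> 'k func) set" where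
  "germ_restriction X Y p A =
    (\<Union>(U, f)\<in>A. germ Y (structure_sheaf Y) p (U \<inter> Y) (restrict f (\<Union>(U \<inter> Y))))"

abbreviation stalk_tensor :: "'k::field point set \<Rightarrow> ('k, 'm) mod_sheaf \<Rightarrow> 'k point set \<Rightarrow>
    ('k, 'n) mod_sheaf \<Rightarrow> 'k point \<Rightarrow>
    (('k point set \<times> 'k func) set,
     (('k point set \<times> 'm) set \<times> ('k point set \<times> 'n) set \<Rightarrow>\<^sub>0 int) set) module" where
  "stalk_tensor X F Y G p \<equiv>
    tensor_module (stalk X (structure_sheaf X) p) (germ_restriction X Y p) (stalk X F p) (stalk Y G p)"

abbreviation germ_tensor :: "'k::field point set \<Rightarrow> ('k, 'm) mod_sheaf \<Rightarrow> 'k point set \<Rightarrow>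
    ('k, 'n) mod_sheaf \<Rightarrow> 'k point \<Rightarrow> 'k point set \<Rightarrow> 'm \<Rightarrow> 'k point set \<Rightarrow> 'n \<Rightarrow>
    (('k point set \<times> 'm) set \<times> ('k point set \<times> 'n) set \<Rightarrow>\<^sub>0 int) set" where
  "germ_tensor X F Y G p U s V t \<equiv>
    pure_tensor (stalk X (structure_sheaf X) p) (germ_restriction X Y p) (stalk X F p) (stalk Y G p)
      (germ X F p U s) (germ Y G p V t)"

text \<open>
  For an inclusion \<open>i : Y \<rightarrow> X\<close> of varieties, an \<open>O_X\<close>-module \<open>F\<close> and an \<open>O_Y\<close>-module \<open>G\<close>, this is
  the \<open>O_Y\<close>-module \<open>i^{-1}F \<otimes> G\<close> over \<open>i^{-1}O_X\<close>: the sheaf with stalks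
  \<open>F_p \<otimes> G_p\<close> over \<open>O_{X,p}\<close>, whose sections are the functions into the stalks that are
  locally given by a finite sum of tensors of sections.  For \<open>Y = X\<close> it is \<open>F \<otimes> G\<close> over \<open>O_X\<close>; for
  \<open>G = O_Y\<close> it is the pullback \<open>i^*F\<close>.
\<close>

definition tensor_sheaf :: "'k::field point set \<Rightarrow> ('k, 'm) mod_sheaf \<Rightarrow> 'k point set \<Rightarrow>
    ('k, 'n) mod_sheaf \<Rightarrow>
    ('k, 'k point \<Rightarrow> (('k point set \<times> 'm) set \<times> ('k point set \<times> 'n) set \<Rightarrow>\<^sub>0 int) set) mod_sheaf" where
  "tensor_sheaf X F Y G =
    \<lparr>sects = (\<lambda>W. \<lparr>carrier = {\<sigma> \<in> extensional W. \<forall>p\<in>W. \<exists>U V n s t.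
          zopen X U \<and> zopen Y V \<and> p \<in> V \<and> V \<subseteq> U \<inter> W \<and>
          (\<forall>j<n. s j \<in> sec F U \<and> t j \<in> sec G V) \<and>
          (\<forall>q\<in>V. \<sigma> q = finsum (stalk_tensor X F Y G q)
              (\<lambda>j. germ_tensor X F Y G q U (s j) V (t j)) {..<n::nat})},
        monoid.mult = undefined, one = undefined,
        zero = (\<lambda>p\<in>W. \<zero>\<^bsub>stalk_tensor X F Y G p\<^esub>),
        add = (\<lambda>\<sigma> \<tau>. \<lambda>p\<in>W. \<sigma> p \<oplus>\<^bsub>stalk_tensor X F Y G p\<^esub> \<tau> p),
        smult = (\<lambda>a \<sigma>. \<lambda>p\<in>W. germ Y (structure_sheaf Y) p W a \<odot>\<^bsub>stalk_tensor X F Y G p\<^esub> \<sigma> p)\<rparr>),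
     res = (\<lambda>U V \<sigma>. restrict \<sigma> V)\<rparr>"

abbreviation twist where
  "twist X F t \<equiv> tensor_sheaf X F X (twisting_sheaf X t)"

abbreviation restrict_sheaf where
  "restrict_sheaf X F Y \<equiv> tensor_sheaf X F Y (structure_sheaf Y)"


section \<open>First cohomology\<close>

text \<open>
  \<open>H^1(X, F)\<close> is the direct limit of the groups \<open>H^1(\<U>, F)\<close> over all open covers \<open>\<U>\<close> of \<open>X\<close>, ordered
  by refinement; in degree one this agrees with derived functor cohomology for every sheaf.
\<close>

definition open_cover :: "'k::field point set \<Rightarrow> 'k point set set \<Rightarrow> bool" where
  "open_cover X \<U> \<longleftrightarrow> (\<forall>U\<in>\<U>. zopen X U) \<and> \<Union>\<U> = X"

definition refinement :: "'k point set set \<Rightarrow> 'k point set set \<Rightarrow> ('k point set \<Rightarrow> 'k point set) \<Rightarrow> bool" where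
  "refinement \<W> \<U> \<rho> \<longleftrightarrow> (\<forall>W\<in>\<W>. \<rho> W \<in> \<U> \<and> W \<subseteq> \<rho> W)"

definition cocycles :: "('k, 'm) mod_sheaf \<Rightarrow> 'k point set set \<Rightarrow> ('k point set \<Rightarrow> 'k point set \<Rightarrow> 'm) set" where
  "cocycles F \<U> = {c. (\<forall>U\<in>\<U>. \<forall>V\<in>\<U>. c U V \<in> sec F (U \<inter> V)) \<and>
    (\<forall>U\<in>\<U>. \<forall>V\<in>\<U>. \<forall>W\<in>\<U>. let T = U \<inter> V \<inter> W in
      (res F (V \<inter> W) T (c V W) \<ominus>\<^bsub>sects F T\<^esub> res F (U \<inter> W) T (c U W))
        \<oplus>\<^bsub>sects F T\<^esub> res F (U \<inter> V) T (c U V) = \<zero>\<^bsub>sects F T\<^esub>)}"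

definition cohomologous :: "('k, 'm) mod_sheaf \<Rightarrow> 'k point set set \<Rightarrow>
    ('k point set \<Rightarrow> 'k point set \<Rightarrow> 'm) \<Rightarrow> ('k point set \<Rightarrow> 'k point set \<Rightarrow> 'm) \<Rightarrow> bool" where
  "cohomologous F \<U> c d \<longleftrightarrow> (\<exists>b. (\<forall>U\<in>\<U>. b U \<in> sec F U) \<and>
    (\<forall>U\<in>\<U>. \<forall>V\<in>\<U>. c U V \<ominus>\<^bsub>sects F (U \<inter> V)\<^esub> d U V =
      res F V (U \<inter> V) (b V) \<ominus>\<^bsub>sects F (U \<inter> V)\<^esub> res F U (U \<inter> V) (b U)))"

definition pull_cocycle :: "('k, 'm) mod_sheaf \<Rightarrow> ('k point set \<Rightarrow> 'k point set) \<Rightarrow>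
    ('k point set \<Rightarrow> 'k point set \<Rightarrow> 'm) \<Rightarrow> 'k point set \<Rightarrow> 'k point set \<Rightarrow> 'm" where
  "pull_cocycle F \<rho> c = (\<lambda>V W. res F (\<rho> V \<inter> \<rho> W) (V \<inter> W) (c (\<rho> V) (\<rho> W)))"

definition H1_class :: "'k::field point set \<Rightarrow> ('k, 'm) mod_sheaf \<Rightarrow> 'k point set set \<Rightarrow>
    ('k point set \<Rightarrow> 'k point set \<Rightarrow> 'm) \<Rightarrow>
    ('k point set set \<times> ('k point set \<Rightarrow> 'k point set \<Rightarrow> 'm)) set" where
  "H1_class X F \<U> c = {(\<V>, d). open_cover X \<V> \<and> d \<in> cocycles F \<V> \<and>
    (\<exists>\<W> \<rho> \<tau>. open_cover X \<W> \<and> refinement \<W> \<U> \<rho> \<and> refinement \<W> \<V> \<tau> \<and>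
      cohomologous F \<W> (pull_cocycle F \<rho> c) (pull_cocycle F \<tau> d))}"

definition H1 :: "'k::field point set \<Rightarrow> ('k, 'm) mod_sheaf \<Rightarrow>
    ('k point set set \<times> ('k point set \<Rightarrow> 'k point set \<Rightarrow> 'm)) set monoid" where
  "H1 X F =
    \<lparr>carrier = {H1_class X F \<U> c |\<U> c. open_cover X \<U> \<and> c \<in> cocycles F \<U>},
     monoid.mult = (\<lambda>A B. \<Union>{H1_class X F \<W> (\<lambda>V W. pull_cocycle F \<rho> c V W \<oplus>\<^bsub>sects F (V \<inter> W)\<^esub> pull_cocycle F \<tau> d V W)
        |\<W> \<rho> \<tau> \<U> c \<V> d. (\<U>, c) \<in> A \<and> (\<V>, d) \<in> B \<and>
          open_cover X \<W> \<and> refinement \<W> \<U> \<rho> \<and> refinement \<W> \<V> \<tau>}),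
     one = H1_class X F {X} (\<lambda>U V. \<zero>\<^bsub>sects F (U \<inter> V)\<^esub>)\<rparr>"

definition H1_vanishes :: "'k::field point set \<Rightarrow> ('k, 'm) mod_sheaf \<Rightarrow> bool" where
  "H1_vanishes X F \<longleftrightarrow> carrier (H1 X F) = {\<one>\<^bsub>H1 X F\<^esub>}"

end

theory Submission
  imports Defs "HOL-Computational_Algebra.Fraction_Field" "HOL-Library.Function_Algebras"
begin

text \<open>
  Coordinates with respect to a basis over a dense open set embed a torsion free coherent sheaf into the constant
  sheaf of vectors over the fraction field of the polynomial functions.  The sheaf is then determined by its
  stalks \<open>S p\<close>, and \<open>H\<^sup>1\<close> vanishes iff every Cousin problem for them is solvable.  For \<open>O(b)\<close> in at least
  three homogeneous coordinates this holds by a Koszul argument.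

  Suppose that \<open>F\<close> restricted to \<open>H\<close> is the sum of the \<open>O\<^sub>H(b\<^sub>i)\<close>.  If \<open>N \<ge> 3\<close> then \<open>H\<^sup>1(O\<^sub>H(b)) = 0\<close>, so the
  sequence of \<open>F(t - 1)\<close>, \<open>F(t)\<close> and the restriction of \<open>F(t)\<close> to \<open>H\<close> propagates the vanishing of \<open>H\<^sup>1\<close> from small \<open>t\<close> to all
  \<open>t\<close>.  Once \<open>H\<^sup>1(F(- b\<^sub>i - 1)) = 0\<close>, the basis sections over \<open>H\<close> lift to sections \<open>s\<^sub>i\<close> of \<open>F(- b\<^sub>i)\<close>.  These are
  independent, since a relation can be divided by the equation of \<open>H\<close>, and generate \<open>F\<close> along \<open>H\<close> by Nakayama.  The closed
  set where they do not generate is disjoint from \<open>H\<close>, so it has codimension at least two, and the coefficients of a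
  germ extend over it.
\<close>

text \<open>All twists \<open>O(b)\<close> live in one field of fractions, with degrees recorded
  only by membership in \<open>Oloc\<close>. Twisting thus becomes multiplication by a form, a
  tensor becomes a vector, and sheaves are compared as families of subsets of one vector space.
  Eliminating a coordinate puts the stalks of \<open>O_H(b)\<close> into the same field. Statements
  that extend something over a closed set share one pattern: the forms whose multiples solve the
  problem make up a graded ideal, the local hypothesis says that this ideal has no zero where it
  matters, and the projective Nullstellensatz yields powers of forms in it. The two cases of the
  criterion come from counting coordinates. The Koszul argument takes three of them, so on H it is
  available only for N >= 3; for N = 2 the hyperplane is a line, \<open>H^1(O_H(b))\<close> can be
  nonzero, and vanishing has to be given in the degrees that occur. Extension over codimension two
  takes two coordinates on H. Passing from values at points to a single rational function always
  rests on irreducibility: nonempty open sets meet.\<close>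

abbreviation "keys \<equiv> Poly_Mapping.keys"
abbreviation "lookup \<equiv> Poly_Mapping.lookup"

section \<open>Polynomial functions\<close>

inductive is_hpoly :: "nat set \<Rightarrow> nat \<Rightarrow> 'k::field func \<Rightarrow> bool" for J where
  zero: "is_hpoly J d (\<lambda>x. 0)"
| const: "is_hpoly J 0 (\<lambda>x. c)"
| var: "is_hpoly J d f \<Longrightarrow> i \<in> J \<Longrightarrow> is_hpoly J (Suc d) (\<lambda>x. x i * f x)"
| add: "is_hpoly J d f \<Longrightarrow> is_hpoly J d g \<Longrightarrow> is_hpoly J d (\<lambda>x. f x + g x)"

definition hpoly :: "nat set \<Rightarrow> nat \<Rightarrow> 'k::field func set" where
  "hpoly J d = {f. is_hpoly J d f}"

lemma hpoly_zero: "(\<lambda>x. 0) \<in> hpoly J d"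
  and hpoly_const: "(\<lambda>x. c) \<in> hpoly J 0"
  and hpoly_var: "f \<in> hpoly J d \<Longrightarrow> i \<in> J \<Longrightarrow> (\<lambda>x. x i * f x) \<in> hpoly J (Suc d)"
  and hpoly_add: "f \<in> hpoly J d \<Longrightarrow> g \<in> hpoly J d \<Longrightarrow> (\<lambda>x. f x + g x) \<in> hpoly J d"
  unfolding hpoly_def by (auto intro: is_hpoly.intros)

lemmas hpoly_intros = hpoly_zero hpoly_const hpoly_var hpoly_add

lemma hpoly_induct [consumes 1, case_names zero const var add]:
  assumes "f \<in> hpoly J d" "\<And>d. P d (\<lambda>x. 0)" "\<And>c. P 0 (\<lambda>x. c)"
    "\<And>f d i. \<lbrakk>f \<in> hpoly J d; P d f; i \<in> J\<rbrakk> \<Longrightarrow> P (Suc d) (\<lambda>x. x i * f x)"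
    "\<And>f d g. \<lbrakk>f \<in> hpoly J d; P d f; g \<in> hpoly J d; P d g\<rbrakk> \<Longrightarrow> P d (\<lambda>x. f x + g x)"
  shows "P d f"
  using assms(1) unfolding hpoly_def mem_Collect_eq
  by (induction rule: is_hpoly.induct) (auto intro: assms(2-) simp: hpoly_def)

inductive_set polyf :: "nat set \<Rightarrow> 'k::field func set" for J where
  const: "(\<lambda>x. c) \<in> polyf J"
| var: "f \<in> polyf J \<Longrightarrow> i \<in> J \<Longrightarrow> (\<lambda>x. x i * f x) \<in> polyf J"
| add: "f \<in> polyf J \<Longrightarrow> g \<in> polyf J \<Longrightarrow> (\<lambda>x. f x + g x) \<in> polyf J"

lemma hpoly_cmult: "f \<in> hpoly J d \<Longrightarrow> (\<lambda>x. c * f x) \<in> hpoly J d"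
proof (induction rule: hpoly_induct)
  case (var f d i)
  have "(\<lambda>x. x i * (c * f x)) \<in> hpoly J (Suc d)" using var by (intro hpoly_var)
  thus ?case by (simp add: mult.left_commute)
next
  case (add f d g)
  thus ?case using hpoly_add[OF add.IH] by (simp add: distrib_left)
qed (auto intro: hpoly_intros)

lemma hpoly_mult: "f \<in> hpoly J d \<Longrightarrow> g \<in> hpoly J e \<Longrightarrow> (\<lambda>x. f x * g x) \<in> hpoly J (d + e)"
proof (induction rule: hpoly_induct)
  case (var f d i)
  hence "(\<lambda>x. x i * (f x * g x)) \<in> hpoly J (Suc (d + e))" by (intro hpoly_var) auto
  thus ?case by (simp add: mult.assoc)
next
  case (add f d f')
  thus ?case using hpoly_add[OF add.IH(1) add.IH(2)] by (simp add: distrib_right)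
qed (auto intro: hpoly_intros hpoly_cmult)

lemma polyf_cmult: "f \<in> polyf J \<Longrightarrow> (\<lambda>x. c * f x) \<in> polyf J"
proof (induction rule: polyf.induct)
  case (var f i)
  have "(\<lambda>x. x i * (c * f x)) \<in> polyf J" using var by (intro polyf.var)
  thus ?case by (simp add: mult.left_commute)
next
  case (add f g)
  thus ?case using polyf.add[OF add.IH] by (simp add: distrib_left)
qed (auto intro: polyf.intros)

lemma polyf_mult: "f \<in> polyf J \<Longrightarrow> g \<in> polyf J \<Longrightarrow> (\<lambda>x. f x * g x) \<in> polyf J"
proof (induction rule: polyf.induct)
  case (var f i)
  hence "(\<lambda>x. x i * (f x * g x)) \<in> polyf J" by (intro polyf.var) auto
  thus ?case by (simp add: mult.assoc)
next
  case (add f f')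
  thus ?case using polyf.add[OF add.IH(1) add.IH(2)] by (simp add: distrib_right)
qed (auto intro: polyf.intros polyf_cmult)

lemma polyf_var: "i \<in> J \<Longrightarrow> (\<lambda>x. x i) \<in> polyf J"
  using polyf.var[OF polyf.const[of 1]] by simp

lemma polyf_uminus: "f \<in> polyf J \<Longrightarrow> (\<lambda>x. - f x) \<in> polyf J"
  using polyf_cmult[of f J "-1"] by simp

lemma polyf_diff: "f \<in> polyf J \<Longrightarrow> g \<in> polyf J \<Longrightarrow> (\<lambda>x. f x - g x) \<in> polyf J"
  using polyf.add[OF _ polyf_uminus, of f J g] by simp

lemma polyf_power: "f \<in> polyf J \<Longrightarrow> (\<lambda>x. f x ^ n) \<in> polyf J"
  by (induction n) (auto intro: polyf.const polyf_mult)

lemma polyf_sum: "(\<And>i. i \<in> A \<Longrightarrow> f i \<in> polyf J) \<Longrightarrow> (\<lambda>x. \<Sum>i\<in>A. f i x) \<in> polyf J"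
  by (induction A rule: infinite_finite_induct) (auto intro: polyf.const polyf.add)

lemma polyf_mono: "f \<in> polyf J \<Longrightarrow> J \<subseteq> J' \<Longrightarrow> f \<in> polyf J'"
  by (induction rule: polyf.induct) (auto intro: polyf.intros)

lemma hpoly_mono: "f \<in> hpoly J d \<Longrightarrow> J \<subseteq> J' \<Longrightarrow> f \<in> hpoly J' d"
  by (induction rule: hpoly_induct) (auto intro: hpoly_intros)

lemma hpoly_polyf: "f \<in> hpoly J d \<Longrightarrow> f \<in> polyf J"
  by (induction rule: hpoly_induct) (auto intro: polyf.intros)

lemma polyf_compose:
  assumes "f \<in> polyf J" "\<And>i. i \<in> J \<Longrightarrow> (\<lambda>x. T x i) \<in> polyf J'"
  shows "(\<lambda>x. f (T x)) \<in> polyf J'"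
  using assms(1) by (induction rule: polyf.induct) (auto intro: polyf.intros polyf_mult assms(2))

lemma polyf_cong: "f \<in> polyf J \<Longrightarrow> (\<And>i. i \<in> J \<Longrightarrow> u i = v i) \<Longrightarrow> f u = f v"
  by (induction rule: polyf.induct) auto

text \<open>Substituting a line reduces questions about zeros to polynomials in one parameter, where
  the degree bounds the number of roots.\<close>

lemma polyf_line: "f \<in> polyf J \<Longrightarrow> \<exists>p. \<forall>t. f (\<lambda>i. u i + t * v i) = poly p t"
proof (induction rule: polyf.induct)
  case (const c)
  show ?case by (intro exI[of _ "[:c:]"]) simp
next
  case (var f i)
  then obtain p where "\<forall>t. f (\<lambda>i. u i + t * v i) = poly p t" by blast
  thus ?case by (intro exI[of _ "[:u i, v i:] * p"]) (simp add: algebra_simps)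
next
  case (add f g)
  then obtain p q where "\<forall>t. f (\<lambda>i. u i + t * v i) = poly p t" "\<forall>t. g (\<lambda>i. u i + t * v i) = poly q t"
    by blast
  thus ?case by (intro exI[of _ "p + q"]) simp
qed

lemma hpoly_scale: "f \<in> hpoly J d \<Longrightarrow> f (\<lambda>i. c * v i) = c ^ d * f v"
  by (induction rule: hpoly_induct) (auto simp: algebra_simps)

text \<open>On the line through \<open>u\<close> and \<open>v\<close> both functions become nonzero
  one-variable polynomials, by their values at the parameters 0 and 1. A product that vanished
  everywhere on the line would be the zero polynomial, because the field is infinite.\<close>

lemma polyf_no_zero_divisors:
  fixes f g :: "'k::field_char_0 func"
  assumes "f \<in> polyf J" "g \<in> polyf J" "f u \<noteq> 0" "g v \<noteq> 0"
  shows "\<exists>w. f w * g w \<noteq> 0"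
proof (rule ccontr)
  assume *: "\<nexists>w. f w * g w \<noteq> 0"
  obtain p where p: "\<And>t. f (\<lambda>i. u i + t * (v i - u i)) = poly p t"
    using polyf_line[OF assms(1), of u "\<lambda>i. v i - u i"] by blast
  obtain q where q: "\<And>t. g (\<lambda>i. u i + t * (v i - u i)) = poly q t"
    using polyf_line[OF assms(2), of u "\<lambda>i. v i - u i"] by blast
  have "poly (p * q) t = poly 0 t" for t
  proof -
    have "f (\<lambda>i. u i + t * (v i - u i)) * g (\<lambda>i. u i + t * (v i - u i)) = 0" using * by blast
    thus ?thesis by (simp only: p q poly_mult poly_0)
  qed
  hence "poly (p * q) = poly 0" by (intro ext)
  hence "p * q = 0" by (simp only: poly_eq_poly_eq_iff)
  moreover have "p \<noteq> 0" using p[of 0] assms(3) by auto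
  moreover have "q \<noteq> 0" using q[of 1] assms(4) by auto
  ultimately show False by simp
qed

section \<open>Formal polynomials and the functions they define\<close>

lemma mpoly_eval_superset:
  assumes "finite A" "keys P \<subseteq> A"
  shows "mpoly_eval P x = (\<Sum>m\<in>A. lookup P m *
      (\<Prod>i\<in>keys m. x i ^ lookup m i))"
  unfolding mpoly_eval_def using assms
  by (intro sum.mono_neutral_left) (auto simp: in_keys_iff)

lemma mpoly_eval_add: "mpoly_eval (P + Q) x = mpoly_eval P x + mpoly_eval Q x"
proof -
  let ?A = "keys P \<union> keys Q"
  have "mpoly_eval (P + Q) x = (\<Sum>m\<in>?A. lookup (P + Q) m *
      (\<Prod>i\<in>keys m. x i ^ lookup m i))"
    by (rule mpoly_eval_superset) (auto simp: Poly_Mapping.keys_add)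
  thus ?thesis
    by (simp add: lookup_add distrib_right sum.distrib mpoly_eval_superset[of ?A P] mpoly_eval_superset[of ?A Q])
qed

lemma mpoly_eval_single:
  "mpoly_eval (Poly_Mapping.single m c) x = c * (\<Prod>i\<in>keys m. x i ^ lookup m i)"
  by (subst mpoly_eval_superset[of "{m}"]) auto

lemma monom_prod_superset:
  fixes x :: "'k::field coords"
  assumes "finite A" "keys m \<subseteq> A"
  shows "(\<Prod>i\<in>keys m. x i ^ lookup m i) = (\<Prod>i\<in>A. x i ^ lookup m i)"
  using assms by (intro prod.mono_neutral_left) (auto simp: in_keys_iff)

lemma monom_deg_superset:
  assumes "finite A" "keys m \<subseteq> A"
  shows "(\<Sum>i\<in>keys m. lookup m i) = (\<Sum>i\<in>A. lookup m i :: nat)"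
  using assms by (intro sum.mono_neutral_left) (auto simp: in_keys_iff)

lemma hpoly_var_power: "i \<in> J \<Longrightarrow> (\<lambda>x. x i ^ n) \<in> hpoly J n"
  using hpoly_const[of 1] by (induction n) (auto intro: hpoly_var)

lemma hpoly_monom:
  "finite A \<Longrightarrow> (\<lambda>x. \<Prod>i\<in>A. x i ^ e i) \<in> hpoly UNIV (\<Sum>i\<in>A. e i)"
proof (induction A rule: finite_induct)
  case empty
  thus ?case using hpoly_const[of 1] by simp
next
  case (insert i A)
  thus ?case using hpoly_mult[OF hpoly_var_power[of i UNIV "e i"] insert.IH] by simp
qed

lemma hpoly_sum: "(\<And>i. i \<in> A \<Longrightarrow> f i \<in> hpoly J d) \<Longrightarrow> (\<lambda>x. \<Sum>i\<in>A. f i x) \<in> hpoly J d"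
  by (induction A rule: infinite_finite_induct) (auto intro: hpoly_zero hpoly_add)

lemma homogeneous_eval_hpoly:
  assumes "homogeneous d P" shows "mpoly_eval P \<in> hpoly UNIV d"
proof -
  have "(\<lambda>x. \<Sum>m\<in>keys P. lookup P m *
      (\<Prod>i\<in>keys m. x i ^ lookup m i)) \<in> hpoly UNIV d"
    using assms unfolding homogeneous_def
    by (intro hpoly_sum hpoly_cmult) (metis hpoly_monom finite_keys)
  thus ?thesis unfolding mpoly_eval_def .
qed

lemma homogeneous_add: "homogeneous d P \<Longrightarrow> homogeneous d Q \<Longrightarrow> homogeneous d (P + Q)"
  unfolding homogeneous_def using Poly_Mapping.keys_add[of P Q] by blast

lemma mpoly_eval_sum: "mpoly_eval (\<Sum>m\<in>A. f m) x = (\<Sum>m\<in>A. mpoly_eval (f m) x)"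
  by (induction A rule: infinite_finite_induct) (auto simp: mpoly_eval_add mpoly_eval_def[of 0])

lemma homogeneous_sum: "(\<And>m. m \<in> A \<Longrightarrow> homogeneous d (f m)) \<Longrightarrow> homogeneous d (\<Sum>m\<in>A. f m)"
  by (induction A rule: infinite_finite_induct) (auto simp: homogeneous_add homogeneous_def[of _ 0])

lemma hpoly_times_var_eval:
  assumes "homogeneous d P"
  shows "\<exists>Q. homogeneous (Suc d) Q \<and> (\<forall>x. mpoly_eval Q x = x i * mpoly_eval P x)"
proof -
  \<comment> \<open>Multiplying by the variable shifts exponents: the product is assembled as a sum
    of shifted monomials, so that additivity of evaluation is enough. \<open>?A m\<close> indexes
    the exponents of \<open>m\<close> and of its shift alike.\<close>
  let ?s = "\<lambda>m :: nat \<Rightarrow>\<^sub>0 nat. m + Poly_Mapping.single i 1"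
  let ?Q = "\<Sum>m\<in>keys P. Poly_Mapping.single (?s m) (lookup P m)"
  let ?A = "\<lambda>m. insert i (keys m)"
  have A: "finite (?A m)" "keys m \<subseteq> ?A m" "keys (?s m) \<subseteq> ?A m" for m :: "nat \<Rightarrow>\<^sub>0 nat"
    using Poly_Mapping.keys_add[of m "Poly_Mapping.single i (1::nat)"] by auto
  have "homogeneous (Suc d) (Poly_Mapping.single (?s m) (lookup P m))"
    if "m \<in> keys P" for m
  proof -
    have "(\<Sum>i\<in>keys m. lookup m i) = d"
      using that assms by (auto simp: homogeneous_def)
    moreover have "(\<Sum>k\<in>?A m. lookup (?s m) k) =
        (\<Sum>k\<in>?A m. lookup m k) + (\<Sum>k\<in>?A m. if k = i then 1 else 0)"
      unfolding sum.distrib[symmetric] by (intro sum.cong) (auto simp: lookup_add lookup_single when_def)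
    moreover have "(\<Sum>k\<in>?A m. if k = i then 1 else 0 :: nat) = 1"
      using A(1)[of m] by (subst sum.delta) auto
    ultimately have "(\<Sum>i\<in>keys (?s m). lookup (?s m) i) = Suc d"
      using monom_deg_superset[OF A(1)[of m] A(2)[of m]] monom_deg_superset[OF A(1)[of m] A(3)[of m]] by linarith
    thus ?thesis by (auto simp: homogeneous_def)
  qed
  hence h: "homogeneous (Suc d) ?Q" by (rule homogeneous_sum)
  have "(\<Prod>k\<in>?A m. x k ^ lookup (?s m) k) = x i * (\<Prod>k\<in>?A m. x k ^ lookup m k)"
    for x :: "nat \<Rightarrow> 'a" and m
  proof -
    have "(\<Prod>k\<in>?A m. x k ^ lookup (?s m) k) =
      (\<Prod>k\<in>?A m. x k ^ lookup m k) * (\<Prod>k\<in>?A m. if k = i then x i else 1)"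
      unfolding prod.distrib[symmetric] by (intro prod.cong) (auto simp: lookup_add lookup_single when_def)
    moreover have "(\<Prod>k\<in>?A m. if k = i then x i else 1) = x i"
      using A(1)[of m] by (subst prod.delta) auto
    ultimately show ?thesis by (simp only: mult.commute)
  qed
  hence "mpoly_eval ?Q x = x i * mpoly_eval P x" for x
    unfolding mpoly_eval_sum mpoly_eval_single monom_prod_superset[OF A(1,3)]
    by (simp add: mpoly_eval_def[of P] monom_prod_superset[OF A(1,2)] sum_distrib_left mult.left_commute
        del: prod.insert prod.insert_if)
  with h show ?thesis by blast
qed

text \<open>The way back to formal polynomials, in terms of which the topology and the twisting
  sections are defined.\<close>

lemma hpoly_UNIV_eval: "f \<in> hpoly UNIV d \<Longrightarrow> \<exists>P. homogeneous d P \<and> mpoly_eval P = f"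
proof (induction rule: hpoly_induct)
  case (zero d)
  show ?case by (intro exI[of _ 0]) (auto simp: homogeneous_def mpoly_eval_def)
next
  case (const c)
  show ?case by (intro exI[of _ "Poly_Mapping.single 0 c"])
      (auto simp: homogeneous_def mpoly_eval_single keys_single)
next
  case (var f d i)
  then obtain P where P: "homogeneous d P" "mpoly_eval P = f" by blast
  obtain Q where "homogeneous (Suc d) Q" "\<forall>x. mpoly_eval Q x = x i * mpoly_eval P x"
    using hpoly_times_var_eval[OF P(1)] by blast
  with P(2) show ?case by (intro exI[of _ Q]) auto
next
  case (add f d g)
  then obtain P Q where "homogeneous d P" "mpoly_eval P = f" "homogeneous d Q" "mpoly_eval Q = g" by blast
  thus ?case by (intro exI[of _ "P + Q"]) (auto simp: homogeneous_add mpoly_eval_add)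
qed

section \<open>The Nullstellensatz\<close>

definition pf_ideal :: "nat set \<Rightarrow> 'k::field func set \<Rightarrow> bool" where
  "pf_ideal J I \<longleftrightarrow> I \<subseteq> polyf J \<and> (\<lambda>x. 0) \<in> I \<and> (\<forall>f\<in>I. \<forall>g\<in>I. (\<lambda>x. f x + g x) \<in> I) \<and>
    (\<forall>a\<in>polyf J. \<forall>f\<in>I. (\<lambda>x. a x * f x) \<in> I)"

lemma pf_idealD:
  assumes "pf_ideal J I"
  shows "f \<in> I \<Longrightarrow> f \<in> polyf J" "(\<lambda>x. 0) \<in> I" "f \<in> I \<Longrightarrow> g \<in> I \<Longrightarrow> (\<lambda>x. f x + g x) \<in> I"
    "a \<in> polyf J \<Longrightarrow> f \<in> I \<Longrightarrow> (\<lambda>x. a x * f x) \<in> I"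
  using assms unfolding pf_ideal_def by auto

text \<open>Polynomials of degree less than \<open>e\<close> in the variable \<open>j\<close> with
  coefficients in the variables of \<open>J\<close>. An exponent may occur repeatedly;
  \<open>below_Suc\<close> collects the coefficient of the top one.\<close>

inductive_set below :: "nat set \<Rightarrow> nat \<Rightarrow> nat \<Rightarrow> 'k::field func set" for J j e where
  zero: "(\<lambda>x. 0) \<in> below J j e"
| add: "\<lbrakk>h \<in> polyf J; m < e; f \<in> below J j e\<rbrakk> \<Longrightarrow> (\<lambda>x. h x * x j ^ m + f x) \<in> below J j e"

lemma below_plus: "f \<in> below J j e \<Longrightarrow> g \<in> below J j e \<Longrightarrow> (\<lambda>x. f x + g x) \<in> below J j e"
  by (induction rule: below.induct) (auto simp: add.assoc intro: below.add)

lemma below_times: "f \<in> below J j e \<Longrightarrow> a \<in> polyf J \<Longrightarrow> (\<lambda>x. a x * f x) \<in> below J j e"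
proof (induction rule: below.induct)
  case (add h m f)
  have "(\<lambda>x. (a x * h x) * x j ^ m + a x * f x) \<in> below J j e"
    using add by (intro below.add polyf_mult) auto
  thus ?case by (simp add: algebra_simps)
qed (auto intro: below.zero)

lemma below_mono: "f \<in> below J j e \<Longrightarrow> e \<le> e' \<Longrightarrow> f \<in> below J j e'"
  by (induction rule: below.induct) (auto intro: below.intros)

lemma below_times_power: "f \<in> below J j e \<Longrightarrow> (\<lambda>x. x j ^ i * f x) \<in> below J j (i + e)"
proof (induction rule: below.induct)
  case (add h m f)
  have "(\<lambda>x. h x * x j ^ (i + m) + x j ^ i * f x) \<in> below J j (i + e)"
    using add by (intro below.add) auto
  thus ?case by (simp add: algebra_simps power_add)
qed (auto intro: below.zero)

lemma below_single: "h \<in> polyf J \<Longrightarrow> m < e \<Longrightarrow> (\<lambda>x. h x * x j ^ m) \<in> below J j e"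
  using below.add[OF _ _ below.zero, of h J m e j] by simp

lemma below_Suc: "f \<in> below J j (Suc e) \<Longrightarrow>
    \<exists>h\<in>polyf J. \<exists>g\<in>below J j e. f = (\<lambda>x. h x * x j ^ e + g x)"
proof (induction rule: below.induct)
  case zero
  show ?case by (intro bexI[of _ "\<lambda>x. 0"]) (auto intro: below.zero polyf.const)
next
  case (add h m f)
  then obtain h' g where *: "h' \<in> polyf J" "g \<in> below J j e" "f = (\<lambda>x. h' x * x j ^ e + g x)" by blast
  show ?case
  proof (cases "m = e")
    case True
    with * add show ?thesis
      by (intro bexI[of _ "\<lambda>x. h x + h' x"] bexI[of _ g]) (auto simp: algebra_simps intro: polyf.add)
  next
    case False
    with * add show ?thesis
      by (intro bexI[of _ h'] bexI[of _ "\<lambda>x. h x * x j ^ m + g x"]) (auto intro: below.add)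
  qed
qed

lemma polyf_insert_below: "f \<in> polyf (insert j J) \<Longrightarrow> \<exists>e. f \<in> below J j e"
proof (induction rule: polyf.induct)
  case (const c)
  show ?case using below_single[of "\<lambda>x. c" J 0 1 j] polyf.const by auto
next
  case (var f i)
  then obtain e where e: "f \<in> below J j e" by blast
  show ?case
  proof (cases "i = j")
    case True
    thus ?thesis using below_times_power[OF e, of 1] by auto
  next
    case False
    thus ?thesis using below_times[OF e polyf_var[of i J]] var by auto
  qed
next
  case (add f g)
  then obtain e e' where "f \<in> below J j e" "g \<in> below J j e'" by blast
  hence "f \<in> below J j (max e e')" "g \<in> below J j (max e e')" by (auto intro: below_mono)
  thus ?case using below_plus by blast
qed

text \<open>The substituted vector is x' + x_j c, where x' is x with coordinate j set to zero.
  Expanding a form of degree d, the coefficient of the d-th power of x_j is the value of the form at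
  c. Choosing c off its zeros thus makes the form monic in x_j up to a scalar.\<close>

lemma hpoly_leading:
  assumes "f \<in> hpoly (insert j J) d" "j \<notin> J"
  shows "\<exists>g\<in>below J j d. (\<lambda>x. f (\<lambda>i. if i = j then c j * x j else x i + c i * x j)) =
    (\<lambda>x. f c * x j ^ d + g x)"
  using assms(1)
proof (induction rule: hpoly_induct)
  case (zero d)
  show ?case by (intro bexI[of _ "\<lambda>x. 0"]) (auto intro: below.zero)
next
  case (const a)
  show ?case by (intro bexI[of _ "\<lambda>x. 0"]) (auto intro: below.zero)
next
  case (var f d i)
  let ?T = "\<lambda>x i. if i = j then c j * x j else x i + c i * x j"
  from var obtain g where g: "g \<in> below J j d" "(\<lambda>x. f (?T x)) = (\<lambda>x. f c * x j ^ d + g x)"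
    by blast
  have g_eq: "f (?T x) = f c * x j ^ d + g x" for x using fun_cong[OF g(2)] .
  have g1: "(\<lambda>x. x j ^ 1 * g x) \<in> below J j (1 + d)" by (rule below_times_power[OF g(1)])
  hence g2: "(\<lambda>x. c i * (x j * g x)) \<in> below J j (Suc d)"
    using below_times[OF _ polyf.const[of "c i" J]] by simp
  show ?case
  proof (cases "i = j")
    case True
    with g2 show ?thesis
      by (intro bexI[of _ "\<lambda>x. c i * (x j * g x)"]) (auto simp: g_eq algebra_simps)
  next
    case False
    hence i: "i \<in> J" using var by auto
    have "(\<lambda>x. (x i * f c) * x j ^ d + x i * g x) \<in> below J j (Suc d)"
      using i by (intro below.add polyf.var polyf.const below_times[OF below_mono[OF g(1)] polyf_var]) auto
    from below_plus[OF this g2] False show ?thesis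
      by (intro bexI[of _ "\<lambda>x. (x i * f c) * x j ^ d + x i * g x + c i * (x j * g x)"])
        (auto simp: g_eq algebra_simps)
  qed
next
  case (add f d f')
  then obtain g g' where g: "g \<in> below J j d" "g' \<in> below J j d"
    "(\<lambda>x. f (\<lambda>i. if i = j then c j * x j else x i + c i * x j)) = (\<lambda>x. f c * x j ^ d + g x)"
    "(\<lambda>x. f' (\<lambda>i. if i = j then c j * x j else x i + c i * x j)) = (\<lambda>x. f' c * x j ^ d + g' x)"
    by blast
  thus ?case
    by (intro bexI[of _ "\<lambda>x. g x + g' x"]) (auto simp: fun_eq_iff algebra_simps intro: below_plus)
qed

lemma polyf_hpoly_sum:
  "f \<in> polyf J \<Longrightarrow> \<exists>D F. (\<forall>d. F d \<in> hpoly J d) \<and> f = (\<lambda>x. \<Sum>d<D. F d x)"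
proof (induction rule: polyf.induct)
  case (const c)
  show ?case
    by (intro exI[of _ 1] exI[of _ "\<lambda>d x. if d = 0 then c else 0"]) (auto intro: hpoly_intros)
next
  case (var f i)
  then obtain D F where F: "\<forall>d. F d \<in> hpoly J d" "f = (\<lambda>x. \<Sum>d<D. F d x)" by blast
  define G where "G d = (case d of 0 \<Rightarrow> (\<lambda>x. 0) | Suc d \<Rightarrow> (\<lambda>x. x i * F d x))" for d
  have "G d \<in> hpoly J d" for d using F var by (auto simp: G_def intro: hpoly_intros split: nat.split)
  moreover have "(\<lambda>x. x i * f x) = (\<lambda>x. \<Sum>d<Suc D. G d x)"
    by (simp only: sum.lessThan_Suc_shift) (simp add: G_def F(2) sum_distrib_left)
  ultimately show ?case by blast
next
  case (add f g)
  then obtain D F D' F' where F: "\<forall>d. F d \<in> hpoly J d" "f = (\<lambda>x. \<Sum>d<D. F d x)"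
    and F': "\<forall>d. F' d \<in> hpoly J d" "g = (\<lambda>x. \<Sum>d<D'. F' d x)" by blast
  define G where "G d = (\<lambda>x. (if d < D then F d x else 0) + (if d < D' then F' d x else 0))" for d
  have "G d \<in> hpoly J d" for d
    using F(1) F'(1) unfolding G_def by (intro hpoly_add) (cases "d < D"; cases "d < D'"; simp add: hpoly_zero)+
  moreover have "(\<Sum>d<max D D'. G d x) = (\<Sum>d<D. F d x) + (\<Sum>d<D'. F' d x)" for x
  proof -
    have "(\<Sum>d<max D D'. if d < D then F d x else 0) = (\<Sum>d<D. F d x)"
      by (intro sum.mono_neutral_cong_right) auto
    moreover have "(\<Sum>d<max D D'. if d < D' then F' d x else 0) = (\<Sum>d<D'. F' d x)"
      by (intro sum.mono_neutral_cong_right) auto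
    ultimately show ?thesis by (simp add: G_def sum.distrib)
  qed
  ultimately show ?case unfolding F(2) F'(2) by (intro exI[of _ "max D D'"] exI[of _ G]) auto
qed

text \<open>The ideal generated in the larger polynomial ring by the polynomials in \<open>J\<close>
  that vanish at \<open>a\<close>: the extension of the maximal ideal of \<open>a\<close>.\<close>

inductive_set null_span :: "nat set \<Rightarrow> nat \<Rightarrow> 'k::field coords \<Rightarrow> 'k func set" for J j a where
  zero: "(\<lambda>x. 0) \<in> null_span J j a"
| add: "\<lbrakk>n \<in> polyf J; n a = 0; u \<in> polyf (insert j J); w \<in> null_span J j a\<rbrakk> \<Longrightarrow>
    (\<lambda>x. n x * u x + w x) \<in> null_span J j a"

lemma null_span_times:
  "w \<in> null_span J j a \<Longrightarrow> v \<in> polyf (insert j J) \<Longrightarrow> (\<lambda>x. v x * w x) \<in> null_span J j a"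
proof (induction rule: null_span.induct)
  case (add n u w)
  hence "(\<lambda>x. n x * (v x * u x) + v x * w x) \<in> null_span J j a"
    by (intro null_span.add polyf_mult) auto
  thus ?case by (simp add: algebra_simps)
qed (auto intro: null_span.zero)

text \<open>Replacing each coefficient by its value at \<open>a\<close> changes \<open>f\<close> by
  an element of the span and does not change its restriction to the line over
  \<open>a\<close>.\<close>

lemma below_null_span:
  assumes "j \<notin> J" "f \<in> below J j e"
  shows "\<exists>p. (\<forall>t. f (a(j := t)) = poly p t) \<and> (\<lambda>x. f x - poly p (x j)) \<in> null_span J j a"
  using assms(2)
proof (induction rule: below.induct)
  case zero
  show ?case by (intro exI[of _ 0]) (auto intro: null_span.zero)
next
  case (add h m f)
  then obtain p where p: "\<forall>t. f (a(j := t)) = poly p t" "(\<lambda>x. f x - poly p (x j)) \<in> null_span J j a"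
    by blast
  have h: "h (a(j := t)) = h a" for t using add assms(1) by (intro polyf_cong[of h J]) auto
  have "(\<lambda>x. (h x - h a) * x j ^ m + (f x - poly p (x j))) \<in> null_span J j a"
    by (intro null_span.add p(2) polyf_diff polyf.const add polyf_power polyf_var) auto
  hence 1: "(\<lambda>x. (h x * x j ^ m + f x) - poly (monom (h a) m + p) (x j)) \<in> null_span J j a"
    by (simp add: poly_monom algebra_simps)
  have 2: "h (a(j := t)) * (a(j := t)) j ^ m + f (a(j := t)) = poly (monom (h a) m + p) t" for t
    by (simp only: h p(1)[rule_format] poly_add poly_monom fun_upd_same)
  show ?case using 1 2 by blast
qed

lemma polyf_poly: "f \<in> polyf J \<Longrightarrow> (\<lambda>x. poly p (f x)) \<in> polyf J"
  by (induction p) (auto intro: polyf.const polyf.add polyf_mult)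

lemma division_by_monic:
  assumes "g \<in> below J j D" "u \<in> below J j e"
  shows "\<exists>c\<in>below J j D. \<exists>q\<in>polyf (insert j J). u = (\<lambda>x. q x * (x j ^ D + g x) + c x)"
  using assms(2)
proof (induction e arbitrary: u)
  case 0
  hence "u \<in> below J j D" by (auto intro: below_mono)
  thus ?case by (intro bexI[of _ u] bexI[of _ "\<lambda>x. 0"]) (auto intro: polyf.const)
next
  case (Suc e)
  show ?case
  proof (cases "Suc e \<le> D")
    case True
    hence "u \<in> below J j D" using Suc by (auto intro: below_mono)
    thus ?thesis by (intro bexI[of _ u] bexI[of _ "\<lambda>x. 0"]) (auto intro: polyf.const)
  next
    case False
    obtain h u' where u: "h \<in> polyf J" "u' \<in> below J j e" "u = (\<lambda>x. h x * x j ^ e + u' x)"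
      using below_Suc[OF Suc.prems] by blast
    have "(\<lambda>x. x j ^ (e - D) * g x) \<in> below J j (e - D + D)" by (rule below_times_power[OF assms(1)])
    hence "(\<lambda>x. x j ^ (e - D) * g x) \<in> below J j e" using False by simp
    from below_times[OF this polyf_uminus[OF u(1)]]
    have "(\<lambda>x. u' x + - h x * (x j ^ (e - D) * g x)) \<in> below J j e"
      using u(2) by (intro below_plus)
    from Suc.IH[OF this] obtain c q where c: "c \<in> below J j D" "q \<in> polyf (insert j J)"
      and cq: "(\<lambda>x. u' x + - h x * (x j ^ (e - D) * g x)) = (\<lambda>x. q x * (x j ^ D + g x) + c x)" by blast
    have "h \<in> polyf (insert j J)" using u(1) by (rule polyf_mono) auto
    hence "(\<lambda>x. q x + h x * x j ^ (e - D)) \<in> polyf (insert j J)"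
      using c(2) by (intro polyf.add polyf_mult polyf_power polyf_var) auto
    moreover have "x j ^ e = x j ^ (e - D) * x j ^ D" for x :: "nat \<Rightarrow> 'a"
      using False by (simp flip: power_add)
    hence "u x = (q x + h x * x j ^ (e - D)) * (x j ^ D + g x) + c x" for x
      using fun_cong[OF cq, of x] unfolding u(3) by (simp add: algebra_simps)
    ultimately show ?thesis using c(1)
      by (intro bexI[of _ c] bexI[of _ "\<lambda>x. q x + h x * x j ^ (e - D)"]) auto
  qed
qed

text \<open>Nakayama: the powers of the variable \<open>j\<close> generating the quotient by \<open>I\<close> are eliminated one by one.\<close>

lemma fibre_ideal_proper:
  fixes I :: "'k::field func set"
  assumes j: "j \<notin> J" and I: "pf_ideal (insert j J) I"
    and g: "g \<in> below J j D" "(\<lambda>x. x j ^ D + g x) \<in> I"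
    and a: "\<And>h. h \<in> I \<Longrightarrow> h \<in> polyf J \<Longrightarrow> h a = 0"
    and f: "f \<in> I" "\<And>t. f (a(j := t)) = 1"
  shows False
proof -
  note ID = pf_idealD[OF I]
  have Jj: "h \<in> polyf J \<Longrightarrow> h \<in> polyf (insert j J)" for h by (rule polyf_mono) auto
  have minus: "(\<lambda>x. h x - h' x) \<in> I" if "h \<in> I" "h' \<in> I" for h h'
    using ID(3)[OF that(1) ID(4)[OF polyf.const[of "-1"] that(2)]] by simp
  obtain e where "f \<in> below J j e" using polyf_insert_below ID(1)[OF f(1)] by blast
  from below_null_span[OF j this, of a] obtain p where p: "\<And>t. f (a(j := t)) = poly p t"
    "(\<lambda>x. f x - poly p (x j)) \<in> null_span J j a" by blast
  hence f1: "(\<lambda>x. f x - 1) \<in> null_span J j a" using f(2) by simp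
  \<comment> \<open>\<open>Q e\<close> says that, after localising at the maximal ideal of
    \<open>a\<close>, the quotient by \<open>I\<close> is generated by the powers of
    \<open>x j\<close> below \<open>e\<close>. The denominators are normalised to have value 1 at
    \<open>a\<close>.\<close>
  define Q where "Q e \<longleftrightarrow> (\<forall>u\<in>polyf (insert j J). \<exists>r\<in>polyf J. \<exists>c\<in>below J j e. r a = 1 \<and>
    (\<lambda>x. r x * u x - c x) \<in> I)" for e
  have QD: "Q D" unfolding Q_def
  proof
    fix u :: "'k func" assume "u \<in> polyf (insert j J)"
    then obtain e where "u \<in> below J j e" using polyf_insert_below by blast
    from division_by_monic[OF g(1) this] obtain c q where c: "c \<in> below J j D" "q \<in> polyf (insert j J)"
      "u = (\<lambda>x. q x * (x j ^ D + g x) + c x)" by blast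
    have "(\<lambda>x. 1 * u x - c x) \<in> I" using ID(4)[OF c(2) g(2)] by (simp add: c(3))
    thus "\<exists>r\<in>polyf J. \<exists>c\<in>below J j D. r a = 1 \<and> (\<lambda>x. r x * u x - c x) \<in> I"
      using c(1) by (intro bexI[of _ "\<lambda>x. 1"] bexI[of _ c]) (auto intro: polyf.const)
  qed
  have step: "Q e" if Qe: "Q (Suc e)" for e
  proof -
    \<comment> \<open>An element of the span is, modulo \<open>I\<close> and up to a denominator,
      \<open>n * x j ^ e\<close> plus lower terms with \<open>n\<close> vanishing at
      \<open>a\<close>: each summand carries such a factor, and \<open>Q (Suc e)\<close> reduces its
      cofactor.\<close>
    have red: "\<exists>r\<in>polyf J. \<exists>n\<in>polyf J. \<exists>c\<in>below J j e. r a = 1 \<and> n a = 0 \<and>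
        (\<lambda>x. r x * w x - n x * x j ^ e - c x) \<in> I" if "w \<in> null_span J j a" for w
      using that
    proof (induction rule: null_span.induct)
      case zero
      show ?case
        by (intro bexI[of _ "\<lambda>x. 1"] bexI[of _ "\<lambda>x. 0"]) (auto intro: polyf.const below.zero ID(2))
    next
      case (add n u w)
      then obtain r n' c where w: "r \<in> polyf J" "n' \<in> polyf J" "c \<in> below J j e" "r a = 1" "n' a = 0"
        "(\<lambda>x. r x * w x - n' x * x j ^ e - c x) \<in> I" by blast
      obtain s d where s: "s \<in> polyf J" "d \<in> below J j (Suc e)" "s a = 1" "(\<lambda>x. s x * u x - d x) \<in> I"
        using Qe add(3) unfolding Q_def by blast
      obtain h d' where d: "h \<in> polyf J" "d' \<in> below J j e" "d = (\<lambda>x. h x * x j ^ e + d' x)"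
        using below_Suc[OF s(2)] by blast
      have "(\<lambda>x. (r x * n x) * (s x * u x - d x) + s x * (r x * w x - n' x * x j ^ e - c x)) \<in> I"
        using add(1) s(1) w(1) by (intro ID(3) ID(4) s(4) w(6) polyf_mult Jj)
      moreover have "(\<lambda>x. (r x * n x) * (s x * u x - d x) + s x * (r x * w x - n' x * x j ^ e - c x)) =
        (\<lambda>x. (r x * s x) * (n x * u x + w x) - (r x * n x * h x + s x * n' x) * x j ^ e -
          ((r x * n x) * d' x + s x * c x))"
        by (simp add: d(3) algebra_simps)
      ultimately have "(\<lambda>x. (r x * s x) * (n x * u x + w x) - (r x * n x * h x + s x * n' x) * x j ^ e -
          ((r x * n x) * d' x + s x * c x)) \<in> I" by simp
      moreover have "(\<lambda>x. r x * s x) \<in> polyf J" by (intro polyf_mult w(1) s(1))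
      moreover have "(\<lambda>x. r x * n x * h x + s x * n' x) \<in> polyf J"
        by (intro polyf_mult polyf.add w(1,2) s(1) add(1) d(1))
      moreover have "(\<lambda>x. (r x * n x) * d' x + s x * c x) \<in> below J j e"
        by (intro below_plus below_times d(2) w(3) polyf_mult w(1) add(1) s(1))
      moreover have "r a * s a = 1" "r a * n a * h a + s a * n' a = 0" using s(3) w(4,5) add(2) by auto
      ultimately show ?case
        by (intro bexI[of _ "\<lambda>x. r x * s x"] bexI[of _ "\<lambda>x. r x * n x * h x + s x * n' x"]
            bexI[of _ "\<lambda>x. (r x * n x) * d' x + s x * c x"] conjI)
    qed
    have xe: "(\<lambda>x. x j ^ e) \<in> polyf (insert j J)" by (intro polyf_power polyf_var) auto
    from red[OF null_span_times[OF f1 xe]] obtain r n c where r: "r \<in> polyf J" "n \<in> polyf J"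
      "c \<in> below J j e" "r a = 1" "n a = 0" "(\<lambda>x. r x * (x j ^ e * (f x - 1)) - n x * x j ^ e - c x) \<in> I"
      by blast
    have rx: "(\<lambda>x. r x * x j ^ e) \<in> polyf (insert j J)" by (intro polyf_mult xe Jj r(1))
    \<comment> \<open>Since \<open>f\<close> lies in \<open>I\<close> and \<open>f - 1\<close> in
      the span, subtracting expresses \<open>x j ^ e\<close> by lower powers. Its coefficient
      \<open>r + n\<close> has value 1 at \<open>a\<close>, so it is an admissible
      denominator.\<close>
    have rn: "(\<lambda>x. (r x + n x) * x j ^ e + c x) \<in> I"
    proof -
      have "(\<lambda>x. (r x * x j ^ e) * f x - (r x * (x j ^ e * (f x - 1)) - n x * x j ^ e - c x)) \<in> I"
        by (rule minus[OF ID(4)[OF rx f(1)] r(6)])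
      moreover have "(r x * x j ^ e) * f x - (r x * (x j ^ e * (f x - 1)) - n x * x j ^ e - c x) =
          (r x + n x) * x j ^ e + c x" for x by (simp add: algebra_simps)
      ultimately show ?thesis by (simp only:)
    qed
    show ?thesis unfolding Q_def
    proof
      fix u :: "'k func" assume "u \<in> polyf (insert j J)"
      then obtain s d where s: "s \<in> polyf J" "d \<in> below J j (Suc e)" "s a = 1" "(\<lambda>x. s x * u x - d x) \<in> I"
        using Qe unfolding Q_def by blast
      obtain h d' where d: "h \<in> polyf J" "d' \<in> below J j e" "d = (\<lambda>x. h x * x j ^ e + d' x)"
        using below_Suc[OF s(2)] by blast
      have "(\<lambda>x. (r x + n x) * (s x * u x - d x) + h x * ((r x + n x) * x j ^ e + c x)) \<in> I"
        using r d by (intro ID(3) ID(4) s(4) rn polyf.add Jj)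
      moreover have "(\<lambda>x. (r x + n x) * (s x * u x - d x) + h x * ((r x + n x) * x j ^ e + c x)) =
        (\<lambda>x. ((r x + n x) * s x) * u x - ((r x + n x) * d' x + - h x * c x))"
        by (simp add: d(3) algebra_simps)
      ultimately have "(\<lambda>x. ((r x + n x) * s x) * u x - ((r x + n x) * d' x + - h x * c x)) \<in> I" by simp
      moreover have "(\<lambda>x. (r x + n x) * s x) \<in> polyf J" by (intro polyf_mult polyf.add r s(1))
      moreover have "(\<lambda>x. (r x + n x) * d' x + - h x * c x) \<in> below J j e"
        by (intro below_plus below_times d r polyf.add polyf_uminus)
      moreover have "(r a + n a) * s a = 1" using r(4,5) s(3) by simp
      ultimately show "\<exists>r\<in>polyf J. \<exists>c\<in>below J j e. r a = 1 \<and> (\<lambda>x. r x * u x - c x) \<in> I"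
        by (intro bexI[of _ "\<lambda>x. (r x + n x) * s x"] bexI[of _ "\<lambda>x. (r x + n x) * d' x + - h x * c x"] conjI)
    qed
  qed
  \<comment> \<open>With no powers left, some \<open>r\<close> with value 1 at \<open>a\<close> lies
    in \<open>I\<close> and in the smaller ring, against the choice of \<open>a\<close>.\<close>
  have "Q 0" using QD step by (induction D) auto
  hence "\<exists>r\<in>polyf J. \<exists>c\<in>below J j 0. r a = 1 \<and> (\<lambda>x. r x * 1 - c x) \<in> I"
    unfolding Q_def by (rule bspec) (rule polyf.const)
  then obtain r c where r: "r \<in> polyf J" "c \<in> below J j 0" "r a = 1" "(\<lambda>x. r x * 1 - c x) \<in> I"
    by (elim bexE conjE)
  have "c = (\<lambda>x. 0)" using r(2) by (cases rule: below.cases) auto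
  with r have "r \<in> I" by simp
  from a[OF this r(1)] r(3) show False by simp
qed

text \<open>The monic element makes the zeros of \<open>I\<close> project onto the zeros of its
  elimination ideal. So a zero \<open>a\<close> of that ideal is taken from the induction
  hypothesis, and a common zero of \<open>I\<close> is found on the line over it.\<close>

lemma nullstellensatz_step:
  fixes I :: "'k::alg_closed_field func set"
  assumes j: "j \<notin> J" and I: "pf_ideal (insert j J) I"
    and IH: "\<And>I' :: 'k func set. pf_ideal J I' \<Longrightarrow> \<forall>v. \<exists>f\<in>I'. f v \<noteq> 0 \<Longrightarrow> (\<lambda>x. 1) \<in> I'"
    and g: "g \<in> below J j D" "(\<lambda>x. x j ^ D + g x) \<in> I"
    and Z: "\<forall>v. \<exists>f\<in>I. f v \<noteq> 0"
  shows "(\<lambda>x. 1) \<in> I"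
proof (rule ccontr)
  assume n1: "(\<lambda>x. 1) \<notin> I"
  note ID = pf_idealD[OF I]
  have Jj: "h \<in> polyf J \<Longrightarrow> h \<in> polyf (insert j J)" for h :: "'k func" by (rule polyf_mono) auto
  have "pf_ideal J (I \<inter> polyf J)"
    unfolding pf_ideal_def using ID(2-4) Jj by (auto intro: polyf.const polyf.add polyf_mult)
  from IH[OF this] n1 obtain a where a: "\<And>h. h \<in> I \<inter> polyf J \<Longrightarrow> h a = 0" by blast
  have proper: False if "f \<in> I" "\<And>t. f (a(j := t)) = 1" for f
    by (rule fibre_ideal_proper[OF j I g _ that]) (use a in auto)
  \<comment> \<open>Restrictions of \<open>I\<close> to the line over \<open>a\<close>. A nonzero
    element \<open>p\<close> of least degree divides all the others, and it is not constant because
    \<open>fibre_ideal_proper\<close> excludes 1; a root of \<open>p\<close> completes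
    \<open>a\<close> to a zero of \<open>I\<close>.\<close>
  define K where "K = {p. \<exists>f\<in>I. \<forall>t. f (a(j := t)) = poly p t}"
  have fp: "\<exists>p\<in>K. \<forall>t. f (a(j := t)) = poly p t" if f: "f \<in> I" for f
  proof -
    obtain e where "f \<in> below J j e" using polyf_insert_below ID(1)[OF f] by blast
    from below_null_span[OF j this, of a] show ?thesis using f unfolding K_def by blast
  qed
  have "\<exists>p\<in>K. p \<noteq> 0"
  proof -
    obtain f where f: "f \<in> I" "f (a(j := 0)) \<noteq> 0" using Z by blast
    thus ?thesis using fp[OF f(1)] by (metis poly_0)
  qed
  then obtain p where p: "p \<in> K \<and> p \<noteq> 0" "\<And>q. q \<in> K \<and> q \<noteq> 0 \<Longrightarrow> degree p \<le> degree q"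
    using ex_has_least_nat[of "\<lambda>p. p \<in> K \<and> p \<noteq> 0" _ degree] by blast
  from p(1) obtain f where f: "f \<in> I" "\<And>t. f (a(j := t)) = poly p t" unfolding K_def by blast
  show False
  proof (cases "degree p = 0")
    case True
    then obtain c where c: "p = [:c:]" by (rule degree_eq_zeroE)
    with p(1) have "c \<noteq> 0" by simp
    thus False
      using proper[OF ID(4)[OF polyf.const[of "1 / c"] f(1)]] by (simp add: f(2) c)
  next
    case False
    then obtain t where t: "poly p t = 0" using alg_closed_imp_poly_has_root by blast
    have "h (a(j := t)) = 0" if h: "h \<in> I" for h
    proof -
      obtain q where q: "q \<in> K" "\<And>t. h (a(j := t)) = poly q t" using fp[OF h] by blast
      define w where "w = (\<lambda>x. h x + poly (- (q div p)) (x j) * f x)"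
      have "w \<in> I" unfolding w_def by (intro ID(3) ID(4) h f(1) polyf_poly polyf_var) auto
      moreover have "w (a(j := t)) = poly (q mod p) t" for t
        by (simp add: w_def f(2) q(2) flip: minus_div_mult_eq_mod)
      ultimately have "q mod p \<in> K" unfolding K_def by blast
      hence "q mod p = 0" using p degree_mod_less[of p q] by fastforce
      hence "q = q div p * p" by (metis add.right_neutral div_mult_mod_eq)
      thus ?thesis using t q(2)[of t] by (metis mult_zero_right poly_mult)
    qed
    thus False using Z by blast
  qed
qed

lemma weak_nullstellensatz:
  fixes I :: "'k::{alg_closed_field, field_char_0} func set"
  assumes "finite J" "pf_ideal J I" "\<forall>v. \<exists>f\<in>I. f v \<noteq> 0"
  shows "(\<lambda>x. 1) \<in> I"
  using assms
proof (induction J arbitrary: I rule: finite_induct)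
  case empty
  note ID = pf_idealD[OF empty(1)]
  obtain f where f: "f \<in> I" "f (\<lambda>x. 0) \<noteq> 0" using empty by blast
  have "f x = f (\<lambda>x. 0)" for x using ID(1)[OF f(1)] by (rule polyf_cong) auto
  hence "(\<lambda>x. 1 / f (\<lambda>x. 0) * f x) = (\<lambda>x. 1)" using f(2) by (metis nonzero_divide_eq_eq)
  thus ?case using ID(4)[OF polyf.const[of "1 / f (\<lambda>x. 0)"] f(1)] by (simp only:)
next
  case (insert j J)
  note ID = pf_idealD[OF insert.prems(1)]
  obtain f0 where f0: "f0 \<in> I" "f0 (\<lambda>x. 0) \<noteq> 0" using insert.prems by blast
  \<comment> \<open>A decomposition with least \<open>D\<close> has a nonzero part of top degree,
    which is the one to be made monic.\<close>
  let ?P = "\<lambda>D. \<exists>F. (\<forall>d. F d \<in> hpoly (insert j J) d) \<and> f0 = (\<lambda>x. \<Sum>d<D. F d x)"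
  define D where "D = (LEAST D. ?P D)"
  have "?P D" unfolding D_def using polyf_hpoly_sum[OF ID(1)[OF f0(1)]] by (rule LeastI_ex)
  then obtain F where F: "\<And>d. F d \<in> hpoly (insert j J) d" "f0 = (\<lambda>x. \<Sum>d<D. F d x)" by blast
  have "D \<noteq> 0" using f0(2) F(2) by (intro notI) simp
  then obtain d where D: "D = Suc d" by (cases D) simp_all
  have "\<exists>u. F d u \<noteq> 0"
  proof (rule ccontr)
    assume "\<nexists>u. F d u \<noteq> 0"
    hence "?P d" using F unfolding D by auto
    hence "D \<le> d" unfolding D_def by (rule Least_le)
    thus False using D by simp
  qed
  then obtain u where "F d u \<noteq> 0" by blast
  \<comment> \<open>\<open>c j\<close> must be nonzero as well, so that the substitution
    \<open>T\<close> is invertible; the absence of zero divisors gives both at once.\<close>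
  then obtain c where c: "F d c * c j \<noteq> 0"
    using polyf_no_zero_divisors[OF hpoly_polyf[OF F(1)] polyf_var[OF insertI1], of d u "\<lambda>_. 1"] F by auto
  define T where "T x = (\<lambda>i. if i = j then c j * x j else x i + c i * x j)" for x :: "'k coords"
  define T' where "T' x = (\<lambda>i. if i = j then x j / c j else x i - c i * (x j / c j))" for x :: "'k coords"
  have TT: "T (T' x) = x" "T' (T x) = x" for x using c by (auto simp: T_def T'_def fun_eq_iff)
  have pT: "(\<lambda>x. f (T x)) \<in> polyf (insert j J)" if "f \<in> polyf (insert j J)" for f
    using that
  proof (rule polyf_compose)
    fix i assume i: "i \<in> insert j J"
    have "(\<lambda>x. (if i = j then c j - 1 else c i) * x j + x i) \<in> polyf (insert j J)"
      by (intro polyf.add polyf_mult polyf_var polyf.const i) auto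
    thus "(\<lambda>x. T x i) \<in> polyf (insert j J)" by (cases "i = j") (auto simp: T_def algebra_simps)
  qed
  have pT': "(\<lambda>x. f (T' x)) \<in> polyf (insert j J)" if "f \<in> polyf (insert j J)" for f
    using that
  proof (rule polyf_compose)
    fix i assume i: "i \<in> insert j J"
    have "(\<lambda>x. (if i = j then 1 / c j - 1 else - c i / c j) * x j + x i) \<in> polyf (insert j J)"
      by (intro polyf.add polyf_mult polyf_var polyf.const i) auto
    thus "(\<lambda>x. T' x i) \<in> polyf (insert j J)" by (cases "i = j") (auto simp: T'_def algebra_simps)
  qed
  define IT where "IT = (\<lambda>f x. f (T x)) ` I"
  have IT: "pf_ideal (insert j J) IT"
    unfolding pf_ideal_def
  proof (intro conjI ballI)
    show "IT \<subseteq> polyf (insert j J)" unfolding IT_def using pT ID(1) by blast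
    show "(\<lambda>x. 0) \<in> IT" unfolding IT_def by (rule image_eqI[OF _ ID(2)]) simp
  next
    fix f g assume "f \<in> IT" "g \<in> IT"
    then obtain f' g' where "f' \<in> I" "g' \<in> I" "f = (\<lambda>x. f' (T x))" "g = (\<lambda>x. g' (T x))"
      unfolding IT_def by blast
    thus "(\<lambda>x. f x + g x) \<in> IT" unfolding IT_def using ID(3)[of f' g'] by (intro image_eqI[of _ _ "\<lambda>x. f' x + g' x"]) auto
  next
    fix a f :: "'k func" assume a: "a \<in> polyf (insert j J)" and "f \<in> IT"
    then obtain f' where f': "f' \<in> I" "f = (\<lambda>x. f' (T x))" unfolding IT_def by blast
    show "(\<lambda>x. a x * f x) \<in> IT" unfolding IT_def f'(2)
      by (intro image_eqI[OF _ ID(4)[OF pT'[OF a] f'(1)]]) (simp add: TT)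
  qed
  have lead: "\<exists>g\<in>below J j e. (\<lambda>x. F e (T x)) = (\<lambda>x. F e c * x j ^ e + g x)" for e
    using hpoly_leading[OF F(1) insert.hyps(2)] unfolding T_def .
  have low: "(\<lambda>x. \<Sum>e\<in>A. F e (T x)) \<in> below J j d" if "A \<subseteq> {..<d}" for A
  proof -
    have "finite A" using that finite_subset by blast
    thus ?thesis using that
    proof (induction A rule: finite_induct)
      case (insert e A)
      obtain g where g: "g \<in> below J j e" "(\<lambda>x. F e (T x)) = (\<lambda>x. F e c * x j ^ e + g x)"
        using lead by blast
      have "g \<in> below J j d" using g(1) insert.prems by (auto intro: below_mono)
      hence "(\<lambda>x. F e c * x j ^ e + g x) \<in> below J j d"
        using insert.prems by (intro below.add polyf.const) auto
      hence "(\<lambda>x. F e (T x)) \<in> below J j d" unfolding g(2) .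
      hence "(\<lambda>x. F e (T x) + (\<Sum>e\<in>A. F e (T x))) \<in> below J j d"
        using insert by (intro below_plus) auto
      thus ?case using insert.hyps by simp
    qed (auto intro: below.zero)
  qed
  obtain g where g: "g \<in> below J j d" "(\<lambda>x. F d (T x)) = (\<lambda>x. F d c * x j ^ d + g x)" using lead by blast
  have f0T: "f0 (T x) = F d c * x j ^ d + (g x + (\<Sum>e<d. F e (T x)))" for x
    using fun_cong[OF g(2), of x] by (simp add: F(2) D)
  define G where "G = (\<lambda>x. 1 / F d c * (g x + (\<Sum>e<d. F e (T x))))"
  have G: "G \<in> below J j d" unfolding G_def
    by (intro below_times below_plus g low polyf.const) auto
  have GI: "(\<lambda>x. x j ^ d + G x) \<in> IT"
  proof -
    have "(\<lambda>x. 1 / F d c * f0 (T x)) \<in> IT"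
    proof (rule pf_idealD(4)[OF IT polyf.const])
      show "(\<lambda>x. f0 (T x)) \<in> IT" unfolding IT_def by (rule image_eqI[OF _ f0(1)]) simp
    qed
    thus ?thesis using c by (simp add: G_def f0T distrib_left)
  qed
  have Z: "\<forall>v. \<exists>f\<in>IT. f v \<noteq> 0"
  proof
    fix v obtain f where "f \<in> I" "f (T v) \<noteq> 0" using insert.prems(2) by blast
    moreover from this have "(\<lambda>x. f (T x)) \<in> IT" unfolding IT_def by (intro image_eqI[OF refl])
    ultimately show "\<exists>f\<in>IT. f v \<noteq> 0" by (intro bexI[of _ "\<lambda>x. f (T x)"])
  qed
  have "(\<lambda>x. 1) \<in> IT"
    by (rule nullstellensatz_step[where g = G and D = d, OF insert.hyps(2) IT _ G GI Z]) (rule insert.IH)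
  then obtain f where f: "f \<in> I" "(\<lambda>x. 1) = (\<lambda>x. f (T x))" unfolding IT_def by (elim imageE)
  have "f x = 1" for x using fun_cong[OF f(2), of "T' x"] by (simp add: TT)
  hence "f = (\<lambda>x. 1)" by (rule ext)
  thus ?case using f(1) by simp
qed

lemma rabinowitsch:
  fixes I :: "'k::{alg_closed_field, field_char_0} func set"
  assumes J: "finite J" and I: "pf_ideal J I" and g: "g \<in> polyf J"
    and Z: "\<forall>v. g v \<noteq> 0 \<longrightarrow> (\<exists>f\<in>I. f v \<noteq> 0)"
  shows "\<exists>k. (\<lambda>x. g x ^ k) \<in> I"
proof -
  note ID = pf_idealD[OF I]
  obtain j where j: "j \<notin> J" using ex_new_if_finite[OF infinite_UNIV_nat J] by blast
  \<comment> \<open>\<open>cl G k F\<close>: substituting \<open>1 / g\<close> for the new variable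
    in \<open>F\<close> and multiplying by \<open>g ^ k\<close> gives \<open>G\<close>. This is
    demanded only where \<open>g\<close> does not vanish.\<close>
  define cl where "cl G k F \<longleftrightarrow> (\<forall>v. g v \<noteq> 0 \<longrightarrow> G v = g v ^ k * F (v(j := 1 / g v)))"
    for G F :: "'k func" and k
  have Jj: "h \<in> polyf J \<Longrightarrow> h \<in> polyf (insert j J)" for h :: "'k func" by (rule polyf_mono) auto
  have clear: "\<exists>k. \<exists>G\<in>polyf J. cl G k F" if "F \<in> polyf (insert j J)" for F
    using that
  proof (induction rule: polyf.induct)
    case (const c)
    show ?case by (intro exI[of _ 0] bexI[of _ "\<lambda>x. c"]) (auto simp: cl_def intro: polyf.const)
  next
    case (var f i)
    then obtain k G where G: "G \<in> polyf J" "cl G k f" by blast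
    show ?case
    proof (cases "i = j")
      case True
      with G show ?thesis by (intro exI[of _ "Suc k"] bexI[of _ G]) (auto simp: cl_def)
    next
      case False
      with var have "i \<in> J" by auto
      thus ?thesis using False G
        by (intro exI[of _ k] bexI[of _ "\<lambda>x. x i * G x"]) (auto simp: cl_def intro: polyf.var)
    qed
  next
    case (add f f')
    then obtain k G k' G' where G: "G \<in> polyf J" "cl G k f" "G' \<in> polyf J" "cl G' k' f'" by blast
    show ?case
    proof (intro exI[of _ "k + k'"] bexI[of _ "\<lambda>x. g x ^ k' * G x + g x ^ k * G' x"])
      show "(\<lambda>x. g x ^ k' * G x + g x ^ k * G' x) \<in> polyf J"
        by (intro polyf.add polyf_mult polyf_power G g)
      show "cl (\<lambda>x. g x ^ k' * G x + g x ^ k * G' x) (k + k') (\<lambda>x. f x + f' x)"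
        using G(2,4) by (auto simp: cl_def power_add algebra_simps)
    qed
  qed
  define I' where "I' = {F \<in> polyf (insert j J). \<exists>k. \<exists>G\<in>I. cl G k F}"
  have "pf_ideal (insert j J) I'"
    unfolding pf_ideal_def
  proof (intro conjI ballI)
    show "I' \<subseteq> polyf (insert j J)" unfolding I'_def by blast
    show "(\<lambda>x. 0) \<in> I'" unfolding I'_def
      by (simp, intro conjI polyf.const exI[of _ 0] bexI[OF _ ID(2)]) (simp add: cl_def)
  next
    fix f f' assume "f \<in> I'" "f' \<in> I'"
    then obtain k G k' G' where G: "G \<in> I" "cl G k f" "G' \<in> I" "cl G' k' f'"
      and f: "f \<in> polyf (insert j J)" "f' \<in> polyf (insert j J)" unfolding I'_def by blast
    have "(\<lambda>x. g x ^ k' * G x + g x ^ k * G' x) \<in> I" by (intro ID(3) ID(4) polyf_power G g)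
    moreover have "cl (\<lambda>x. g x ^ k' * G x + g x ^ k * G' x) (k + k') (\<lambda>x. f x + f' x)"
      using G(2,4) by (auto simp: cl_def power_add algebra_simps)
    ultimately show "(\<lambda>x. f x + f' x) \<in> I'" unfolding I'_def using polyf.add[OF f] by blast
  next
    fix a f :: "'k func" assume a: "a \<in> polyf (insert j J)" and "f \<in> I'"
    then obtain k G where G: "G \<in> I" "cl G k f" and f: "f \<in> polyf (insert j J)" unfolding I'_def by blast
    obtain k' A where A: "A \<in> polyf J" "cl A k' a" using clear[OF a] by blast
    have "(\<lambda>x. A x * G x) \<in> I" by (intro ID(4) A G)
    moreover have "cl (\<lambda>x. A x * G x) (k + k') (\<lambda>x. a x * f x)"
      using G(2) A(2) by (auto simp: cl_def power_add algebra_simps)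
    ultimately show "(\<lambda>x. a x * f x) \<in> I'" unfolding I'_def using polyf_mult[OF a f] by blast
  qed
  moreover have "\<forall>v. \<exists>f\<in>I'. f v \<noteq> 0"
  proof
    fix v show "\<exists>f\<in>I'. f v \<noteq> 0"
    proof (cases "v j * g v = 1")
      case True
      hence "g v \<noteq> 0" by auto
      with Z obtain f where f: "f \<in> I" "f v \<noteq> 0" by blast
      have "f (u(j := t)) = f u" for u t using j by (intro polyf_cong[OF ID(1)[OF f(1)]]) auto
      hence "cl f 0 f" by (simp add: cl_def)
      hence "f \<in> I'" unfolding I'_def using f(1) Jj[OF ID(1)[OF f(1)]] by blast
      thus ?thesis using f(2) by blast
    next
      case False
      \<comment> \<open>\<open>x j * g x - 1\<close> becomes 0 under the substitution and hence
        belongs to \<open>I'\<close>; it settles all points off the graph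
        \<open>x j = 1 / g\<close>.\<close>
      have "g (u(j := t)) = g u" for u t using j by (intro polyf_cong[OF g]) auto
      hence "cl (\<lambda>x. 0) 0 (\<lambda>x. x j * g x - 1)" by (simp add: cl_def)
      moreover have "(\<lambda>x. x j * g x - 1) \<in> polyf (insert j J)"
        by (intro polyf_diff polyf.const polyf.var Jj g) auto
      ultimately have "(\<lambda>x. x j * g x - 1) \<in> I'" unfolding I'_def using ID(2) by blast
      thus ?thesis using False by (intro bexI) auto
    qed
  qed
  ultimately have "(\<lambda>x. 1) \<in> I'" using weak_nullstellensatz[of "insert j J" I'] J by blast
  then obtain k G where G: "G \<in> I" "cl G k (\<lambda>x. 1)" unfolding I'_def by blast
  \<comment> \<open>The extra factor \<open>g\<close> makes the identity hold also at the zeros of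
    \<open>g\<close>, about which \<open>cl\<close> says nothing.\<close>
  have "(\<lambda>x. g x * G x) = (\<lambda>x. g x ^ Suc k)"
  proof
    fix x show "g x * G x = g x ^ Suc k" using G(2) by (cases "g x = 0") (auto simp: cl_def)
  qed
  thus ?thesis using ID(4)[OF g G(1)] by (intro exI[of _ "Suc k"]) (simp only:)
qed

section \<open>Graded ideals\<close>

inductive_set graded_span :: "(nat \<Rightarrow> 'k::field func set) \<Rightarrow> 'k func set" for B where
  zero: "(\<lambda>x. 0) \<in> graded_span B"
| add: "f \<in> B d \<Longrightarrow> g \<in> graded_span B \<Longrightarrow> (\<lambda>x. f x + g x) \<in> graded_span B"

lemma graded_span_add:
  "f \<in> graded_span B \<Longrightarrow> g \<in> graded_span B \<Longrightarrow> (\<lambda>x. f x + g x) \<in> graded_span B"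
  by (induction rule: graded_span.induct) (auto simp: add.assoc intro: graded_span.add)

lemma graded_span_components:
  assumes "\<And>d. (\<lambda>x. 0) \<in> B d" "\<And>d f g. f \<in> B d \<Longrightarrow> g \<in> B d \<Longrightarrow> (\<lambda>x. f x + g x) \<in> B d"
    and "f \<in> graded_span B"
  shows "\<exists>F D. (\<forall>d. F d \<in> B d) \<and> (\<forall>d\<ge>D. F d = (\<lambda>x. 0)) \<and> f = (\<lambda>x. \<Sum>d<D. F d x)"
  using assms(3)
proof (induction rule: graded_span.induct)
  case zero
  show ?case by (intro exI[of _ "\<lambda>d x. 0"] exI[of _ 0]) (auto intro: assms(1))
next
  case (add f d g)
  then obtain F D where F: "\<forall>d. F d \<in> B d" "\<forall>d\<ge>D. F d = (\<lambda>x. 0)" "g = (\<lambda>x. \<Sum>d<D. F d x)" by blast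
  define G where "G = F(d := (\<lambda>x. f x + F d x))"
  let ?D = "max D (Suc d)"
  have gx: "g x = (\<Sum>e<?D. F e x)" for x
    unfolding F(3) using F(2) by (intro sum.mono_neutral_left) auto
  have "f x + g x = (\<Sum>e<?D. G e x)" for x
  proof -
    have "(\<Sum>e<?D. G e x) = (\<Sum>e<?D. F e x + (if e = d then f x else 0))"
      by (intro sum.cong) (auto simp: G_def)
    also have "\<dots> = (\<Sum>e<?D. F e x) + f x" by (simp add: sum.distrib sum.delta)
    finally show ?thesis by (simp add: gx)
  qed
  hence 1: "(\<lambda>x. f x + g x) = (\<lambda>x. \<Sum>e<?D. G e x)" by (rule ext)
  have 2: "\<forall>e. G e \<in> B e" using F(1) assms(2) add by (auto simp: G_def)
  have 3: "\<forall>e\<ge>?D. G e = (\<lambda>x. 0)" using F(2) by (auto simp: G_def)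
  show ?case using 1 2 3 by blast
qed

text \<open>The ideal spanned by the \<open>B d\<close> contains a power of \<open>g\<close>; as
  this power is homogeneous, it equals its own component of degree \<open>k * e\<close>.
  \<open>B\<close> is an arbitrary graded family so that it can later be the set of forms that clear
  some denominator.\<close>

lemma graded_nullstellensatz:
  fixes B :: "nat \<Rightarrow> 'k::{alg_closed_field, field_char_0} func set"
  assumes J: "finite J" and BJ: "\<And>d. B d \<subseteq> hpoly J d" and B0: "\<And>d. (\<lambda>x. 0) \<in> B d"
    and Badd: "\<And>d f g. f \<in> B d \<Longrightarrow> g \<in> B d \<Longrightarrow> (\<lambda>x. f x + g x) \<in> B d"
    and Bmult: "\<And>d e f a. f \<in> B d \<Longrightarrow> a \<in> hpoly J e \<Longrightarrow> (\<lambda>x. a x * f x) \<in> B (e + d)"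
    and g: "g \<in> hpoly J e"
    and Z: "\<And>v. g v \<noteq> 0 \<Longrightarrow> \<exists>d. \<exists>f\<in>B d. f v \<noteq> 0"
  shows "\<exists>k. (\<lambda>x. g x ^ k) \<in> B (k * e)"
proof -
  let ?I = "graded_span B"
  have sp: "f \<in> B d \<Longrightarrow> f \<in> ?I" for f d using graded_span.add[OF _ graded_span.zero, of f B d] by simp
  have hm: "(\<lambda>x. a x * f x) \<in> ?I" if "a \<in> hpoly J e" "f \<in> ?I" for a e f
    using that(2)
  proof (induction rule: graded_span.induct)
    case (add f d g)
    have "(\<lambda>x. a x * f x + a x * g x) \<in> ?I"
      using Bmult[OF add(1) that(1)] add.IH by (rule graded_span.add)
    thus ?case by (simp add: distrib_left)
  qed (simp add: graded_span.zero)
  have "pf_ideal J ?I"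
    unfolding pf_ideal_def
  proof (intro conjI ballI)
    show "?I \<subseteq> polyf J"
    proof
      fix f assume "f \<in> ?I" thus "f \<in> polyf J"
        by (induction rule: graded_span.induct) (use BJ hpoly_polyf in \<open>blast intro: polyf.intros\<close>)+
    qed
    show "(\<lambda>x. 0) \<in> ?I" by (rule graded_span.zero)
    show "(\<lambda>x. f x + g x) \<in> ?I" if "f \<in> ?I" "g \<in> ?I" for f g using that by (rule graded_span_add)
  next
    fix a f :: "'k func" assume "a \<in> polyf J" and f: "f \<in> ?I"
    obtain D F where F: "\<And>d. F d \<in> hpoly J d" "a = (\<lambda>x. \<Sum>d<D. F d x)"
      using polyf_hpoly_sum[OF \<open>a \<in> polyf J\<close>] by blast
    have "(\<lambda>x. (\<Sum>d<D. F d x) * f x) \<in> ?I" for D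
    proof (induction D)
      case (Suc D)
      from graded_span_add[OF Suc hm[OF F(1) f]] show ?case by (simp add: distrib_right)
    qed (simp add: graded_span.zero)
    thus "(\<lambda>x. a x * f x) \<in> ?I" unfolding F(2) .
  qed
  moreover have "\<forall>v. g v \<noteq> 0 \<longrightarrow> (\<exists>f\<in>?I. f v \<noteq> 0)" using Z sp by blast
  ultimately obtain k where gk: "(\<lambda>x. g x ^ k) \<in> ?I" using rabinowitsch[OF J _ hpoly_polyf[OF g]] by blast
  then obtain F D where F: "\<And>d. F d \<in> B d" "\<And>d. d \<ge> D \<Longrightarrow> F d = (\<lambda>x. 0)"
    and gF: "(\<lambda>x. g x ^ k) = (\<lambda>x. \<Sum>d<D. F d x)"
    using graded_span_components[of B, OF B0 _ gk] Badd by blast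
  have "g v ^ k = F (k * e) v" for v
  proof -
    \<comment> \<open>Scaling the argument by \<open>t\<close> separates the degrees: comparing
      coefficients of powers of \<open>t\<close> isolates the component.\<close>
    have "poly (\<Sum>d<D. monom (F d v) d) t = poly (monom (g v ^ k) (k * e)) t" for t
    proof -
      have "g (\<lambda>i. t * v i) ^ k = (t ^ e * g v) ^ k" by (simp add: hpoly_scale[OF g])
      also have "\<dots> = t ^ (k * e) * g v ^ k" by (simp add: power_mult_distrib power_mult[symmetric] mult.commute)
      finally have "t ^ (k * e) * g v ^ k = (\<Sum>d<D. F d (\<lambda>i. t * v i))" using fun_cong[OF gF] by simp
      also have "\<dots> = (\<Sum>d<D. t ^ d * F d v)"
        using F(1) BJ by (intro sum.cong refl hpoly_scale) blast
      finally show ?thesis by (simp add: poly_sum poly_monom mult.commute)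
    qed
    hence "(\<Sum>d<D. monom (F d v) d) = monom (g v ^ k) (k * e)"
      by (simp add: poly_eq_poly_eq_iff[symmetric] fun_eq_iff)
    from arg_cong[OF this, of "\<lambda>p. coeff p (k * e)"]
    have "(\<Sum>d<D. if d = k * e then F d v else 0) = g v ^ k" by (simp add: coeff_sum)
    thus ?thesis using F(2)[of "k * e"] by (cases "k * e < D") (auto simp: sum.delta)
  qed
  hence "(\<lambda>x. g x ^ k) = F (k * e)" by (rule ext)
  thus ?thesis using F(1) by metis
qed

section \<open>The ring of polynomial functions and its fraction field\<close>

typedef (overloaded) 'k pfun = "polyf UNIV :: ('k::field) func set"
  morphisms pev Abs_pfun using polyf.const by blast

setup_lifting type_definition_pfun

instantiation pfun :: (field) comm_ring_1
begin
lift_definition zero_pfun :: "'a pfun" is "\<lambda>x. 0" by (rule polyf.const)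
lift_definition one_pfun :: "'a pfun" is "\<lambda>x. 1" by (rule polyf.const)
lift_definition plus_pfun :: "'a pfun \<Rightarrow> 'a pfun \<Rightarrow> 'a pfun" is "\<lambda>f g x. f x + g x" by (rule polyf.add)
lift_definition minus_pfun :: "'a pfun \<Rightarrow> 'a pfun \<Rightarrow> 'a pfun" is "\<lambda>f g x. f x - g x" by (rule polyf_diff)
lift_definition uminus_pfun :: "'a pfun \<Rightarrow> 'a pfun" is "\<lambda>f x. - f x" by (rule polyf_uminus)
lift_definition times_pfun :: "'a pfun \<Rightarrow> 'a pfun \<Rightarrow> 'a pfun" is "\<lambda>f g x. f x * g x" by (rule polyf_mult)
instance by standard (transfer; auto simp: fun_eq_iff algebra_simps)+
end

lemma pev_simps [simp]:
  "pev 0 v = 0" "pev 1 v = 1" "pev (P + Q) v = pev P v + pev Q v" "pev (P - Q) v = pev P v - pev Q v"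
  "pev (- P) v = - pev P v" "pev (P * Q) v = pev P v * pev Q v"
  by (transfer; simp)+

lemma pev_power [simp]: "pev (P ^ n) v = pev P v ^ n"
  by (induction n) auto

lemma pev_sum [simp]: "pev (sum f A) v = (\<Sum>i\<in>A. pev (f i) v)"
  by (induction A rule: infinite_finite_induct) auto

lemma pfun_eqI: "(\<And>v. pev P v = pev Q v) \<Longrightarrow> P = Q"
  by (metis ext pev_inject)

instance pfun :: (field_char_0) idom
proof
  fix P Q :: "'a pfun" assume "P \<noteq> 0" "Q \<noteq> 0"
  then obtain u v where "pev P u \<noteq> 0" "pev Q v \<noteq> 0" by (metis pfun_eqI pev_simps(1))
  then obtain w where "pev P w * pev Q w \<noteq> 0" using polyf_no_zero_divisors[OF pev pev] by blast
  thus "P * Q \<noteq> 0" by (metis pev_simps(1,6))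
qed

lift_definition pvar :: "nat \<Rightarrow> 'k::field pfun" is "\<lambda>i x. x i" by (rule polyf_var) simp
lift_definition pconst :: "'k::field \<Rightarrow> 'k pfun" is "\<lambda>c x. c" by (rule polyf.const)

lemma pev_pvar [simp]: "pev (pvar i) v = v i" and pev_pconst [simp]: "pev (pconst c) v = c"
  by (transfer; simp)+

text \<open>Degrees are integers, so that \<open>HP J b\<close> is \<open>{0}\<close> for negative \<open>b\<close>.\<close>

definition HP :: "nat set \<Rightarrow> int \<Rightarrow> 'k::field pfun set" where
  "HP J b = {P. P = 0 \<or> b \<ge> 0 \<and> pev P \<in> hpoly J (nat b)}"

lemma HP_nat: "P \<in> HP J (int d) \<longleftrightarrow> pev P \<in> hpoly J d"
  using hpoly_zero[of J d] by (auto simp: HP_def zero_pfun.rep_eq)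

lemma HP_cases:
  assumes "P \<in> HP J b" obtains "P = 0" | d where "b = int d" "pev P \<in> hpoly J d"
  using assms by (auto simp: HP_def) (metis nat_0_le)

lemma HP_0 [simp]: "0 \<in> HP J b" by (simp add: HP_def)

lemma HP_neg: "P \<in> HP J b \<Longrightarrow> b < 0 \<Longrightarrow> P = 0" by (auto simp: HP_def)

lemma HP_deg_nonneg: "P \<in> HP J b \<Longrightarrow> P \<noteq> 0 \<Longrightarrow> b \<ge> 0" by (auto simp: HP_def)

lemma HP_add: "P \<in> HP J b \<Longrightarrow> Q \<in> HP J b \<Longrightarrow> P + Q \<in> HP J b"
  by (auto simp: HP_def plus_pfun.rep_eq hpoly_add)

lemma HP_mult: "P \<in> HP J b \<Longrightarrow> Q \<in> HP J c \<Longrightarrow> P * Q \<in> HP J (b + c)"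
  by (auto simp: HP_def times_pfun.rep_eq nat_add_distrib hpoly_mult)

lemma HP_pconst: "pconst c \<in> HP J 0"
  by (auto simp: HP_def pconst.rep_eq hpoly_const)

lemma HP_1: "1 \<in> HP J 0"
  by (auto simp: HP_def one_pfun.rep_eq hpoly_const)

lemma HP_uminus: "P \<in> HP J b \<Longrightarrow> - P \<in> HP J b"
  using HP_mult[OF HP_pconst[of "-1"], of P J b] by (simp add: pfun_eqI[of "pconst (-1) * P" "- P"])

lemma HP_diff: "P \<in> HP J b \<Longrightarrow> Q \<in> HP J b \<Longrightarrow> P - Q \<in> HP J b"
  using HP_add[of P J b "- Q"] HP_uminus[of Q J b] by simp

lemma HP_pvar: "i \<in> J \<Longrightarrow> pvar i \<in> HP J 1"
  using hpoly_var[OF hpoly_const[of 1 J], of i] by (auto simp: HP_def pvar.rep_eq)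

lemma HP_power: "P \<in> HP J b \<Longrightarrow> P ^ n \<in> HP J (int n * b)"
  by (induction n) (auto simp: HP_1 algebra_simps dest: HP_mult)

lemma HP_mono: "P \<in> HP J b \<Longrightarrow> J \<subseteq> J' \<Longrightarrow> P \<in> HP J' b"
  by (auto simp: HP_def dest: hpoly_mono)

lemma HP_cong: "P \<in> HP J b \<Longrightarrow> (\<And>i. i \<in> J \<Longrightarrow> u i = v i) \<Longrightarrow> pev P u = pev P v"
  by (auto simp: HP_def intro: polyf_cong[OF hpoly_polyf])

lemma HP_scale: "P \<in> HP J b \<Longrightarrow> pev P (\<lambda>i. c * v i) = c ^ nat b * pev P v"
  by (auto simp: HP_def hpoly_scale)

lemma HP_sum: "(\<And>i. i \<in> A \<Longrightarrow> f i \<in> HP J b) \<Longrightarrow> sum f A \<in> HP J b"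
  by (induction A rule: infinite_finite_induct) (auto intro: HP_add)

lemma HP_Suc_induct [consumes 1, case_names zero const var add]:
  assumes "P \<in> HP J b" "\<And>b. R b 0" "\<And>c. R 0 (pconst c)"
    "\<And>P b i. \<lbrakk>P \<in> HP J b; R b P; i \<in> J\<rbrakk> \<Longrightarrow> R (b + 1) (pvar i * P)"
    "\<And>P Q b. \<lbrakk>P \<in> HP J b; R b P; Q \<in> HP J b; R b Q\<rbrakk> \<Longrightarrow> R b (P + Q)"
  shows "R b P"
  using assms(1)
proof (cases rule: HP_cases)
  case (2 d)
  have "\<exists>Q. pev Q = f \<and> Q \<in> HP J (int d) \<and> R (int d) Q" if "f \<in> hpoly J d" for f d
    using that
  proof (induction rule: hpoly_induct)
    case (zero d)
    show ?case by (intro exI[of _ 0]) (auto simp: assms(2))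
  next
    case (const c)
    show ?case using assms(3)[of c] by (intro exI[of _ "pconst c"]) (auto simp: HP_pconst)
  next
    case (var f d i)
    then obtain Q where "pev Q = f" "Q \<in> HP J (int d)" "R (int d) Q" by blast
    thus ?case using assms(4)[of Q "int d" i] var.hyps(2) HP_mult[OF HP_pvar[OF var.hyps(2)], of Q "int d"]
      by (intro exI[of _ "pvar i * Q"]) (auto simp: add.commute)
  next
    case (add f d g)
    then obtain P Q where "pev P = f" "P \<in> HP J (int d)" "R (int d) P" "pev Q = g" "Q \<in> HP J (int d)" "R (int d) Q"
      by blast
    thus ?case using assms(5)[of P "int d" Q] by (intro exI[of _ "P + Q"]) (auto simp: HP_add)
  qed
  from this[OF 2(2)] show ?thesis using 2(1) by (auto simp: pev_inject)
qed (auto simp: assms(2))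

type_synonym 'k rat = "'k pfun fract"

definition pf :: "'k::field_char_0 pfun \<Rightarrow> 'k rat" where "pf P = Fract P 1"

lemma pf_simps [simp]: "pf 0 = 0" "pf 1 = 1" "pf (P + Q) = pf P + pf Q" "pf (P - Q) = pf P - pf Q"
  "pf (P * Q) = pf P * pf Q" "pf (- P) = - pf P"
  by (simp_all add: pf_def Zero_fract_def One_fract_def)

lemma pf_power [simp]: "pf (P ^ n) = pf P ^ n"
  by (induction n) auto

lemma pf_eq_iff [simp]: "pf P = pf Q \<longleftrightarrow> P = Q"
  by (simp add: pf_def eq_fract)

lemma pf_eq_0_iff [simp]: "pf P = 0 \<longleftrightarrow> P = 0"
  using pf_eq_iff[of P 0] by simp

section \<open>Nonvanishing at points and local rings\<close>

definition nz :: "'k::field pfun \<Rightarrow> 'k point \<Rightarrow> bool" where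
  "nz P p \<longleftrightarrow> (\<forall>v\<in>p. pev P v \<noteq> 0)"

lemma nz_mult [simp]: "nz (P * Q) p \<longleftrightarrow> nz P p \<and> nz Q p" by (auto simp: nz_def)
lemma nz_1 [simp]: "nz 1 p" by (auto simp: nz_def)
lemma nz_power [intro]: "nz P p \<Longrightarrow> nz (P ^ n) p" by (auto simp: nz_def)
text \<open>The stalk of \<open>O(b)\<close> at \<open>p\<close>, for the variety with homogeneous coordinates indexed by \<open>J\<close>.\<close>

definition Oloc :: "nat set \<Rightarrow> int \<Rightarrow> 'k::field_char_0 point \<Rightarrow> 'k rat set" where
  "Oloc J b p = {z. \<exists>P Q a c. P \<in> HP J a \<and> Q \<in> HP J c \<and> a - c = b \<and> nz Q p \<and> z = pf P / pf Q}"

lemma OlocI: "\<lbrakk>P \<in> HP J a; Q \<in> HP J c; a - c = b; nz Q p; z = pf P / pf Q\<rbrakk> \<Longrightarrow> z \<in> Oloc J b p"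
  unfolding Oloc_def by blast

lemma OlocE:
  assumes "z \<in> Oloc J b p"
  obtains P Q a c where "P \<in> HP J a" "Q \<in> HP J c" "a - c = b" "nz Q p" "z = pf P / pf Q"
  using assms unfolding Oloc_def by blast

lemma Oloc_mono: "z \<in> Oloc J b p \<Longrightarrow> J \<subseteq> J' \<Longrightarrow> z \<in> Oloc J' b p"
  by (elim OlocE, rule OlocI) (auto intro: HP_mono)

text \<open>
  The variety \<open>X\<close> is parametrised by the coordinates in \<open>J\<close>: the whole space with \<open>J = {..N}\<close>, or a
  hyperplane, from which one coordinate with nonzero coefficient has been eliminated.
\<close>

locale linvar =
  fixes X :: "'k::{alg_closed_field, field_char_0} point set" and J :: "nat set"
  assumes finJ: "finite J" and J_ne: "J \<noteq> {}"
    and pt_proj: "p \<in> X \<Longrightarrow> v \<in> p \<Longrightarrow> p = proj_point v"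
    and pt_ne: "p \<in> X \<Longrightarrow> p \<noteq> {}"
    and pt_nz: "p \<in> X \<Longrightarrow> v \<in> p \<Longrightarrow> \<exists>i\<in>J. v i \<noteq> 0"
    and pt_ex: "\<exists>i\<in>J. w i \<noteq> 0 \<Longrightarrow> \<exists>p\<in>X. \<exists>v\<in>p. \<forall>i\<in>J. v i = w i"
    and pt_red: "f \<in> hpoly UNIV d \<Longrightarrow> \<exists>f'\<in>hpoly J d. \<forall>p\<in>X. \<forall>v\<in>p. f v = f' v"
begin

lemma nz_iff:
  assumes "P \<in> HP J' b" "p \<in> X" "v \<in> p" shows "nz P p \<longleftrightarrow> pev P v \<noteq> 0"
proof
  assume P: "pev P v \<noteq> 0"
  show "nz P p" unfolding nz_def
  proof
    fix w assume "w \<in> p"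
    then obtain c where c: "c \<noteq> 0" "w = (\<lambda>i. c * v i)"
      using pt_proj[OF assms(2,3)] by (auto simp: proj_point_def)
    thus "pev P w \<noteq> 0" using P HP_scale[OF assms(1), of c v] by simp
  qed
qed (use assms(3) in \<open>auto simp: nz_def\<close>)

lemma nz_nonzero: "nz P p \<Longrightarrow> p \<in> X \<Longrightarrow> P \<noteq> 0"
  using pt_ne by (force simp: nz_def)

lemma nz_pf: "nz P p \<Longrightarrow> p \<in> X \<Longrightarrow> pf P \<noteq> 0"
  using nz_nonzero by simp

lemma nz_add: "\<lbrakk>P \<in> HP J' b; Q \<in> HP J' b; p \<in> X; nz (P + Q) p\<rbrakk> \<Longrightarrow> nz P p \<or> nz Q p"
proof -
  assume *: "P \<in> HP J' b" "Q \<in> HP J' b" "p \<in> X" "nz (P + Q) p"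
  obtain v where "v \<in> p" using pt_ne[OF *(3)] by blast
  with * show ?thesis using nz_iff[OF HP_add[OF *(1,2)] *(3)] nz_iff[OF *(1) *(3)] nz_iff[OF *(2) *(3)]
    by fastforce
qed

lemma ex_pvar: assumes "p \<in> X" obtains i where "i \<in> J" "nz (pvar i) p"
proof -
  obtain v where v: "v \<in> p" using pt_ne[OF assms] by blast
  then obtain i where "i \<in> J" "v i \<noteq> 0" using pt_nz[OF assms] by blast
  thus ?thesis using that nz_iff[OF HP_pvar assms v] by auto
qed

lemma ex_nz:
  assumes "P \<in> HP J b" "P \<noteq> 0" shows "\<exists>p\<in>X. nz P p"
proof -
  obtain i where i: "i \<in> J" using J_ne by blast
  have "pvar i * P \<noteq> (0 :: 'k pfun)"
  proof -
    have "pev (pvar i :: 'k pfun) (\<lambda>_. 1) \<noteq> pev 0 (\<lambda>_. 1)" by simp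
    hence "pvar i \<noteq> (0 :: 'k pfun)" by metis
    thus ?thesis using assms(2) by simp
  qed
  then obtain w where w: "pev (pvar i * P) w \<noteq> 0" by (metis pfun_eqI pev_simps(1))
  hence "\<exists>i\<in>J. w i \<noteq> 0" using i by auto
  then obtain p v where p: "p \<in> X" "v \<in> p" "\<forall>i\<in>J. v i = w i" using pt_ex by blast
  have "pev P v = pev P w" using HP_cong[OF assms(1)] p(3) by blast
  thus ?thesis using p w nz_iff[OF assms(1) p(1,2)] by auto
qed

lemma Oloc_0: assumes "p \<in> X" shows "0 \<in> Oloc J b p"
  by (rule OlocI[of 0 J b 1 0]) (auto simp: HP_1)

text \<open>Over a common denominator the degrees of the numerators differ by the difference of the
  twists, which is what \<open>a + b' - b\<close> records.\<close>

lemma Oloc_common: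
  assumes "z \<in> Oloc J b p" "w \<in> Oloc J b' p" "p \<in> X"
  obtains P R Q a c where "P \<in> HP J a" "R \<in> HP J (a + b' - b)" "Q \<in> HP J c" "a - c = b" "nz Q p"
    "z = pf P / pf Q" "w = pf R / pf Q"
proof -
  obtain P Q a c where z: "P \<in> HP J a" "Q \<in> HP J c" "a - c = b" "nz Q p" "z = pf P / pf Q"
    using assms(1) by (rule OlocE)
  obtain P' Q' a' c' where w: "P' \<in> HP J a'" "Q' \<in> HP J c'" "a' - c' = b'" "nz Q' p" "w = pf P' / pf Q'"
    using assms(2) by (rule OlocE)
  have 1: "P * Q' \<in> HP J (a + c')" "Q * Q' \<in> HP J (c + c')" "a + c' - (c + c') = b" "nz (Q * Q') p"
    using z w by (auto intro: HP_mult)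
  have "P' * Q \<in> HP J (a' + c)" using z w by (auto intro: HP_mult)
  moreover have "a' + c = a + c' + b' - b" using z w by simp
  ultimately have 2: "P' * Q \<in> HP J (a + c' + b' - b)" by simp
  have "z = pf (P * Q') / pf (Q * Q')" "w = pf (P' * Q) / pf (Q * Q')"
    using z w nz_pf[OF z(4) assms(3)] nz_pf[OF w(4) assms(3)] by simp_all
  thus ?thesis using that[OF 1(1) 2 1(2-4)] by blast
qed

lemma Oloc_add: assumes "z \<in> Oloc J b p" "w \<in> Oloc J b p" "p \<in> X" shows "z + w \<in> Oloc J b p"
proof -
  obtain P R Q a c where "P \<in> HP J a" "R \<in> HP J (a + b - b)" "Q \<in> HP J c" "a - c = b" "nz Q p"
    "z = pf P / pf Q" "w = pf R / pf Q" by (rule Oloc_common[OF assms])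
  thus ?thesis by (intro OlocI[of "P + R" J a Q c]) (auto simp: HP_add add_divide_distrib)
qed

lemma Oloc_mult: assumes "z \<in> Oloc J b p" "w \<in> Oloc J b' p" shows "z * w \<in> Oloc J (b + b') p"
proof -
  obtain P Q a c where z: "P \<in> HP J a" "Q \<in> HP J c" "a - c = b" "nz Q p" "z = pf P / pf Q"
    using assms(1) by (rule OlocE)
  obtain P' Q' a' c' where w: "P' \<in> HP J a'" "Q' \<in> HP J c'" "a' - c' = b'" "nz Q' p" "w = pf P' / pf Q'"
    using assms(2) by (rule OlocE)
  show ?thesis
    by (rule OlocI[OF HP_mult[OF z(1) w(1)] HP_mult[OF z(2) w(2)]]) (use z w in auto)
qed

lemma Oloc_HP: "P \<in> HP J b \<Longrightarrow> pf P \<in> Oloc J b p"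
  by (rule OlocI[of P J b 1 0]) (auto simp: HP_1)

lemma Oloc_inv: "Q \<in> HP J c \<Longrightarrow> nz Q p \<Longrightarrow> 1 / pf Q \<in> Oloc J (- c) p"
  by (rule OlocI[of 1 J 0 Q c]) (auto simp: HP_1)

lemma Oloc_uminus: assumes "z \<in> Oloc J b p" shows "- z \<in> Oloc J b p"
proof -
  obtain P Q a c where "P \<in> HP J a" "Q \<in> HP J c" "a - c = b" "nz Q p" "z = pf P / pf Q"
    using assms by (rule OlocE)
  thus ?thesis by (intro OlocI[of "- P" J a Q c]) (auto intro: HP_uminus)
qed

lemma Oloc_diff: "\<lbrakk>z \<in> Oloc J b p; w \<in> Oloc J b p; p \<in> X\<rbrakk> \<Longrightarrow> z - w \<in> Oloc J b p"
  using Oloc_add[of z b p "- w"] Oloc_uminus[of w b p] by simp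

lemma Oloc_1: "1 \<in> Oloc J 0 p" using Oloc_HP[OF HP_1] by simp

lemma Oloc_power: "z \<in> Oloc J b p \<Longrightarrow> z ^ n \<in> Oloc J (int n * b) p"
proof (induction n)
  case (Suc n)
  thus ?case using Oloc_mult[OF Suc(2) Suc.IH] by (simp add: algebra_simps)
qed (simp add: Oloc_1)

lemma Oloc_powi: assumes "Q \<in> HP J 1" "nz Q p" shows "pf Q powi t \<in> Oloc J t p"
proof (cases "t \<ge> 0")
  case True
  thus ?thesis using Oloc_power[OF Oloc_HP[OF assms(1)], where n = "nat t" and p = p] by (simp add: power_int_def)
next
  case False
  thus ?thesis using Oloc_power[OF Oloc_inv[OF assms], where n = "nat (- t)"]
    by (simp add: power_int_def inverse_eq_divide)
qed

lemma Oloc_open: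
  assumes "z \<in> Oloc J b p" "p \<in> X"
  obtains g c where "g \<in> HP J c" "c \<ge> 1" "nz g p" "\<And>q. q \<in> X \<Longrightarrow> nz g q \<Longrightarrow> z \<in> Oloc J b q"
proof -
  obtain P Q a c where z: "P \<in> HP J a" "Q \<in> HP J c" "a - c = b" "nz Q p" "z = pf P / pf Q"
    using assms(1) by (rule OlocE)
  \<comment> \<open>The factor \<open>pvar i\<close> raises the degree to at least 1. Forms of
    positive degree vanish at the zero vector, as the Nullstellensatz for points requires.\<close>
  obtain i where i: "i \<in> J" "nz (pvar i) p" using ex_pvar[OF assms(2)] .
  have "c \<ge> 0" using HP_deg_nonneg[OF z(2) nz_nonzero[OF z(4) assms(2)]] .
  moreover have "pvar i * Q \<in> HP J (1 + c)" using HP_mult[OF HP_pvar[OF i(1)] z(2)] .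
  moreover have "z \<in> Oloc J b q" if "nz (pvar i * Q) q" for q using z that by (intro OlocI) auto
  ultimately show ?thesis using that z(4) i(2) by force
qed

end

subsection \<open>Division by linear forms\<close>

definition lform :: "(nat \<Rightarrow> 'k::field) \<Rightarrow> nat set \<Rightarrow> 'k pfun" where
  "lform a J = (\<Sum>i\<in>J. pconst (a i) * pvar i)"

text \<open>For nonzero \<open>a j\<close>, the projection along coordinate \<open>j\<close> onto
  the hyperplane \<open>lform a J = 0\<close>; composing with it computes in the coordinate ring of
  that hyperplane.\<close>

definition elim_coord :: "(nat \<Rightarrow> 'k::field) \<Rightarrow> nat set \<Rightarrow> nat \<Rightarrow> 'k coords \<Rightarrow> 'k coords" where
  "elim_coord a J j v = v(j := - (\<Sum>i\<in>J - {j}. a i * v i) / a j)"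

lift_definition psub :: "(nat \<Rightarrow> 'k::field) \<Rightarrow> nat set \<Rightarrow> nat \<Rightarrow> 'k pfun \<Rightarrow> 'k pfun"
  is "\<lambda>a J j f v. f (elim_coord a J j v)"
proof -
  fix a :: "nat \<Rightarrow> 'k" and J j and f :: "'k func" assume "f \<in> polyf UNIV"
  thus "(\<lambda>v. f (elim_coord a J j v)) \<in> polyf UNIV"
  proof (rule polyf_compose)
    fix i :: nat
    have "(\<lambda>v. (- 1 / a j) * (\<Sum>i\<in>J - {j}. a i * v i)) \<in> polyf UNIV"
      by (intro polyf_mult polyf_sum polyf.const polyf_var) auto
    hence "(\<lambda>v. - (\<Sum>i\<in>J - {j}. a i * v i) / a j) \<in> polyf UNIV" by simp
    thus "(\<lambda>v. elim_coord a J j v i) \<in> polyf UNIV"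
      using polyf_var[of i UNIV] by (cases "i = j") (simp_all add: elim_coord_def)
  qed
qed

lemma pev_psub [simp]: "pev (psub a J j P) v = pev P (elim_coord a J j v)"
  by transfer simp

lemma psub_simps [simp]:
  "psub a J j 0 = 0" "psub a J j 1 = 1" "psub a J j (P + Q) = psub a J j P + psub a J j Q"
  "psub a J j (P - Q) = psub a J j P - psub a J j Q" "psub a J j (P * Q) = psub a J j P * psub a J j Q"
  "psub a J j (P ^ n) = psub a J j P ^ n" "psub a J j (pconst c) = pconst c"
  by (rule pfun_eqI; simp)+

lemma psub_id: "P \<in> HP (J - {j}) d \<Longrightarrow> psub a J j P = P"
  by (rule pfun_eqI, simp, rule HP_cong[of P "J - {j}" d]) (auto simp: elim_coord_def)

lemma pvar_nonzero [simp]: "pvar i \<noteq> (0 :: 'k::field pfun)"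
proof -
  have "pev (pvar i :: 'k pfun) (\<lambda>_. 1) \<noteq> pev 0 (\<lambda>_. 1)" by simp
  thus ?thesis by metis
qed

lemma pev_lform: "pev (lform a J) v = (\<Sum>i\<in>J. a i * v i)"
  by (simp add: lform_def)

lemma HP_lform: "lform a J \<in> HP J 1"
  unfolding lform_def using HP_mult[OF HP_pconst HP_pvar] by (intro HP_sum) force

context
  fixes a :: "nat \<Rightarrow> 'k::field_char_0" and J :: "nat set" and j :: nat
  assumes J: "finite J" "j \<in> J" and aj: "a j \<noteq> 0"
begin

lemma psub_lform: "psub a J j (lform a J) = 0"
proof (rule pfun_eqI)
  fix v
  have "(\<Sum>i\<in>J. a i * elim_coord a J j v i) = a j * elim_coord a J j v j + (\<Sum>i\<in>J - {j}. a i * elim_coord a J j v i)"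
    by (rule sum.remove[OF J])
  also have "(\<Sum>i\<in>J - {j}. a i * elim_coord a J j v i) = (\<Sum>i\<in>J - {j}. a i * v i)"
    by (intro sum.cong) (auto simp: elim_coord_def)
  finally show "pev (psub a J j (lform a J)) v = pev 0 v" using aj by (simp add: pev_lform elim_coord_def)
qed

lemma lform_nonzero: "lform a J \<noteq> 0"
proof
  assume "lform a J = 0"
  hence "pev (lform a J) (\<lambda>i. if i = j then 1 else 0) = 0" by simp
  thus False using aj J by (simp add: pev_lform if_distrib[of "\<lambda>x. _ * x"] sum.delta cong: if_cong)
qed

lemma psub_pvar: "psub a J j (pvar j) \<in> HP (J - {j}) 1"
  "pvar j = lform a J * pconst (1 / a j) + psub a J j (pvar j)"
proof -
  have "psub a J j (pvar j) = lform (\<lambda>i. - a i / a j) (J - {j})"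
    by (rule pfun_eqI) (simp add: pev_lform elim_coord_def sum_divide_distrib sum_negf)
  thus "psub a J j (pvar j) \<in> HP (J - {j}) 1" using HP_lform by metis
  show "pvar j = lform a J * pconst (1 / a j) + psub a J j (pvar j)"
  proof (rule pfun_eqI)
    fix v
    have "(\<Sum>i\<in>J. a i * v i) = a j * v j + (\<Sum>i\<in>J - {j}. a i * v i)" by (rule sum.remove[OF J])
    thus "pev (pvar j) v = pev (lform a J * pconst (1 / a j) + psub a J j (pvar j)) v"
      using aj by (simp add: pev_lform elim_coord_def field_simps)
  qed
qed

text \<open>Division by the linear form: \<open>psub\<close> gives the remainder, which is free of
  the variable \<open>j\<close> and keeps the degree.\<close>

lemma psub_HP:
  assumes "P \<in> HP J d"
  shows "psub a J j P \<in> HP (J - {j}) d \<and> (\<exists>P1\<in>HP J (d - 1). P = lform a J * P1 + psub a J j P)"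
  using assms
proof (induction rule: HP_Suc_induct)
  case (zero b)
  show ?case by (auto intro: bexI[of _ 0])
next
  case (const c)
  show ?case by (auto simp: HP_pconst intro: bexI[of _ 0])
next
  case (var P b i)
  let ?s = "psub a J j"
  obtain P1 where P1: "P1 \<in> HP J (b - 1)" "P = lform a J * P1 + ?s P" and sP: "?s P \<in> HP (J - {j}) b"
    using var.IH by blast
  have sPJ: "?s P \<in> HP J b" using sP by (rule HP_mono) auto
  have xP: "pvar i * P1 \<in> HP J b" using HP_mult[OF HP_pvar[OF var.hyps(2)] P1(1)] by simp
  show ?case
  proof (cases "i = j")
    case True
    have "?s (pvar i * P) \<in> HP (J - {j}) (b + 1)"
      using HP_mult[OF psub_pvar(1) sP] True by (simp add: add.commute)
    moreover have "pvar i * P1 + pconst (1 / a j) * ?s P \<in> HP J (b + 1 - 1)"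
      using HP_add[OF xP, of "pconst (1 / a j) * ?s P"] HP_mult[OF HP_pconst sPJ] by simp
    moreover have "pvar i * P = lform a J * (pvar i * P1 + pconst (1 / a j) * ?s P) + ?s (pvar i * P)"
    proof -
      have "pvar i * P = lform a J * (pvar i * P1) + pvar j * ?s P"
        using True by (subst P1(2)) (simp add: algebra_simps)
      also have "pvar j * ?s P = lform a J * (pconst (1 / a j) * ?s P) + ?s (pvar j) * ?s P"
        by (subst psub_pvar(2)) (simp add: algebra_simps)
      finally have fin: "pvar i * P = lform a J * (pvar i * P1) +
        (lform a J * (pconst (1 / a j) * ?s P) + ?s (pvar j) * ?s P)" .
      have e: "?s (pvar i * P) = ?s (pvar j) * ?s P" using True by simp
      show ?thesis unfolding e by (simp only: fin distrib_left add.assoc)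
    qed
    ultimately show ?thesis by blast
  next
    case False
    hence i: "i \<in> J - {j}" using var by auto
    have s: "?s (pvar i) = pvar i" by (rule psub_id[OF HP_pvar[OF i]])
    have "?s (pvar i * P) \<in> HP (J - {j}) (b + 1)"
      using HP_mult[OF HP_pvar[OF i] sP] by (simp add: s add.commute)
    moreover have "pvar i * P = lform a J * (pvar i * P1) + ?s (pvar i * P)"
      by (subst P1(2)) (simp add: s algebra_simps)
    moreover have "pvar i * P1 \<in> HP J (b + 1 - 1)" using xP by simp
    ultimately show ?thesis by blast
  qed
next
  case (add P Q b)
  define p q where "p = psub a J j P" and "q = psub a J j Q"
  from add obtain P1 Q1 where P1: "P1 \<in> HP J (b - 1)" "P = lform a J * P1 + p"
    and Q1: "Q1 \<in> HP J (b - 1)" "Q = lform a J * Q1 + q" unfolding p_def q_def by blast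
  have pq: "psub a J j (P + Q) = p + q" by (simp add: p_def q_def)
  have "P + Q = lform a J * (P1 + Q1) + (p + q)" unfolding P1(2) Q1(2) by (simp add: algebra_simps)
  hence "P + Q = lform a J * (P1 + Q1) + psub a J j (P + Q)" unfolding pq .
  moreover have "psub a J j (P + Q) \<in> HP (J - {j}) b" using add.IH by (simp add: HP_add)
  ultimately show ?case using HP_add[OF P1(1) Q1(1)] by blast
qed

lemma lform_dvd:
  assumes "P \<in> HP J d" "psub a J j P = 0" obtains P1 where "P1 \<in> HP J (d - 1)" "P = lform a J * P1"
  using psub_HP[OF assms(1)] assms(2) by auto

end

section \<open>Coprimality of powers of coordinates\<close>

lemma pvar_lform: "finite J \<Longrightarrow> i \<in> J \<Longrightarrow> pvar i = lform (\<lambda>k. if k = i then 1 else 0) J"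
  by (rule pfun_eqI) (simp add: pev_lform if_distrib[of "\<lambda>x. x * _"] sum.delta cong: if_cong)

lemma pvar_decomp:
  fixes P :: "'k::field_char_0 pfun"
  assumes "finite J" "i \<in> J" "P \<in> HP J d"
  obtains P1 P2 where "P1 \<in> HP J (d - 1)" "P2 \<in> HP (J - {i}) d" "P = pvar i * P1 + P2"
proof -
  let ?a = "\<lambda>k. if k = i then 1 else 0 :: 'k"
  have s: "psub ?a J i P \<in> HP (J - {i}) d \<and> (\<exists>P1\<in>HP J (d - 1). P = lform ?a J * P1 + psub ?a J i P)"
    using assms by (intro psub_HP) auto
  then obtain P1 where "P1 \<in> HP J (d - 1)" "P = lform ?a J * P1 + psub ?a J i P" by blast
  thus ?thesis using that s unfolding pvar_lform[OF assms(1,2), symmetric] by blast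
qed

text \<open>Setting the variable to zero kills one side of the equation and fixes the other.\<close>

lemma pvar_times_free:
  assumes "finite J" "i \<in> J" "pvar i * U = W" "W \<in> HP (J - {i}) d" shows "W = (0 :: 'k::field_char_0 pfun)"
proof -
  let ?a = "\<lambda>k. if k = i then 1 else 0 :: 'k"
  have "psub ?a J i W = psub ?a J i (pvar i) * psub ?a J i U" unfolding assms(3)[symmetric] by simp
  also have "psub ?a J i (pvar i) = 0"
    unfolding pvar_lform[OF assms(1,2)] using assms(1,2) by (intro psub_lform) auto
  finally show ?thesis using psub_id[OF assms(4)] by simp
qed

lemma pvar_dvd_mult:
  assumes J: "finite J" "i \<in> J" "k \<in> J" "i \<noteq> k"
    and "pvar i * U = pvar k ^ m * W" "W \<in> HP J d"
  obtains C :: "'k::field_char_0 pfun" where "C \<in> HP J (d - 1)" "W = pvar i * C"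
proof -
  obtain W1 W2 where W: "W1 \<in> HP J (d - 1)" "W2 \<in> HP (J - {i}) d" "W = pvar i * W1 + W2"
    using pvar_decomp[OF J(1,2) assms(6)] .
  have "pvar k ^ m \<in> HP (J - {i}) (int m * 1)" using J by (intro HP_power HP_pvar) auto
  hence "pvar k ^ m * W2 \<in> HP (J - {i}) (int m * 1 + d)" using W(2) by (rule HP_mult)
  moreover have "pvar i * (U - pvar k ^ m * W1) = pvar k ^ m * W2"
    using assms(5) W(3) by (simp add: algebra_simps)
  ultimately have "pvar k ^ m * W2 = 0" using pvar_times_free[OF J(1,2)] by blast
  hence "W2 = 0" by simp
  thus ?thesis using that W by simp
qed

lemma pvar_power_dvd_mult:
  assumes J: "finite J" "i \<in> J" "k \<in> J" "i \<noteq> k"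
    and "pvar i ^ K * U = pvar k ^ m * W" "W \<in> HP J d"
  shows "\<exists>C\<in>HP J (d - int K). W = pvar i ^ K * (C :: 'k::field_char_0 pfun)"
  using assms(5,6)
proof (induction K arbitrary: W d)
  case (Suc K)
  have "pvar i * (pvar i ^ K * U) = pvar k ^ m * W" using Suc.prems(1) by (simp add: mult.assoc)
  then obtain C where C: "C \<in> HP J (d - 1)" "W = pvar i * C" using pvar_dvd_mult[OF J _ Suc.prems(2)] by blast
  have "pvar i * (pvar i ^ K * U) = pvar i * (pvar k ^ m * C)"
    using Suc.prems(1) C(2) by (simp add: algebra_simps)
  hence "pvar i ^ K * U = pvar k ^ m * C" by simp
  then obtain C' where C': "C' \<in> HP J (d - 1 - int K)" "C = pvar i ^ K * C'" using Suc.IH C(1) by blast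
  have e: "d - 1 - int K = d - int (Suc K)" by simp
  show ?case using C(2) C'(2) C'(1)[unfolded e] by (intro bexI[of _ C']) (auto simp: mult.assoc)
qed auto

text \<open>\<open>pvar l\<close> is not a zero divisor modulo the powers of \<open>pvar i\<close>
  and \<open>pvar k\<close>. Its factors are cancelled one by one: when \<open>A\<close> and
  \<open>B\<close> are split into multiples of \<open>pvar l\<close> and parts free of it, the free
  parts cancel each other.\<close>

lemma pvar_colon:
  assumes J: "finite J" "i \<in> J" "k \<in> J" "l \<in> J" "i \<noteq> l" "k \<noteq> l"
    and "pvar l ^ m * W = pvar i ^ K * A + pvar k ^ K * B" "W \<in> HP J d"
    and "A \<in> HP J (d + int m - int K)" "B \<in> HP J (d + int m - int K)"
  shows "\<exists>A'\<in>HP J (d - int K). \<exists>B'\<in>HP J (d - int K). W = pvar i ^ K * A' + pvar k ^ K * (B' :: 'k::field_char_0 pfun)"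
  using assms(7-)
proof (induction m arbitrary: W d A B)
  case 0
  thus ?case by auto
next
  case (Suc m)
  let ?d = "d + int (Suc m) - int K"
  obtain A1 A2 where A: "A1 \<in> HP J (?d - 1)" "A2 \<in> HP (J - {l}) ?d" "A = pvar l * A1 + A2"
    using pvar_decomp[OF J(1,4) Suc.prems(3)] .
  obtain B1 B2 where B: "B1 \<in> HP J (?d - 1)" "B2 \<in> HP (J - {l}) ?d" "B = pvar l * B1 + B2"
    using pvar_decomp[OF J(1,4) Suc.prems(4)] .
  have "pvar i ^ K \<in> HP (J - {l}) (int K * 1)" "pvar k ^ K \<in> HP (J - {l}) (int K * 1)"
    using J by (auto intro!: HP_power HP_pvar simp del: mult_1_right)
  hence f: "pvar i ^ K * A2 + pvar k ^ K * B2 \<in> HP (J - {l}) (int K * 1 + ?d)"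
    using A B by (intro HP_add HP_mult)
  have "pvar l * (pvar l ^ m * W - pvar i ^ K * A1 - pvar k ^ K * B1) = pvar i ^ K * A2 + pvar k ^ K * B2"
    using Suc.prems(1) A(3) B(3) by (simp add: algebra_simps)
  from pvar_times_free[OF J(1,4) this f] have "pvar i ^ K * A2 + pvar k ^ K * B2 = 0" .
  hence "pvar l * (pvar l ^ m * W) = pvar l * (pvar i ^ K * A1 + pvar k ^ K * B1)"
    using Suc.prems(1) A(3) B(3) by (simp add: algebra_simps)
  hence "pvar l ^ m * W = pvar i ^ K * A1 + pvar k ^ K * B1" by simp
  moreover have e: "?d - 1 = d + int m - int K" by simp
  ultimately show ?case using Suc.IH[OF _ Suc.prems(2) A(1)[unfolded e] B(1)[unfolded e]] by blast
qed

text \<open>\<open>P0\<close> and \<open>P1\<close> lift coprime powers from the hyperplane, and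
  coprimality lifts with them. Modulo the linear form the relation is solved by some
  \<open>C0\<close>; what remains after subtracting it is divisible by the form, and the quotients
  satisfy the same relation in lower degree.\<close>

lemma regular_sequence:
  fixes P0 P1 :: "'k::field_char_0 pfun"
  assumes J: "finite J" "j \<in> J" "i \<in> J - {j}" "k \<in> J - {j}" "i \<noteq> k" and a: "a j \<noteq> 0"
    and P: "P0 \<in> HP J (int K)" "P1 \<in> HP J (int K)" "psub a J j P0 = pvar i ^ K" "psub a J j P1 = pvar k ^ K"
    and R: "R0 \<in> HP J d" "R1 \<in> HP J d" "P0 * R1 = P1 * R0"
  shows "\<exists>C\<in>HP J (d - int K). R0 = P0 * C"
proof -
  \<comment> \<open>Induction on a bound \<open>n\<close> for the integer degree \<open>d\<close>;
    in negative degrees only zero is left.\<close>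
  have "\<exists>C\<in>HP J (d - int K). R0 = P0 * C"
    if "d < int n" "R0 \<in> HP J d" "R1 \<in> HP J d" "P0 * R1 = P1 * R0" for n d R0 R1
    using that
  proof (induction n arbitrary: d R0 R1)
    case 0
    hence "R0 = 0" by (auto intro: HP_neg)
    thus ?case by (intro bexI[of _ 0]) auto
  next
    case (Suc n)
    note ps = psub_HP[of J j a, OF J(1,2) a]
    let ?s = "psub a J j"
    have sR: "?s R0 \<in> HP (J - {j}) d" "?s R1 \<in> HP (J - {j}) d" using ps Suc.prems by blast+
    have "?s P0 * ?s R1 = ?s P1 * ?s R0" using arg_cong[OF Suc.prems(4), of ?s] by simp
    hence e: "pvar i ^ K * ?s R1 = pvar k ^ K * ?s R0" by (simp add: P)
    obtain C0 where C0: "C0 \<in> HP (J - {j}) (d - int K)" "?s R0 = pvar i ^ K * C0"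
      using pvar_power_dvd_mult[OF _ J(3,4,5) e sR(1)] J(1) by blast
    have "pvar i ^ K * ?s R1 = pvar i ^ K * (pvar k ^ K * C0)" using e C0(2) by (simp add: algebra_simps)
    hence sR1: "?s R1 = pvar k ^ K * C0" by simp
    have C0J: "C0 \<in> HP J (d - int K)" using C0(1) by (rule HP_mono) auto
    have sC: "?s C0 = C0" by (rule psub_id[OF C0(1)])
    have m: "P0 * C0 \<in> HP J d" "P1 * C0 \<in> HP J d" using HP_mult[OF P(1) C0J] HP_mult[OF P(2) C0J] by simp_all
    obtain T0 where T0: "T0 \<in> HP J (d - 1)" "R0 - P0 * C0 = lform a J * T0"
      using lform_dvd[of J j a, OF J(1,2) a HP_diff[OF Suc.prems(2) m(1)]] by (auto simp: C0 sC P)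
    obtain T1 where T1: "T1 \<in> HP J (d - 1)" "R1 - P1 * C0 = lform a J * T1"
      using lform_dvd[of J j a, OF J(1,2) a HP_diff[OF Suc.prems(3) m(2)]] by (auto simp: sR1 sC P)
    have "lform a J * (P0 * T1) = P0 * (lform a J * T1)" by (simp add: mult.left_commute)
    also have "\<dots> = P1 * (lform a J * T0)" unfolding T0(2)[symmetric] T1(2)[symmetric]
      using Suc.prems(4) by (simp add: algebra_simps)
    finally have "lform a J * (P0 * T1) = lform a J * (P1 * T0)" by (simp add: mult.left_commute)
    hence "P0 * T1 = P1 * T0" using lform_nonzero[of J j a, OF J(1,2) a] by simp
    then obtain C where C: "C \<in> HP J (d - 1 - int K)" "T0 = P0 * C"
      using Suc.IH[of "d - 1" T0 T1] Suc.prems(1) T0(1) T1(1) by auto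
    have "lform a J * C \<in> HP J (d - int K)" using HP_mult[OF HP_lform C(1)] by (simp add: algebra_simps)
    hence "C0 + lform a J * C \<in> HP J (d - int K)" using C0J by (rule HP_add[rotated])
    moreover have "R0 = P0 * (C0 + lform a J * C)" using T0(2) C(2) by (simp add: algebra_simps)
    ultimately show ?case by blast
  qed
  from this[of d "nat (d + 1)"] R show ?thesis by simp
qed

subsection \<open>Regular functions\<close>

context linvar begin

section \<open>The Zariski topology in terms of forms\<close>

lemma zopen_subset: "zopen X U \<Longrightarrow> U \<subseteq> X"
  using openin_subset[of "zariski X" U]
  by (auto simp: zariski_def topology_generated_by_topspace basic_open_def)

lemma zopen_nz: assumes "g \<in> HP J c" shows "zopen X {q \<in> X. nz g q}"
proof -
  have "\<exists>d P. homogeneous d P \<and> basic_open X P = {q \<in> X. nz g q}"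
    using assms
  proof (cases rule: HP_cases)
    case 1
    hence "{q \<in> X. nz g q} = {}" using pt_ne by (auto simp: nz_def)
    moreover have "basic_open X 0 = {}" using pt_ne by (force simp: basic_open_def mpoly_eval_def)
    moreover have "homogeneous 0 0" by (simp add: homogeneous_def)
    ultimately show ?thesis by blast
  next
    case (2 d)
    then obtain P where P: "homogeneous d P" "mpoly_eval P = pev g"
      using hpoly_UNIV_eval[OF hpoly_mono[OF 2(2)]] by blast
    hence "basic_open X P = {q \<in> X. nz g q}" by (simp add: basic_open_def nz_def)
    with P show ?thesis by blast
  qed
  thus ?thesis unfolding zariski_def by (metis (mono_tags, lifting) mem_Collect_eq topology_generated_by_Basis)
qed

lemma zopen_basis:
  assumes "zopen X U" "p \<in> U"
  obtains g c where "g \<in> HP J c" "c \<ge> 1" "nz g p" "\<And>q. q \<in> X \<Longrightarrow> nz g q \<Longrightarrow> q \<in> U"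
proof -
  have pX: "p \<in> X" using zopen_subset assms by blast
  have "generate_topology_on {basic_open X P |P d. homogeneous d P} U"
    using assms(1) unfolding zariski_def openin_topology_generated_by_iff .
  hence "\<exists>g c. g \<in> HP J c \<and> c \<ge> 1 \<and> nz g p \<and> (\<forall>q\<in>X. nz g q \<longrightarrow> q \<in> U)"
    using assms(2)
  proof (induction rule: generate_topology_on.induct)
    case (Int U V)
    then obtain g c h d where g: "g \<in> HP J c" "c \<ge> 1" "nz g p" "\<forall>q\<in>X. nz g q \<longrightarrow> q \<in> U"
      and h: "h \<in> HP J d" "d \<ge> 1" "nz h p" "\<forall>q\<in>X. nz h q \<longrightarrow> q \<in> V" by blast
    thus ?case using HP_mult[OF g(1) h(1)] by (intro exI[of _ "g * h"] exI[of _ "c + d"]) auto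
  next
    case (UN K)
    thus ?case by blast
  next
    case (Basis U)
    then obtain P d where P: "homogeneous d P" "U = basic_open X P" by blast
    obtain f where f: "f \<in> hpoly J d" "\<forall>p\<in>X. \<forall>v\<in>p. mpoly_eval P v = f v"
      using pt_red[OF homogeneous_eval_hpoly[OF P(1)]] by blast
    define g where "g = Abs_pfun f"
    have pg: "pev g = f" unfolding g_def
      by (rule Abs_pfun_inverse) (rule polyf_mono[OF hpoly_polyf[OF f(1)]], simp)
    have U: "q \<in> U \<longleftrightarrow> nz g q" if "q \<in> X" for q
      using that f(2) by (auto simp: P(2) basic_open_def nz_def pg)
    obtain i where i: "i \<in> J" "nz (pvar i) p" using ex_pvar[OF pX] .
    have "g \<in> HP J (int d)" using f(1) pg by (simp add: HP_nat)
    hence "pvar i * g \<in> HP J (1 + int d)" using HP_mult[OF HP_pvar[OF i(1)]] by blast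
    thus ?case using U pX i(2) Basis.prems by (intro exI[of _ "pvar i * g"] exI[of _ "1 + int d"]) auto
  qed auto
  thus ?thesis using that by blast
qed

lemma zopen_X: "zopen X X"
  using zopen_nz[OF HP_1] by simp

lemma zopen_Int: "zopen X U \<Longrightarrow> zopen X V \<Longrightarrow> zopen X (U \<inter> V)"
  by (rule openin_Int)

text \<open>A product of nonzero forms is nonzero, hence nonvanishing at some point.\<close>

lemma zopen_irreducible:
  assumes "zopen X U" "zopen X V" "U \<noteq> {}" "V \<noteq> {}" shows "U \<inter> V \<noteq> {}"
proof -
  obtain p q where p: "p \<in> U" "q \<in> V" using assms by blast
  obtain g c where g: "g \<in> HP J c" "nz g p" "\<And>q. q \<in> X \<Longrightarrow> nz g q \<Longrightarrow> q \<in> U"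
    using zopen_basis[OF assms(1) p(1)] by metis
  obtain h d where h: "h \<in> HP J d" "nz h q" "\<And>q. q \<in> X \<Longrightarrow> nz h q \<Longrightarrow> q \<in> V"
    using zopen_basis[OF assms(2) p(2)] by metis
  have "g * h \<noteq> 0" using nz_nonzero g(2) h(2) zopen_subset assms(1,2) p by (metis in_mono mult_eq_0_iff)
  then obtain r where "r \<in> X" "nz (g * h) r" using ex_nz[OF HP_mult[OF g(1) h(1)]] by blast
  thus ?thesis using g(3) h(3) by auto
qed

lemma zopen_meet: "\<lbrakk>zopen X U; zopen X V; U \<noteq> {}; V \<noteq> {}\<rbrakk> \<Longrightarrow> zopen X (U \<inter> V) \<and> U \<inter> V \<noteq> {}"
  using zopen_Int zopen_irreducible by blast

text \<open>Positive degree makes \<open>g\<close> vanish at the zero vector, so every vector that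
  has to be tested belongs to a point. The conclusion covers all large exponents, so that several
  applications can share one.\<close>

lemma nullstellensatz_pts:
  assumes B: "\<And>d. B d \<subseteq> HP J (int d)" "\<And>d. 0 \<in> B d" "\<And>d P Q. P \<in> B d \<Longrightarrow> Q \<in> B d \<Longrightarrow> P + Q \<in> B d"
    "\<And>d e P a. P \<in> B d \<Longrightarrow> a \<in> HP J (int e) \<Longrightarrow> a * P \<in> B (e + d)"
    and g: "g \<in> HP J (int e)" "e \<ge> 1"
    and Z: "\<And>p. p \<in> X \<Longrightarrow> nz g p \<Longrightarrow> \<exists>d. \<exists>P\<in>B d. nz P p"
  shows "\<exists>k. \<forall>K\<ge>k. g ^ K \<in> B (K * e)"
proof -
  have "\<exists>k. (\<lambda>x. pev g x ^ k) \<in> pev ` B (k * e)"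
  proof (rule graded_nullstellensatz[OF finJ])
    show "pev ` B d \<subseteq> hpoly J d" for d using subsetD[OF B(1)] by (auto simp: HP_nat[symmetric])
    show "(\<lambda>x. 0) \<in> pev ` B d" for d using B(2) by (intro image_eqI[of _ _ 0]) (auto simp: zero_pfun.rep_eq)
    show "(\<lambda>x. f x + g x) \<in> pev ` B d" if "f \<in> pev ` B d" "g \<in> pev ` B d" for d f g
      using that B(3) by (auto simp: plus_pfun.rep_eq[symmetric])
    show "pev g \<in> hpoly J e" using g(1) by (simp add: HP_nat)
    show "(\<lambda>x. a x * f x) \<in> pev ` B (e + d)" if f: "f \<in> pev ` B d" and a: "a \<in> hpoly J e" for d e f a
    proof -
      have "pev (Abs_pfun a) = a" by (rule Abs_pfun_inverse) (rule polyf_mono[OF hpoly_polyf[OF a]], simp)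
      hence "Abs_pfun a \<in> HP J (int e)" "pev (Abs_pfun a) = a" using a by (simp_all add: HP_nat)
      moreover obtain P where "P \<in> B d" "f = pev P" using f by blast
      ultimately show ?thesis using B(4)[of P d "Abs_pfun a" e]
        by (intro image_eqI[of _ _ "Abs_pfun a * P"]) (auto simp: times_pfun.rep_eq)
    qed
    fix v assume v: "pev g v \<noteq> 0"
    have "\<exists>i\<in>J. v i \<noteq> 0"
    proof (rule ccontr)
      assume "\<not> ?thesis"
      hence "pev g v = pev g (\<lambda>i. 0 * v i)" by (intro HP_cong[OF g(1)]) auto
      also have "\<dots> = 0" using HP_scale[OF g(1), of 0 v] g(2) by simp
      finally show False using v by simp
    qed
    then obtain p w where p: "p \<in> X" "w \<in> p" "\<forall>i\<in>J. w i = v i" using pt_ex by blast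
    have eq: "pev P w = pev P v" if "P \<in> HP J b" for P b using HP_cong[OF that] p(3) by blast
    have "nz g p" using nz_iff[OF g(1) p(1,2)] eq[OF g(1)] v by simp
    from Z[OF p(1) this] obtain d P where P: "P \<in> B d" "nz P p" by blast
    hence "pev P w \<noteq> 0" using p(2) by (auto simp: nz_def)
    hence "pev P v \<noteq> 0" using eq P(1) B(1) by (metis in_mono)
    thus "\<exists>d. \<exists>f\<in>pev ` B d. f v \<noteq> 0" using P(1) by blast
  qed
  then obtain k P where "P \<in> B (k * e)" "(\<lambda>x. pev g x ^ k) = pev P" by blast
  moreover from this have "g ^ k = P" by (intro pfun_eqI) (simp add: fun_eq_iff)
  ultimately have gk: "g ^ k \<in> B (k * e)" by simp
  show ?thesis
  proof (intro exI allI impI)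
    fix K assume "k \<le> K"
    hence "g ^ (K - k) * g ^ k = g ^ K" "(K - k) * e + k * e = K * e"
      by (simp_all add: power_add[symmetric] add_mult_distrib[symmetric])
    moreover have "g ^ (K - k) \<in> HP J (int ((K - k) * e))" using HP_power[OF g(1), of "K - k"] by simp
    ultimately show "g ^ K \<in> B (K * e)" using B(4)[OF gk] by metis
  qed
qed

text \<open>The denominators of \<open>z\<close> form a graded ideal. Regularity at the points where
  \<open>g\<close> does not vanish says that this ideal has no zero there, so it contains the high
  powers of \<open>g\<close>.\<close>

lemma regular_on_basic:
  assumes g: "g \<in> HP J c" "c \<ge> 1" and z: "\<And>p. p \<in> X \<Longrightarrow> nz g p \<Longrightarrow> z \<in> Oloc J b p"
  shows "\<exists>k. \<forall>K\<ge>k. \<exists>P\<in>HP J (b + int K * c). z * pf g ^ K = pf P"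
proof -
  obtain e where e: "c = int e" "e \<ge> 1" using g(2) by (metis int_one_le_iff_zero_less nat_0_le nat_int zero_le_one order_trans of_nat_1 of_nat_le_iff)
  define B where "B d = {Q \<in> HP J (int d). \<exists>P\<in>HP J (b + int d). z * pf Q = pf P}" for d :: nat
  have "\<exists>k. \<forall>K\<ge>k. g ^ K \<in> B (K * e)"
  proof (rule nullstellensatz_pts)
    show "g \<in> HP J (int e)" using g e by simp
    show "B d \<subseteq> HP J (int d)" for d by (auto simp: B_def)
    show "0 \<in> B d" for d by (auto simp: B_def intro: bexI[of _ 0])
    show "P + Q \<in> B d" if "P \<in> B d" "Q \<in> B d" for d P Q
    proof -
      from that obtain P' Q' where P': "P' \<in> HP J (b + int d)" "z * pf P = pf P'"
        "Q' \<in> HP J (b + int d)" "z * pf Q = pf Q'" and "P \<in> HP J (int d)" "Q \<in> HP J (int d)"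
        unfolding B_def by blast
      hence "P + Q \<in> HP J (int d)" "P' + Q' \<in> HP J (b + int d)" "z * pf (P + Q) = pf (P' + Q')"
        by (auto simp: distrib_left intro: HP_add)
      thus ?thesis unfolding B_def by blast
    qed
    show "a * P \<in> B (e + d)" if P: "P \<in> B d" and a: "a \<in> HP J (int e)" for d e P a
    proof -
      from P obtain P' where P': "P' \<in> HP J (b + int d)" "z * pf P = pf P'" "P \<in> HP J (int d)"
        unfolding B_def by blast
      have "a * P \<in> HP J (int (e + d))" using HP_mult[OF a P'(3)] by simp
      moreover have "a * P' \<in> HP J (b + int (e + d))" using HP_mult[OF a P'(1)] by (simp add: algebra_simps)
      moreover have "z * pf (a * P) = pf (a * P')" using P'(2) by (simp add: algebra_simps)
      ultimately show ?thesis unfolding B_def by blast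
    qed
    fix p assume p: "p \<in> X" "nz g p"
    from z[OF this] obtain P Q a c' where P: "P \<in> HP J a" "Q \<in> HP J c'" "a - c' = b" "nz Q p" "z = pf P / pf Q"
      by (rule OlocE)
    have "c' \<ge> 0" using HP_deg_nonneg[OF P(2) nz_nonzero[OF P(4) p(1)]] .
    hence "Q \<in> B (nat c')" using P nz_pf[OF P(4) p(1)] unfolding B_def
      by (auto intro!: bexI[of _ P])
    thus "\<exists>d. \<exists>P\<in>B d. nz P p" using P(4) by blast
  qed (use e in auto)
  then obtain k where "\<forall>K\<ge>k. g ^ K \<in> B (K * e)" by blast
  thus ?thesis unfolding B_def by (intro exI[of _ k]) (auto simp: e)
qed

lemma two_indices:
  assumes "card A \<ge> 2" obtains i k where "i \<in> A" "k \<in> A" "i \<noteq> k"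
  using assms by (metis card_2_iff' obtain_subset_with_card_n subsetD)

text \<open>\<open>z\<close> has a power of one coordinate as denominator and also a power of
  another; by coprimality the denominator divides the numerator.\<close>

lemma regular_global:
  assumes "card J \<ge> 2" and z: "\<And>p. p \<in> X \<Longrightarrow> z \<in> Oloc J b p"
  obtains P where "P \<in> HP J b" "z = pf P"
proof -
  obtain i k where ik: "i \<in> J" "k \<in> J" "i \<noteq> k" using two_indices[OF assms(1)] .
  obtain m where m: "\<forall>K\<ge>m. \<exists>P\<in>HP J (b + int K * 1). z * pf (pvar i) ^ K = pf P"
    using regular_on_basic[OF HP_pvar[OF ik(1)] _ z] by force
  obtain n where n: "\<forall>K\<ge>n. \<exists>P\<in>HP J (b + int K * 1). z * pf (pvar k) ^ K = pf P"
    using regular_on_basic[OF HP_pvar[OF ik(2)] _ z] by force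
  define K where "K = max m n"
  obtain P where P: "P \<in> HP J (b + int K * 1)" "z * pf (pvar i) ^ K = pf P" using m unfolding K_def by (meson max.cobounded1)
  obtain Q where Q: "Q \<in> HP J (b + int K * 1)" "z * pf (pvar k) ^ K = pf Q" using n unfolding K_def by (meson max.cobounded2)
  have "pf (pvar i ^ K * Q) = pf (pvar k ^ K * P)" using P(2) Q(2) by (simp add: algebra_simps flip: P(2) Q(2))
  hence "pvar i ^ K * Q = pvar k ^ K * P" by (simp only: pf_eq_iff)
  from pvar_power_dvd_mult[OF finJ ik this P(1)] obtain C where
    C: "C \<in> HP J b" "P = pvar i ^ K * C" by auto
  have "pf (pvar i) ^ K * z = pf (pvar i) ^ K * pf C" using P(2) C(2) by (simp add: mult.commute)
  hence "z = pf C" by simp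
  thus ?thesis using that C(1) by blast
qed

text \<open>The relation between the two numerators over a common denominator is divided out by
  coprimality. The point \<open>q\<close> may lie on the locus where both coordinates vanish, which
  has codimension two.\<close>

lemma regular_codim2:
  assumes q: "q \<in> X" and ik: "i \<in> J" "k \<in> J" "i \<noteq> k"
    and u: "pf (pvar i) ^ K * u \<in> Oloc J (b + int K) q" "pf (pvar k) ^ K * u \<in> Oloc J (b + int K) q"
  shows "u \<in> Oloc J b q"
proof -
  obtain P R Q a c where P: "P \<in> HP J a" "R \<in> HP J (a + (b + int K) - (b + int K))" "Q \<in> HP J c"
    "a - c = b + int K" "nz Q q" "pf (pvar i) ^ K * u = pf P / pf Q" "pf (pvar k) ^ K * u = pf R / pf Q"
    by (rule Oloc_common[OF u q])
  have Q0: "pf Q \<noteq> 0" using nz_pf[OF P(5) q] .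
  hence "pf P = pf (pvar i) ^ K * u * pf Q" "pf R = pf (pvar k) ^ K * u * pf Q" using P(6,7) by simp_all
  hence "pf (pvar i ^ K * R) = pf (pvar k ^ K * P)" by (simp add: algebra_simps)
  hence "pvar i ^ K * R = pvar k ^ K * P" by (simp only: pf_eq_iff)
  from pvar_power_dvd_mult[OF finJ ik this P(1)] obtain C where
    C: "C \<in> HP J (a - int K)" "P = pvar i ^ K * C" by auto
  have "pf (pvar i) ^ K * (u * pf Q) = pf (pvar i) ^ K * pf C"
    using C(2) \<open>pf P = _\<close> by (simp add: mult.assoc)
  hence "u * pf Q = pf C" by simp
  hence "u = pf C / pf Q" using Q0 by (simp add: field_simps)
  thus ?thesis using C(1) P by (intro OlocI[of C J "a - int K" Q c]) auto
qed

text \<open>The forms whose nonvanishing locus is covered by finitely many of the loci of the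
  \<open>g p\<close> make up a graded ideal. It contains every \<open>g p\<close>, so it has no
  zeros and contains a power of each coordinate.\<close>

lemma quasi_compact:
  assumes g: "\<And>p. p \<in> X \<Longrightarrow> g p \<in> HP J (c p) \<and> nz (g p) p"
  obtains A where "finite A" "A \<subseteq> X" "\<And>q. q \<in> X \<Longrightarrow> \<exists>p\<in>A. nz (g p) q"
proof -
  define B where "B d = {P \<in> HP J (int d). \<exists>A. finite A \<and> A \<subseteq> X \<and> (\<forall>q\<in>X. nz P q \<longrightarrow> (\<exists>p\<in>A. nz (g p) q))}"
    for d :: nat
  have pow: "\<exists>k. \<forall>K\<ge>k. pvar i ^ K \<in> B (K * 1)" if "i \<in> J" for i
  proof (rule nullstellensatz_pts)
    show "pvar i \<in> HP J (int 1)" using HP_pvar[OF that] by simp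
    show "B d \<subseteq> HP J (int d)" for d by (auto simp: B_def)
    show "0 \<in> B d" for d using nz_nonzero by (auto simp: B_def intro!: exI[of _ "{}"])
    show "P + Q \<in> B d" if "P \<in> B d" "Q \<in> B d" for d P Q
    proof -
      from that obtain A A' where A: "finite A" "A \<subseteq> X" "\<forall>q\<in>X. nz P q \<longrightarrow> (\<exists>p\<in>A. nz (g p) q)"
        "finite A'" "A' \<subseteq> X" "\<forall>q\<in>X. nz Q q \<longrightarrow> (\<exists>p\<in>A'. nz (g p) q)"
        and PQ: "P \<in> HP J (int d)" "Q \<in> HP J (int d)" unfolding B_def by blast
      have "\<forall>q\<in>X. nz (P + Q) q \<longrightarrow> (\<exists>p\<in>A \<union> A'. nz (g p) q)" using nz_add[OF PQ] A(3,6) by blast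
      thus ?thesis using A HP_add[OF PQ] unfolding B_def by (auto intro!: exI[of _ "A \<union> A'"])
    qed
    show "a * P \<in> B (e + d)" if "P \<in> B d" "a \<in> HP J (int e)" for d e P a
      using that HP_mult[of a J "int e" P "int d"] unfolding B_def by auto
    fix p assume p: "p \<in> X"
    hence "c p \<ge> 0" using g nz_nonzero HP_deg_nonneg by blast
    hence "g p \<in> B (nat (c p))" using g[OF p] p unfolding B_def by (auto intro!: exI[of _ "{p}"])
    thus "\<exists>d. \<exists>P\<in>B d. nz P p" using g[OF p] by blast
  qed auto
  have "\<exists>A. finite A \<and> A \<subseteq> X \<and> (\<forall>q\<in>X. nz (pvar i) q \<longrightarrow> (\<exists>p\<in>A. nz (g p) q))" if "i \<in> J" for i
  proof -
    obtain k where "\<forall>K\<ge>k. pvar i ^ K \<in> B (K * 1)" using pow[OF \<open>i \<in> J\<close>] by blast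
    hence "pvar i ^ k \<in> B (k * 1)" by simp
    then obtain A where "finite A" "A \<subseteq> X" "\<forall>q\<in>X. nz (pvar i ^ k) q \<longrightarrow> (\<exists>p\<in>A. nz (g p) q)"
      unfolding B_def by blast
    thus ?thesis by (intro exI[of _ A]) (auto intro: nz_power)
  qed
  then obtain A where A: "\<And>i. i \<in> J \<Longrightarrow> finite (A i) \<and> A i \<subseteq> X \<and> (\<forall>q\<in>X. nz (pvar i) q \<longrightarrow> (\<exists>p\<in>A i. nz (g p) q))"
    by metis
  show ?thesis
  proof
    show "finite (\<Union>i\<in>J. A i)" "(\<Union>i\<in>J. A i) \<subseteq> X" using A finJ by blast+
    show "\<exists>p\<in>\<Union>i\<in>J. A i. nz (g p) q" if "q \<in> X" for q
      using ex_pvar[OF that] A that by (metis UN_I)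
  qed
qed

end

section \<open>Cousin problems\<close>

abbreviation "near X p P \<equiv> \<exists>V. zopen X V \<and> p \<in> V \<and> (\<forall>q\<in>V. P q)"

text \<open>
  For a sheaf given by its stalks, embedded in a constant group, a \<open>1\<close>-cocycle is a family of principal
  parts, and it is a coboundary when the corresponding Cousin problem is solvable.
\<close>

definition cousin :: "'k::field point set \<Rightarrow> ('k point \<Rightarrow> 'v::ab_group_add set) \<Rightarrow> bool" where
  "cousin X S \<longleftrightarrow> (\<forall>f. (\<forall>p\<in>X. near X p (\<lambda>q. f q - f p \<in> S q)) \<longrightarrow>
    (\<exists>z. \<forall>p\<in>X. z - f p \<in> S p))"

context linvar begin

lemma cousin_data:
  assumes "\<forall>p\<in>X. near X p (\<lambda>q. f q - f p \<in> S q)"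
  obtains g c where "\<And>p. p \<in> X \<Longrightarrow> g p \<in> HP J (c p) \<and> c p \<ge> 1 \<and> nz (g p) p"
    "\<And>p q. \<lbrakk>p \<in> X; q \<in> X; nz (g p) q\<rbrakk> \<Longrightarrow> f q - f p \<in> S q"
proof -
  have "\<forall>p\<in>X. \<exists>x. fst x \<in> HP J (snd x) \<and> snd x \<ge> 1 \<and> nz (fst x) p \<and> (\<forall>q\<in>X. nz (fst x) q \<longrightarrow> f q - f p \<in> S q)"
  proof
    fix p assume "p \<in> X"
    then obtain V where V: "zopen X V" "p \<in> V" "\<forall>q\<in>V. f q - f p \<in> S q" using assms by blast
    obtain g c where "g \<in> HP J c" "c \<ge> 1" "nz g p" "\<And>q. q \<in> X \<Longrightarrow> nz g q \<Longrightarrow> q \<in> V"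
      by (rule zopen_basis[OF V(1,2)]) blast
    thus "\<exists>x. fst x \<in> HP J (snd x) \<and> snd x \<ge> 1 \<and> nz (fst x) p \<and> (\<forall>q\<in>X. nz (fst x) q \<longrightarrow> f q - f p \<in> S q)"
      using V(3) by (intro exI[of _ "(g, c)"]) auto
  qed
  then obtain x where "\<forall>p\<in>X. fst (x p) \<in> HP J (snd (x p)) \<and> snd (x p) \<ge> 1 \<and> nz (fst (x p)) p \<and>
      (\<forall>q\<in>X. nz (fst (x p)) q \<longrightarrow> f q - f p \<in> S q)" by (rule bchoice[THEN exE])
  thus ?thesis using that[of "\<lambda>p. fst (x p)" "\<lambda>p. snd (x p)"] by simp
qed

text \<open>The forms that multiply the problem into a solvable one make up a graded ideal. It has
  no zeros: a high power of \<open>g p\<close> belongs to it, with solution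
  \<open>g p ^ K * f p\<close>, because this power clears the poles of \<open>f p - f r\<close>
  along \<open>g p = 0\<close>.\<close>

lemma cousin_clear:
  assumes g: "\<And>p. p \<in> X \<Longrightarrow> g p \<in> HP J (c p) \<and> c p \<ge> 1 \<and> nz (g p) p"
    and f: "\<And>p q. \<lbrakk>p \<in> X; q \<in> X; nz (g p) q\<rbrakk> \<Longrightarrow> f q - f p \<in> Oloc J b q"
    and i: "i \<in> J"
  shows "\<exists>k. \<forall>K\<ge>k. \<exists>z. \<forall>q\<in>X. z - pf (pvar i) ^ K * f q \<in> Oloc J (b + int K) q"
proof -
  obtain A where A: "finite A" "A \<subseteq> X" "\<And>q. q \<in> X \<Longrightarrow> \<exists>p\<in>A. nz (g p) q"
    using quasi_compact[of g c] g by blast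
  define B where "B d = {P \<in> HP J (int d). \<exists>z. \<forall>q\<in>X. z - pf P * f q \<in> Oloc J (b + int d) q}" for d :: nat
  have "\<exists>k. \<forall>K\<ge>k. pvar i ^ K \<in> B (K * 1)"
  proof (rule nullstellensatz_pts)
    show "pvar i \<in> HP J (int 1)" using HP_pvar[OF i] by simp
    show "B d \<subseteq> HP J (int d)" for d by (auto simp: B_def)
    show "0 \<in> B d" for d using Oloc_0 by (auto simp: B_def intro!: exI[of _ 0])
    show "P + Q \<in> B d" if PQ: "P \<in> B d" "Q \<in> B d" for d P Q
    proof -
      obtain z w where z: "\<forall>q\<in>X. z - pf P * f q \<in> Oloc J (b + int d) q" "\<forall>q\<in>X. w - pf Q * f q \<in> Oloc J (b + int d) q"
        using PQ unfolding B_def by blast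
      have "(z + w) - pf (P + Q) * f q \<in> Oloc J (b + int d) q" if "q \<in> X" for q
        using Oloc_add[of "z - pf P * f q" "b + int d" q "w - pf Q * f q"] z that by (simp add: algebra_simps)
      thus ?thesis using PQ HP_add[of P J "int d" Q] unfolding B_def by blast
    qed
    show "a * P \<in> B (e + d)" if P: "P \<in> B d" and a: "a \<in> HP J (int e)" for d e P a
    proof -
      obtain z where z: "\<forall>q\<in>X. z - pf P * f q \<in> Oloc J (b + int d) q" using P unfolding B_def by blast
      have "pf a * z - pf (a * P) * f q \<in> Oloc J (b + int (e + d)) q" if "q \<in> X" for q
        using Oloc_mult[OF Oloc_HP[OF a, of q], of "z - pf P * f q" "b + int d"] z that
        by (simp add: algebra_simps)
      thus ?thesis using HP_mult[OF a, of P "int d"] P unfolding B_def by auto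
    qed
    fix p assume p: "p \<in> X"
    note gp = g[OF p]
    have "\<exists>k. \<forall>K\<ge>k. \<exists>P\<in>HP J (b + int K * (c p + c r)). (f p - f r) * pf (g p * g r) ^ K = pf P"
      if r: "r \<in> X" for r
    proof (rule regular_on_basic)
      show "g p * g r \<in> HP J (c p + c r)" "c p + c r \<ge> 1" using g[OF r] gp by (auto intro: HP_mult)
      fix q assume q: "q \<in> X" "nz (g p * g r) q"
      thus "f p - f r \<in> Oloc J b q"
        using Oloc_diff[OF f[OF r q(1)] f[OF p q(1)] q(1)] by simp
    qed
    then obtain k where k: "\<And>r. r \<in> X \<Longrightarrow>
        \<forall>K\<ge>k r. \<exists>P\<in>HP J (b + int K * (c p + c r)). (f p - f r) * pf (g p * g r) ^ K = pf P" by metis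
    \<comment> \<open>One exponent for the finitely many \<open>r\<close> of the subcover.\<close>
    define K where "K = (\<Sum>r\<in>A. k r)"
    have "pf (g p ^ K) * f p - pf (g p ^ K) * f q \<in> Oloc J (b + int K * c p) q" if q: "q \<in> X" for q
    proof -
      obtain r where r: "r \<in> A" "nz (g r) q" using A(3)[OF q] by blast
      hence rX: "r \<in> X" using A(2) by blast
      have "k r \<le> K" unfolding K_def using A(1) r(1) by (intro member_le_sum) auto
      then obtain P where P: "P \<in> HP J (b + int K * (c p + c r))" "(f p - f r) * pf (g p * g r) ^ K = pf P"
        using k[OF rX] by blast
      have gr: "g r ^ K \<in> HP J (int K * c r)" "nz (g r ^ K) q" using HP_power g[OF rX] r(2) by (auto intro: nz_power)
      have "(f p - f r) * pf (g p ^ K) = pf P / pf (g r ^ K)"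
        using nz_pf[OF gr(2) q] P(2) by (simp add: field_simps power_mult_distrib)
      hence 1: "(f p - f r) * pf (g p ^ K) \<in> Oloc J (b + int K * c p) q"
        using P(1) gr by (intro OlocI) (auto simp: algebra_simps)
      have gpK: "g p ^ K \<in> HP J (int K * c p)" using gp by (intro HP_power) auto
      have 2: "pf (g p ^ K) * (f q - f r) \<in> Oloc J (int K * c p + b) q"
        by (rule Oloc_mult[OF Oloc_HP[OF gpK] f[OF rX q r(2)]])
      show ?thesis using Oloc_diff[OF 1 _ q, of "pf (g p ^ K) * (f q - f r)"] 2
        by (simp add: algebra_simps)
    qed
    moreover have "int (nat (int K * c p)) = int K * c p" using gp by simp
    moreover have "g p ^ K \<in> HP J (int K * c p)" using gp by (intro HP_power) auto
    ultimately have "g p ^ K \<in> B (nat (int K * c p))" unfolding B_def by auto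
    thus "\<exists>d. \<exists>P\<in>B d. nz P p" using gp nz_power by blast
  qed auto
  thus ?thesis unfolding B_def by auto
qed

lemma three_indices:
  assumes "card A \<ge> 3" obtains i k l where "i \<in> A" "k \<in> A" "l \<in> A" "i \<noteq> k" "i \<noteq> l" "k \<noteq> l"
proof -
  obtain B where B: "B \<subseteq> A" "card B = 3" using obtain_subset_with_card_n[OF assms] by metis
  then obtain i k l where "B = {i, k, l}" "i \<noteq> k" "i \<noteq> l" "k \<noteq> l" by (auto simp: card_3_iff)
  thus ?thesis using that[of i k l] B(1) by auto
qed

text \<open>\<open>fi\<close>, \<open>fk\<close>, \<open>fl\<close> solve the problem multiplied by
  \<open>x\<close>, \<open>y\<close>, \<open>w\<close>. Their cross differences are regular
  everywhere, hence forms with \<open>w * P1 = y * P2 - x * P3\<close>. Cancelling \<open>w\<close>,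
  for which the third coordinate is there, gives \<open>P1 = x * Q0 + y * Q1\<close>; the
  corrections \<open>Q1\<close> and \<open>Q0\<close> then make the quotients of \<open>fi\<close>
  by \<open>x\<close> and of \<open>fk\<close> by \<open>y\<close> agree.\<close>

theorem cousin_Oloc:
  assumes "card J \<ge> 3" shows "cousin X (Oloc J b)"
  unfolding cousin_def
proof (intro allI impI)
  fix f assume "\<forall>p\<in>X. near X p (\<lambda>q. f q - f p \<in> Oloc J b q)"
  then obtain g c where g: "\<And>p. p \<in> X \<Longrightarrow> g p \<in> HP J (c p) \<and> c p \<ge> 1 \<and> nz (g p) p"
    and f: "\<And>p q. \<lbrakk>p \<in> X; q \<in> X; nz (g p) q\<rbrakk> \<Longrightarrow> f q - f p \<in> Oloc J b q"
    by (rule cousin_data[of f "Oloc J b"]) blast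
  note cl = cousin_clear[of g c f b, OF g f]
  obtain i k l where ikl: "i \<in> J" "k \<in> J" "l \<in> J" "i \<noteq> k" "i \<noteq> l" "k \<noteq> l"
    using three_indices[OF assms] .
  obtain m1 where m1: "\<forall>K\<ge>m1. \<exists>z. \<forall>q\<in>X. z - pf (pvar i) ^ K * f q \<in> Oloc J (b + int K) q" using cl ikl(1) by blast
  obtain m2 where m2: "\<forall>K\<ge>m2. \<exists>z. \<forall>q\<in>X. z - pf (pvar k) ^ K * f q \<in> Oloc J (b + int K) q" using cl ikl(2) by blast
  obtain m3 where m3: "\<forall>K\<ge>m3. \<exists>z. \<forall>q\<in>X. z - pf (pvar l) ^ K * f q \<in> Oloc J (b + int K) q" using cl ikl(3) by blast
  define K where "K = m1 + m2 + m3"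
  define x y w where "x = pf (pvar i :: 'k pfun) ^ K" and "y = pf (pvar k :: 'k pfun) ^ K" and "w = pf (pvar l :: 'k pfun) ^ K"
  have "K \<ge> m1" "K \<ge> m2" "K \<ge> m3" by (auto simp: K_def)
  then obtain fi fk fl where fi: "\<And>q. q \<in> X \<Longrightarrow> fi - x * f q \<in> Oloc J (b + int K) q"
    and fk: "\<And>q. q \<in> X \<Longrightarrow> fk - y * f q \<in> Oloc J (b + int K) q"
    and fl: "\<And>q. q \<in> X \<Longrightarrow> fl - w * f q \<in> Oloc J (b + int K) q"
    using m1 m2 m3 unfolding x_def y_def w_def by metis
  have card2: "card J \<ge> 2" using assms by simp
  have xO: "x \<in> Oloc J (int K) q" "y \<in> Oloc J (int K) q" "w \<in> Oloc J (int K) q" for q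
    using Oloc_HP[OF HP_power[OF HP_pvar]] ikl unfolding x_def y_def w_def by (force simp flip: pf_power)+
  have A: "\<exists>P\<in>HP J (b + int K + int K). s * u - t * v = pf P"
    if "\<And>q. q \<in> X \<Longrightarrow> u - t * f q \<in> Oloc J (b + int K) q" "\<And>q. q \<in> X \<Longrightarrow> v - s * f q \<in> Oloc J (b + int K) q"
      "\<And>q. s \<in> Oloc J (int K) q" "\<And>q. t \<in> Oloc J (int K) q" for s t u v
  proof -
    have "s * u - t * v \<in> Oloc J (b + int K + int K) q" if q: "q \<in> X" for q
      using Oloc_diff[OF Oloc_mult[OF \<open>\<And>q. q \<in> X \<Longrightarrow> u - t * f q \<in> Oloc J (b + int K) q\<close>[OF q] \<open>\<And>q. s \<in> Oloc J (int K) q\<close>]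
          Oloc_mult[OF \<open>\<And>q. q \<in> X \<Longrightarrow> v - s * f q \<in> Oloc J (b + int K) q\<close>[OF q] \<open>\<And>q. t \<in> Oloc J (int K) q\<close>] q]
      by (simp add: algebra_simps)
    from regular_global[OF card2 this] show ?thesis by metis
  qed
  obtain P1 where P1: "P1 \<in> HP J (b + int K + int K)" "y * fi - x * fk = pf P1" using A[OF fi fk xO(2,1)] by blast
  obtain P2 where P2: "P2 \<in> HP J (b + int K + int K)" "w * fi - x * fl = pf P2" using A[OF fi fl xO(3,1)] by blast
  obtain P3 where P3: "P3 \<in> HP J (b + int K + int K)" "w * fk - y * fl = pf P3" using A[OF fk fl xO(3,2)] by blast
  have "pf (pvar l ^ K * P1) = pf (pvar i ^ K * (- P3) + pvar k ^ K * P2)"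
    by (simp add: P1(2)[symmetric] P2(2)[symmetric] P3(2)[symmetric] x_def y_def w_def algebra_simps)
  hence "pvar l ^ K * P1 = pvar i ^ K * (- P3) + pvar k ^ K * P2" by (simp only: pf_eq_iff)
  moreover have "- P3 \<in> HP J (b + int K + int K + int K - int K)" "P2 \<in> HP J (b + int K + int K + int K - int K)"
    using HP_uminus[OF P3(1)] P2(1) by simp_all
  ultimately have "\<exists>A'\<in>HP J (b + int K + int K - int K). \<exists>B'\<in>HP J (b + int K + int K - int K).
      P1 = pvar i ^ K * A' + pvar k ^ K * B'"
    by (rule pvar_colon[OF finJ ikl(1,2,3) ikl(5,6) _ P1(1)])
  moreover have "b + int K + int K - int K = b + int K" by simp
  ultimately obtain Q0 Q1 where
    Q: "Q0 \<in> HP J (b + int K)" "Q1 \<in> HP J (b + int K)" "P1 = pvar i ^ K * Q0 + pvar k ^ K * Q1" by metis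
  have nzx: "x \<noteq> 0" "y \<noteq> 0" by (auto simp: x_def y_def)
  define z where "z = (fi - pf Q1) / x"
  have xz: "x * z = fi - pf Q1" using nzx by (simp add: z_def)
  have "y * fi - x * fk = x * pf Q0 + y * pf Q1" unfolding P1(2) Q(3) by (simp add: x_def y_def)
  moreover have "x * (y * z) = y * (fi - pf Q1)" unfolding xz[symmetric] by (simp add: mult.left_commute)
  ultimately have "x * (y * z) = x * (fk + pf Q0)" by (simp add: algebra_simps)
  hence yz: "y * z = fk + pf Q0" using nzx by simp
  show "\<exists>z. \<forall>p\<in>X. z - f p \<in> Oloc J b p"
  proof (intro exI ballI)
    fix q assume q: "q \<in> X"
    show "z - f q \<in> Oloc J b q"
    \<comment> \<open>A pole of \<open>z - f q\<close> could only lie where both coordinates vanish,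
      which codimension two excludes.\<close>
    proof (rule regular_codim2[OF q ikl(1,2,4), where K = K])
      show "pf (pvar i) ^ K * (z - f q) \<in> Oloc J (b + int K) q"
      proof -
        have "x * (z - f q) = (fi - x * f q) - pf Q1" unfolding right_diff_distrib xz by simp
        thus ?thesis using Oloc_diff[OF fi[OF q] Oloc_HP[OF Q(2)] q] by (simp only: x_def)
      qed
      show "pf (pvar k) ^ K * (z - f q) \<in> Oloc J (b + int K) q"
      proof -
        have "y * (z - f q) = (fk - y * f q) + pf Q0" unfolding right_diff_distrib yz by simp
        thus ?thesis using Oloc_add[OF fk[OF q] Oloc_HP[OF Q(1)] q] by (simp only: y_def)
      qed
    qed
  qed
qed

text \<open>A closed set that does not meet the hyperplane \<open>lform a J = 0\<close> has codimension at least two.\<close>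

theorem hartogs:
  assumes j: "j \<in> J" "a j \<noteq> 0" and card: "card (J - {j}) \<ge> 2"
    and g: "g \<in> HP J c" "c \<ge> 1" and p0: "p0 \<in> X" "nz g p0"
    and h: "\<And>u. u \<in> X \<Longrightarrow> \<not> nz (lform a J) u \<Longrightarrow> h u \<in> HP J (e u) \<and> e u \<ge> 1 \<and> nz (h u) u"
    and z: "\<And>q u. \<lbrakk>q \<in> X; u \<in> X; \<not> nz (lform a J) u; nz g q; nz (h u) q\<rbrakk> \<Longrightarrow> z \<in> Oloc J b q"
  shows "z \<in> Oloc J b p0"
proof -
  let ?l = "lform a J"
  \<comment> \<open>Forms that clear the denominator of \<open>z\<close> up to powers of
    \<open>g\<close>; the order of the pole along \<open>g = 0\<close> is left free.\<close>
  define A where "A d = {P \<in> HP J (int d). \<exists>m. \<forall>M\<ge>m. \<exists>R\<in>HP J (b + int M * c + int d). z * pf g ^ M * pf P = pf R}"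
    for d :: nat
  \<comment> \<open>At the zeros of the linear form the powers of the \<open>h p\<close> are in
    \<open>A\<close>; adding multiples of the linear form removes the zeros elsewhere, so
    \<open>B\<close> has none at all.\<close>
  define B where "B d = {P + ?l * P' | P P'. P \<in> A d \<and> P' \<in> HP J (int d - 1)}" for d :: nat
  have A_add: "P + Q \<in> A d" if PQ: "P \<in> A d" "Q \<in> A d" for P Q d
  proof -
    obtain m n where m: "\<forall>M\<ge>m. \<exists>R\<in>HP J (b + int M * c + int d). z * pf g ^ M * pf P = pf R"
      "\<forall>M\<ge>n. \<exists>R\<in>HP J (b + int M * c + int d). z * pf g ^ M * pf Q = pf R" using PQ unfolding A_def by blast
    have "\<exists>R\<in>HP J (b + int M * c + int d). z * pf g ^ M * pf (P + Q) = pf R" if "M \<ge> max m n" for M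
    proof -
      have "m \<le> M" "n \<le> M" using that by auto
      then obtain R R' where "R \<in> HP J (b + int M * c + int d)" "z * pf g ^ M * pf P = pf R"
        "R' \<in> HP J (b + int M * c + int d)" "z * pf g ^ M * pf Q = pf R'" using m by blast
      thus ?thesis by (intro bexI[of _ "R + R'"]) (auto simp: distrib_left HP_add)
    qed
    thus ?thesis using PQ HP_add unfolding A_def by blast
  qed
  have A_mult: "x * P \<in> A (e + d)" if P: "P \<in> A d" and x: "x \<in> HP J (int e)" for P d x e
  proof -
    obtain m where m: "\<forall>M\<ge>m. \<exists>R\<in>HP J (b + int M * c + int d). z * pf g ^ M * pf P = pf R"
      using P unfolding A_def by blast
    have "\<exists>R\<in>HP J (b + int M * c + int (e + d)). z * pf g ^ M * pf (x * P) = pf R" if "M \<ge> m" for M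
    proof -
      obtain R where R: "R \<in> HP J (b + int M * c + int d)" "z * pf g ^ M * pf P = pf R" using m \<open>M \<ge> m\<close> by blast
      have "x * R \<in> HP J (b + int M * c + int (e + d))" using HP_mult[OF x R(1)] by (simp add: algebra_simps)
      moreover have "z * pf g ^ M * pf (x * P) = pf (x * R)" by (simp add: R(2)[symmetric] algebra_simps)
      ultimately show ?thesis by blast
    qed
    thus ?thesis using HP_mult[OF x, of P "int d"] P unfolding A_def by auto
  qed
  have l1: "?l \<in> HP J 1" by (rule HP_lform)
  have key: "\<exists>k. \<forall>K\<ge>k. pvar i ^ K \<in> B (K * 1)" if i: "i \<in> J" for i
  proof (rule nullstellensatz_pts)
    show "pvar i \<in> HP J (int 1)" using HP_pvar[OF i] by simp
    show "B d \<subseteq> HP J (int d)" for d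
      using HP_mult[OF l1, of _ "int d - 1"] by (auto simp: B_def A_def intro!: HP_add)
    show "0 \<in> B d" for d
    proof -
      have "0 \<in> A d" unfolding A_def by (auto intro!: exI[of _ 0] bexI[of _ 0])
      thus ?thesis unfolding B_def by (auto intro!: exI[of _ 0])
    qed
    show "P + Q \<in> B d" if PQ: "P \<in> B d" "Q \<in> B d" for d P Q
    proof -
      obtain P1 P2 Q1 Q2 where 1: "P1 \<in> A d" "P2 \<in> HP J (int d - 1)" "P = P1 + ?l * P2"
        "Q1 \<in> A d" "Q2 \<in> HP J (int d - 1)" "Q = Q1 + ?l * Q2" using PQ unfolding B_def by blast
      have "P + Q = (P1 + Q1) + ?l * (P2 + Q2)" using 1 by (simp add: algebra_simps)
      thus ?thesis using A_add[OF 1(1,4)] HP_add[OF 1(2,5)] unfolding B_def by blast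
    qed
    show "x * P \<in> B (e + d)" if P: "P \<in> B d" and x: "x \<in> HP J (int e)" for d e P x
    proof -
      obtain P1 P2 where 1: "P1 \<in> A d" "P2 \<in> HP J (int d - 1)" "P = P1 + ?l * P2" using P unfolding B_def by blast
      have "x * P = (x * P1) + ?l * (x * P2)" using 1 by (simp add: algebra_simps)
      moreover have "x * P2 \<in> HP J (int (e + d) - 1)" using HP_mult[OF x 1(2)] by (simp add: algebra_simps)
      ultimately show ?thesis using A_mult[OF 1(1) x] unfolding B_def by blast
    qed
    fix p assume p: "p \<in> X"
    show "\<exists>d. \<exists>P\<in>B d. nz P p"
    proof (cases "nz ?l p")
      case True
      have "0 \<in> A 1" unfolding A_def by (auto intro!: exI[of _ 0] bexI[of _ 0])
      hence "0 + ?l * 1 \<in> B 1" unfolding B_def using HP_1 by fastforce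
      thus ?thesis using True by auto
    next
      case False
      note hp = h[OF p False]
      have gh: "g * h p \<in> HP J (c + e p)" "c + e p \<ge> 1" using g hp by (auto intro: HP_mult)
      obtain k where k: "\<forall>K\<ge>k. \<exists>P\<in>HP J (b + int K * (c + e p)). z * pf (g * h p) ^ K = pf P"
        using regular_on_basic[OF gh] z[OF _ p False] by (metis nz_mult)
      obtain R where R: "R \<in> HP J (b + int k * (c + e p))" "z * pf (g * h p) ^ k = pf R" using k by blast
      have ek: "int (nat (int k * e p)) = int k * e p" using hp by simp
      have "h p ^ k \<in> HP J (int k * e p)" using hp by (intro HP_power) auto
      moreover have "\<exists>R\<in>HP J (b + int M * c + int k * e p). z * pf g ^ M * pf (h p ^ k) = pf R" if "M \<ge> k" for M
      proof -
        have "g ^ (M - k) \<in> HP J (int (M - k) * c)" using g(1) by (rule HP_power)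
        from HP_mult[OF this R(1)] that have "g ^ (M - k) * R \<in> HP J (b + int M * c + int k * e p)"
          by (simp add: algebra_simps of_nat_diff)
        moreover have "pf g ^ M = pf g ^ (M - k) * pf g ^ k" using that by (simp flip: power_add)
        hence "z * pf g ^ M * pf (h p ^ k) = pf (g ^ (M - k) * R)"
          by (simp add: R(2)[symmetric] power_mult_distrib algebra_simps)
        ultimately show ?thesis by blast
      qed
      ultimately have "h p ^ k \<in> A (nat (int k * e p))" unfolding A_def ek by auto
      hence "h p ^ k + ?l * 0 \<in> B (nat (int k * e p))" unfolding B_def using HP_0 by blast
      hence "h p ^ k \<in> B (nat (int k * e p))" by simp
      thus ?thesis using hp nz_power by blast
    qed
  qed auto
  \<comment> \<open>Both coordinates differ from \<open>j\<close>, so that their powers survive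
    reduction modulo the linear form.\<close>
  obtain i k where ik: "i \<in> J - {j}" "k \<in> J - {j}" "i \<noteq> k" using two_indices[OF card] .
  obtain m1 where m1: "\<forall>K\<ge>m1. pvar i ^ K \<in> B (K * 1)" using key ik by blast
  obtain m2 where m2: "\<forall>K\<ge>m2. pvar k ^ K \<in> B (K * 1)" using key ik by blast
  define K where "K = max m1 m2"
  have "pvar i ^ K \<in> B K" "pvar k ^ K \<in> B K" using m1 m2 by (auto simp: K_def)
  then obtain P0 P0' P1 P1' where P: "P0 \<in> A K" "P1 \<in> A K"
    "pvar i ^ K = P0 + ?l * P0'" "pvar k ^ K = P1 + ?l * P1'" unfolding B_def by blast
  obtain n1 n2 where n: "\<forall>M\<ge>n1. \<exists>R\<in>HP J (b + int M * c + int K). z * pf g ^ M * pf P0 = pf R"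
    "\<forall>M\<ge>n2. \<exists>R\<in>HP J (b + int M * c + int K). z * pf g ^ M * pf P1 = pf R" using P(1,2) unfolding A_def by blast
  define M where "M = max n1 n2"
  have "n1 \<le> M" "n2 \<le> M" by (auto simp: M_def)
  then obtain R0 R1 where R: "R0 \<in> HP J (b + int M * c + int K)" "z * pf g ^ M * pf P0 = pf R0"
    "R1 \<in> HP J (b + int M * c + int K)" "z * pf g ^ M * pf P1 = pf R1"
    using n by blast
  \<comment> \<open>\<open>P0\<close> and \<open>P1\<close> clear the same element, which relates
    the results \<open>R0\<close> and \<open>R1\<close>. Modulo the linear form they are powers of
    different coordinates, so \<open>regular_sequence\<close> makes \<open>P0\<close> divide
    \<open>R0\<close>, and \<open>z * g ^ M\<close> is a form.\<close>
  have "pf (P0 * R1) = pf (P1 * R0)" by (simp add: R(2,4)[symmetric] algebra_simps)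
  hence e: "P0 * R1 = P1 * R0" by (simp only: pf_eq_iff)
  let ?s = "psub a J j"
  have sx: "?s (pvar i ^ K) = pvar i ^ K" "?s (pvar k ^ K) = pvar k ^ K"
    using psub_id[OF HP_power[OF HP_pvar[OF ik(1)]]] psub_id[OF HP_power[OF HP_pvar[OF ik(2)]]] by auto
  have s0: "?s ?l = 0" using psub_lform[of J j a] finJ j by blast
  have sP: "?s P0 = pvar i ^ K" "?s P1 = pvar k ^ K"
    using arg_cong[OF P(3), of ?s] arg_cong[OF P(4), of ?s] unfolding sx by (simp_all add: s0)
  have PK: "P0 \<in> HP J (int K)" "P1 \<in> HP J (int K)" using P(1,2) unfolding A_def by auto
  obtain C where C: "C \<in> HP J (b + int M * c + int K - int K)" "R0 = P0 * C"
    using regular_sequence[of J j i k a P0 K P1 R0 "b + int M * c + int K" R1] finJ j ik PK sP R(1,3) e by blast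
  have "P0 \<noteq> 0" using sP(1) by auto
  moreover have "pf P0 * (z * pf g ^ M) = pf P0 * pf C" using R(2) C(2) by (simp add: algebra_simps)
  ultimately have "z * pf g ^ M = pf C" by simp
  hence "z = pf C / pf (g ^ M)" using nz_pf[OF p0(2,1)] by (simp add: field_simps)
  thus ?thesis using C(1) HP_power[OF g(1), of M] p0(2)
    by (intro OlocI[of C J _ "g ^ M" "int M * c"]) (auto intro: nz_power)
qed

end

section \<open>Families of stalks in a constant sheaf\<close>

definition vs :: "'a::field \<Rightarrow> (nat \<Rightarrow> 'a) \<Rightarrow> nat \<Rightarrow> 'a" where "vs c z = (\<lambda>i. c * z i)"

lemma vs_simps [simp]:
  "vs 1 z = z" "vs 0 z = 0" "vs c 0 = 0" "vs c (vs d z) = vs (c * d) z" "vs (- c) z = - vs c z" "vs c (- z) = - vs c z"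
  by (auto simp: vs_def fun_eq_iff)

lemma vs_add: "vs c (z + w) = vs c z + vs c w" and vs_diff: "vs c (z - w) = vs c z - vs c w"
  and vs_add_left: "vs (c + d) z = vs c z + vs d z" and vs_diff_left: "vs (c - d) z = vs c z - vs d z"
  by (auto simp: vs_def fun_eq_iff algebra_simps)

lemma sum_fun_apply: "(sum f A) i = (\<Sum>x\<in>A. f x i)" for f :: "'a \<Rightarrow> nat \<Rightarrow> 'b::comm_monoid_add"
  by (induction A rule: infinite_finite_induct) auto

lemma vs_sum: "vs c (sum f A) = (\<Sum>i\<in>A. vs c (f i))"
  by (rule ext) (simp add: vs_def sum_fun_apply sum_distrib_left)

text \<open>The stalks of a submodule of a constant sheaf: openness says that an element of one
  stalk belongs to the nearby ones.\<close>

locale stalks = linvar X J for X :: "'k::{alg_closed_field, field_char_0} point set" and J +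
  fixes S :: "'k point \<Rightarrow> (nat \<Rightarrow> 'k rat) set"
  assumes S_0: "p \<in> X \<Longrightarrow> 0 \<in> S p"
    and S_add: "\<lbrakk>p \<in> X; z \<in> S p; w \<in> S p\<rbrakk> \<Longrightarrow> z + w \<in> S p"
    and S_vs: "\<lbrakk>p \<in> X; f \<in> Oloc J 0 p; z \<in> S p\<rbrakk> \<Longrightarrow> vs f z \<in> S p"
    and S_open: "p \<in> X \<Longrightarrow> z \<in> S p \<Longrightarrow> near X p (\<lambda>q. z \<in> S q)"
begin

text \<open>The stalk of the twist by \<open>t\<close>, realised by multiplication inside the same
  space. As \<open>O(t)\<close> is invertible, single products suffice and no sums have to be
  formed.\<close>

definition St :: "int \<Rightarrow> 'k point \<Rightarrow> (nat \<Rightarrow> 'k rat) set" where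
  "St t p = {vs f z |f z. f \<in> Oloc J t p \<and> z \<in> S p}"

lemma S_uminus: "p \<in> X \<Longrightarrow> z \<in> S p \<Longrightarrow> - z \<in> S p"
  using S_vs[OF _ Oloc_uminus[OF Oloc_1]] by simp

text \<open>A linear form not vanishing at \<open>p\<close> generates \<open>O(1)\<close> there, so
  the twisted stalk is one multiplication away from \<open>S p\<close>.\<close>

lemma St_iff:
  assumes "p \<in> X" "y \<in> HP J 1" "nz y p"
  shows "z \<in> St t p \<longleftrightarrow> vs (pf y powi (- t)) z \<in> S p"
proof
  have y0: "pf y \<noteq> 0" using nz_pf assms by blast
  {
    assume "z \<in> St t p"
    then obtain f w where f: "f \<in> Oloc J t p" "w \<in> S p" "z = vs f w" unfolding St_def by blast
    have "pf y powi (- t) * f \<in> Oloc J 0 p" using Oloc_mult[OF Oloc_powi[OF assms(2,3), of "- t"] f(1)] by simp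
    thus "vs (pf y powi (- t)) z \<in> S p" using S_vs[OF assms(1)] f by simp
  next
    assume "vs (pf y powi (- t)) z \<in> S p"
    moreover have "z = vs (pf y powi t) (vs (pf y powi (- t)) z)" using y0 by (simp flip: power_int_add)
    ultimately show "z \<in> St t p" using Oloc_powi[OF assms(2,3), of t] unfolding St_def by blast
  }
qed

lemma ex_y: assumes "p \<in> X" obtains i where "i \<in> J" "pvar i \<in> HP J 1" "nz (pvar i) p" "pf (pvar i :: 'k pfun) \<noteq> 0"
  using ex_pvar[OF assms] HP_pvar that by (metis nz_pf assms)

lemma St_S: assumes "p \<in> X" shows "St 0 p = S p"
proof -
  obtain i where i: "(pvar i :: 'k pfun) \<in> HP J 1" "nz (pvar i) p" using ex_y[OF assms] by blast
  show ?thesis using St_iff[OF assms i, of _ 0] by auto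
qed

lemma St_0: assumes "p \<in> X" shows "0 \<in> St t p"
proof -
  obtain i where i: "(pvar i :: 'k pfun) \<in> HP J 1" "nz (pvar i) p" using ex_y[OF assms] by blast
  show ?thesis using St_iff[OF assms i, of 0 t] S_0[OF assms] by simp
qed

lemma St_add: assumes "p \<in> X" "z \<in> St t p" "w \<in> St t p" shows "z + w \<in> St t p"
proof -
  obtain i where "(pvar i :: 'k pfun) \<in> HP J 1" "nz (pvar i) p" using ex_y[OF assms(1)] by blast
  note St_iff[OF assms(1) this, of _ t]
  thus ?thesis using S_add[OF assms(1)] assms(2,3) by (simp add: vs_add)
qed

lemma St_vs: assumes "f \<in> Oloc J s p" "z \<in> St t p" shows "vs f z \<in> St (t + s) p"
proof -
  obtain g w where "g \<in> Oloc J t p" "w \<in> S p" "z = vs g w" using assms(2) unfolding St_def by blast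
  thus ?thesis using Oloc_mult[OF _ assms(1), of g t] unfolding St_def by (auto simp: mult.commute)
qed

lemma St_uminus: "z \<in> St t p \<Longrightarrow> - z \<in> St t p"
  using St_vs[OF Oloc_uminus[OF Oloc_1], of z t p] by simp

lemma St_diff: "\<lbrakk>p \<in> X; z \<in> St t p; w \<in> St t p\<rbrakk> \<Longrightarrow> z - w \<in> St t p"
  using St_add[of p z t "- w"] St_uminus by simp

lemma St_sum: "p \<in> X \<Longrightarrow> (\<And>i. i \<in> A \<Longrightarrow> f i \<in> St t p) \<Longrightarrow> sum f A \<in> St t p"
  by (induction A rule: infinite_finite_induct) (auto intro: St_0 St_add)

lemma Oloc_zopen: assumes "p \<in> X" "z \<in> Oloc J b p" shows "near X p (\<lambda>q. z \<in> Oloc J b q)"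
proof -
  obtain g c where g: "g \<in> HP J c" "nz g p" "\<And>q. q \<in> X \<Longrightarrow> nz g q \<Longrightarrow> z \<in> Oloc J b q"
    by (rule Oloc_open[OF assms(2,1)]) blast
  thus ?thesis using zopen_nz[OF g(1)] assms(1) by (intro exI[of _ "{q \<in> X. nz g q}"]) auto
qed

lemma St_open: assumes "p \<in> X" "z \<in> St t p" shows "near X p (\<lambda>q. z \<in> St t q)"
proof -
  obtain f w where f: "f \<in> Oloc J t p" "w \<in> S p" "z = vs f w" using assms(2) unfolding St_def by blast
  obtain V where V: "zopen X V" "p \<in> V" "\<forall>q\<in>V. f \<in> Oloc J t q" using Oloc_zopen[OF assms(1) f(1)] by blast
  obtain W where W: "zopen X W" "p \<in> W" "\<forall>q\<in>W. w \<in> S q" using S_open[OF assms(1) f(2)] by blast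
  have "\<forall>q\<in>V \<inter> W. z \<in> St t q" using V(3) W(3) f(3) unfolding St_def by blast
  thus ?thesis using zopen_Int[OF V(1) W(1)] V(2) W(2) by blast
qed

end

locale hyperplane_pair = X: linvar X J + H: linvar H "J - {j}"
  for X :: "'k::{alg_closed_field, field_char_0} point set" and J H j +
  fixes a :: "nat \<Rightarrow> 'k"
  assumes jJ: "j \<in> J" and aj: "a j \<noteq> 0" and H_eq: "H = {p \<in> X. \<not> nz (lform a J) p}"
begin

abbreviation L :: "'k pfun" where "L \<equiv> lform a J"
abbreviation J' :: "nat set" where "J' \<equiv> J - {j}"
abbreviation ps :: "'k pfun \<Rightarrow> 'k pfun" where "ps \<equiv> psub a J j"

lemma H_X: "p \<in> H \<Longrightarrow> p \<in> X" by (simp add: H_eq)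

lemma L_0: assumes "p \<in> H" "v \<in> p" shows "pev L v = 0"
  using assms X.nz_iff[OF HP_lform] by (auto simp: H_eq)

lemma pev_ps: assumes "p \<in> H" "v \<in> p" shows "pev (ps P) v = pev P v"
proof -
  have "a j * v j + (\<Sum>i\<in>J'. a i * v i) = 0"
    using L_0[OF assms] sum.remove[OF X.finJ jJ, of "\<lambda>i. a i * v i"] by (simp add: pev_lform)
  hence "a j * v j = - (\<Sum>i\<in>J'. a i * v i)" by (simp add: add_eq_0_iff)
  hence "v j = - (\<Sum>i\<in>J'. a i * v i) / a j" using aj by (simp add: field_simps)
  hence "elim_coord a J j v = v" by (auto simp: elim_coord_def fun_eq_iff)
  thus ?thesis by simp
qed

lemma nz_ps: "p \<in> H \<Longrightarrow> nz (ps P) p \<longleftrightarrow> nz P p"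
  using pev_ps by (auto simp: nz_def)

lemma ps_HP: "P \<in> HP J d \<Longrightarrow> ps P \<in> HP J' d"
  using psub_HP[of J j a] X.finJ jJ aj by blast

lemma J'_J: "z \<in> Oloc J' b p \<Longrightarrow> z \<in> Oloc J b p" by (erule Oloc_mono) auto

text \<open>Restriction of rational functions to \<open>H\<close>, written in the coordinates of
  \<open>J'\<close>. It makes sense for fractions having a denominator that does not vanish
  identically on the hyperplane.\<close>

definition red :: "'k rat \<Rightarrow> 'k rat" where
  "red z = (THE w. \<exists>P Q. ps Q \<noteq> 0 \<and> z = pf P / pf Q \<and> w = pf (ps P) / pf (ps Q))"

lemma red_eq: assumes "ps Q \<noteq> 0" shows "red (pf P / pf Q) = pf (ps P) / pf (ps Q)"
  unfolding red_def
proof (rule the_equality)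
  show "\<exists>P' Q'. ps Q' \<noteq> 0 \<and> pf P / pf Q = pf P' / pf Q' \<and> pf (ps P) / pf (ps Q) = pf (ps P') / pf (ps Q')"
    using assms by blast
  fix w assume "\<exists>P' Q'. ps Q' \<noteq> 0 \<and> pf P / pf Q = pf P' / pf Q' \<and> w = pf (ps P') / pf (ps Q')"
  then obtain P' Q' where *: "ps Q' \<noteq> 0" "pf P / pf Q = pf P' / pf Q'" "w = pf (ps P') / pf (ps Q')" by blast
  have "Q \<noteq> 0" "Q' \<noteq> 0" using assms *(1) by auto
  hence "pf (P * Q') = pf (P' * Q)" using *(2) by (simp add: field_simps)
  hence "P * Q' = P' * Q" by (simp only: pf_eq_iff)
  hence "ps P * ps Q' = ps P' * ps Q" by (metis psub_simps(5))
  hence "pf (ps P) * pf (ps Q') = pf (ps P') * pf (ps Q)" by (metis pf_simps(5))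
  thus "w = pf (ps P) / pf (ps Q)" unfolding *(3) using *(1) assms by (simp add: frac_eq_eq)
qed

lemma red_repr:
  assumes "z \<in> Oloc J b p" "p \<in> H"
  obtains P Q d c where "P \<in> HP J d" "Q \<in> HP J c" "d - c = b" "nz Q p" "nz (ps Q) p" "ps Q \<noteq> 0" "pf Q \<noteq> 0"
    "z = pf P / pf Q" "red z = pf (ps P) / pf (ps Q)"
proof -
  obtain P Q d c where *: "P \<in> HP J d" "Q \<in> HP J c" "d - c = b" "nz Q p" "z = pf P / pf Q"
    using assms(1) by (rule OlocE)
  have "nz (ps Q) p" using nz_ps[OF assms(2)] *(4) by simp
  moreover from this have "ps Q \<noteq> 0" using H.nz_nonzero assms(2) by blast
  ultimately show ?thesis using that * red_eq X.nz_pf[OF *(4) H_X[OF assms(2)]] by blast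
qed

lemma red_Oloc: assumes "z \<in> Oloc J b p" "p \<in> H" shows "red z \<in> Oloc J' b p"
  by (rule red_repr[OF assms], rule OlocI) (auto intro: ps_HP)

lemma red_pf: "red (pf P) = pf (ps P)"
  using red_eq[of 1 P] by simp

lemma red_add:
  assumes "z \<in> Oloc J b p" "w \<in> Oloc J b' p" "p \<in> H" shows "red (z + w) = red z + red w"
proof -
  obtain P Q where z: "ps Q \<noteq> 0" "pf Q \<noteq> 0" "z = pf P / pf Q" "red z = pf (ps P) / pf (ps Q)"
    by (rule red_repr[OF assms(1,3)]) blast
  obtain R T where w: "ps T \<noteq> 0" "pf T \<noteq> 0" "w = pf R / pf T" "red w = pf (ps R) / pf (ps T)"
    by (rule red_repr[OF assms(2,3)]) blast
  have "z + w = pf (P * T + R * Q) / pf (Q * T)" using z w by (simp add: field_simps)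
  moreover have "red (pf (P * T + R * Q) / pf (Q * T)) = red z + red w"
    using z w by (subst red_eq) (auto simp: field_simps)
  ultimately show ?thesis by simp
qed

lemma red_mult:
  assumes "z \<in> Oloc J b p" "w \<in> Oloc J b' p" "p \<in> H" shows "red (z * w) = red z * red w"
proof -
  obtain P Q where z: "ps Q \<noteq> 0" "z = pf P / pf Q" "red z = pf (ps P) / pf (ps Q)"
    by (rule red_repr[OF assms(1,3)]) blast
  obtain R T where w: "ps T \<noteq> 0" "w = pf R / pf T" "red w = pf (ps R) / pf (ps T)"
    by (rule red_repr[OF assms(2,3)]) blast
  have "z * w = pf (P * R) / pf (Q * T)" using z w by simp
  moreover have "red (pf (P * R) / pf (Q * T)) = red z * red w" using z w by (subst red_eq) auto
  ultimately show ?thesis by simp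
qed

lemma red_id: assumes "z \<in> Oloc J' b p" "p \<in> H" shows "red z = z"
proof -
  obtain P Q d c where *: "P \<in> HP J' d" "Q \<in> HP J' c" "nz Q p" "z = pf P / pf Q"
    using assms(1) by (rule OlocE)
  have "ps P = P" "ps Q = Q" using *(1,2) psub_id by blast+
  moreover have "Q \<noteq> 0" using H.nz_nonzero *(3) assms(2) by blast
  ultimately show ?thesis using red_eq[of Q P] *(4) by simp
qed

lemma red_L [simp]: "red (pf L) = 0"
  using psub_lform[of J j a] X.finJ jJ aj by (simp add: red_pf)

text \<open>Over the denominator \<open>Q * ps Q\<close> the difference between \<open>z\<close> and
  its reduction has a numerator that \<open>ps\<close> kills, hence one divisible by
  \<open>L\<close>.\<close>

lemma red_decomp:
  assumes "z \<in> Oloc J b p" "p \<in> H" obtains w where "w \<in> Oloc J (b - 1) p" "z = red z + pf L * w"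
proof -
  obtain P Q d c where *: "P \<in> HP J d" "Q \<in> HP J c" "d - c = b" "nz Q p" "nz (ps Q) p" "ps Q \<noteq> 0" "pf Q \<noteq> 0"
    "z = pf P / pf Q" "red z = pf (ps P) / pf (ps Q)" by (rule red_repr[OF assms])
  have m: "ps P \<in> HP J d" "ps Q \<in> HP J c" using ps_HP *(1,2) HP_mono[of _ J'] by blast+
  have ii: "ps (ps P) = ps P" "ps (ps Q) = ps Q" using ps_HP *(1,2) psub_id by blast+
  have "P * ps Q - ps P * Q \<in> HP J (d + c)" by (intro HP_diff HP_mult * m)
  moreover have "ps (P * ps Q - ps P * Q) = 0" by (simp add: ii mult.commute)
  ultimately obtain R where R: "R \<in> HP J (d + c - 1)" "P * ps Q - ps P * Q = L * R"
    using lform_dvd[of J j a] X.finJ jJ aj by metis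
  have "z - red z = pf (P * ps Q - ps P * Q) / pf (Q * ps Q)" using * by (simp add: field_simps)
  hence "z = red z + pf L * (pf R / pf (Q * ps Q))" unfolding R(2) by (simp add: algebra_simps)
  moreover have "pf R / pf (Q * ps Q) \<in> Oloc J (b - 1) p"
    by (rule OlocI[OF R(1) HP_mult[OF *(2) m(2)]]) (use * in auto)
  ultimately show ?thesis using that by blast
qed

lemma zopen_H: assumes "zopen X U" shows "zopen H (U \<inter> H)"
proof (subst openin_subopen, intro ballI)
  fix p assume p: "p \<in> U \<inter> H"
  hence "p \<in> U" by simp
  from assms this obtain g c where g: "g \<in> HP J c" "nz g p" "\<And>q. q \<in> X \<Longrightarrow> nz g q \<Longrightarrow> q \<in> U"
    by (rule X.zopen_basis) blast
  have "zopen H {q \<in> H. nz (ps g) q}" using H.zopen_nz[OF ps_HP[OF g(1)]] .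
  moreover have "p \<in> {q \<in> H. nz (ps g) q}" "{q \<in> H. nz (ps g) q} \<subseteq> U \<inter> H"
    using p g(2,3) nz_ps H_X by auto
  ultimately show "\<exists>T. zopen H T \<and> p \<in> T \<and> T \<subseteq> U \<inter> H" by blast
qed

lemma H_ne: "H \<noteq> {}"
  using H.ex_nz[OF HP_1] by auto

lemma H_generic: "\<lbrakk>zopen X U; zopen X V; p \<in> U \<inter> H; q \<in> V \<inter> H\<rbrakk> \<Longrightarrow> \<exists>r\<in>H. r \<in> U \<inter> V"
  using H.zopen_irreducible[OF zopen_H zopen_H, of U V] by blast

text \<open>\<open>pf L * c\<close> has value 0 on \<open>H\<close>, so it lies in the maximal ideal
  of the local ring; this is what the Nakayama argument inverts.\<close>

lemma unit_near_H:
  assumes "c \<in> Oloc J (- 1) p" "p \<in> H"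
  shows "1 - pf L * c \<noteq> 0" "1 / (1 - pf L * c) \<in> Oloc J 0 p"
proof -
  obtain P Q d e where *: "P \<in> HP J d" "Q \<in> HP J e" "d - e = - 1" "nz Q p" "c = pf P / pf Q"
    using assms(1) by (rule OlocE)
  have Q0: "pf Q \<noteq> 0" using X.nz_pf *(4) H_X assms(2) by blast
  have "L * P \<in> HP J e" using HP_mult[OF HP_lform *(1), of a] *(3) by (simp add: algebra_simps)
  hence QL: "Q - L * P \<in> HP J e" using *(2) by (intro HP_diff)
  have n: "nz (Q - L * P) p" using *(4) L_0[OF assms(2)] by (auto simp: nz_def)
  hence n0: "pf (Q - L * P) \<noteq> 0" using X.nz_pf H_X assms(2) by blast
  have e: "1 - pf L * c = pf (Q - L * P) / pf Q" using Q0 *(5) by (simp add: field_simps)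
  show "1 - pf L * c \<noteq> 0" using e n0 Q0 by simp
  show "1 / (1 - pf L * c) \<in> Oloc J 0 p" unfolding e
    by (rule OlocI[OF *(2) QL _ n]) auto
qed

end

subsection \<open>The splitting criterion for stalks\<close>

lemma cousinD:
  assumes "cousin X S" "\<forall>p\<in>X. near X p (\<lambda>q. f q - f p \<in> S q)"
  shows "\<exists>z. \<forall>p\<in>X. z - f p \<in> S p"
  using assms unfolding cousin_def by (elim allE[of _ f] impE)

lemma (in linvar) cousin_sum:
  fixes n :: nat
  assumes cous: "\<And>i. i < n \<Longrightarrow> cousin X (Oloc J (c i))"
    and S: "\<And>p. S p = {d. (\<forall>i<n. d i \<in> Oloc J (c i) p) \<and> (\<forall>i\<ge>n. d i = (0 :: 'k rat))}"
  shows "cousin X S"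
  unfolding cousin_def
proof (intro allI impI)
  fix f assume f: "\<forall>p\<in>X. near X p (\<lambda>q. f q - f p \<in> S q)"
  have "\<exists>z. \<forall>p\<in>X. z - f p i \<in> Oloc J (c i) p" if i: "i < n" for i
  proof -
    have "\<forall>p\<in>X. near X p (\<lambda>q. f q i - f p i \<in> Oloc J (c i) q)"
    proof
      fix p assume "p \<in> X"
      then obtain V where "zopen X V" "p \<in> V" "\<forall>q\<in>V. f q - f p \<in> S q" using f by blast
      thus "near X p (\<lambda>q. f q i - f p i \<in> Oloc J (c i) q)"
        using i by (intro exI[of _ V]) (auto simp: S)
    qed
    from cousinD[OF cous[OF i] this] show ?thesis .
  qed
  then obtain z where z: "\<And>i p. i < n \<Longrightarrow> p \<in> X \<Longrightarrow> z i - f p i \<in> Oloc J (c i) p" by metis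
  obtain p0 where p0: "p0 \<in> X" using ex_nz[OF HP_1] by auto
  define w where "w i = (if i < n then z i else f p0 i)" for i
  \<comment> \<open>The components from \<open>n\<close> on do not vary: local differences are zero
    there, and any two of the neighbourhoods meet.\<close>
  have tail: "f p i = f p0 i" if p: "p \<in> X" and i: "i \<ge> n" for p i
  proof -
    obtain V where V: "zopen X V" "p \<in> V" "\<forall>q\<in>V. f q - f p \<in> S q" using f p by blast
    obtain W where W: "zopen X W" "p0 \<in> W" "\<forall>q\<in>W. f q - f p0 \<in> S q" using f p0 by blast
    obtain r where "r \<in> V" "r \<in> W" using zopen_irreducible[OF V(1) W(1)] V(2) W(2) by blast
    hence "f r - f p \<in> S r" "f r - f p0 \<in> S r" using V(3) W(3) by blast+
    thus ?thesis using i by (auto simp: S)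
  qed
  have "w - f p \<in> S p" if "p \<in> X" for p
    using z[OF _ that] tail[OF that] by (auto simp: S w_def)
  thus "\<exists>z. \<forall>p\<in>X. z - f p \<in> S p" by blast
qed

text \<open>\<open>Psi\<close> is the isomorphism of the restriction to \<open>H\<close> with the sum of the \<open>O_H(b i)\<close>, composed with the
  projection of \<open>S p\<close> onto its quotient by the equation of \<open>H\<close>.\<close>

locale reduction = hyperplane_pair X J H j a + stalks X J S
  for X :: "'k::{alg_closed_field, field_char_0} point set" and J H j a S +
  fixes n :: nat and b :: "nat \<Rightarrow> int" and Psi :: "(nat \<Rightarrow> 'k rat) \<Rightarrow> nat \<Rightarrow> 'k rat"
  assumes Psi_in: "\<lbrakk>p \<in> H; z \<in> S p; i < n\<rbrakk> \<Longrightarrow> Psi z i \<in> Oloc J' (b i) p"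
    and Psi_out: "\<lbrakk>p \<in> H; z \<in> S p; i \<ge> n\<rbrakk> \<Longrightarrow> Psi z i = 0"
    and Psi_add: "\<lbrakk>p \<in> H; z \<in> S p; w \<in> S p\<rbrakk> \<Longrightarrow> Psi (z + w) = Psi z + Psi w"
    and Psi_vs: "\<lbrakk>p \<in> H; f \<in> Oloc J 0 p; z \<in> S p\<rbrakk> \<Longrightarrow> Psi (vs f z) = vs (red f) (Psi z)"
    and Psi_surj: "\<lbrakk>p \<in> H; (\<And>i. i < n \<Longrightarrow> d i \<in> Oloc J' (b i) p); (\<And>i. i \<ge> n \<Longrightarrow> d i = 0)\<rbrakk> \<Longrightarrow>
      \<exists>z\<in>S p. Psi z = d"
    and Psi_ker: "\<lbrakk>p \<in> H; z \<in> S p; Psi z = 0\<rbrakk> \<Longrightarrow> \<exists>w\<in>St (- 1) p. z = vs (pf L) w"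
    and S_finite: "p \<in> X \<Longrightarrow> \<exists>V m T. zopen X V \<and> p \<in> V \<and> (\<forall>q\<in>V. \<forall>i<m. T i \<in> S q) \<and>
      (\<forall>q\<in>V. \<forall>z\<in>S q. \<exists>c. (\<forall>i<m. c i \<in> Oloc J 0 q) \<and> z = (\<Sum>i<m::nat. vs (c i) (T i)))"
begin

definition OH :: "int \<Rightarrow> 'k point \<Rightarrow> (nat \<Rightarrow> 'k rat) set" where
  "OH t p = {d. (\<forall>i<n. d i \<in> Oloc J' (b i + t) p) \<and> (\<forall>i\<ge>n. d i = 0)}"

definition i0 :: nat where "i0 = (SOME i. i \<in> J')"

lemma i0: "i0 \<in> J'" using H.J_ne by (simp only: i0_def some_in_eq) simp

text \<open>Extends \<open>Psi\<close> to the twist by \<open>t\<close> by moving to degree 0 and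
  back with one fixed coordinate. Where that coordinate vanishes the argument of \<open>Psi\<close>
  may lie outside \<open>S p\<close>; \<open>Psit_at\<close> handles this.\<close>

definition Psit :: "int \<Rightarrow> (nat \<Rightarrow> 'k rat) \<Rightarrow> nat \<Rightarrow> 'k rat" where
  "Psit t z = vs (pf (pvar i0) powi t) (Psi (vs (pf (pvar i0) powi (- t)) z))"

lemma OH_vs: assumes "f \<in> Oloc J' s p" "d \<in> OH t p" shows "vs f d \<in> OH (t + s) p"
proof -
  have "f * d i \<in> Oloc J' (b i + (t + s)) p" if "i < n" for i
    using H.Oloc_mult[OF assms(1), of "d i" "b i + t"] assms(2) that by (simp add: OH_def algebra_simps)
  thus ?thesis using assms(2) by (simp add: OH_def vs_def)
qed

lemma pvar_J: "i \<in> J' \<Longrightarrow> (pvar i :: 'k pfun) \<in> HP J 1" using HP_pvar by blast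

text \<open>The fixed coordinate may vanish at \<open>p\<close>. But \<open>Psi\<close> depends on
  the vector alone, so the identity can be checked at any point of \<open>H\<close> where
  \<open>z\<close> is in the twisted stalk and both coordinates are invertible; such a point exists
  by irreducibility of \<open>H\<close>.\<close>

lemma Psit_at:
  assumes "p \<in> H" "i \<in> J'" "nz (pvar i) p" "z \<in> St t p"
  shows "Psit t z = vs (pf (pvar i) powi t) (Psi (vs (pf (pvar i) powi (- t)) z))"
proof -
  obtain V where V: "zopen X V" "p \<in> V" "\<forall>q\<in>V. z \<in> St t q" using St_open[OF H_X[OF assms(1)] assms(4)] by blast
  have o0: "zopen X {q \<in> X. nz (pvar i0) q}" by (rule X.zopen_nz[OF pvar_J[OF i0]])
  obtain p1 where p1: "p1 \<in> H" "nz (pvar i0) p1" using H.ex_nz[OF HP_pvar[OF i0] pvar_nonzero] by blast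
  have oV: "zopen X (V \<inter> {q \<in> X. nz (pvar i) q})" by (rule X.zopen_Int[OF V(1) X.zopen_nz[OF pvar_J[OF assms(2)]]])
  obtain q where q: "q \<in> H" "q \<in> V" "nz (pvar i) q" "nz (pvar i0) q"
    using H_generic[OF oV o0, of p p1] V(2) assms p1 H_X by blast
  define x y where "x = pf (pvar i0 :: 'k pfun)" and "y = pf (pvar i :: 'k pfun)"
  have xy: "x \<noteq> 0" "y \<noteq> 0" by (auto simp: x_def y_def)
  have qX: "q \<in> X" using H_X q(1) .
  define z1 where "z1 = vs (y powi (- t)) z"
  have z1: "z1 \<in> S q" using St_iff[OF qX pvar_J[OF assms(2)] q(3)] V(3) q(2) unfolding z1_def y_def by blast
  define f where "f = x powi (- t) * y powi t"
  have f: "f \<in> Oloc J' 0 q" using H.Oloc_mult[OF H.Oloc_powi[OF HP_pvar[OF i0] q(4), of "- t"]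
        H.Oloc_powi[OF HP_pvar[OF assms(2)] q(3), of t]] by (simp add: f_def x_def y_def)
  have "vs (x powi (- t)) z = vs f z1" using xy by (simp add: f_def z1_def flip: power_int_add mult.assoc)
     (simp add: mult.assoc flip: power_int_add)
  hence "Psi (vs (x powi (- t)) z) = vs f (Psi z1)"
    using Psi_vs[OF q(1) J'_J[OF f] z1] red_id[OF f q(1)] by simp
  hence "vs (x powi t) (Psi (vs (x powi (- t)) z)) = vs (y powi t) (Psi z1)"
    using xy by (simp add: f_def flip: power_int_add mult.assoc)
  thus ?thesis by (simp add: Psit_def z1_def x_def y_def)
qed

lemma ex_yH: assumes "p \<in> H" obtains i where "i \<in> J'" "nz (pvar i) p" "pf (pvar i :: 'k pfun) \<noteq> 0"
  using H.ex_pvar[OF assms] by (metis pf_eq_0_iff pvar_nonzero)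

lemma St_yH:
  assumes "p \<in> H" "i \<in> J'" "nz (pvar i) p" shows "z \<in> St t p \<longleftrightarrow> vs (pf (pvar i) powi (- t)) z \<in> S p"
  using St_iff[OF H_X[OF assms(1)] pvar_J[OF assms(2)] assms(3)] .

lemma OH_0: "p \<in> H \<Longrightarrow> z \<in> S p \<Longrightarrow> Psi z \<in> OH 0 p"
  using Psi_in Psi_out by (auto simp: OH_def)

lemma Psit_in: assumes "p \<in> H" "z \<in> St t p" shows "Psit t z \<in> OH t p"
proof -
  obtain i where i: "i \<in> J'" "nz (pvar i) p" using ex_yH[OF assms(1)] by blast
  show ?thesis
    using OH_vs[OF H.Oloc_powi[OF HP_pvar[OF i(1)] i(2), of t] OH_0[OF assms(1)]] assms(2)
    unfolding Psit_at[OF assms(1) i assms(2)] St_yH[OF assms(1) i] by simp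
qed

lemma Psit_add: assumes "p \<in> H" "z \<in> St t p" "w \<in> St t p" shows "Psit t (z + w) = Psit t z + Psit t w"
proof -
  obtain i where i: "i \<in> J'" "nz (pvar i) p" using ex_yH[OF assms(1)] by blast
  have zw: "z + w \<in> St t p" by (rule St_add[OF H_X[OF assms(1)] assms(2,3)])
  show ?thesis
    unfolding Psit_at[OF assms(1) i assms(2)] Psit_at[OF assms(1) i assms(3)] Psit_at[OF assms(1) i zw]
    using Psi_add[OF assms(1)] assms(2,3) unfolding St_yH[OF assms(1) i] by (simp add: vs_add)
qed

lemma Psit_vs: assumes "p \<in> H" "f \<in> Oloc J s p" "z \<in> St t p" shows "Psit (t + s) (vs f z) = vs (red f) (Psit t z)"
proof -
  obtain i where i: "i \<in> J'" "nz (pvar i) p" using ex_yH[OF assms(1)] by blast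
  define y where "y = pf (pvar i :: 'k pfun)"
  have y0: "y \<noteq> 0" by (simp add: y_def)
  have fz: "vs f z \<in> St (t + s) p" by (rule St_vs[OF assms(2,3)])
  have yp: "y powi m \<in> Oloc J' m p" for m using H.Oloc_powi[OF HP_pvar[OF i(1)] i(2)] by (simp add: y_def)
  have yf: "y powi (- s) * f \<in> Oloc J 0 p" using X.Oloc_mult[OF J'_J[OF yp[of "- s"]] assms(2)] by simp
  have zS: "vs (y powi (- t)) z \<in> S p" using assms(3) St_yH[OF assms(1) i] by (simp add: y_def)
  have "vs (y powi (- (t + s))) (vs f z) = vs (y powi (- s) * f) (vs (y powi (- t)) z)"
  proof -
    have "- (t + s) = - s + - t" by simp
    hence "y powi (- (t + s)) = y powi (- s) * y powi (- t)" by (simp only: power_int_add[OF disjI1[OF y0]])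
    thus ?thesis by (simp add: mult_ac)
  qed
  hence "Psi (vs (y powi (- (t + s))) (vs f z)) = vs (y powi (- s) * red f) (Psi (vs (y powi (- t)) z))"
    using Psi_vs[OF assms(1) yf zS] red_mult[OF J'_J[OF yp[of "- s"]] assms(2,1)] red_id[OF yp assms(1)] by simp
  thus ?thesis
    unfolding Psit_at[OF assms(1) i assms(3)] Psit_at[OF assms(1) i fz] y_def[symmetric]
    using y0 by (simp add: power_int_add power_int_minus field_simps del: minus_add_distrib)
qed

lemma Psit_surj: assumes "p \<in> H" "d \<in> OH t p" shows "\<exists>z\<in>St t p. Psit t z = d"
proof -
  obtain i where i: "i \<in> J'" "nz (pvar i) p" using ex_yH[OF assms(1)] by blast
  define y where "y = pf (pvar i :: 'k pfun)"
  have y0: "y \<noteq> 0" by (simp add: y_def)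
  have "vs (y powi (- t)) d \<in> OH (t + - t) p" unfolding y_def
    by (rule OH_vs[OF H.Oloc_powi[OF HP_pvar[OF i(1)] i(2)] assms(2)])
  hence "vs (y powi (- t)) d \<in> OH 0 p" by simp
  hence "\<exists>z\<in>S p. Psi z = vs (y powi (- t)) d" by (intro Psi_surj[OF assms(1)]) (auto simp: OH_def)
  then obtain z where z: "z \<in> S p" "Psi z = vs (y powi (- t)) d" by blast
  have e: "vs (y powi (- t)) (vs (y powi t) z) = z" using y0 by (simp flip: power_int_add)
  hence St: "vs (y powi t) z \<in> St t p" using St_yH[OF assms(1) i] z(1) by (simp add: y_def)
  moreover have "Psit t (vs (y powi t) z) = d"
    using e y0 z(2) unfolding Psit_at[OF assms(1) i St] y_def[symmetric] by (simp flip: power_int_add)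
  ultimately show ?thesis by blast
qed

lemma Psit_ker: assumes "p \<in> H" "z \<in> St t p" "Psit t z = 0" shows "\<exists>w\<in>St (t - 1) p. z = vs (pf L) w"
proof -
  obtain i where i: "i \<in> J'" "nz (pvar i) p" using ex_yH[OF assms(1)] by blast
  define y where "y = pf (pvar i :: 'k pfun)"
  have y0: "y \<noteq> 0" by (simp add: y_def)
  have zS: "vs (y powi (- t)) z \<in> S p" using assms(2) St_yH[OF assms(1) i] by (simp add: y_def)
  have "vs (y powi t) (Psi (vs (y powi (- t)) z)) = 0"
    using assms(3) unfolding Psit_at[OF assms(1) i assms(2)] y_def .
  hence "vs (y powi (- t)) (vs (y powi t) (Psi (vs (y powi (- t)) z))) = 0" by simp
  hence "Psi (vs (y powi (- t)) z) = 0" using y0 by (simp flip: power_int_add)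
  then obtain w where w: "w \<in> St (- 1) p" "vs (y powi (- t)) z = vs (pf L) w" using Psi_ker[OF assms(1) zS] by blast
  have "vs (y powi t) w \<in> St (- 1 + t) p"
    unfolding y_def by (rule St_vs[OF J'_J[OF H.Oloc_powi[OF HP_pvar[OF i(1)] i(2)]] w(1)])
  moreover have "z = vs (pf L) (vs (y powi t) w)"
  proof -
    have "z = vs (y powi t) (vs (y powi (- t)) z)" using y0 by (simp flip: power_int_add)
    thus ?thesis unfolding w(2) by (simp add: mult.commute)
  qed
  moreover have "- 1 + t = t - 1" by simp
  ultimately show ?thesis by metis
qed

lemma Psit_uminus: assumes "p \<in> H" "z \<in> St t p" shows "Psit t (- z) = - Psit t z"
proof -
  have m: "- 1 \<in> Oloc J' 0 p" by (rule H.Oloc_uminus[OF H.Oloc_1])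
  thus ?thesis using Psit_vs[OF assms(1) J'_J[OF m] assms(2)] red_id[OF m assms(1)] by simp
qed

lemma Psit_diff: assumes "p \<in> H" "z \<in> St t p" "w \<in> St t p" shows "Psit t (z - w) = Psit t z - Psit t w"
  using Psit_add[OF assms(1,2) St_uminus[OF assms(3)]] Psit_uminus[OF assms(1,3)] by simp

lemma Psit_sum:
  assumes "p \<in> H" "finite A" "\<And>i. i \<in> A \<Longrightarrow> f i \<in> St t p" shows "Psit t (sum f A) = (\<Sum>i\<in>A. Psit t (f i))"
  using assms(2,3)
proof (induction A rule: finite_induct)
  case empty
  have "0 \<in> St t p" by (rule St_0[OF H_X[OF assms(1)]])
  hence "Psit t 0 = 0" using Psit_diff[OF assms(1), of 0 t 0] by simp
  thus ?case by (simp add: zero_fun_def)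
next
  case (insert i A)
  have "sum f A \<in> St t p" using insert by (intro St_sum[OF H_X[OF assms(1)]]) auto
  hence "Psit t (f i + sum f A) = Psit t (f i) + Psit t (sum f A)"
    using insert by (intro Psit_add[OF assms(1)]) auto
  hence "Psit t (sum f (insert i A)) = (\<Sum>i\<in>insert i A. Psit t (f i))"
    unfolding sum.insert[OF insert.hyps] using insert by (simp only: insertI2)
  thus ?case .
qed

lemma off_H:
  assumes "p \<in> X" "p \<notin> H" "z \<in> St t p" shows "vs (1 / pf L) z \<in> St (t - 1) p"
proof -
  have "1 / pf L \<in> Oloc J (- 1) p" using assms by (intro X.Oloc_inv[OF HP_lform]) (auto simp: H_eq)
  from St_vs[OF this assms(3)] show ?thesis by simp
qed

lemma L0: "pf L \<noteq> 0" using lform_nonzero[of J j a] X.finJ jJ aj by simp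

lemma L_St: "z \<in> St t p \<Longrightarrow> vs (pf L) z \<in> St (t + 1) p"
  by (rule St_vs[OF X.Oloc_HP[OF HP_lform]])

lemma L_cancel [simp]: "vs (pf L) (vs (1 / pf L) z) = z" "vs (1 / pf L) (vs (pf L) z) = z"
  using L0 by simp_all

lemma Psit_L: "p \<in> H \<Longrightarrow> z \<in> St t p \<Longrightarrow> Psit (t + 1) (vs (pf L) z) = 0"
  using Psit_vs[OF _ X.Oloc_HP[OF HP_lform], of p z t] by simp

lemma zopen_off_H: "zopen X (X - H)"
proof -
  have "X - H = {q \<in> X. nz L q}" by (auto simp: H_eq)
  thus ?thesis using X.zopen_nz[OF HP_lform] by simp
qed

text \<open>Adjusting a Cousin problem by \<open>s\<close> makes its differences vanish along \<open>H\<close>, so that they are divisible by \<open>L\<close>.\<close>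

lemma cousin_div:
  assumes cous: "cousin X (St (t - 1))"
    and f: "\<forall>p\<in>X. near X p (\<lambda>q. f q - f p \<in> St t q)"
    and s: "\<And>p. p \<in> H \<Longrightarrow> s p \<in> St t p"
    and van: "\<And>p q. \<lbrakk>p \<in> H; q \<in> H; f q - f p \<in> St t q; s p \<in> St t q\<rbrakk> \<Longrightarrow>
      Psit t ((f q - f p) + (s q - s p)) = 0"
  shows "\<exists>z. (\<forall>p\<in>X. z - f p \<in> St t p) \<and> (\<forall>p\<in>H. Psit t (z - f p) = Psit t (s p))"
proof -
  define s' where "s' p = (if p \<in> H then s p else 0)" for p
  have s': "s' p \<in> St t p" if "p \<in> X" for p using s St_0[OF that] by (simp add: s'_def)
  \<comment> \<open>The corrected data divided by \<open>L\<close> is a Cousin problem for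
    \<open>St (t - 1)\<close>.\<close>
  define g where "g p = vs (1 / pf L) (f p + s' p)" for p
  have gd: "near X p (\<lambda>q. g q - g p \<in> St (t - 1) q)" if p: "p \<in> X" for p
  proof -
    obtain V where V: "zopen X V" "p \<in> V" "\<forall>q\<in>V. f q - f p \<in> St t q" using f p by blast
    obtain W where W: "zopen X W" "p \<in> W" "\<forall>q\<in>W. s' p \<in> St t q" using St_open[OF p s'[OF p]] by blast
    \<comment> \<open>Corrections are compared only between points of \<open>H\<close>. A
      neighbourhood of a point off \<open>H\<close> is therefore shrunk to the complement of
      \<open>H\<close>, on which \<open>L\<close> is invertible.\<close>
    define U where "U = (if p \<in> H then X else X - H)"
    have U: "zopen X U" "p \<in> U" using X.zopen_X zopen_off_H p by (auto simp: U_def)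
    have "g q - g p \<in> St (t - 1) q" if q: "q \<in> V \<inter> W \<inter> U" for q
    proof -
      have qX: "q \<in> X" using X.zopen_subset[OF V(1)] q by blast
      have fq: "f q - f p \<in> St t q" and sp: "s' p \<in> St t q" using q V(3) W(3) by blast+
      have mem: "(f q - f p) + (s' q - s' p) \<in> St t q" by (intro St_add St_diff qX fq s' sp)
      have eq: "g q - g p = vs (1 / pf L) ((f q - f p) + (s' q - s' p))"
        unfolding g_def vs_diff[symmetric] by (simp add: algebra_simps)
      show ?thesis
      proof (cases "q \<in> H")
        case False
        thus ?thesis unfolding eq by (rule off_H[OF qX _ mem])
      next
        case True
        hence pH: "p \<in> H" using q by (auto simp: U_def split: if_splits)
        have "Psit t ((f q - f p) + (s' q - s' p)) = 0"
          using van[OF pH True fq] sp True pH by (simp add: s'_def)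
        then obtain w where w: "w \<in> St (t - 1) q" "(f q - f p) + (s' q - s' p) = vs (pf L) w"
          using Psit_ker[OF True mem] by blast
        thus ?thesis unfolding eq w(2) L_cancel(2) by simp
      qed
    qed
    thus ?thesis using X.zopen_Int[OF X.zopen_Int[OF V(1) W(1)] U(1)] V(2) W(2) U(2) by blast
  qed
  then obtain z where z: "\<And>p. p \<in> X \<Longrightarrow> z - g p \<in> St (t - 1) p" using cousinD[OF cous, of g] by blast
  have e: "vs (pf L) z - f p = vs (pf L) (z - g p) + s' p" for p
  proof -
    have "vs (pf L) (g p) = f p + s' p" by (simp only: g_def L_cancel)
    thus ?thesis by (simp only: vs_diff) simp
  qed
  have m: "vs (pf L) (z - g p) \<in> St t p" if "p \<in> X" for p using L_St[OF z[OF that]] by simp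
  show ?thesis
  proof (intro exI[of _ "vs (pf L) z"] conjI ballI)
    show "vs (pf L) z - f p \<in> St t p" if "p \<in> X" for p unfolding e by (intro St_add m s' that)
    show "Psit t (vs (pf L) z - f p) = Psit t (s p)" if "p \<in> H" for p
      unfolding e using Psit_add[OF that m[OF H_X[OF that]] s'[OF H_X[OF that]]] Psit_L[OF that z[OF H_X[OF that]]] that
      by (simp add: s'_def)
  qed
qed

text \<open>Local lifts of \<open>d\<close> serve as corrections of the zero Cousin problem. Their
  differences vanish along \<open>H\<close>, and the adjusted solution is the global lift.\<close>

lemma lift_section:
  assumes cous: "cousin X (St (t - 1))" and d: "\<And>p. p \<in> H \<Longrightarrow> d \<in> OH t p"
  obtains s where "\<And>p. p \<in> X \<Longrightarrow> s \<in> St t p" "Psit t s = d"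
proof -
  have "\<forall>p\<in>H. \<exists>s. s \<in> St t p \<and> Psit t s = d" using Psit_surj d by blast
  then obtain s where s: "\<forall>p\<in>H. s p \<in> St t p \<and> Psit t (s p) = d" by (rule bchoice[THEN exE])
  have "\<exists>z. (\<forall>p\<in>X. z - (0 :: nat \<Rightarrow> 'k rat) \<in> St t p) \<and> (\<forall>p\<in>H. Psit t (z - 0) = Psit t (s p))"
  proof (rule cousin_div[OF cous, of "\<lambda>_. 0"])
    show "\<forall>p\<in>X. near X p (\<lambda>q. (0 :: nat \<Rightarrow> 'k rat) - 0 \<in> St t q)"
      using X.zopen_X St_0 by (intro ballI exI[of _ X]) auto
    show "Psit t (0 - 0 + (s q - s p)) = 0" if "p \<in> H" "q \<in> H" "s p \<in> St t q" for p q
      using Psit_diff[OF that(2), of "s q" t "s p"] s that by simp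
  qed (use s in auto)
  then obtain z where "\<forall>p\<in>X. z \<in> St t p" "\<forall>p\<in>H. Psit t z = Psit t (s p)" by auto
  thus ?thesis using that[of z] s H_ne by auto
qed

text \<open>One step of the long exact cohomology sequence in terms of Cousin problems: solve the
  problem induced on \<open>H\<close>, lift the solution pointwise, and use the lifts as
  corrections.\<close>

lemma cousin_up:
  assumes cous: "cousin X (St (t - 1))" and cH: "cousin H (OH t)"
  shows "cousin X (St t)"
  unfolding cousin_def
proof (intro allI impI)
  fix f assume f: "\<forall>p\<in>X. near X p (\<lambda>q. f q - f p \<in> St t q)"
  then obtain V where V: "\<And>p. p \<in> X \<Longrightarrow> zopen X (V p) \<and> p \<in> V p \<and> (\<forall>q\<in>V p. f q - f p \<in> St t q)"
    by (metis (no_types))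
  obtain p0 where p0: "p0 \<in> H" using H_ne by blast
  \<comment> \<open>\<open>Psit\<close> is meaningful only on differences of the data, so everything
    is measured from a base point on \<open>H\<close>; such differences lie in the stalk at a
    general point of \<open>H\<close>.\<close>
  define d where "d p = Psit t (f p - f p0)" for p
  have dd: "d q - d p = Psit t (f q - f p)" if pq: "p \<in> H" "q \<in> H" for p q
  proof -
    note Vs = V[OF H_X[OF pq(1)]] V[OF H_X[OF pq(2)]] V[OF H_X[OF p0]]
    obtain r' where r': "r' \<in> H" "r' \<in> V p \<inter> V q" using H_generic[of "V p" "V q" p q] Vs pq by blast
    obtain r where r: "r \<in> H" "r \<in> V p" "r \<in> V q" "r \<in> V p0"
      using H_generic[of "V p \<inter> V q" "V p0" r' p0] Vs r' p0 X.zopen_Int by blast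
    note rX = H_X[OF r(1)]
    have m: "f r - f p \<in> St t r" "f r - f q \<in> St t r" "f r - f p0 \<in> St t r" using Vs r by blast+
    have "f p - f p0 \<in> St t r" "f q - f p0 \<in> St t r"
      using St_diff[OF rX m(3) m(1)] St_diff[OF rX m(3) m(2)] by simp_all
    from Psit_diff[OF r(1) this(2,1)] show ?thesis by (simp add: d_def)
  qed
  have "\<forall>p\<in>H. near H p (\<lambda>q. d q - d p \<in> OH t q)"
  proof
    fix p assume p: "p \<in> H"
    show "near H p (\<lambda>q. d q - d p \<in> OH t q)"
      using zopen_H[of "V p"] V[OF H_X[OF p]] p dd[OF p] Psit_in by (intro exI[of _ "V p \<inter> H"]) auto
  qed
  from cousinD[OF cH this] obtain e where e: "\<And>p. p \<in> H \<Longrightarrow> e - d p \<in> OH t p" by blast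
  have "\<forall>p\<in>H. \<exists>s. s \<in> St t p \<and> Psit t s = e - d p" using Psit_surj e by blast
  then obtain s where s: "\<forall>p\<in>H. s p \<in> St t p \<and> Psit t (s p) = e - d p" by (rule bchoice[THEN exE])
  have "\<exists>z. (\<forall>p\<in>X. z - f p \<in> St t p) \<and> (\<forall>p\<in>H. Psit t (z - f p) = Psit t (s p))"
  proof (rule cousin_div[OF cous f])
    fix p q assume *: "p \<in> H" "q \<in> H" "f q - f p \<in> St t q" "s p \<in> St t q"
    have sq: "s q \<in> St t q" using s *(2) by blast
    show "Psit t (f q - f p + (s q - s p)) = 0"
      using Psit_add[OF *(2,3) St_diff[OF H_X[OF *(2)] sq *(4)]] Psit_diff[OF *(2) sq *(4)] s *(1,2) dd[OF *(1,2)]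
      by (simp add: algebra_simps)
  qed (use s in auto)
  thus "\<exists>z. \<forall>p\<in>X. z - f p \<in> St t p" by blast
qed

lemma cousin_OH: "card J' \<ge> 3 \<Longrightarrow> cousin H (OH t)"
  by (rule H.cousin_sum[where n = n and c = "\<lambda>i. b i + t"]) (auto simp: OH_def intro!: H.cousin_Oloc)

end

section \<open>Lifted sections and the module they span\<close>

lemma (in linvar) common_denominator:
  assumes "p \<in> X" "\<And>i. i < n \<Longrightarrow> f i \<in> Oloc J (b i) p"
  shows "\<exists>D c P. D \<in> HP J c \<and> nz D p \<and> (\<forall>i<n::nat. P i \<in> HP J (b i + c) \<and> f i = pf (P i) / pf D)"
  using assms(2)
proof (induction n)
  case 0
  show ?case by (intro exI[of _ 1] exI[of _ 0]) (auto simp: HP_1)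
next
  case (Suc n)
  have "\<exists>D c P. D \<in> HP J c \<and> nz D p \<and> (\<forall>i<n. P i \<in> HP J (b i + c) \<and> f i = pf (P i) / pf D)"
    by (rule Suc.IH) (use Suc.prems in auto)
  then obtain D c P where D: "D \<in> HP J c" "nz D p" "\<And>i. i < n \<Longrightarrow> P i \<in> HP J (b i + c)"
    "\<And>i. i < n \<Longrightarrow> f i = pf (P i) / pf D" by blast
  obtain R Q a e where R: "R \<in> HP J a" "Q \<in> HP J e" "a - e = b n" "nz Q p" "f n = pf R / pf Q"
    using Suc.prems[of n] by (auto elim: OlocE)
  have n0: "pf D \<noteq> 0" "pf Q \<noteq> 0" using nz_pf assms(1) D(2) R(4) by blast+
  define P' where "P' i = (if i < n then P i * Q else R * D)" for i
  have "P' i \<in> HP J (b i + (c + e)) \<and> f i = pf (P' i) / pf (D * Q)" if "i < Suc n" for i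
  proof (cases "i < n")
    case True
    thus ?thesis using HP_mult[OF D(3)[OF True] R(2)] D(4) n0 by (simp add: P'_def algebra_simps)
  next
    case False
    hence "i = n" using that by simp
    moreover have "a + c = b n + (c + e)" using R(3) by simp
    hence "R * D \<in> HP J (b n + (c + e))" using HP_mult[OF R(1) D(1)] by metis
    ultimately show ?thesis using R(5) n0 by (simp add: P'_def)
  qed
  thus ?case using HP_mult[OF D(1) R(2)] D(2) R(4) by (intro exI[of _ "D * Q"] exI[of _ "c + e"] exI[of _ P']) auto
qed

locale lifted_basis = reduction X J H j a S n b Psi
  for X :: "'k::{alg_closed_field, field_char_0} point set" and J H j a S n b Psi +
  fixes s :: "nat \<Rightarrow> nat \<Rightarrow> 'k rat"
  assumes s_St: "i < n \<Longrightarrow> p \<in> X \<Longrightarrow> s i \<in> St (- b i) p"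
    and s_Psi: "i < n \<Longrightarrow> Psit (- b i) (s i) = (\<lambda>k. if k = i then 1 else 0)"
    and card2: "card J' \<ge> 2"
begin

definition comb :: "(nat \<Rightarrow> 'k rat) \<Rightarrow> nat \<Rightarrow> 'k rat" where
  "comb f = (\<Sum>i<n. vs (f i) (s i))"

lemma comb_vs: "comb (\<lambda>i. c * f i) = vs c (comb f)"
  by (simp add: comb_def vs_sum)

lemma comb_diff: "comb (\<lambda>i. f i - g i) = comb f - comb g"
  by (simp add: comb_def vs_diff_left sum_subtractf)

lemma comb_add: "comb (\<lambda>i. f i + g i) = comb f + comb g"
  by (simp add: comb_def vs_add_left sum.distrib)

lemma comb_St: assumes "p \<in> X" "\<And>i. i < n \<Longrightarrow> f i \<in> Oloc J (b i + t) p" shows "comb f \<in> St t p"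
  unfolding comb_def
proof (rule St_sum[OF assms(1)])
  fix i assume "i \<in> {..<n}"
  hence i: "i < n" by simp
  show "vs (f i) (s i) \<in> St t p" using St_vs[OF assms(2)[OF i] s_St[OF i assms(1)]] by simp
qed

lemma Psit_comb:
  assumes "p \<in> H" "\<And>i. i < n \<Longrightarrow> f i \<in> Oloc J (b i + t) p"
  shows "Psit t (comb f) = (\<lambda>k. if k < n then red (f k) else 0)"
proof -
  have pX: "p \<in> X" using H_X assms(1) .
  have m: "vs (f i) (s i) \<in> St t p" "Psit t (vs (f i) (s i)) = (\<lambda>k. if k = i then red (f i) else 0)"
    if i: "i < n" for i
    using St_vs[OF assms(2)[OF i] s_St[OF i pX]] Psit_vs[OF assms(1) assms(2)[OF i] s_St[OF i pX]] s_Psi[OF i]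
    by (simp_all add: vs_def fun_eq_iff)
  have "Psit t (comb f) = (\<Sum>i<n. (\<lambda>k. if k = i then red (f i) else 0))"
  proof -
    have "Psit t (comb f) = (\<Sum>i<n. Psit t (vs (f i) (s i)))"
      unfolding comb_def by (rule Psit_sum[OF assms(1)]) (use m(1) in auto)
    also have "\<dots> = (\<Sum>i<n. (\<lambda>k. if k = i then red (f i) else 0))"
      by (rule sum.cong[OF refl]) (use m(2) in simp)
    finally show ?thesis .
  qed
  also have "\<dots> = (\<lambda>k. if k < n then red (f k) else 0)"
    by (rule ext) (simp add: sum_fun_apply)
  finally show ?thesis .
qed

text \<open>Dividing a relation by \<open>L\<close> lowers its degree \<open>c\<close> by one. The
  induction runs over a bound \<open>m\<close> for the degrees of the coefficients and starts where
  all of them are negative, so that the coefficients are zero.\<close>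

lemma comb_poly_indep:
  assumes "\<And>i. i < n \<Longrightarrow> P i \<in> HP J (b i + c)" "comb (\<lambda>i. pf (P i)) = 0"
  shows "\<forall>i<n. P i = 0"
proof -
  have "\<forall>i<n. P i = 0" if "\<forall>i<n. b i + c < int m" "\<And>i. i < n \<Longrightarrow> P i \<in> HP J (b i + c)" "comb (\<lambda>i. pf (P i)) = 0"
    for m c P
    using that
  proof (induction m arbitrary: c P)
    case 0
    show ?case using 0 by (auto intro: HP_neg)
  next
    case (Suc m)
    obtain q where q: "q \<in> H" using H_ne by blast
    have c0: "comb (\<lambda>i. pf (P i)) = 0" by (rule Suc.prems(3))
    have "Psit c 0 = 0" using Psit_diff[OF q St_0[OF H_X[OF q]] St_0[OF H_X[OF q]], of c] by simp
    moreover have "Psit c (comb (\<lambda>i. pf (P i))) = (\<lambda>k. if k < n then red (pf (P k)) else 0)"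
      by (rule Psit_comb[OF q]) (rule X.Oloc_HP[OF Suc.prems(2)])
    ultimately have "(\<lambda>k. if k < n then red (pf (P k)) else 0) = 0" unfolding c0 by (rule trans[OF sym, rotated])
    from fun_cong[OF this] have "red (pf (P k)) = 0" if "k < n" for k using that by (metis zero_fun_apply)
    hence ps0: "ps (P k) = 0" if "k < n" for k using that by (simp add: red_pf)
    have "\<exists>Q. Q \<in> HP J (b k + c - 1) \<and> P k = L * Q" if k: "k < n" for k
      using lform_dvd[OF X.finJ jJ aj Suc.prems(2)[OF k] ps0[OF k]] by blast
    then obtain Q where Q: "\<And>k. k < n \<Longrightarrow> Q k \<in> HP J (b k + c - 1)" "\<And>k. k < n \<Longrightarrow> P k = L * Q k" by metis
    have "comb (\<lambda>i. pf (P i)) = vs (pf L) (comb (\<lambda>i. pf (Q i)))"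
      unfolding comb_vs[symmetric] unfolding comb_def using Q(2) by (intro sum.cong) auto
    hence "vs (1 / pf L) (vs (pf L) (comb (\<lambda>i. pf (Q i)))) = 0" unfolding c0 by (metis vs_simps(3))
    hence "comb (\<lambda>i. pf (Q i)) = 0" by (simp only: L_cancel)
    moreover have "\<forall>i<n. b i + (c - 1) < int m" using Suc.prems(1) by force
    moreover have "Q i \<in> HP J (b i + (c - 1))" if "i < n" for i using Q(1)[OF that] by (simp add: algebra_simps)
    ultimately have "\<forall>k<n. Q k = 0" by (intro Suc.IH)
    thus ?case using Q(2) by simp
  qed
  moreover obtain m where "\<forall>i<n. b i + c < int m"
  proof -
    have "b i + c < int (Suc (\<Sum>k<n. nat \<bar>b k + c\<bar>))" if "i < n" for i
    proof -
      have "nat \<bar>b i + c\<bar> \<le> (\<Sum>k<n. nat \<bar>b k + c\<bar>)" using that by (intro member_le_sum) auto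
      thus ?thesis by linarith
    qed
    thus ?thesis using that by blast
  qed
  ultimately show ?thesis using assms by blast
qed

text \<open>The two families of coefficients may come from different points: clearing denominators
  turns their difference into a polynomial relation. Coefficients thus belong to the vector and not
  to a stalk, so they can be carried from one point to another.\<close>

lemma comb_inj:
  assumes "p \<in> X" "q \<in> X" "\<And>i. i < n \<Longrightarrow> f i \<in> Oloc J (b i) p" "\<And>i. i < n \<Longrightarrow> g i \<in> Oloc J (b i) q"
    and "comb f = comb g" "i < n"
  shows "f i = g i"
proof -
  obtain D c P where D: "D \<in> HP J c" "nz D p" "\<And>i. i < n \<Longrightarrow> P i \<in> HP J (b i + c)" "\<And>i. i < n \<Longrightarrow> f i = pf (P i) / pf D"
    using X.common_denominator[of p n f b, OF assms(1,3)] by blast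
  obtain E e R where E: "E \<in> HP J e" "nz E q" "\<And>i. i < n \<Longrightarrow> R i \<in> HP J (b i + e)" "\<And>i. i < n \<Longrightarrow> g i = pf (R i) / pf E"
    using X.common_denominator[of q n g b, OF assms(2,4)] by blast
  have n0: "pf D \<noteq> 0" "pf E \<noteq> 0" using X.nz_pf assms(1,2) D(2) E(2) by blast+
  define T where "T i = P i * E - R i * D" for i
  have "T i \<in> HP J (b i + (c + e))" if "i < n" for i
    using HP_mult[OF D(3)[OF that] E(1)] HP_mult[OF E(3)[OF that] D(1)] unfolding T_def
    by (intro HP_diff) (simp_all add: algebra_simps)
  moreover have "comb (\<lambda>i. pf (T i)) = 0"
  proof -
    have "comb (\<lambda>i. pf (T i)) = comb (\<lambda>i. (pf D * pf E) * (f i - g i))"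
      unfolding comb_def
    proof (rule sum.cong[OF refl])
      fix i assume "i \<in> {..<n}"
      hence "f i = pf (P i) / pf D" "g i = pf (R i) / pf E" using D(4) E(4) by auto
      hence "pf (T i) = pf D * pf E * (f i - g i)" using n0 by (simp add: T_def right_diff_distrib)
      thus "vs (pf (T i)) (s i) = vs (pf D * pf E * (f i - g i)) (s i)" by simp
    qed
    also have "\<dots> = vs (pf D * pf E) (comb f - comb g)" unfolding comb_diff[symmetric] by (rule comb_vs)
    finally show ?thesis using assms(5) by simp
  qed
  ultimately have "T i = 0" using comb_poly_indep[of T "c + e"] assms(6) by blast
  hence "pf (P i * E) = pf (R i * D)" by (simp add: T_def)
  hence "pf (P i) * pf E = pf (R i) * pf D" by simp
  thus ?thesis unfolding D(4)[OF assms(6)] E(4)[OF assms(6)] using n0 by (simp only: frac_eq_eq not_False_eq_True)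
qed

definition E :: "'k point \<Rightarrow> (nat \<Rightarrow> 'k rat) set" where
  "E p = {comb f |f. \<forall>i<n. f i \<in> Oloc J (b i) p}"

lemma E_S: "p \<in> X \<Longrightarrow> E p \<subseteq> S p"
  using comb_St[of p _ 0] St_S by (auto simp: E_def)

lemma E_add: assumes "p \<in> X" "z \<in> E p" "w \<in> E p" shows "z + w \<in> E p"
proof -
  obtain f g where "\<forall>i<n. f i \<in> Oloc J (b i) p" "\<forall>i<n. g i \<in> Oloc J (b i) p" "z = comb f" "w = comb g"
    using assms unfolding E_def by blast
  thus ?thesis using X.Oloc_add[OF _ _ assms(1)] comb_add[of f g]
    unfolding E_def by (intro CollectI exI[of _ "\<lambda>i. f i + g i"]) auto
qed

lemma E_vs: assumes "c \<in> Oloc J 0 p" "z \<in> E p" shows "vs c z \<in> E p"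
proof -
  obtain f where "\<forall>i<n. f i \<in> Oloc J (b i) p" "z = comb f" using assms unfolding E_def by blast
  thus ?thesis using X.Oloc_mult[OF assms(1)] comb_vs[of c f]
    unfolding E_def by (intro CollectI exI[of _ "\<lambda>i. c * f i"]) fastforce
qed

lemma E_0: "p \<in> X \<Longrightarrow> 0 \<in> E p"
  using X.Oloc_0 unfolding E_def by (intro CollectI exI[of _ "\<lambda>_. 0"]) (simp add: comb_def)

lemma E_sum: "p \<in> X \<Longrightarrow> (\<And>i. i \<in> A \<Longrightarrow> f i \<in> E p) \<Longrightarrow> sum f A \<in> E p"
  by (induction A rule: infinite_finite_induct) (auto intro: E_0 E_add)

lemma E_open: assumes "p \<in> X" "z \<in> E p" shows "near X p (\<lambda>q. z \<in> E q)"
proof -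
  obtain f where f: "\<And>i. i < n \<Longrightarrow> f i \<in> Oloc J (b i) p" "z = comb f" using assms unfolding E_def by blast
  obtain D c P where D: "D \<in> HP J c" "nz D p" "\<And>i. i < n \<Longrightarrow> P i \<in> HP J (b i + c)" "\<And>i. i < n \<Longrightarrow> f i = pf (P i) / pf D"
    using X.common_denominator[of p n f b, OF assms(1) f(1)] by blast
  have "z \<in> E q" if "nz D q" for q
  proof -
    have "f i \<in> Oloc J (b i) q" if i: "i < n" for i
      by (rule OlocI[OF D(3)[OF i] D(1) _ \<open>nz D q\<close> D(4)[OF i]]) simp
    thus ?thesis unfolding E_def f(2) by blast
  qed
  thus ?thesis using X.zopen_nz[OF D(1)] assms(1) D(2) by (intro exI[of _ "{q \<in> X. nz D q}"]) auto
qed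

text \<open>The components of \<open>Psit 0 z\<close>, read as functions on \<open>X\<close> because
  \<open>J'\<close> is contained in \<open>J\<close>, are the coefficients of a combination that
  agrees with \<open>z\<close> along \<open>H\<close>.\<close>

lemma mod_L:
  assumes "p \<in> H" "z \<in> S p"
  shows "\<exists>e\<in>E p. \<exists>c\<in>Oloc J (- 1) p. \<exists>w\<in>S p. z = e + vs (pf L * c) w"
proof -
  have pX: "p \<in> X" using H_X assms(1) .
  have z0: "z \<in> St 0 p" using St_S[OF pX] assms(2) by simp
  define d where "d = Psit 0 z"
  have d: "d \<in> OH 0 p" unfolding d_def by (rule Psit_in[OF assms(1) z0])
  hence dO: "d i \<in> Oloc J' (b i) p" if "i < n" for i using that by (simp add: OH_def)
  have dJ: "d i \<in> Oloc J (b i + 0) p" if "i < n" for i using J'_J dO[OF that] by simp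
  have cd: "comb d \<in> St 0 p" by (rule comb_St[OF pX dJ])
  have "(if k < n then red (d k) else 0) = d k" for k
    using red_id[OF dO assms(1), of k] d by (simp add: OH_def)
  hence "Psit 0 (comb d) = d" using Psit_comb[of p d 0, OF assms(1) dJ] by (simp only:)
  hence "Psit 0 (z - comb d) = 0" using Psit_diff[OF assms(1) z0 cd] by (simp add: d_def)
  then obtain w where w: "w \<in> St (- 1) p" "z - comb d = vs (pf L) w"
    using Psit_ker[OF assms(1) St_diff[OF pX z0 cd]] by auto
  then obtain c w' where c: "c \<in> Oloc J (- 1) p" "w' \<in> S p" "w = vs c w'" unfolding St_def by blast
  have "comb d \<in> E p" using dJ unfolding E_def by auto
  moreover have "z = comb d + vs (pf L * c) w'" using w(2) c(3) by (metis add.commute diff_add_cancel vs_simps(4))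
  ultimately show ?thesis using c by blast
qed

lemma nakayama: assumes "p \<in> H" shows "S p = E p"
proof
  have pX: "p \<in> X" using H_X assms .
  show "E p \<subseteq> S p" by (rule E_S[OF pX])
  obtain V m T where T: "p \<in> V" "\<forall>q\<in>V. \<forall>i<m. T i \<in> S q"
    "\<forall>q\<in>V. \<forall>z\<in>S q. \<exists>c. (\<forall>i<m. c i \<in> Oloc J 0 q) \<and> z = (\<Sum>i<m::nat. vs (c i) (T i))"
    using S_finite[OF pX] by blast
  have TS: "T i \<in> S p" if "i < m" for i using T that by blast
  have E': "vs c e \<in> E p" if "c \<in> Oloc J 0 p" "e \<in> E p" for c e by (rule E_vs[OF that])
  \<comment> \<open>\<open>S p\<close> is spanned over \<open>E p\<close> by the first
    \<open>k\<close> generators. Descending from \<open>m\<close> to 0, one generator is eliminated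
    at a time.\<close>
  have step: "\<exists>e\<in>E p. \<exists>c. (\<forall>i<k. c i \<in> Oloc J 0 p) \<and> z = e + (\<Sum>i<k. vs (c i) (T i))"
    if "k \<le> m" "z \<in> S p" for k z
    using that
  proof (induction k arbitrary: z rule: inc_induct)
    case base
    then obtain c where "\<forall>i<m. c i \<in> Oloc J 0 p" "z = (\<Sum>i<m. vs (c i) (T i))" using T by blast
    thus ?case using E_0[OF pX] by (intro bexI[of _ 0] exI[of _ c]) auto
  next
    case (step k)
    obtain e c w where e: "e \<in> E p" "c \<in> Oloc J (- 1) p" "w \<in> S p" "T k = e + vs (pf L * c) w"
      using mod_L[OF assms TS[OF step.hyps(2)]] by blast
    obtain e' d where e': "e' \<in> E p" "\<forall>i<Suc k. d i \<in> Oloc J 0 p" "w = e' + (\<Sum>i<Suc k. vs (d i) (T i))"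
      using step.IH[OF e(3)] by blast
    define u where "u = pf L * c"
    have u: "u \<in> Oloc J 0 p" using X.Oloc_mult[OF X.Oloc_HP[OF HP_lform] e(2), of a] by (simp add: u_def)
    have cd: "c * d k \<in> Oloc J (- 1) p" using X.Oloc_mult[OF e(2), of "d k" 0] e'(2) by simp
    \<comment> \<open>\<open>T k\<close> occurs in its own expansion with coefficient
      \<open>u * d k\<close>, a multiple of \<open>L\<close>; hence \<open>1 - u * d k\<close> is a
      unit at \<open>p\<close>, with inverse \<open>v\<close>.\<close>
    define v where "v = 1 / (1 - pf L * (c * d k))"
    have v: "v \<in> Oloc J 0 p" "1 - u * d k \<noteq> 0"
      using unit_near_H[OF cd assms] by (simp_all add: v_def u_def mult.assoc)
    have v1: "v * (1 - u * d k) = 1" using v(2) by (simp add: v_def u_def mult.assoc)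
    have Tk: "T k = vs v (e + vs u e') + (\<Sum>i<k. vs (v * u * d i) (T i))"
    proof -
      have "T k = e + vs u e' + (\<Sum>i<k. vs (u * d i) (T i)) + vs (u * d k) (T k)"
        using e(4) unfolding u_def[symmetric] e'(3) by (simp add: vs_add vs_sum add_ac)
      hence "vs (1 - u * d k) (T k) = e + vs u e' + (\<Sum>i<k. vs (u * d i) (T i))"
        by (simp add: vs_diff_left diff_eq_eq)
      hence "vs v (vs (1 - u * d k) (T k)) = vs v (e + vs u e' + (\<Sum>i<k. vs (u * d i) (T i)))" by simp
      thus ?thesis using v1 by (simp add: vs_add vs_sum mult.assoc)
    qed
    obtain f g where f: "f \<in> E p" "\<forall>i<Suc k. g i \<in> Oloc J 0 p" "z = f + (\<Sum>i<Suc k. vs (g i) (T i))"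
      using step.IH[OF step.prems] by blast
    have gk: "g k \<in> Oloc J 0 p" using f(2) by simp
    have "z = (f + vs (g k) (vs v (e + vs u e'))) + (\<Sum>i<k. vs (g i + g k * (v * u * d i)) (T i))"
    proof -
      have "z = f + (\<Sum>i<k. vs (g i) (T i)) + vs (g k) (T k)" using f(3) by (simp add: add.assoc)
      also have "vs (g k) (T k) = vs (g k) (vs v (e + vs u e')) + (\<Sum>i<k. vs (g k * (v * u * d i)) (T i))"
        by (subst Tk) (simp add: vs_add vs_sum)
      finally show ?thesis by (simp only: vs_add_left sum.distrib add_ac)
    qed
    moreover have "f + vs (g k) (vs v (e + vs u e')) \<in> E p"
      by (intro E_add[OF pX] E' f(1) gk v(1) u e(1) e'(1))
    moreover have "g i + g k * (v * u * d i) \<in> Oloc J 0 p" if "i < k" for i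
    proof -
      have "d i \<in> Oloc J 0 p" "g i \<in> Oloc J 0 p" using e'(2) f(2) that by auto
      thus ?thesis
        using X.Oloc_mult[OF gk X.Oloc_mult[OF X.Oloc_mult[OF v(1) u]], of "d i" 0] X.Oloc_add[OF _ _ pX] by simp
    qed
    ultimately show ?case
      by (intro bexI[of _ "f + vs (g k) (vs v (e + vs u e'))"] exI[of _ "\<lambda>i. g i + g k * (v * u * d i)"] conjI allI impI)
  qed
  show "S p \<subseteq> E p"
  proof
    fix z assume "z \<in> S p"
    from step[OF _ this, of 0] show "z \<in> E p" by auto
  qed
qed

text \<open>Equality at \<open>p\<close> spreads to a neighbourhood, because it is enough that the
  finitely many generators of \<open>S\<close> lie in \<open>E\<close>.\<close>

lemma E_near_H: assumes "p \<in> H" shows "near X p (\<lambda>q. S q = E q)"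
proof -
  have pX: "p \<in> X" using H_X assms .
  obtain V m T where T: "zopen X V" "p \<in> V" "\<forall>q\<in>V. \<forall>i<m. T i \<in> S q"
    "\<forall>q\<in>V. \<forall>z\<in>S q. \<exists>c. (\<forall>i<m. c i \<in> Oloc J 0 q) \<and> z = (\<Sum>i<m::nat. vs (c i) (T i))"
    using S_finite[OF pX] by blast
  have "near X p (\<lambda>q. \<forall>i<k. T i \<in> E q)" if "k \<le> m" for k
    using that
  proof (induction k)
    case 0
    show ?case using X.zopen_X pX by blast
  next
    case (Suc k)
    then obtain W where W: "zopen X W" "p \<in> W" "\<forall>q\<in>W. \<forall>i<k. T i \<in> E q" by auto
    have "T k \<in> E p" using T(2,3) Suc.prems nakayama[OF assms] by auto
    then obtain W' where W': "zopen X W'" "p \<in> W'" "\<forall>q\<in>W'. T k \<in> E q" using E_open[OF pX] by blast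
    show ?case using X.zopen_Int[OF W(1) W'(1)] W W' by (intro exI[of _ "W \<inter> W'"]) (auto simp: less_Suc_eq)
  qed
  then obtain W where W: "zopen X W" "p \<in> W" "\<forall>q\<in>W. \<forall>i<m. T i \<in> E q" by blast
  have "S q = E q" if q: "q \<in> V \<inter> W" for q
  proof
    have qX: "q \<in> X" using q X.zopen_subset[OF T(1)] by blast
    show "E q \<subseteq> S q" by (rule E_S[OF qX])
    show "S q \<subseteq> E q"
    proof
      fix z assume "z \<in> S q"
      then obtain c where c: "\<forall>i<m. c i \<in> Oloc J 0 q" "z = (\<Sum>i<m. vs (c i) (T i))" using T(4) q by blast
      thus "z \<in> E q" using W(3) q by (auto intro!: E_sum[OF qX] E_vs)
    qed
  qed
  thus ?thesis using X.zopen_Int[OF T(1) W(1)] T(2) W(2) by blast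
qed

theorem S_eq_E: assumes p0: "p0 \<in> X" shows "S p0 = E p0"
proof
  show "E p0 \<subseteq> S p0" by (rule E_S[OF p0])
  show "S p0 \<subseteq> E p0"
  proof
    fix z assume z: "z \<in> S p0"
    have "\<forall>u\<in>H. \<exists>x. fst x \<in> HP J (snd x) \<and> snd x \<ge> 1 \<and> nz (fst x) u \<and> (\<forall>q\<in>X. nz (fst x) q \<longrightarrow> S q = E q)"
    proof
      fix u assume u: "u \<in> H"
      obtain V where V: "zopen X V" "u \<in> V" "\<forall>q\<in>V. S q = E q" using E_near_H[OF u] by blast
      obtain g c where "g \<in> HP J c" "c \<ge> 1" "nz g u" "\<And>q. q \<in> X \<Longrightarrow> nz g q \<Longrightarrow> q \<in> V"
        by (rule X.zopen_basis[OF V(1,2)]) blast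
      thus "\<exists>x. fst x \<in> HP J (snd x) \<and> snd x \<ge> 1 \<and> nz (fst x) u \<and> (\<forall>q\<in>X. nz (fst x) q \<longrightarrow> S q = E q)"
        using V(3) by (intro exI[of _ "(g, c)"]) auto
    qed
    then obtain x where x: "\<forall>u\<in>H. fst (x u) \<in> HP J (snd (x u)) \<and> snd (x u) \<ge> 1 \<and> nz (fst (x u)) u \<and>
        (\<forall>q\<in>X. nz (fst (x u)) q \<longrightarrow> S q = E q)" by (rule bchoice[THEN exE])
    define h where "h u = fst (x u)" for u
    have h: "h u \<in> HP J (snd (x u)) \<and> snd (x u) \<ge> 1 \<and> nz (h u) u" "\<And>q. q \<in> X \<Longrightarrow> nz (h u) q \<Longrightarrow> S q = E q"
      if "u \<in> H" for u using x that by (auto simp: h_def)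
    obtain V where V: "zopen X V" "p0 \<in> V" "\<forall>q\<in>V. z \<in> S q" using S_open[OF p0 z] by blast
    obtain g c where g: "g \<in> HP J c" "c \<ge> 1" "nz g p0" "\<And>q. q \<in> X \<Longrightarrow> nz g q \<Longrightarrow> q \<in> V"
      by (rule X.zopen_basis[OF V(1,2)]) blast
    obtain u0 where u0: "u0 \<in> H" using H_ne by blast
    \<comment> \<open>A point \<open>q0\<close> where \<open>g\<close> and some \<open>h u0\<close>
      do not vanish supplies coefficients of \<open>z\<close>. By \<open>comb_inj\<close> the same
      coefficients serve wherever \<open>z\<close> lies in \<open>E\<close>, so each of them
      satisfies the hypothesis of \<open>hartogs\<close>.\<close>
    have "g * h u0 \<noteq> 0" using X.nz_nonzero[OF g(3) p0] X.nz_nonzero[of "h u0" u0] h(1)[OF u0] H_X[OF u0] by simp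
    then obtain q0 where q0: "q0 \<in> X" "nz (g * h u0) q0"
      using X.ex_nz[OF HP_mult[OF g(1)], of "h u0"] h(1)[OF u0] by blast
    hence "z \<in> E q0" using V(3) g(4) h(2)[OF u0] by auto
    then obtain f where f: "\<And>i. i < n \<Longrightarrow> f i \<in> Oloc J (b i) q0" "z = comb f" unfolding E_def by blast
    have "f i \<in> Oloc J (b i) p0" if i: "i < n" for i
    proof (rule X.hartogs[where h = h and g = g and a = a and j = j and e = "\<lambda>u. snd (x u)"])
      fix q u assume q: "q \<in> X" "u \<in> X" "\<not> nz L u" "nz g q" "nz (h u) q"
      hence "z \<in> E q" using V(3) g(4) h(2)[of u] by (auto simp: H_eq)
      then obtain f' where f': "\<And>i. i < n \<Longrightarrow> f' i \<in> Oloc J (b i) q" "z = comb f'" unfolding E_def by blast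
      have "f i = f' i" by (rule comb_inj[OF q0(1) q(1) f(1) f'(1) _ i]) (use f(2) f'(2) in auto)
      thus "f i \<in> Oloc J (b i) q" using f'(1)[OF i] by simp
    qed (use jJ aj card2 g p0 h(1) H_eq in auto)
    thus "z \<in> E p0" unfolding E_def f(2) by blast
  qed
qed

end

text \<open>The \<open>i\<close>-th unit vector is a section of the restriction twisted by
  \<open>- b i\<close>; lifting it to \<open>X\<close> is obstructed by the cohomology of the twist
  one lower.\<close>

theorem (in reduction) stalks_split:
  assumes "card J' \<ge> 2" and cous: "\<And>i. i < n \<Longrightarrow> cousin X (St (- b i - 1))"
  obtains s where "lifted_basis X J H j a S n b Psi s"
proof -
  have "\<exists>s. (\<forall>p\<in>X. s \<in> St (- b i) p) \<and> Psit (- b i) s = (\<lambda>k. if k = i then 1 else 0)" if i: "i < n" for i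
  proof -
    have "(\<lambda>k. if k = i then 1 else 0) \<in> OH (- b i) p" if "p \<in> H" for p
      using H.Oloc_0[OF that] H.Oloc_1 i by (auto simp: OH_def)
    thus ?thesis using lift_section[of "- b i" "\<lambda>k. if k = i then 1 else 0"] cous[OF i] by metis
  qed
  then obtain s where "\<And>i. i < n \<Longrightarrow> (\<forall>p\<in>X. s i \<in> St (- b i) p) \<and> Psit (- b i) (s i) = (\<lambda>k. if k = i then 1 else 0)"
    by metis
  hence "lifted_basis X J H j a S n b Psi s"
    using assms(1) by unfold_locales auto
  thus ?thesis using that by blast
qed

section \<open>Projective space and its hyperplanes\<close>

lemma proj_point_eq:
  assumes "v \<in> proj_point w" shows "proj_point v = proj_point (w :: 'k::field coords)"
proof -
  obtain c where c: "c \<noteq> 0" "v = (\<lambda>i. c * w i)" using assms by (auto simp: proj_point_def)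
  show ?thesis
  proof (intro subset_antisym subsetI)
    fix u assume "u \<in> proj_point v"
    then obtain d where "d \<noteq> 0" "u = (\<lambda>i. d * v i)" by (auto simp: proj_point_def)
    thus "u \<in> proj_point w" using c unfolding proj_point_def
      by (intro CollectI exI[of _ "d * c"]) (simp add: mult.assoc)
  next
    fix u assume "u \<in> proj_point w"
    then obtain d where "d \<noteq> 0" "u = (\<lambda>i. d * w i)" by (auto simp: proj_point_def)
    thus "u \<in> proj_point v" using c unfolding proj_point_def
      by (intro CollectI exI[of _ "d / c"]) simp
  qed
qed

lemma proj_spaceD:
  assumes "p \<in> proj_space N" "v \<in> p"
  shows "p = proj_point v" "\<And>i. i > N \<Longrightarrow> v i = 0" "\<exists>i\<le>N. v i \<noteq> 0"
proof -
  obtain w where w: "p = proj_point w" "\<forall>i>N. w i = 0" "\<exists>i\<le>N. w i \<noteq> 0"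
    using assms(1) by (auto simp: proj_space_def)
  thus "p = proj_point v" using assms(2) proj_point_eq by blast
  obtain c where "c \<noteq> 0" "v = (\<lambda>i. c * w i)" using assms(2) w(1) by (auto simp: proj_point_def)
  thus "\<And>i. i > N \<Longrightarrow> v i = 0" "\<exists>i\<le>N. v i \<noteq> 0" using w by auto
qed

lemma proj_point_self: "v \<in> proj_point v"
  by (auto simp: proj_point_def intro: exI[of _ 1])

lemma proj_space_ne: "p \<in> proj_space N \<Longrightarrow> p \<noteq> {}"
  using proj_point_self by (auto simp: proj_space_def)

lemma hpoly_truncate:
  "f \<in> hpoly UNIV d \<Longrightarrow> \<exists>f'\<in>hpoly {..N} d. \<forall>v. (\<forall>i>N. v i = 0) \<longrightarrow> f v = f' v"
proof (induction rule: hpoly_induct)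
  case (var f d i)
  then obtain f' where f': "f' \<in> hpoly {..N} d" "\<forall>v. (\<forall>i>N. v i = 0) \<longrightarrow> f v = f' v" by blast
  show ?case
  proof (cases "i \<le> N")
    case True
    thus ?thesis using f' by (intro bexI[of _ "\<lambda>x. x i * f' x"]) (auto intro: hpoly_var)
  next
    case False
    thus ?thesis by (intro bexI[of _ "\<lambda>x. 0"]) (auto intro: hpoly_zero)
  qed
next
  case (add f d g)
  then obtain f' g' where "f' \<in> hpoly {..N} d" "\<forall>v. (\<forall>i>N. v i = 0) \<longrightarrow> f v = f' v"
    "g' \<in> hpoly {..N} d" "\<forall>v. (\<forall>i>N. v i = 0) \<longrightarrow> g v = g' v" by blast
  thus ?case by (intro bexI[of _ "\<lambda>x. f' x + g' x"]) (auto intro: hpoly_add)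
qed (auto intro!: bexI hpoly_zero hpoly_const)

lemma linvar_proj_space: "linvar (proj_space N :: 'k::{alg_closed_field, field_char_0} point set) {..N}"
proof
  show "\<exists>p\<in>proj_space N. \<exists>v\<in>p. \<forall>i\<in>{..N}. v i = w i" if "\<exists>i\<in>{..N}. w i \<noteq> 0" for w :: "'k coords"
  proof -
    let ?v = "\<lambda>i. if i \<le> N then w i else 0"
    have "proj_point ?v \<in> proj_space N" using that unfolding proj_space_def by (intro CollectI exI[of _ ?v]) auto
    thus ?thesis using proj_point_self[of ?v] by (intro bexI[of _ "proj_point ?v"] bexI[of _ ?v]) auto
  qed
  show "\<exists>f'\<in>hpoly {..N} d. \<forall>p\<in>proj_space N. \<forall>v\<in>p. f v = f' v" if "f \<in> hpoly UNIV d" for f :: "'k func" and d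
    using hpoly_truncate[OF that, of N] proj_spaceD(2) by blast
  show "p = proj_point v" if "p \<in> proj_space N" "v \<in> p" for p and v :: "'k coords"
    using proj_spaceD(1)[OF that] .
  show "\<exists>i\<in>{..N}. v i \<noteq> 0" if "p \<in> proj_space N" "v \<in> p" for p and v :: "'k coords"
    using proj_spaceD(3)[OF that] by auto
  show "p \<noteq> {}" if "p \<in> proj_space N" for p :: "'k point" using proj_space_ne[OF that] .
qed auto

lemma hyperplane_pair_exists:
  assumes "hyperplane N (H :: 'k::{alg_closed_field, field_char_0} point set)" "N \<ge> 1"
  shows "\<exists>j a. hyperplane_pair (proj_space N) {..N} H j a"
proof -
  obtain a where a: "\<exists>i\<le>N. a i \<noteq> 0" "H = {p \<in> proj_space N. \<forall>v\<in>p. (\<Sum>i\<le>N. a i * v i) = 0}"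
    using assms(1) by (auto simp: hyperplane_def)
  then obtain j where j: "j \<le> N" "a j \<noteq> 0" by blast
  interpret X: linvar "proj_space N :: 'k point set" "{..N}" by (rule linvar_proj_space)
  have HX: "p \<in> H \<Longrightarrow> p \<in> proj_space N" for p using a by blast
  have sum: "(\<Sum>i\<le>N. a i * v i) = a j * v j + (\<Sum>i\<in>{..N} - {j}. a i * v i)" for v :: "'k coords"
    using j by (intro sum.remove) auto
  have "linvar H ({..N} - {j})"
  proof
    show "finite ({..N} - {j})" by simp
    show "{..N} - {j} \<noteq> {}"
      using assms(2) j(1) by (cases "j = 0") (auto intro: exI[of _ 0] exI[of _ 1])
    show "p = proj_point v" if "p \<in> H" "v \<in> p" for p v using that HX proj_spaceD(1) by blast
    show "p \<noteq> {}" if "p \<in> H" for p using that HX proj_space_ne by blast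
    show "\<exists>i\<in>{..N} - {j}. v i \<noteq> 0" if pv: "p \<in> H" "v \<in> p" for p v
    proof (rule ccontr)
      assume c: "\<not> ?thesis"
      hence "(\<Sum>i\<in>{..N} - {j}. a i * v i) = 0" by (intro sum.neutral) auto
      moreover have "(\<Sum>i\<le>N. a i * v i) = 0" using pv a(2) by auto
      ultimately have "v j = 0" using sum[of v] j(2) by simp
      moreover obtain i where "i \<le> N" "v i \<noteq> 0" using proj_spaceD(3) HX pv by blast
      ultimately show False using c by (cases "i = j") auto
    qed
    show "\<exists>p\<in>H. \<exists>v\<in>p. \<forall>i\<in>{..N} - {j}. v i = w i" if "\<exists>i\<in>{..N} - {j}. w i \<noteq> 0" for w :: "'k coords"
    proof -
      \<comment> \<open>The eliminated coordinate is solved from the equation of \<open>H\<close>,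
        and the coordinates above \<open>N\<close> are zero.\<close>
      define v where "v i = (if i = j then - (\<Sum>i\<in>{..N} - {j}. a i * w i) / a j else if i \<le> N then w i else 0)" for i
      have "proj_point v \<in> proj_space N"
        using that j(1) unfolding proj_space_def by (intro CollectI exI[of _ v]) (auto simp: v_def)
      moreover have "(\<Sum>i\<in>{..N} - {j}. a i * v i) = (\<Sum>i\<in>{..N} - {j}. a i * w i)"
        by (intro sum.cong) (auto simp: v_def)
      hence s0: "(\<Sum>i\<le>N. a i * v i) = 0" using sum[of v] j(2) by (simp add: v_def)
      have "(\<Sum>i\<le>N. a i * (c * v i)) = c * (\<Sum>i\<le>N. a i * v i)" for c
        by (simp add: sum_distrib_left mult.left_commute)
      hence "\<forall>u\<in>proj_point v. (\<Sum>i\<le>N. a i * u i) = 0" using s0 by (auto simp: proj_point_def)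
      ultimately have "proj_point v \<in> H" using a(2) by blast
      thus ?thesis using proj_point_self[of v] by (intro bexI[of _ "proj_point v"] bexI[of _ v]) (auto simp: v_def)
    qed
    show "\<exists>f'\<in>hpoly ({..N} - {j}) d. \<forall>p\<in>H. \<forall>v\<in>p. f v = f' v" if f: "f \<in> hpoly UNIV d" for f :: "'k func" and d
    proof -
      obtain g where g: "g \<in> hpoly {..N} d" "\<forall>v. (\<forall>i>N. v i = 0) \<longrightarrow> f v = g v" using hpoly_truncate[OF f] by blast
      define P where "P = Abs_pfun g"
      have P: "pev P = g" unfolding P_def
        by (rule Abs_pfun_inverse) (rule polyf_mono[OF hpoly_polyf[OF g(1)]], simp)
      hence "P \<in> HP {..N} (int d)" using g(1) by (simp add: HP_nat)
      \<comment> \<open>On vectors of \<open>H\<close> the projection \<open>elim_coord\<close> is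
        the identity, so \<open>psub\<close> rewrites a form in the remaining coordinates without
        changing its values there.\<close>
      hence "psub a {..N} j P \<in> HP ({..N} - {j}) (int d)" using psub_HP[of "{..N}" j a] j by auto
      hence "pev (psub a {..N} j P) \<in> hpoly ({..N} - {j}) d" by (simp add: HP_nat)
      moreover have "f v = pev (psub a {..N} j P) v" if pv: "p \<in> H" "v \<in> p" for p v
      proof -
        have "a j * v j + (\<Sum>i\<in>{..N} - {j}. a i * v i) = 0" using pv a(2) sum[of v] by auto
        hence "v j * a j = - (\<Sum>i\<in>{..N} - {j}. a i * v i)" by (simp add: add_eq_0_iff mult.commute)
        hence "v j = - (\<Sum>i\<in>{..N} - {j}. a i * v i) / a j" using j(2)
          by (metis nonzero_mult_div_cancel_right)
        hence "elim_coord a {..N} j v = v" by (auto simp: elim_coord_def fun_eq_iff)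
        thus ?thesis using g(2) proj_spaceD(2)[OF HX[OF pv(1)] pv(2)] by (simp add: P)
      qed
      ultimately show ?thesis by blast
    qed
  qed
  moreover have "H = {p \<in> proj_space N. \<not> nz (lform a {..N}) p}"
  proof -
    have "(\<forall>v\<in>p. (\<Sum>i\<le>N. a i * v i) = 0) \<longleftrightarrow> \<not> nz (lform a {..N}) p" if p: "p \<in> proj_space N" for p
    proof -
      obtain v where v: "v \<in> p" using proj_space_ne[OF p] by blast
      show ?thesis using X.nz_iff[OF HP_lform p, of _ a] v by (auto simp: pev_lform nz_def)
    qed
    thus ?thesis using a(2) by blast
  qed
  ultimately have "hyperplane_pair (proj_space N) {..N} H j a"
    using j by (intro hyperplane_pair.intro hyperplane_pair_axioms.intro linvar_proj_space) auto
  thus ?thesis by blast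
qed

section \<open>Sections of twisting sheaves as rational functions\<close>

definition ev :: "'k::field_char_0 rat \<Rightarrow> 'k coords \<Rightarrow> 'k" where
  "ev z v = (THE c. \<exists>P Q. pev Q v \<noteq> 0 \<and> z = pf P / pf Q \<and> c = pev P v / pev Q v)"

lemma ev_eq:
  assumes "pev Q v \<noteq> 0" shows "ev (pf P / pf Q) v = pev P v / pev Q v"
  unfolding ev_def
proof (rule the_equality)
  show "\<exists>P' Q'. pev Q' v \<noteq> 0 \<and> pf P / pf Q = pf P' / pf Q' \<and> pev P v / pev Q v = pev P' v / pev Q' v"
    using assms by blast
  fix c assume "\<exists>P' Q'. pev Q' v \<noteq> 0 \<and> pf P / pf Q = pf P' / pf Q' \<and> c = pev P' v / pev Q' v"
  then obtain P' Q' where *: "pev Q' v \<noteq> 0" "pf P / pf Q = pf P' / pf Q'" "c = pev P' v / pev Q' v" by blast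
  have "pf Q \<noteq> 0" "pf Q' \<noteq> 0" using assms *(1) by auto
  hence "pf P * pf Q' = pf P' * pf Q" using *(2) by (simp add: frac_eq_eq)
  hence "P * Q' = P' * Q" by (metis pf_simps(5) pf_eq_iff)
  hence "pev P v * pev Q' v = pev P' v * pev Q v" by (metis pev_simps(6))
  thus "c = pev P v / pev Q v" unfolding *(3) using *(1) assms by (simp add: frac_eq_eq)
qed

context linvar begin

lemma ev_repr:
  assumes "z \<in> Oloc J b p" "p \<in> X" "v \<in> p"
  obtains P Q a c where "P \<in> HP J a" "Q \<in> HP J c" "a - c = b" "nz Q p" "pev Q v \<noteq> 0" "pf Q \<noteq> 0" "z = pf P / pf Q"
    "ev z v = pev P v / pev Q v"
proof -
  obtain P Q a c where *: "P \<in> HP J a" "Q \<in> HP J c" "a - c = b" "nz Q p" "z = pf P / pf Q"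
    using assms(1) by (rule OlocE)
  have "pev Q v \<noteq> 0" using *(4) assms(3) by (auto simp: nz_def)
  thus ?thesis using that * ev_eq nz_pf[OF *(4) assms(2)] by blast
qed

lemma ev_add:
  assumes "z \<in> Oloc J b p" "w \<in> Oloc J b' p" "p \<in> X" "v \<in> p" shows "ev (z + w) v = ev z v + ev w v"
proof -
  obtain P Q where z: "pev Q v \<noteq> 0" "pf Q \<noteq> 0" "z = pf P / pf Q" "ev z v = pev P v / pev Q v"
    by (rule ev_repr[OF assms(1,3,4)]) blast
  obtain R T where w: "pev T v \<noteq> 0" "pf T \<noteq> 0" "w = pf R / pf T" "ev w v = pev R v / pev T v"
    by (rule ev_repr[OF assms(2,3,4)]) blast
  have e: "z + w = pf (P * T + R * Q) / pf (Q * T)" using z w by (simp add: add_frac_eq)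
  have "pev (Q * T) v \<noteq> 0" using z w by simp
  from ev_eq[OF this, of "P * T + R * Q"] show ?thesis unfolding e using z w by (simp add: add_frac_eq)
qed

lemma ev_mult:
  assumes "z \<in> Oloc J b p" "w \<in> Oloc J b' p" "p \<in> X" "v \<in> p" shows "ev (z * w) v = ev z v * ev w v"
proof -
  obtain P Q where z: "pev Q v \<noteq> 0" "z = pf P / pf Q" "ev z v = pev P v / pev Q v"
    by (rule ev_repr[OF assms(1,3,4)]) blast
  obtain R T where w: "pev T v \<noteq> 0" "w = pf R / pf T" "ev w v = pev R v / pev T v"
    by (rule ev_repr[OF assms(2,3,4)]) blast
  have e: "z * w = pf (P * R) / pf (Q * T)" using z w by simp
  have "pev (Q * T) v \<noteq> 0" using z w by simp
  from ev_eq[OF this, of "P * R"] show ?thesis unfolding e using z w by simp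
qed

lemma ev_pf: "ev (pf P) v = pev P v"
  using ev_eq[of 1 v P] by simp

lemma ev_0 [simp]: "ev 0 v = 0" and ev_1 [simp]: "ev 1 v = 1"
  using ev_pf[of 0] ev_pf[of 1] by simp_all

definition Osec :: "int \<Rightarrow> 'k point set \<Rightarrow> 'k rat set" where
  "Osec b U = {z. \<forall>p\<in>U. z \<in> Oloc J b p}"

definition fn :: "'k point set \<Rightarrow> 'k rat \<Rightarrow> 'k func" where
  "fn U z = (\<lambda>v\<in>\<Union>U. ev z v)"

definition fr :: "int \<Rightarrow> 'k point set \<Rightarrow> 'k func \<Rightarrow> 'k rat" where
  "fr b U f = (THE z. z \<in> Osec b U \<and> f = fn U z)"

lemma fn_apply: "p \<in> U \<Longrightarrow> v \<in> p \<Longrightarrow> fn U z v = ev z v"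
  by (auto simp: fn_def restrict_def)

text \<open>If two fractions over a common denominator differed, the product of the difference of
  numerators, the denominator and a form cutting out a basic subset of \<open>U\<close> would be
  nonzero. It would then be nonvanishing at a point of \<open>U\<close>, where the values
  differ.\<close>

lemma fn_inj:
  assumes U: "zopen X U" "U \<noteq> {}" and zw: "z \<in> Osec b U" "w \<in> Osec b U" "\<And>p v. p \<in> U \<Longrightarrow> v \<in> p \<Longrightarrow> ev z v = ev w v"
  shows "z = w"
proof -
  obtain p where p: "p \<in> U" using U(2) by blast
  have pX: "p \<in> X" using p zopen_subset[OF U(1)] by blast
  have "z \<in> Oloc J b p" "w \<in> Oloc J b p" using zw p by (auto simp: Osec_def)
  then obtain P R Q a c where *: "P \<in> HP J a" "R \<in> HP J (a + b - b)" "Q \<in> HP J c" "nz Q p"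
    "z = pf P / pf Q" "w = pf R / pf Q" by (rule Oloc_common[OF _ _ pX]) blast
  obtain g e where g: "g \<in> HP J e" "nz g p" "\<And>q. q \<in> X \<Longrightarrow> nz g q \<Longrightarrow> q \<in> U"
    by (rule zopen_basis[OF U(1) p]) blast
  have PR: "P - R \<in> HP J a" using * by (intro HP_diff) auto
  have "P - R = 0"
  proof (rule ccontr)
    assume "P - R \<noteq> 0"
    hence "(P - R) * (Q * g) \<noteq> 0" using nz_nonzero[OF *(4) pX] nz_nonzero[OF g(2) pX] by simp
    then obtain q where q: "q \<in> X" "nz ((P - R) * (Q * g)) q"
      using ex_nz[OF HP_mult[OF PR HP_mult[OF *(3) g(1)]]] by blast
    hence qU: "q \<in> U" and nq: "nz Q q" "nz (P - R) q" using g(3) by auto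
    obtain v where v: "v \<in> q" using pt_ne[OF q(1)] by blast
    have "pev Q v \<noteq> 0" using nq v by (auto simp: nz_def)
    hence "pev P v / pev Q v = pev R v / pev Q v" using zw(3)[OF qU v] ev_eq * by metis
    hence "pev (P - R) v = 0" using \<open>pev Q v \<noteq> 0\<close> by simp
    thus False using nq v by (auto simp: nz_def)
  qed
  thus ?thesis using * by simp
qed

lemma fn_tw:
  assumes U: "zopen X U" and z: "z \<in> Osec b U" shows "fn U z \<in> twisting_sections X b U"
  unfolding twisting_sections_def
proof (intro CollectI conjI ballI)
  show "fn U z \<in> extensional (\<Union>U)" by (simp add: fn_def)
  fix p assume p: "p \<in> U"
  have pX: "p \<in> X" using p zopen_subset[OF U(1)] by blast
  have zp: "z \<in> Oloc J b p" using z p by (simp add: Osec_def)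
  obtain P Q a c where z': "P \<in> HP J a" "Q \<in> HP J c" "a - c = b" "nz Q p" "z = pf P / pf Q"
    by (rule OlocE[OF zp])
  obtain i where i: "i \<in> J" "nz (pvar i) p" using ex_pvar[OF pX] .
  \<comment> \<open>A zero numerator may carry a negative degree \<open>a\<close>. Multiplication by
    \<open>pvar i ^ m\<close> makes both degrees natural numbers, as
    \<open>twisting_sections\<close> demands.\<close>
  define m where "m = nat \<bar>b\<bar>"
  define P' Q' where "P' = P * pvar i ^ m" and "Q' = Q * pvar i ^ m"
  have c0: "c \<ge> 0" using HP_deg_nonneg[OF z'(2) nz_nonzero[OF z'(4) pX]] .
  define e where "e = nat c + m"
  define d where "d = nat (c + b + int m)"
  have de: "int d - int e = b" "int e = c + int m" "int d = a + int m" using c0 z'(3) by (auto simp: d_def e_def m_def)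
  have y: "pvar i ^ m \<in> HP J (int m)" using HP_power[OF HP_pvar[OF i(1)], of m] by simp
  have PQ': "P' \<in> HP J (int d)" "Q' \<in> HP J (int e)" "nz Q' p"
    using HP_mult[OF z'(1) y] HP_mult[OF z'(2) y] z'(4) i(2) unfolding P'_def Q'_def de by (auto intro: nz_power)
  obtain A where A: "homogeneous d A" "mpoly_eval A = pev P'"
    using hpoly_UNIV_eval[OF hpoly_mono] PQ'(1) unfolding HP_nat by blast
  obtain B where B: "homogeneous e B" "mpoly_eval B = pev Q'"
    using hpoly_UNIV_eval[OF hpoly_mono] PQ'(2) unfolding HP_nat by blast
  define V where "V = U \<inter> {q \<in> X. nz Q' q}"
  have V: "zopen X V" "p \<in> V" "V \<subseteq> U"
    using zopen_Int[OF U zopen_nz[OF PQ'(2)]] p pX PQ'(3) by (auto simp: V_def)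
  have zPQ: "z = pf P' / pf Q'" using z'(5) i by (simp add: P'_def Q'_def)
  hence "mpoly_eval B v \<noteq> 0 \<and> fn U z v = mpoly_eval A v / mpoly_eval B v" if "v \<in> \<Union>V" for v
  proof -
    have "pev Q' v \<noteq> 0" "v \<in> \<Union>U" using that by (auto simp: V_def nz_def)
    thus ?thesis using ev_eq zPQ by (simp add: fn_def A B)
  qed
  thus "\<exists>V d e P Q. zopen X V \<and> p \<in> V \<and> V \<subseteq> U \<and> homogeneous d P \<and> homogeneous e Q \<and> int d - int e = b \<and>
      (\<forall>v\<in>\<Union>V. mpoly_eval Q v \<noteq> 0 \<and> fn U z v = mpoly_eval P v / mpoly_eval Q v)"
    using V A(1) B(1) de(1) by blast
qed

lemma tw_local:
  assumes U: "zopen X U" "p \<in> U" and f: "f \<in> twisting_sections X b U"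
  shows "\<exists>z V. zopen X V \<and> p \<in> V \<and> V \<subseteq> U \<and> z \<in> Osec b V \<and> (\<forall>q\<in>V. \<forall>v\<in>q. f v = ev z v)"
proof -
  obtain V d e A B where *: "zopen X V" "p \<in> V" "V \<subseteq> U" "homogeneous d A" "homogeneous e B" "int d - int e = b"
    "\<forall>v\<in>\<Union>V. mpoly_eval B v \<noteq> 0 \<and> f v = mpoly_eval A v / mpoly_eval B v"
    using f U(2) unfolding twisting_sections_def by blast
  have VX: "V \<subseteq> X" using zopen_subset[OF *(1)] .
  have "\<exists>P. P \<in> HP J (int d) \<and> (\<forall>q\<in>X. \<forall>v\<in>q. mpoly_eval A v = pev P v)" if hA: "homogeneous d A" for A d
  proof -
    obtain g where g: "g \<in> hpoly J d" "\<forall>q\<in>X. \<forall>v\<in>q. mpoly_eval A v = g v"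
      using pt_red[OF homogeneous_eval_hpoly[OF hA]] by blast
    have "pev (Abs_pfun g) = g" by (rule Abs_pfun_inverse) (rule polyf_mono[OF hpoly_polyf[OF g(1)]], simp)
    thus ?thesis using g by (intro exI[of _ "Abs_pfun g"]) (auto simp: HP_nat)
  qed
  from this[OF *(4)] this[OF *(5)] obtain P Q where
    P: "P \<in> HP J (int d)" "\<forall>q\<in>X. \<forall>v\<in>q. mpoly_eval A v = pev P v"
    and Q: "Q \<in> HP J (int e)" "\<forall>q\<in>X. \<forall>v\<in>q. mpoly_eval B v = pev Q v" by blast
  have nzQ: "nz Q q" if q: "q \<in> V" for q
    unfolding nz_def
  proof
    fix v assume "v \<in> q"
    thus "pev Q v \<noteq> 0" using q *(7) Q(2) VX by (metis UnionI subsetD)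
  qed
  have "pf P / pf Q \<in> Osec b V" unfolding Osec_def using OlocI[OF P(1) Q(1) *(6) nzQ refl] by blast
  moreover have "f v = ev (pf P / pf Q) v" if q: "q \<in> V" "v \<in> q" for q v
  proof -
    have "pev Q v \<noteq> 0" using nzQ[OF q(1)] q(2) by (auto simp: nz_def)
    moreover have "f v = mpoly_eval A v / mpoly_eval B v" "mpoly_eval A v = pev P v" "mpoly_eval B v = pev Q v"
      using q *(7) P(2) Q(2) VX by blast+
    ultimately show ?thesis using ev_eq[of Q v P] by simp
  qed
  ultimately show ?thesis using *(1-3) by blast
qed

text \<open>The local fractions of a section agree on overlaps, and these are never empty, so the
  fraction found at one point represents the section on all of \<open>U\<close>.\<close>

lemma tw_fn:
  assumes U: "zopen X U" "U \<noteq> {}" and f: "f \<in> twisting_sections X b U"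
  shows "\<exists>z\<in>Osec b U. f = fn U z"
proof -
  obtain p where p: "p \<in> U" using U(2) by blast
  obtain z V where z: "zopen X V" "p \<in> V" "V \<subseteq> U" "z \<in> Osec b V" "\<forall>q\<in>V. \<forall>v\<in>q. f v = ev z v"
    using tw_local[OF U(1) p f] by blast
  have key: "z \<in> Oloc J b q \<and> (\<forall>v\<in>q. f v = ev z v)" if q: "q \<in> U" for q
  proof -
    obtain w W where w: "zopen X W" "q \<in> W" "W \<subseteq> U" "w \<in> Osec b W" "\<forall>q\<in>W. \<forall>v\<in>q. f v = ev w v"
      using tw_local[OF U(1) q f] by blast
    have "z = w"
    proof (rule fn_inj[of "V \<inter> W"])
      show "zopen X (V \<inter> W)" using z(1) w(1) by (rule zopen_Int)
      show "V \<inter> W \<noteq> {}" using zopen_irreducible[OF z(1) w(1)] z(2) w(2) by blast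
      show "z \<in> Osec b (V \<inter> W)" "w \<in> Osec b (V \<inter> W)" using z(4) w(4) by (auto simp: Osec_def)
      show "ev z v = ev w v" if "p \<in> V \<inter> W" "v \<in> p" for p v using that z(5) w(5) by (metis IntD1 IntD2)
    qed
    thus ?thesis using w by (auto simp: Osec_def)
  qed
  have "f = fn U z"
  proof
    fix v show "f v = fn U z v"
      using key f unfolding fn_def twisting_sections_def extensional_def by auto
  qed
  thus ?thesis using key by (auto simp: Osec_def)
qed

lemma fr_fn: assumes "zopen X U" "U \<noteq> {}" "z \<in> Osec b U" shows "fr b U (fn U z) = z"
  unfolding fr_def
proof (rule the_equality)
  fix w assume w: "w \<in> Osec b U \<and> fn U z = fn U w"
  show "w = z"
  proof (rule fn_inj[OF assms(1,2)])
    fix p v assume "p \<in> U" "v \<in> p"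
    thus "ev w v = ev z v" using w fn_apply by metis
  qed (use w assms in auto)
qed (use assms in auto)

lemma fr_tw:
  assumes "zopen X U" "U \<noteq> {}" "f \<in> twisting_sections X b U"
  shows "fr b U f \<in> Osec b U" "fn U (fr b U f) = f"
  using tw_fn[OF assms] fr_fn[OF assms(1,2)] by auto

lemma fn_res: "V \<subseteq> U \<Longrightarrow> restrict (fn U z) (\<Union>V) = fn V z"
  by (auto simp: fn_def fun_eq_iff restrict_def)

lemma Osec_mono: "z \<in> Osec b U \<Longrightarrow> V \<subseteq> U \<Longrightarrow> z \<in> Osec b V"
  by (auto simp: Osec_def)

lemma fn_add:
  assumes "U \<subseteq> X" "z \<in> Osec b U" "w \<in> Osec b U" shows "(\<lambda>v\<in>\<Union>U. fn U z v + fn U w v) = fn U (z + w)"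
  using assms ev_add by (fastforce simp: fn_def Osec_def fun_eq_iff restrict_def)

lemma fn_mult:
  assumes "U \<subseteq> X" "z \<in> Osec b U" "w \<in> Osec b' U" shows "(\<lambda>v\<in>\<Union>U. fn U z v * fn U w v) = fn U (z * w)"
  using assms ev_mult by (fastforce simp: fn_def Osec_def fun_eq_iff restrict_def)

lemma fn_0: "(\<lambda>v\<in>\<Union>U. 0) = fn U 0" and fn_1: "(\<lambda>v\<in>\<Union>U. 1) = fn U 1"
  by (auto simp: fn_def fun_eq_iff restrict_def)

lemma Osec_add: "\<lbrakk>U \<subseteq> X; z \<in> Osec b U; w \<in> Osec b U\<rbrakk> \<Longrightarrow> z + w \<in> Osec b U"
  by (auto simp: Osec_def intro: Oloc_add)

lemma Osec_mult: "z \<in> Osec b U \<Longrightarrow> w \<in> Osec b' U \<Longrightarrow> z * w \<in> Osec (b + b') U"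
  by (auto simp: Osec_def intro: Oloc_mult)

lemma Osec_0: "U \<subseteq> X \<Longrightarrow> 0 \<in> Osec b U" and Osec_1: "1 \<in> Osec 0 U"
  by (auto simp: Osec_def Oloc_0 Oloc_1)

end

abbreviation sect_zero ("\<zero>[_,_]") where "\<zero>[F,U] \<equiv> \<zero>\<^bsub>sects F U\<^esub>"
abbreviation sect_add ("(_ \<oplus>[_,_]/ _)" [65, 0, 0, 66] 65) where "s \<oplus>[F,U] t \<equiv> s \<oplus>\<^bsub>sects F U\<^esub> t"
abbreviation sect_minus ("(_ \<ominus>[_,_]/ _)" [65, 0, 0, 66] 65) where "s \<ominus>[F,U] t \<equiv> s \<ominus>\<^bsub>sects F U\<^esub> t"
abbreviation sect_smult ("(_ \<odot>[_,_]/ _)" [70, 0, 0, 71] 70) where "a \<odot>[F,U] s \<equiv> a \<odot>\<^bsub>sects F U\<^esub> s"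

section \<open>Sheaves embedded in a constant group\<close>

text \<open>A sheaf in which restriction between nonempty open sets is injective, with sections
  recorded by their values in one group. The empty set is excluded because restriction to it forgets
  the value. The action \<open>sm\<close> is a parameter so that both \<open>O(b)\<close> and
  sheaves of vectors are covered.\<close>

locale emb = linvar X J for X :: "'k::{alg_closed_field, field_char_0} point set" and J +
  fixes G :: "('k, 'm) mod_sheaf" and kap :: "'k point set \<Rightarrow> 'm \<Rightarrow> 'v::ab_group_add"
    and sm :: "'k rat \<Rightarrow> 'v \<Rightarrow> 'v"
  assumes e_res: "\<lbrakk>zopen X U; zopen X V; V \<subseteq> U; V \<noteq> {}; s \<in> sec G U\<rbrakk> \<Longrightarrow>
      res G U V s \<in> sec G V \<and> kap V (res G U V s) = kap U s"
    and e_inj: "\<lbrakk>zopen X U; U \<noteq> {}; s \<in> sec G U; t \<in> sec G U; kap U s = kap U t\<rbrakk> \<Longrightarrow> s = t"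
    and e_add: "\<lbrakk>zopen X U; U \<noteq> {}; s \<in> sec G U; t \<in> sec G U\<rbrakk> \<Longrightarrow>
      s \<oplus>[G,U] t \<in> sec G U \<and> kap U (s \<oplus>[G,U] t) = kap U s + kap U t"
    and e_zero: "zopen X U \<Longrightarrow> U \<noteq> {} \<Longrightarrow> \<zero>[G,U] \<in> sec G U \<and> kap U \<zero>[G,U] = 0"
    and e_sm: "\<lbrakk>zopen X U; U \<noteq> {}; a \<in> twisting_sections X 0 U; s \<in> sec G U\<rbrakk> \<Longrightarrow>
      a \<odot>[G,U] s \<in> sec G U \<and> kap U (a \<odot>[G,U] s) = sm (fr 0 U a) (kap U s)"
begin

definition gm :: "'k point \<Rightarrow> 'v \<Rightarrow> ('k point set \<times> 'm) set" where
  "gm p z = {(V, t). zopen X V \<and> p \<in> V \<and> t \<in> sec G V \<and> kap V t = z}"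

definition stk :: "'k point \<Rightarrow> 'v set" where
  "stk p = {kap U s |U s. zopen X U \<and> p \<in> U \<and> s \<in> sec G U}"

lemma germ_gm:
  assumes "zopen X U" "p \<in> U" "s \<in> sec G U" shows "germ X G p U s = gm p (kap U s)"
proof -
  have "(\<exists>W. zopen X W \<and> p \<in> W \<and> W \<subseteq> U \<inter> V \<and> res G U W s = res G V W t) \<longleftrightarrow> kap V t = kap U s"
    if V: "zopen X V" "p \<in> V" "t \<in> sec G V" for V t
  proof
    assume "\<exists>W. zopen X W \<and> p \<in> W \<and> W \<subseteq> U \<inter> V \<and> res G U W s = res G V W t"
    then obtain W where W: "zopen X W" "p \<in> W" "W \<subseteq> U" "W \<subseteq> V" "res G U W s = res G V W t" by blast
    have "W \<noteq> {}" using W(2) by blast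
    thus "kap V t = kap U s"
      using e_res[OF assms(1) W(1,3) _ assms(3)] e_res[OF V(1) W(1,4) _ V(3)] W(5) by simp
  next
    assume k: "kap V t = kap U s"
    let ?W = "U \<inter> V"
    have W: "zopen X ?W" "?W \<noteq> {}" using zopen_Int[OF assms(1) V(1)] assms(2) V(2) by auto
    have "res G U ?W s = res G V ?W t"
      using e_res[OF assms(1) W(1) _ W(2) assms(3)] e_res[OF V(1) W(1) _ W(2) V(3)] k
      by (intro e_inj[OF W]) auto
    thus "\<exists>W. zopen X W \<and> p \<in> W \<and> W \<subseteq> U \<inter> V \<and> res G U W s = res G V W t"
      using W(1) assms(2) V(2) by (intro exI[of _ ?W]) auto
  qed
  thus ?thesis unfolding germ_def gm_def by auto
qed

lemma stkE:
  assumes "z \<in> stk p" obtains U s where "zopen X U" "p \<in> U" "s \<in> sec G U" "kap U s = z" "(U, s) \<in> gm p z"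
  using assms by (auto simp: stk_def gm_def)

lemma gm_inj: "z \<in> stk p \<Longrightarrow> gm p z = gm p w \<Longrightarrow> z = w"
  by (erule stkE) (auto simp: gm_def)

lemma carrier_stalk: "p \<in> X \<Longrightarrow> carrier (stalk X G p) = gm p ` stk p"
  unfolding stalk_def stk_def using germ_gm by fastforce

lemma stk_add: assumes "z \<in> stk p" "w \<in> stk p" shows "z + w \<in> stk p"
proof -
  obtain U s where U: "zopen X U" "p \<in> U" "s \<in> sec G U" "kap U s = z" by (rule stkE[OF assms(1)])
  obtain V t where V: "zopen X V" "p \<in> V" "t \<in> sec G V" "kap V t = w" by (rule stkE[OF assms(2)])
  have W: "zopen X (U \<inter> V)" "U \<inter> V \<noteq> {}" using zopen_Int[OF U(1) V(1)] U(2) V(2) by auto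
  have s: "res G U (U \<inter> V) s \<in> sec G (U \<inter> V)" "kap (U \<inter> V) (res G U (U \<inter> V) s) = z"
    using e_res[OF U(1) W(1) _ W(2) U(3)] U(4) by auto
  have t: "res G V (U \<inter> V) t \<in> sec G (U \<inter> V)" "kap (U \<inter> V) (res G V (U \<inter> V) t) = w"
    using e_res[OF V(1) W(1) _ W(2) V(3)] V(4) by auto
  show ?thesis using e_add[OF W s(1) t(1)] s(2) t(2) W(1) U(2) V(2) unfolding stk_def by force
qed

lemma stk_0: assumes "p \<in> X" shows "0 \<in> stk p"
  using e_zero[OF zopen_X] assms zopen_X unfolding stk_def by force

lemma stk_open: assumes "z \<in> stk p" shows "near X p (\<lambda>q. z \<in> stk q)"
  by (rule stkE[OF assms]) (auto simp: stk_def)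

text \<open>The stalk operations are unions over all representatives; every choice contributes the
  same germ, so the union is that germ.\<close>

lemma UN_const2:
  assumes "(U0, s0) \<in> A" "(V0, t0) \<in> B" "\<And>U s V t. (U, s) \<in> A \<Longrightarrow> (V, t) \<in> B \<Longrightarrow> f U s V t = c"
  shows "(\<Union>(U, s)\<in>A. \<Union>(V, t)\<in>B. f U s V t) = c"
proof -
  have "(\<Union>(U, s)\<in>A. \<Union>(V, t)\<in>B. f U s V t) = (\<Union>x\<in>A. \<Union>y\<in>B. c)"
    using assms(3) by (intro SUP_cong refl) (auto simp: case_prod_beta)
  thus ?thesis using assms(1,2) by auto
qed

lemma stalk_add: assumes "z \<in> stk p" "w \<in> stk p" shows "gm p z \<oplus>\<^bsub>stalk X G p\<^esub> gm p w = gm p (z + w)"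
proof -
  obtain U0 s0 where 1: "(U0, s0) \<in> gm p z" by (rule stkE[OF assms(1)])
  obtain V0 t0 where 2: "(V0, t0) \<in> gm p w" by (rule stkE[OF assms(2)])
  show ?thesis unfolding stalk_def ring_record_simps
  proof (simp, rule UN_const2[OF 1 2])
    fix U s V t assume "(U, s) \<in> gm p z" "(V, t) \<in> gm p w"
    hence U: "zopen X U" "p \<in> U" "s \<in> sec G U" "kap U s = z" and V: "zopen X V" "p \<in> V" "t \<in> sec G V" "kap V t = w"
      by (auto simp: gm_def)
    have W: "zopen X (U \<inter> V)" "U \<inter> V \<noteq> {}" using zopen_Int[OF U(1) V(1)] U(2) V(2) by auto
    have s: "res G U (U \<inter> V) s \<in> sec G (U \<inter> V)" "kap (U \<inter> V) (res G U (U \<inter> V) s) = z"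
      using e_res[OF U(1) W(1) _ W(2) U(3)] U(4) by auto
    have t: "res G V (U \<inter> V) t \<in> sec G (U \<inter> V)" "kap (U \<inter> V) (res G V (U \<inter> V) t) = w"
      using e_res[OF V(1) W(1) _ W(2) V(3)] V(4) by auto
    show "germ X G p (U \<inter> V) (res G U (U \<inter> V) s \<oplus>[G,U \<inter> V] res G V (U \<inter> V) t) = gm p (z + w)"
      using e_add[OF W s(1) t(1)] s(2) t(2) U(2) V(2) germ_gm[OF W(1)] by simp
  qed
qed

lemma stalk_zero: assumes "p \<in> X" shows "\<zero>\<^bsub>stalk X G p\<^esub> = gm p 0"
proof -
  have "X \<noteq> {}" using assms by blast
  thus ?thesis using e_zero[OF zopen_X] germ_gm[OF zopen_X assms] unfolding stalk_def by simp
qed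

end

lemma (in linvar) emb_tw: "emb X J (twisting_sheaf X b) (fr b) (*)"
proof
  fix U V s assume *: "zopen X U" "zopen X V" "V \<subseteq> U" "V \<noteq> {}" "s \<in> sec (twisting_sheaf X b) U"
  hence U: "U \<noteq> {}" by blast
  have s: "fr b U s \<in> Osec b U" "fn U (fr b U s) = s" using fr_tw[OF *(1) U, of s b] *(5) by (simp_all add: twisting_sheaf_def)
  have e: "restrict s (\<Union>V) = fn V (fr b U s)" using fn_res[OF *(3), of "fr b U s"] s(2) by simp
  have o: "fr b U s \<in> Osec b V" using Osec_mono[OF s(1) *(3)] .
  show "res (twisting_sheaf X b) U V s \<in> sec (twisting_sheaf X b) V \<and> fr b V (res (twisting_sheaf X b) U V s) = fr b U s"
    using fn_tw[OF *(2) o] fr_fn[OF *(2,4) o] by (simp add: twisting_sheaf_def e)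
next
  fix U s t assume U: "zopen X U" "U \<noteq> {}" and s: "s \<in> sec (twisting_sheaf X b) U" and t: "t \<in> sec (twisting_sheaf X b) U"
  have s': "fr b U s \<in> Osec b U" "fn U (fr b U s) = s" and t': "fr b U t \<in> Osec b U" "fn U (fr b U t) = t"
    using fr_tw[OF U, of _ b] s t by (simp_all add: twisting_sheaf_def)
  show "s = t" if "fr b U s = fr b U t" using s'(2) t'(2) that by metis
  have o: "fr b U s + fr b U t \<in> Osec b U" by (rule Osec_add[OF zopen_subset[OF U(1)] s'(1) t'(1)])
  have "(\<lambda>v\<in>\<Union>U. s v + t v) = fn U (fr b U s + fr b U t)"
    using fn_add[OF zopen_subset[OF U(1)] s'(1) t'(1)] s'(2) t'(2) by simp
  thus "s \<oplus>[twisting_sheaf X b,U] t \<in> sec (twisting_sheaf X b) U \<and>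
      fr b U (s \<oplus>[twisting_sheaf X b,U] t) = fr b U s + fr b U t"
    using fn_tw[OF U(1) o] fr_fn[OF U o] by (simp add: twisting_sheaf_def)
next
  fix U assume U: "zopen X U" "U \<noteq> {}"
  show "\<zero>[twisting_sheaf X b,U] \<in> sec (twisting_sheaf X b) U \<and> fr b U \<zero>[twisting_sheaf X b,U] = 0"
    using fn_tw[OF U(1) Osec_0[OF zopen_subset[OF U(1)]]] fr_fn[OF U Osec_0[OF zopen_subset[OF U(1)]]]
    by (simp add: twisting_sheaf_def fn_0)
next
  fix U a s assume U: "zopen X U" "U \<noteq> {}" and a: "a \<in> twisting_sections X 0 U" and s: "s \<in> sec (twisting_sheaf X b) U"
  have s': "fr b U s \<in> Osec b U" "fn U (fr b U s) = s" using fr_tw[OF U, of s b] s by (simp_all add: twisting_sheaf_def)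
  have a': "fr 0 U a \<in> Osec 0 U" "fn U (fr 0 U a) = a" using fr_tw[OF U a] .
  have o: "fr 0 U a * fr b U s \<in> Osec b U" using Osec_mult[OF a'(1) s'(1)] by simp
  have "(\<lambda>v\<in>\<Union>U. a v * s v) = fn U (fr 0 U a * fr b U s)"
    using fn_mult[OF zopen_subset[OF U(1)] a'(1) s'(1)] s'(2) a'(2) by simp
  thus "a \<odot>[twisting_sheaf X b,U] s \<in> sec (twisting_sheaf X b) U \<and>
      fr b U (a \<odot>[twisting_sheaf X b,U] s) = fr 0 U a * fr b U s"
    using fn_tw[OF U(1) o] fr_fn[OF U o] by (simp add: twisting_sheaf_def)
qed

context linvar begin

definition gO :: "int \<Rightarrow> 'k point \<Rightarrow> 'k rat \<Rightarrow> ('k point set \<times> 'k func) set" where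
  "gO b = emb.gm X (twisting_sheaf X b) (fr b)"

lemma stk_tw: assumes "p \<in> X" shows "emb.stk X (twisting_sheaf X b) (fr b) p = Oloc J b p"
proof -
  interpret T: emb X J "twisting_sheaf X b" "fr b" "(*)" by (rule emb_tw)
  show ?thesis
  proof (intro subset_antisym subsetI)
    fix z assume "z \<in> T.stk p"
    then obtain U f where U: "zopen X U" "p \<in> U" "f \<in> twisting_sections X b U" "fr b U f = z"
      by (rule T.stkE) (simp add: twisting_sheaf_def)
    hence "z \<in> Osec b U" using fr_tw(1)[of U f b] by auto
    thus "z \<in> Oloc J b p" using U(2) by (simp add: Osec_def)
  next
    fix z assume z: "z \<in> Oloc J b p"
    obtain g c where g: "g \<in> HP J c" "nz g p" "\<And>q. q \<in> X \<Longrightarrow> nz g q \<Longrightarrow> z \<in> Oloc J b q"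
      by (rule Oloc_open[OF z assms]) blast
    define V where "V = {q \<in> X. nz g q}"
    have V: "zopen X V" "p \<in> V" "V \<noteq> {}" using zopen_nz[OF g(1)] assms g(2) by (auto simp: V_def)
    have o: "z \<in> Osec b V" using g(3) by (auto simp: Osec_def V_def)
    show "z \<in> T.stk p" unfolding T.stk_def using V(1,2) fn_tw[OF V(1) o] fr_fn[OF V(1,3) o]
      by (intro CollectI exI[of _ V] exI[of _ "fn V z"]) (simp add: twisting_sheaf_def)
  qed
qed

lemma carrier_stalk_O: "p \<in> X \<Longrightarrow> carrier (stalk X (twisting_sheaf X b) p) = gO b p ` Oloc J b p"
  using emb.carrier_stalk[OF emb_tw] stk_tw by (simp add: gO_def)

lemma gO_inj: "\<lbrakk>p \<in> X; z \<in> Oloc J b p; gO b p z = gO b p w\<rbrakk> \<Longrightarrow> z = w"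
  using emb.gm_inj[OF emb_tw] stk_tw by (metis gO_def)

lemma gO_mem: "(U, f) \<in> gO b p z \<longleftrightarrow> zopen X U \<and> p \<in> U \<and> f \<in> twisting_sections X b U \<and> fr b U f = z"
  unfolding gO_def emb.gm_def[OF emb_tw] by (simp add: twisting_sheaf_def)

lemma gO_ne: assumes "p \<in> X" "z \<in> Oloc J b p" shows "\<exists>U f. (U, f) \<in> gO b p z"
  using assms emb.stkE[OF emb_tw] stk_tw by (metis gO_def)

lemma germ_O: "\<lbrakk>zopen X U; p \<in> U; f \<in> twisting_sections X b U\<rbrakk> \<Longrightarrow> germ X (twisting_sheaf X b) p U f = gO b p (fr b U f)"
  using emb.germ_gm[OF emb_tw, of U p f b] by (simp add: gO_def twisting_sheaf_def)

lemma stalk_add_O: "\<lbrakk>p \<in> X; z \<in> Oloc J b p; w \<in> Oloc J b p\<rbrakk> \<Longrightarrow>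
    gO b p z \<oplus>\<^bsub>stalk X (twisting_sheaf X b) p\<^esub> gO b p w = gO b p (z + w)"
  using emb.stalk_add[OF emb_tw] stk_tw by (metis gO_def)

lemma stalk_zero_O: "p \<in> X \<Longrightarrow> \<zero>\<^bsub>stalk X (twisting_sheaf X b) p\<^esub> = gO b p 0"
  using emb.stalk_zero[OF emb_tw] by (metis gO_def)

end

context emb begin

lemma stk_sm: assumes "p \<in> X" "a \<in> Oloc J 0 p" "z \<in> stk p" shows "sm a z \<in> stk p"
  and stalk_smult: "gO 0 p a \<odot>\<^bsub>stalk X G p\<^esub> gm p z = gm p (sm a z)"
proof -
  obtain U0 a0 where 1: "(U0, a0) \<in> gO 0 p a" using gO_ne[OF assms(1,2)] by blast
  obtain V0 t0 where 2: "(V0, t0) \<in> gm p z" by (rule stkE[OF assms(3)])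
  have *: "zopen X (U \<inter> V) \<and> (restrict c (\<Union>(U \<inter> V)) \<odot>[G,U \<inter> V] res G V (U \<inter> V) t) \<in> sec G (U \<inter> V) \<and>
      kap (U \<inter> V) (restrict c (\<Union>(U \<inter> V)) \<odot>[G,U \<inter> V] res G V (U \<inter> V) t) = sm a z \<and> p \<in> U \<inter> V"
    if "(U, c) \<in> gO 0 p a" "(V, t) \<in> gm p z" for U c V t
  proof -
    from that have U: "zopen X U" "p \<in> U" "c \<in> twisting_sections X 0 U" "fr 0 U c = a"
      and V: "zopen X V" "p \<in> V" "t \<in> sec G V" "kap V t = z" by (auto simp: gm_def gO_mem)
    have W: "zopen X (U \<inter> V)" "U \<inter> V \<noteq> {}" using zopen_Int[OF U(1) V(1)] U(2) V(2) by auto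
    have c: "restrict c (\<Union>(U \<inter> V)) \<in> twisting_sections X 0 (U \<inter> V)" "fr 0 (U \<inter> V) (restrict c (\<Union>(U \<inter> V))) = a"
      using emb.e_res[OF emb_tw U(1) W(1) _ W(2), of c 0] U(3,4) by (auto simp: twisting_sheaf_def)
    have t: "res G V (U \<inter> V) t \<in> sec G (U \<inter> V)" "kap (U \<inter> V) (res G V (U \<inter> V) t) = z"
      using e_res[OF V(1) W(1) _ W(2) V(3)] V(4) by auto
    show ?thesis using e_sm[OF W c(1) t(1)] c(2) t(2) W(1) U(2) V(2) by simp
  qed
  show "sm a z \<in> stk p" using *[OF 1 2] unfolding stk_def by force
  show "gO 0 p a \<odot>\<^bsub>stalk X G p\<^esub> gm p z = gm p (sm a z)"
    unfolding stalk_def ring_record_simps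
  proof (simp, rule UN_const2[OF 1 2])
    fix U c V t assume "(U, c) \<in> gO 0 p a" "(V, t) \<in> gm p z"
    from *[OF this] show "germ X G p (U \<inter> V) (res (structure_sheaf X) U (U \<inter> V) c \<odot>[G,U \<inter> V] res G V (U \<inter> V) t) =
        gm p (sm a z)"
      using germ_gm[of "U \<inter> V" p] by (simp add: twisting_sheaf_def)
  qed
qed

end

lemma (in linvar) stalk_smult_O: "\<lbrakk>p \<in> X; a \<in> Oloc J 0 p; z \<in> Oloc J b p\<rbrakk> \<Longrightarrow>
    gO 0 p a \<odot>\<^bsub>stalk X (twisting_sheaf X b) p\<^esub> gO b p z = gO b p (a * z)"
  using emb.stalk_smult[OF emb_tw, of p a z b] stk_tw by (simp add: gO_def)

section \<open>Tensor products of sheaves\<close>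

text \<open>Additive extension of \<open>f\<close> to formal sums of pairs. Its values on the tensor
  relations can be computed, which is the means of telling tensors apart.\<close>

definition bieval :: "('m \<Rightarrow> 'n \<Rightarrow> nat \<Rightarrow> 'a::comm_ring_1) \<Rightarrow> ('m \<times> 'n \<Rightarrow>\<^sub>0 int) \<Rightarrow> nat \<Rightarrow> 'a" where
  "bieval f c = (\<lambda>i. \<Sum>x\<in>keys c. of_int (lookup c x) * f (fst x) (snd x) i)"

lemma bieval_superset:
  assumes "finite A" "keys c \<subseteq> A"
  shows "bieval f c i = (\<Sum>x\<in>A. of_int (lookup c x) * f (fst x) (snd x) i)"
  unfolding bieval_def using assms by (intro sum.mono_neutral_left) (auto simp: in_keys_iff)

lemma bieval_add: "bieval f (c + d) = bieval f c + bieval f d"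
proof
  fix i
  let ?A = "keys c \<union> keys d"
  have "keys (c + d) \<subseteq> ?A" by (rule Poly_Mapping.keys_add)
  thus "bieval f (c + d) i = (bieval f c + bieval f d) i"
    by (simp add: bieval_superset[of ?A] lookup_add distrib_right sum.distrib)
qed

lemma bieval_uminus: "bieval f (- c) = - bieval f c"
  by (simp add: bieval_def fun_eq_iff sum_negf)

lemma bieval_diff: "bieval f (c - d) = bieval f c - bieval f d"
  using bieval_add[of f c "- d"] bieval_uminus[of f d] by simp

lemma bieval_0 [simp]: "bieval f 0 = 0"
  by (simp add: bieval_def fun_eq_iff)

lemma bieval_frag_of [simp]: "bieval f (frag_of (x, y)) = f x y"
  by (simp add: bieval_def fun_eq_iff)

lemma emb_stalks:
  assumes "emb X J F kap vs" shows "stalks X J (emb.stk X F kap)"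
proof -
  interpret emb X J F kap vs by fact
  show ?thesis
    by unfold_locales (use stk_0 stk_add stk_sm stk_open in auto)
qed

text \<open>
  The sheaf \<open>tensor_sheaf X F Y (twisting_sheaf Y t)\<close>, where \<open>Y = X\<close> or \<open>Y\<close> is a hyperplane of \<open>X\<close>:
  its stalk at \<open>p\<close> is \<open>St t p\<close> modulo \<open>B p\<close>.
\<close>

locale tsheaf = emb X J F kap vs + Y: linvar Y J'
  for X :: "'k::{alg_closed_field, field_char_0} point set" and J and F :: "('k, 'm) mod_sheaf"
    and kap :: "'k point set \<Rightarrow> 'm \<Rightarrow> nat \<Rightarrow> 'k rat" and Y :: "'k point set" and J' +
  fixes t :: int and rd :: "'k rat \<Rightarrow> 'k rat" and B :: "'k point \<Rightarrow> (nat \<Rightarrow> 'k rat) set"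
  assumes YX: "Y \<subseteq> X" and JJ: "J' \<subseteq> J"
    and open_Y: "zopen X U \<Longrightarrow> zopen Y (U \<inter> Y)"
    and rd_O: "p \<in> Y \<Longrightarrow> f \<in> Oloc J 0 p \<Longrightarrow> rd f \<in> Oloc J' 0 p"
    and rd_ev: "\<lbrakk>p \<in> Y; f \<in> Oloc J 0 p; v \<in> p\<rbrakk> \<Longrightarrow> ev (rd f) v = ev f v"
    and rd_id: "p \<in> Y \<Longrightarrow> f \<in> Oloc J' 0 p \<Longrightarrow> rd f = f"
    and B_0: "p \<in> Y \<Longrightarrow> 0 \<in> B p" and B_add: "\<lbrakk>p \<in> Y; z \<in> B p; w \<in> B p\<rbrakk> \<Longrightarrow> z + w \<in> B p"
    and B_uminus: "p \<in> Y \<Longrightarrow> z \<in> B p \<Longrightarrow> - z \<in> B p"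
    and B_rd: "\<lbrakk>p \<in> Y; a \<in> Oloc J 0 p; g \<in> Oloc J' t p; z \<in> stk p\<rbrakk> \<Longrightarrow> vs ((a - rd a) * g) z \<in> B p"
    and B_ker: "\<lbrakk>p \<in> Y; i \<in> J'; nz (pvar i) p; m \<in> stk p; vs (pf (pvar i) powi t) m \<in> B p\<rbrakk> \<Longrightarrow>
      \<exists>u\<in>Oloc J 0 p. \<exists>m'\<in>stk p. m = vs u m' \<and> rd u = 0"
begin

sublocale S: stalks X J stk
  by (rule emb_stalks) (rule emb_axioms)

lemma YinX: "p \<in> Y \<Longrightarrow> p \<in> X" using YX by blast
lemma OJ: "f \<in> Oloc J' b p \<Longrightarrow> f \<in> Oloc J b p" by (erule Oloc_mono) (rule JJ)

definition yi :: "'k point \<Rightarrow> nat" where "yi p = (SOME i. i \<in> J' \<and> nz (pvar i :: 'k pfun) p)"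
definition y :: "'k point \<Rightarrow> 'k rat" where "y p = pf (pvar (yi p)) powi t"

lemma yi: assumes "p \<in> Y" shows "yi p \<in> J'" "nz (pvar (yi p)) p"
proof -
  have "\<exists>i. i \<in> J' \<and> nz (pvar i :: 'k pfun) p" using Y.ex_pvar[OF assms] by blast
  from someI_ex[OF this] show "yi p \<in> J'" "nz (pvar (yi p)) p" unfolding yi_def by auto
qed

lemma y_O: "p \<in> Y \<Longrightarrow> y p \<in> Oloc J' t p"
  unfolding y_def using Y.Oloc_powi[OF HP_pvar] yi by blast

lemma y_nz: "y p \<noteq> 0" by (simp add: y_def)

lemma y_div: assumes "p \<in> Y" "g \<in> Oloc J' t p" shows "g / y p \<in> Oloc J' 0 p"
proof -
  have "pf (pvar (yi p)) powi (- t) \<in> Oloc J' (- t) p" using Y.Oloc_powi[OF HP_pvar] yi[OF assms(1)] by blast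
  from Y.Oloc_mult[OF assms(2) this] show ?thesis by (simp add: y_def power_int_minus field_simps)
qed

lemma St_y: assumes "p \<in> Y" shows "S.St t p = vs (y p) ` stk p"
proof -
  have *: "z \<in> S.St t p \<longleftrightarrow> vs (1 / y p) z \<in> stk p" for z
    using S.St_iff[OF YinX[OF assms] HP_pvar[of "yi p" J] yi(2)[OF assms], of z t] yi(1)[OF assms] JJ
    by (auto simp: y_def power_int_minus inverse_eq_divide)
  show ?thesis
  proof (intro subset_antisym subsetI)
    fix z assume "z \<in> S.St t p"
    thus "z \<in> vs (y p) ` stk p" using * y_nz[of p] by (intro image_eqI[of _ _ "vs (1 / y p) z"]) auto
  next
    fix z assume "z \<in> vs (y p) ` stk p"
    then obtain w where w: "w \<in> stk p" "z = vs (y p) w" by blast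
    have "vs (1 / y p) z = w" unfolding w(2) using y_nz[of p] by simp
    thus "z \<in> S.St t p" using * w(1) by metis
  qed
qed

text \<open>\<open>rd\<close> keeps the value at each vector over \<open>Y\<close>, so restricting
  the function amounts to applying \<open>rd\<close> to its fraction.\<close>

lemma germ_restriction_gO:
  assumes "p \<in> Y" "a \<in> Oloc J 0 p" shows "germ_restriction X Y p (gO 0 p a) = Y.gO 0 p (rd a)"
proof -
  have "germ Y (structure_sheaf Y) p (U \<inter> Y) (restrict f (\<Union>(U \<inter> Y))) = Y.gO 0 p (rd a)" if "(U, f) \<in> gO 0 p a" for U f
  proof -
    from that have U: "zopen X U" "p \<in> U" "f \<in> twisting_sections X 0 U" "fr 0 U f = a" by (auto simp: gO_mem)
    hence "U \<noteq> {}" by blast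
    from fr_tw[OF U(1) this U(3)] have f: "a \<in> Osec 0 U" "f = fn U a" unfolding U(4) by (auto simp only:)
    have W: "zopen Y (U \<inter> Y)" "U \<inter> Y \<noteq> {}" using open_Y[OF U(1)] U(2) assms(1) by auto
    have aq: "a \<in> Oloc J 0 q" if "q \<in> U \<inter> Y" for q using f(1) that by (auto simp: Osec_def)
    have o: "rd a \<in> Y.Osec 0 (U \<inter> Y)" using rd_O[OF _ aq] by (auto simp: Y.Osec_def)
    have "restrict f (\<Union>(U \<inter> Y)) = Y.fn (U \<inter> Y) (rd a)"
    proof
      fix v show "restrict f (\<Union>(U \<inter> Y)) v = Y.fn (U \<inter> Y) (rd a) v"
      proof (cases "v \<in> \<Union>(U \<inter> Y)")
        case True
        then obtain q where q: "q \<in> U \<inter> Y" "v \<in> q" by blast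
        hence "f v = ev a v" using f(2) fn_apply by auto
        thus ?thesis using True rd_ev[OF _ aq[OF q(1)] q(2)] q Y.fn_apply[OF q] by auto
      qed (simp add: Y.fn_def)
    qed
    thus ?thesis using Y.germ_O[OF W(1), of p] Y.fn_tw[OF W(1) o] Y.fr_fn[OF W o] U(2) assms(1) by simp
  qed
  moreover obtain U f where "(U, f) \<in> gO 0 p a" using gO_ne[OF YinX[OF assms(1)] assms(2)] by blast
  ultimately show ?thesis unfolding germ_restriction_def by (auto simp: case_prod_beta)
qed

abbreviation Tp where "Tp p \<equiv> stalk_tensor X F Y (twisting_sheaf Y t) p"

abbreviation TT where "TT \<equiv> tensor_sheaf X F Y (twisting_sheaf Y t)"

context fixes p assumes p: "p \<in> Y" begin

abbreviation "FR \<equiv> stalk X (structure_sheaf X) p"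
abbreviation "FM \<equiv> stalk X F p"
abbreviation "FN \<equiv> stalk Y (twisting_sheaf Y t) p"
abbreviation "SMN \<equiv> carrier FM \<times> carrier FN"
abbreviation "gr \<equiv> germ_restriction X Y p"
abbreviation "gR \<equiv> gO 0 p"
abbreviation "gM \<equiv> gm p"
abbreviation "gN \<equiv> Y.gO t p"
abbreviation "SR \<equiv> Oloc J 0 p"
abbreviation "SM \<equiv> stk p"
abbreviation "SN \<equiv> Oloc J' t p"
abbreviation "ST \<equiv> S.St t p"
abbreviation "yp \<equiv> y p"

text \<open>Since \<open>O(t)\<close> is generated by \<open>y p\<close> at \<open>p\<close>, every tensor is congruent to one of the form \<open>z \<otimes> y p\<close>.\<close>

definition "KT = tensor_relations FR gr FM FN"
definition "fg z g = frag_of (gM z, gN g)"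
definition "coset c = (\<lambda>h. h + c) ` KT"
definition "tzp z = coset (fg (vs (1 / yp) z) yp)"

lemmas cR = carrier_stalk_O[OF YinX[OF p], of 0] and cM = carrier_stalk[OF YinX[OF p]] and cN = Y.carrier_stalk_O[OF p, of t]
  and addM = stalk_add[of _ p] and addN = Y.stalk_add_O[OF p, of _ t] and smM = stalk_smult[OF YinX[OF p]]
  and SM_0 = stk_0[OF YinX[OF p]] and SM_add = stk_add[of _ p] and SM_uminus = S.S_uminus[OF YinX[OF p]]
  and SM_vs = stk_sm(1)[OF YinX[OF p]] and SN_0 = Y.Oloc_0[OF p, of t] and e_SN = y_O[OF p] and e_nz = y_nz[of p]
  and ST_def = St_y[OF p] and B_kerp = B_ker[OF p yi[OF p], folded y_def]

lemma injM: "inj_on gM SM" by (rule inj_onI) (rule gm_inj)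
lemma injN: "inj_on gN SN" by (rule inj_onI) (rule Y.gO_inj[OF p])
lemma SN_add: "g \<in> SN \<Longrightarrow> h \<in> SN \<Longrightarrow> g + h \<in> SN" by (rule Y.Oloc_add[OF _ _ p])
lemma SN_rd: "a \<in> SR \<Longrightarrow> g \<in> SN \<Longrightarrow> rd a * g \<in> SN" using Y.Oloc_mult[OF rd_O[OF p]] by simp
lemma smN: "a \<in> SR \<Longrightarrow> g \<in> SN \<Longrightarrow> gr (gR a) \<odot>\<^bsub>FN\<^esub> gN g = gN (rd a * g)"
  unfolding germ_restriction_gO[OF p] by (rule Y.stalk_smult_O[OF p rd_O[OF p]])
lemma e_gen: "g \<in> SN \<Longrightarrow> g / yp \<in> SR \<and> rd (g / yp) = g / yp"
  using y_div[OF p] OJ rd_id[OF p] by blast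

definition gens where
  "gens = {frag_of (x \<oplus>\<^bsub>FM\<^esub> y, z) - frag_of (x, z) - frag_of (y, z) |x y z.
        x \<in> carrier FM \<and> y \<in> carrier FM \<and> z \<in> carrier FN} \<union>
     {frag_of (x, y \<oplus>\<^bsub>FN\<^esub> z) - frag_of (x, y) - frag_of (x, z) |x y z.
        x \<in> carrier FM \<and> y \<in> carrier FN \<and> z \<in> carrier FN} \<union>
     {frag_of (a \<odot>\<^bsub>FM\<^esub> x, z) - frag_of (x, gr a \<odot>\<^bsub>FN\<^esub> z) |a x z.
        a \<in> carrier FR \<and> x \<in> carrier FM \<and> z \<in> carrier FN}"

lemma gens_cases [consumes 1, case_names 1 2 3]:
  assumes "c \<in> gens"
  obtains z w g where "z \<in> SM" "w \<in> SM" "g \<in> SN" "c = fg (z + w) g - fg z g - fg w g"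
  | z g h where "z \<in> SM" "g \<in> SN" "h \<in> SN" "c = fg z (g + h) - fg z g - fg z h"
  | a z g where "a \<in> SR" "z \<in> SM" "g \<in> SN" "c = fg (vs a z) g - fg z (rd a * g)"
  using assms unfolding gens_def fg_def cM cN cR by (auto simp: addM addN smM smN)

lemma fg_gens:
  "\<lbrakk>z \<in> SM; w \<in> SM; g \<in> SN\<rbrakk> \<Longrightarrow> fg (z + w) g - fg z g - fg w g \<in> gens"
  "\<lbrakk>z \<in> SM; g \<in> SN; h \<in> SN\<rbrakk> \<Longrightarrow> fg z (g + h) - fg z g - fg z h \<in> gens"
  "\<lbrakk>a \<in> SR; z \<in> SM; g \<in> SN\<rbrakk> \<Longrightarrow> fg (vs a z) g - fg z (rd a * g) \<in> gens"
proof -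
  assume *: "z \<in> SM" "w \<in> SM" "g \<in> SN"
  show "fg (z + w) g - fg z g - fg w g \<in> gens"
    unfolding gens_def fg_def using * addM[OF *(1,2)] cM cN
    by (intro UnI1 CollectI exI[of _ "gM z"] exI[of _ "gM w"] exI[of _ "gN g"]) auto
next
  assume *: "z \<in> SM" "g \<in> SN" "h \<in> SN"
  show "fg z (g + h) - fg z g - fg z h \<in> gens"
    unfolding gens_def fg_def using * addN[OF *(2,3)] cM cN
    by (intro UnI1[OF UnI2] CollectI exI[of _ "gM z"] exI[of _ "gN g"] exI[of _ "gN h"]) auto
next
  assume *: "a \<in> SR" "z \<in> SM" "g \<in> SN"
  show "fg (vs a z) g - fg z (rd a * g) \<in> gens"
    unfolding gens_def fg_def using * smM[OF *(1,2)] smN[OF *(1,3)] cM cN cR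
    by (intro UnI2 CollectI exI[of _ "gR a"] exI[of _ "gM z"] exI[of _ "gN g"]) auto
qed

lemma fg_S: "z \<in> SM \<Longrightarrow> g \<in> SN \<Longrightarrow> keys (fg z g) \<subseteq> SMN"
  by (simp add: fg_def cM cN)

lemma keys_diff_S: "keys c \<subseteq> SMN \<Longrightarrow> keys d \<subseteq> SMN \<Longrightarrow> keys (c - d) \<subseteq> SMN"
  
  using keys_diff[of c d] by blast

lemma gens_S: assumes "c \<in> gens" shows "keys c \<subseteq> SMN"
  using assms
proof (cases rule: gens_cases)
  case (1 z w g)
  show ?thesis unfolding 1(4) by (intro keys_diff_S fg_S SM_add 1)
next
  case (2 z g h)
  show ?thesis unfolding 2(4) by (intro keys_diff_S fg_S SN_add 2)
next
  case (3 a z g)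
  show ?thesis unfolding 3(4) by (intro keys_diff_S fg_S SM_vs SN_rd 3)
qed

lemma KT_gen: "KT = generate (free_Abelian_group SMN) gens"
  unfolding KT_def tensor_relations_def gens_def ..

lemma K_induct [consumes 1, case_names zero gen diff]:
  assumes "c \<in> KT" "P 0" "\<And>c. c \<in> gens \<Longrightarrow> P c" "\<And>c d. P c \<Longrightarrow> P d \<Longrightarrow> P (c - d)"
  shows "P c"
proof -
  have neg: "P (- c)" if "P c" for c using assms(4)[OF assms(2) that] by simp
  have "c \<in> generate (free_Abelian_group SMN) gens"
    using assms(1) unfolding KT_gen .
  thus ?thesis
  proof (induction rule: generate.induct)
    case (inv h)
    thus ?case using gens_S neg assms(3) by simp
  next
    case (eng c d)
    thus ?case using assms(4)[OF _ neg, of c d] by simp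
  qed (use assms in auto)
qed

lemma K_gens: "c \<in> gens \<Longrightarrow> c \<in> KT"
  unfolding KT_gen by (rule generate.incl)

lemma K_0: "0 \<in> KT"
  using generate.one[of "free_Abelian_group SMN" gens] unfolding KT_gen by simp

lemma K_add: "c \<in> KT \<Longrightarrow> d \<in> KT \<Longrightarrow> c + d \<in> KT"
  using generate.eng[of c "free_Abelian_group SMN" gens d] unfolding KT_gen by simp

lemma K_uminus: assumes "c \<in> KT" shows "- c \<in> KT"
proof -
  have "- c \<in> KT \<and> c \<in> KT" using assms
  proof (induction c rule: K_induct)
    case (gen c)
    have "inv\<^bsub>free_Abelian_group SMN\<^esub> c \<in> KT"
      using gen unfolding KT_gen by (rule generate.inv)
    thus ?case using gens_S[OF gen] K_gens[OF gen] by simp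
  next
    case (diff c d)
    thus ?case using K_add[of c "- d"] K_add[of "- c" d] by (simp add: add.commute)
  qed (use K_0 in auto)
  thus ?thesis by blast
qed

lemma K_diff: "c \<in> KT \<Longrightarrow> d \<in> KT \<Longrightarrow> c - d \<in> KT"
  using K_add[of c "- d"] K_uminus[of d] by simp

definition tval where "tval = bieval (\<lambda>x y. vs (the_inv_into SN gN y) (the_inv_into SM gM x))"

lemma tval_fg: "z \<in> SM \<Longrightarrow> g \<in> SN \<Longrightarrow> tval (fg z g) = vs g z"
  using the_inv_into_f_f[OF injM] the_inv_into_f_f[OF injN] by (simp add: tval_def fg_def)

lemma tval_diff: "tval (c - d) = tval c - tval d"
  by (simp add: tval_def bieval_diff)

text \<open>The additivity relations evaluate to 0. Moving a scalar across the tensor sign changes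
  the value by \<open>vs ((a - rd a) * g) z\<close>, which lies in \<open>B p\<close> by
  \<open>B_rd\<close>.\<close>

lemma tval_K: assumes "c \<in> KT" shows "tval c \<in> B p"
  using assms
proof (induction c rule: K_induct)
  case zero
  show ?case unfolding tval_def bieval_0 by (rule B_0[OF p])
next
  case (gen c)
  thus ?case
  proof (cases rule: gens_cases)
    case (1 z w g)
    hence "tval c = 0" using tval_fg SM_add by (simp add: tval_diff vs_add)
    thus ?thesis using B_0[OF p] by metis
  next
    case (2 z g h)
    hence "tval c = 0" using tval_fg SN_add by (simp add: tval_diff vs_add_left)
    thus ?thesis using B_0[OF p] by metis
  next
    case (3 a z g)
    have "tval c = tval (fg (vs a z) g) - tval (fg z (rd a * g))" unfolding 3(4) by (rule tval_diff)
    also have "\<dots> = vs ((a - rd a) * g) z"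
    proof -
      have "(a - rd a) * g = g * a - rd a * g" by (simp add: algebra_simps)
      thus ?thesis unfolding tval_fg[OF SM_vs[OF 3(1,2)] 3(3)] tval_fg[OF 3(2) SN_rd[OF 3(1,3)]]
        by (simp add: vs_diff_left)
    qed
    finally show ?thesis using B_rd[OF p 3(1,3,2)] by simp
  qed
next
  case (diff c d)
  hence "tval c - tval d \<in> B p" using B_add[OF p diff(1) B_uminus[OF p diff(2)]] by simp
  thus ?case by (metis tval_diff)
qed

lemma fg_0_left: "g \<in> SN \<Longrightarrow> fg 0 g \<in> KT"
  using K_uminus[OF K_gens[OF fg_gens(1)[OF SM_0 SM_0]]] by simp

lemma fg_0_right: "z \<in> SM \<Longrightarrow> fg z 0 \<in> KT"
  using K_uminus[OF K_gens[OF fg_gens(2)[OF _ SN_0 SN_0]]] by simp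

lemma fg_diff: assumes "z \<in> SM" "w \<in> SM" "g \<in> SN" shows "fg z g - fg w g - fg (z - w) g \<in> KT"
proof -
  have d: "z - w \<in> SM" using SM_add[OF assms(1) SM_uminus[OF assms(2)]] by simp
  have "fg z g - fg (z - w) g - fg w g \<in> KT" using K_gens[OF fg_gens(1)[OF d assms(2,3)]] by simp
  thus ?thesis by (simp add: algebra_simps)
qed

lemma fg_vs: "\<lbrakk>a \<in> SR; z \<in> SM; g \<in> SN\<rbrakk> \<Longrightarrow> fg (vs a z) g - fg z (rd a * g) \<in> KT"
  by (rule K_gens[OF fg_gens(3)])

lemma fg_e: assumes "z \<in> SM" "g \<in> SN" shows "fg z g - fg (vs (g / yp) z) yp \<in> KT" "vs (g / yp) z \<in> SM"
proof -
  have g: "g / yp \<in> SR" "rd (g / yp) * yp = g" using e_gen[OF assms(2)] e_nz by auto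
  show "vs (g / yp) z \<in> SM" by (rule SM_vs[OF g(1) assms(1)])
  show "fg z g - fg (vs (g / yp) z) yp \<in> KT" using K_uminus[OF fg_vs[OF g(1) assms(1) e_SN]] g(2) by simp
qed

lemma reduce:
  assumes "keys c \<subseteq> SMN" shows "\<exists>z\<in>SM. c - fg z yp \<in> KT"
  using assms
proof (induction c rule: frag_induction)
  case zero
  have "0 - fg 0 yp \<in> KT" using K_diff[OF K_0 fg_0_left[OF e_SN]] .
  thus ?case using SM_0 by (rule bexI)
next
  case (one x)
  then obtain z g where "z \<in> SM" "g \<in> SN" "frag_of x = fg z g" unfolding fg_def cM cN by auto
  thus ?case using fg_e[of z g] by (intro bexI[of _ "vs (g / yp) z"]) auto
next
  case (diff a b)
  then obtain z w where z: "z \<in> SM" "a - fg z yp \<in> KT" "w \<in> SM" "b - fg w yp \<in> KT" by blast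
  have d: "z - w \<in> SM" using SM_add[OF z(1) SM_uminus[OF z(3)]] by simp
  have "(a - fg z yp) - (b - fg w yp) + (fg z yp - fg w yp - fg (z - w) yp) \<in> KT"
    by (intro K_add K_diff z fg_diff e_SN)
  moreover have "(a - fg z yp) - (b - fg w yp) + (fg z yp - fg w yp - fg (z - w) yp) = (a - b) - fg (z - w) yp"
    by (simp add: algebra_simps)
  ultimately have "(a - b) - fg (z - w) yp \<in> KT" by metis
  thus ?case using d by (rule bexI)
qed

text \<open>Evaluation gives one direction. For the other, \<open>B_ker\<close> writes the
  difference as \<open>vs u m\<close> with \<open>rd u = 0\<close>, and moving \<open>u\<close>
  across the tensor sign leaves a tensor with 0.\<close>

lemma fg_eq_iff: assumes "z \<in> SM" "w \<in> SM" shows "fg z yp - fg w yp \<in> KT \<longleftrightarrow> vs yp (z - w) \<in> B p"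
proof
  assume "fg z yp - fg w yp \<in> KT"
  from tval_K[OF this] show "vs yp (z - w) \<in> B p"
    unfolding tval_diff tval_fg[OF assms(1) e_SN] tval_fg[OF assms(2) e_SN] vs_diff .
next
  have d: "z - w \<in> SM" using SM_add[OF assms(1) SM_uminus[OF assms(2)]] by simp
  assume "vs yp (z - w) \<in> B p"
  from B_kerp[OF d this] obtain u m where u: "u \<in> SR" "m \<in> SM" "z - w = vs u m" "rd u = 0" by blast
  have "fg (z - w) yp - fg m 0 \<in> KT" using fg_vs[OF u(1,2) e_SN] u(3,4) by simp
  from K_add[OF this fg_0_right[OF u(2)]] have "fg (z - w) yp \<in> KT" by simp
  from K_add[OF fg_diff[OF assms e_SN] this] show "fg z yp - fg w yp \<in> KT" by simp
qed

lemma coset_eq_iff: "coset c = coset d \<longleftrightarrow> c - d \<in> KT"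
proof
  assume "coset c = coset d"
  moreover have "c \<in> coset c" unfolding coset_def using K_0 by (intro image_eqI[of _ _ 0]) auto
  ultimately obtain h where "h \<in> KT" "c = h + d" unfolding coset_def by blast
  thus "c - d \<in> KT" by simp
next
  have *: "coset c \<subseteq> coset d" if "c - d \<in> KT" for c d
  proof
    fix x assume "x \<in> coset c"
    then obtain h where h: "h \<in> KT" "x = h + c" unfolding coset_def by blast
    hence "h + (c - d) \<in> KT" using that by (intro K_add)
    thus "x \<in> coset d" unfolding coset_def h(2) by (intro image_eqI[of _ _ "h + (c - d)"]) auto
  qed
  assume "c - d \<in> KT"
  thus "coset c = coset d" using *[of c d] *[of d c] K_uminus[of "c - d"] by auto
qed

lemma r_coset_coset: "KT #>\<^bsub>free_Abelian_group SMN\<^esub> c = coset c"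
  by (auto simp: r_coset_def coset_def)

lemma ST_SM: "z \<in> ST \<Longrightarrow> vs (1 / yp) z \<in> SM"
  using e_nz by (auto simp: ST_def)

lemma ST_vs: "z \<in> SM \<Longrightarrow> vs yp z \<in> ST" by (simp add: ST_def)

lemma carrier_Tp: "carrier (Tp p) = tzp ` ST"
proof -
  have "carrier (Tp p) = coset ` {c. keys c \<subseteq> SMN}"
    unfolding tensor_module_def Let_def KT_def[symmetric]
    by (simp only: partial_object.simps carrier_FactGroup r_coset_coset) (auto intro!: image_eqI)
  also have "\<dots> = tzp ` ST"
  proof (intro subset_antisym subsetI)
    fix x assume "x \<in> coset ` {c. keys c \<subseteq> SMN}"
    then obtain c where c: "keys c \<subseteq> SMN" "x = coset c" by blast
    obtain z where z: "z \<in> SM" "c - fg z yp \<in> KT" using reduce[OF c(1)] by blast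
    hence "x = tzp (vs yp z)" using e_nz unfolding c(2) tzp_def coset_eq_iff by simp
    thus "x \<in> tzp ` ST" using ST_vs[OF z(1)] by blast
  next
    fix x assume "x \<in> tzp ` ST"
    thus "x \<in> coset ` {c. keys c \<subseteq> SMN}" using fg_S[OF ST_SM e_SN] unfolding tzp_def by blast
  qed
  finally show ?thesis .
qed

lemma tzp_eq_iff: assumes "z \<in> ST" "w \<in> ST" shows "tzp z = tzp w \<longleftrightarrow> z - w \<in> B p"
  unfolding tzp_def coset_eq_iff fg_eq_iff[OF ST_SM[OF assms(1)] ST_SM[OF assms(2)]]
  using e_nz by (simp add: vs_diff)

lemma coset_add: "set_mult (free_Abelian_group SMN) (coset c) (coset d) = coset (c + d)"
proof (intro subset_antisym subsetI)
  fix x assume "x \<in> set_mult (free_Abelian_group SMN) (coset c) (coset d)"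
  then obtain h k where "h \<in> KT" "k \<in> KT" "x = (h + c) + (k + d)" unfolding set_mult_def coset_def by auto
  thus "x \<in> coset (c + d)" unfolding coset_def
    by (intro image_eqI[of _ _ "h + k"]) (auto simp: algebra_simps intro: K_add)
next
  fix x assume "x \<in> coset (c + d)"
  then obtain h where h: "h \<in> KT" "x = h + (c + d)" unfolding coset_def by blast
  have "h + c \<in> coset c" "d \<in> coset d" unfolding coset_def using h(1) K_0 by (auto intro: image_eqI[of _ _ 0])
  thus "x \<in> set_mult (free_Abelian_group SMN) (coset c) (coset d)"
    unfolding set_mult_def h(2) by (intro UN_I[of "h + c"] UN_I[of d]) (simp_all add: add.assoc)
qed

lemma ST_add: "z \<in> ST \<Longrightarrow> w \<in> ST \<Longrightarrow> z + w \<in> ST"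
  using SM_add by (auto simp: ST_def vs_add[symmetric])

lemma ST_0: "0 \<in> ST"
  using ST_vs[OF SM_0] by simp

lemma tzp_add: assumes "z \<in> ST" "w \<in> ST" shows "tzp z \<oplus>\<^bsub>Tp p\<^esub> tzp w = tzp (z + w)"
proof -
  let ?z = "vs (1 / yp) z" and ?w = "vs (1 / yp) w"
  have "tzp z \<oplus>\<^bsub>Tp p\<^esub> tzp w = coset (fg ?z yp + fg ?w yp)"
    unfolding tensor_module_def Let_def tzp_def by (simp add: FactGroup_def coset_add)
  also have "\<dots> = coset (fg (?z + ?w) yp)"
    unfolding coset_eq_iff using K_uminus[OF K_gens[OF fg_gens(1)[OF ST_SM[OF assms(1)] ST_SM[OF assms(2)] e_SN]]]
    by (simp add: algebra_simps)
  finally show ?thesis by (simp add: tzp_def vs_add)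
qed

lemma tzp_zero: "\<zero>\<^bsub>Tp p\<^esub> = tzp 0"
proof -
  have "\<zero>\<^bsub>Tp p\<^esub> = coset 0" unfolding tensor_module_def Let_def KT_def[symmetric] by (simp add: coset_def)
  thus ?thesis using K_uminus[OF fg_0_left[OF e_SN]] by (simp add: tzp_def coset_eq_iff)
qed

lemma tzp_pure: assumes "z \<in> SM" "g \<in> SN"
  shows "pure_tensor FR gr FM FN (gM z) (gN g) = tzp (vs g z)" "vs g z \<in> ST"
proof -
  have "vs g z = vs yp (vs (g / yp) z)" using e_nz by simp
  thus "vs g z \<in> ST" using ST_vs[OF fg_e(2)[OF assms]] by simp
  have "pure_tensor FR gr FM FN (gM z) (gN g) = coset (fg z g)"
    unfolding pure_tensor_def KT_def[symmetric] fg_def[symmetric] r_coset_coset ..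
  also have "\<dots> = coset (fg (vs (g / yp) z) yp)" unfolding coset_eq_iff by (rule fg_e(1)[OF assms])
  finally show "pure_tensor FR gr FM FN (gM z) (gN g) = tzp (vs g z)" using e_nz by (simp add: tzp_def)
qed

lemma tzp_smult:
  assumes a: "a \<in> Oloc J' 0 p" and z: "z \<in> ST"
  shows "Y.gO 0 p a \<odot>\<^bsub>Tp p\<^esub> tzp z = tzp (vs a z)" "vs a z \<in> ST"
proof -
  let ?phi = "frag_extend (\<lambda>(x, y). frag_of (x, Y.gO 0 p a \<odot>\<^bsub>FN\<^esub> y))"
  have aN: "a * g \<in> SN" if "g \<in> SN" for g using Y.Oloc_mult[OF a that] by simp
  have phi: "?phi (fg z g) = fg z (a * g)" if "g \<in> SN" for z g
    using Y.stalk_smult_O[OF p a that] by (simp add: fg_def)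
  have aJ: "a \<in> SR" by (rule OJ[OF a])
  have phiK: "?phi c \<in> KT" if "c \<in> KT" for c
    using that
  proof (induction c rule: K_induct)
    case (gen c)
    thus ?case
    proof (cases rule: gens_cases)
      case (1 z w g)
      thus ?thesis using 1(3) aN[OF 1(3)] K_gens[OF fg_gens(1)[OF 1(1,2), of "a * g"]] by (simp add: frag_extend_diff phi)
    next
      case (2 z g h)
      thus ?thesis using aN K_gens[OF fg_gens(2)[OF 2(1), of "a * g" "a * h"]]
        by (simp add: frag_extend_diff phi SN_add distrib_left)
    next
      case (3 r z g)
      thus ?thesis using 3(3) aN[OF 3(3)] fg_vs[OF 3(1,2), of "a * g"]
        by (simp add: frag_extend_diff phi SN_rd mult.left_commute)
    qed
  next
    case (diff c d)
    thus ?case by (simp add: frag_extend_diff K_diff)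
  qed (use K_0 in simp)
  let ?z = "vs (1 / yp) z"
  have "Y.gO 0 p a \<odot>\<^bsub>Tp p\<^esub> tzp z = (\<Union>c\<in>tzp z. coset (?phi c))"
    unfolding tensor_module_def Let_def KT_def[symmetric] r_coset_coset by simp
  also have "\<dots> = (\<Union>c\<in>tzp z. coset (fg ?z (a * yp)))"
  proof (intro SUP_cong refl)
    fix c assume "c \<in> tzp z"
    then obtain h where h: "h \<in> KT" "c = h + fg ?z yp" unfolding tzp_def coset_def by blast
    have "?phi c - fg ?z (a * yp) = ?phi h" using phi[OF e_SN] by (simp add: h(2) frag_extend_add)
    thus "coset (?phi c) = coset (fg ?z (a * yp))" unfolding coset_eq_iff using phiK[OF h(1)] by simp
  qed
  also have "\<dots> = coset (fg ?z (a * yp))"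
    using K_0 unfolding tzp_def coset_def[of "fg ?z yp"] by auto
  also have "\<dots> = coset (fg (vs a ?z) yp)"
    unfolding coset_eq_iff using K_uminus[OF fg_vs[OF aJ ST_SM[OF z] e_SN]] rd_id[OF p a] by simp
  finally show "Y.gO 0 p a \<odot>\<^bsub>Tp p\<^esub> tzp z = tzp (vs a z)" by (simp add: tzp_def mult.commute)
  have "vs a z = vs yp (vs a ?z)" using e_nz by (simp add: mult.commute)
  thus "vs a z \<in> ST" using ST_vs[OF SM_vs[OF aJ ST_SM[OF z]]] by simp
qed

text \<open>The laws are inherited from addition of vectors along \<open>tzp\<close>; they are what
  makes the finite sums in the definition of the tensor sheaf computable.\<close>

lemma abelian_monoid_Tp: "abelian_monoid (Tp p)"
proof (rule abelian_monoidI)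
  fix x y z assume "x \<in> carrier (Tp p)" "y \<in> carrier (Tp p)" "z \<in> carrier (Tp p)"
  then obtain a b c where "a \<in> ST" "b \<in> ST" "c \<in> ST" "x = tzp a" "y = tzp b" "z = tzp c" unfolding carrier_Tp by blast
  thus "x \<oplus>\<^bsub>Tp p\<^esub> y \<oplus>\<^bsub>Tp p\<^esub> z = x \<oplus>\<^bsub>Tp p\<^esub> (y \<oplus>\<^bsub>Tp p\<^esub> z)" by (simp add: tzp_add ST_add add.assoc)
next
  fix x y assume "x \<in> carrier (Tp p)" "y \<in> carrier (Tp p)"
  then obtain a b where ab: "a \<in> ST" "b \<in> ST" "x = tzp a" "y = tzp b" unfolding carrier_Tp by blast
  thus "x \<oplus>\<^bsub>Tp p\<^esub> y \<in> carrier (Tp p)" using ST_add[OF ab(1,2)] unfolding carrier_Tp by (simp add: tzp_add)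
  show "x \<oplus>\<^bsub>Tp p\<^esub> y = y \<oplus>\<^bsub>Tp p\<^esub> x" using ab by (simp add: tzp_add add.commute)
next
  fix x assume "x \<in> carrier (Tp p)"
  then obtain a where "a \<in> ST" "x = tzp a" unfolding carrier_Tp by blast
  thus "\<zero>\<^bsub>Tp p\<^esub> \<oplus>\<^bsub>Tp p\<^esub> x = x" unfolding tzp_zero by (simp add: tzp_add ST_0)
qed (simp add: tzp_zero carrier_Tp ST_0)

lemma tzp_finsum:
  assumes "\<And>j. j < n \<Longrightarrow> w j \<in> ST"
  shows "finsum (Tp p) (\<lambda>j. tzp (w j)) {..<n::nat} = tzp (\<Sum>j<n. w j)" "(\<Sum>j<n. w j) \<in> ST"
proof -
  interpret A: abelian_monoid "Tp p" by (rule abelian_monoid_Tp)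
  have "finsum (Tp p) (\<lambda>j. tzp (w j)) {..<k} = tzp (\<Sum>j<k. w j) \<and> (\<Sum>j<k. w j) \<in> ST" if "k \<le> n" for k
    using that
  proof (induction k)
    case 0
    show ?case using tzp_zero ST_0 by (simp add: zero_fun_def)
  next
    case (Suc k)
    have k: "tzp (w j) \<in> carrier (Tp p)" if "j < n" for j using assms[OF that] by (simp add: carrier_Tp)
    have "finsum (Tp p) (\<lambda>j. tzp (w j)) (insert k {..<k}) = tzp (w k) \<oplus>\<^bsub>Tp p\<^esub> finsum (Tp p) (\<lambda>j. tzp (w j)) {..<k}"
      using k Suc.prems by (intro A.finsum_insert) auto
    also have "\<dots> = tzp (w k + (\<Sum>j<k. w j))" using Suc assms[of k] by (simp add: tzp_add)
    finally have 1: "finsum (Tp p) (\<lambda>j. tzp (w j)) {..<Suc k} = tzp (w k + (\<Sum>j<k. w j))" by (simp add: lessThan_Suc)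
    have 2: "(\<Sum>j<Suc k. w j) = w k + (\<Sum>j<k. w j)" by (simp add: add.commute)
    have "w k \<in> ST" "(\<Sum>j<k. w j) \<in> ST" using Suc assms[of k] by auto
    from ST_add[OF this] show ?case unfolding 1 2 by (rule conjI[OF refl])
  qed
  thus "finsum (Tp p) (\<lambda>j. tzp (w j)) {..<n::nat} = tzp (\<Sum>j<n. w j)" "(\<Sum>j<n. w j) \<in> ST" by auto
qed

end

lemma tzp_finsum_pure:
  assumes W: "zopen X U" "zopen Y V" "V \<subseteq> U" and s: "\<And>j. j < n \<Longrightarrow> s j \<in> sec F U"
    and h: "\<And>j. j < n \<Longrightarrow> h j \<in> twisting_sections Y t V" and q: "q \<in> V"
  shows "finsum (Tp q) (\<lambda>j. germ_tensor X F Y (twisting_sheaf Y t) q U (s j) V (h j)) {..<n::nat} =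
      tzp q (\<Sum>j<n. vs (Y.fr t V (h j)) (kap U (s j)))"
    "(\<Sum>j<n. vs (Y.fr t V (h j)) (kap U (s j))) \<in> S.St t q"
proof -
  have qY: "q \<in> Y" using q Y.zopen_subset[OF W(2)] by blast
  have qU: "q \<in> U" using q W(3) by blast
  have one: "germ_tensor X F Y (twisting_sheaf Y t) q U (s j) V (h j) = tzp q (vs (Y.fr t V (h j)) (kap U (s j))) \<and>
      vs (Y.fr t V (h j)) (kap U (s j)) \<in> S.St t q" if j: "j < n" for j
  proof -
    have "kap U (s j) \<in> stk q" unfolding stk_def using W(1) qU s[OF j] by blast
    moreover have "Y.fr t V (h j) \<in> Oloc J' t q" using Y.fr_tw(1)[OF W(2) _ h[OF j]] q by (auto simp: Y.Osec_def)
    ultimately show ?thesis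
      unfolding germ_gm[OF W(1) qU s[OF j]] Y.germ_O[OF W(2) q h[OF j]] by (intro conjI tzp_pure[OF qY])
  qed
  note A = tzp_finsum[OF qY, of n "\<lambda>j. vs (Y.fr t V (h j)) (kap U (s j))"]
  interpret M: abelian_monoid "Tp q" by (rule abelian_monoid_Tp[OF qY])
  have "finsum (Tp q) (\<lambda>j. germ_tensor X F Y (twisting_sheaf Y t) q U (s j) V (h j)) {..<n} =
      finsum (Tp q) (\<lambda>j. tzp q (vs (Y.fr t V (h j)) (kap U (s j)))) {..<n}"
    by (rule M.finsum_cong') (use one carrier_Tp[OF qY] in auto)
  thus "finsum (Tp q) (\<lambda>j. germ_tensor X F Y (twisting_sheaf Y t) q U (s j) V (h j)) {..<n::nat} =
      tzp q (\<Sum>j<n. vs (Y.fr t V (h j)) (kap U (s j)))"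
    "(\<Sum>j<n. vs (Y.fr t V (h j)) (kap U (s j))) \<in> S.St t q" using A one by auto
qed

section \<open>Sections of the tensor sheaf as locally constant vectors\<close>

definition tsec :: "'k point set \<Rightarrow> ('k point \<Rightarrow> (('k point set \<times> 'm) set \<times> ('k point set \<times> 'k func) set \<Rightarrow>\<^sub>0 int) set) set" where
  "tsec W = {\<sigma> \<in> extensional W. \<forall>p\<in>W. \<exists>V z. zopen Y V \<and> p \<in> V \<and> V \<subseteq> W \<and> (\<forall>q\<in>V. z \<in> S.St t q \<and> \<sigma> q = tzp q z)}"

text \<open>A finite sum of tensors of sections is the class of one and the same vector at all
  points of a neighbourhood. Conversely a vector is \<open>y p\<close> times an element of the
  stalk, so a single pure tensor represents it nearby.\<close>

lemma sec_TT: assumes W: "zopen Y W" shows "sec TT W = tsec W"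
proof (intro subset_antisym subsetI)
  fix \<sigma> assume \<sigma>: "\<sigma> \<in> sec TT W"
  show "\<sigma> \<in> tsec W" unfolding tsec_def
  proof (intro CollectI conjI ballI)
    show "\<sigma> \<in> extensional W" using \<sigma> by (simp add: tensor_sheaf_def)
    fix p assume "p \<in> W"
    then obtain U V n s h where *: "zopen X U" "zopen Y V" "p \<in> V" "V \<subseteq> U \<inter> W"
      "\<forall>j<n. s j \<in> sec F U \<and> h j \<in> sec (twisting_sheaf Y t) V"
      "\<forall>q\<in>V. \<sigma> q = finsum (Tp q) (\<lambda>j. germ_tensor X F Y (twisting_sheaf Y t) q U (s j) V (h j)) {..<n::nat}"
      using \<sigma> by (auto simp: tensor_sheaf_def)
    have h: "h j \<in> twisting_sections Y t V" if "j < n" for j using *(5) that by (simp add: twisting_sheaf_def)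
    have s: "s j \<in> sec F U" if "j < n" for j using *(5) that by blast
    have VU: "V \<subseteq> U" "V \<subseteq> W" using *(4) by auto
    have "\<forall>q\<in>V. (\<Sum>j<n. vs (Y.fr t V (h j)) (kap U (s j))) \<in> S.St t q \<and> \<sigma> q = tzp q (\<Sum>j<n. vs (Y.fr t V (h j)) (kap U (s j)))"
    proof
      fix q assume q: "q \<in> V"
      note tf = tzp_finsum_pure[where n = n and s = s and h = h, OF *(1,2) VU(1) s h q]
      have "\<sigma> q = finsum (Tp q) (\<lambda>j. germ_tensor X F Y (twisting_sheaf Y t) q U (s j) V (h j)) {..<n}"
        using *(6) q by (rule bspec)
      also note tf(1)
      finally show "(\<Sum>j<n. vs (Y.fr t V (h j)) (kap U (s j))) \<in> S.St t q \<and>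
          \<sigma> q = tzp q (\<Sum>j<n. vs (Y.fr t V (h j)) (kap U (s j)))" by (intro conjI tf(2))
    qed
    thus "\<exists>V z. zopen Y V \<and> p \<in> V \<and> V \<subseteq> W \<and> (\<forall>q\<in>V. z \<in> S.St t q \<and> \<sigma> q = tzp q z)"
      using *(2,3) VU(2) by (intro exI conjI)
  qed
next
  fix \<sigma> assume \<sigma>: "\<sigma> \<in> tsec W"
  have "\<exists>U V n s h. zopen X U \<and> zopen Y V \<and> p \<in> V \<and> V \<subseteq> U \<inter> W \<and>
      (\<forall>j<n. s j \<in> sec F U \<and> h j \<in> sec (twisting_sheaf Y t) V) \<and>
      (\<forall>q\<in>V. \<sigma> q = finsum (Tp q) (\<lambda>j. germ_tensor X F Y (twisting_sheaf Y t) q U (s j) V (h j)) {..<n::nat})"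
    if pW: "p \<in> W" for p
  proof -
    obtain V z where V: "zopen Y V" "p \<in> V" "V \<subseteq> W" "\<forall>q\<in>V. z \<in> S.St t q \<and> \<sigma> q = tzp q z"
      using \<sigma> pW unfolding tsec_def by blast
    have pY: "p \<in> Y" using V(1,2) Y.zopen_subset by blast
    obtain z0 where z0: "z0 \<in> stk p" "z = vs (y p) z0" using V(2,4) St_y[OF pY] by blast
    obtain U s where U: "zopen X U" "p \<in> U" "s \<in> sec F U" "kap U s = z0" by (rule stkE[OF z0(1)])
    obtain g c where g: "g \<in> HP J' c" "nz g p" "\<And>q. q \<in> Y \<Longrightarrow> nz g q \<Longrightarrow> y p \<in> Oloc J' t q"
      by (rule Y.Oloc_open[OF y_O[OF pY] pY]) blast
    define V' where "V' = V \<inter> (U \<inter> Y) \<inter> {q \<in> Y. nz g q}"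
    have V': "zopen Y V'" "p \<in> V'" "V' \<subseteq> U \<inter> W" "V' \<subseteq> U" "V' \<noteq> {}" "V' \<subseteq> V"
      using Y.zopen_Int[OF Y.zopen_Int[OF V(1) open_Y[OF U(1)]] Y.zopen_nz[OF g(1)]] V(2,3) U(2) pY g(2)
      by (auto simp: V'_def)
    have o: "y p \<in> Y.Osec t V'" using g(3) by (auto simp: Y.Osec_def V'_def)
    define h where "h = Y.fn V' (y p)"
    have h: "h \<in> twisting_sections Y t V'" "Y.fr t V' h = y p"
      using Y.fn_tw[OF V'(1) o] Y.fr_fn[OF V'(1,5) o] by (auto simp: h_def)
    have "\<sigma> q = finsum (Tp q) (\<lambda>j. germ_tensor X F Y (twisting_sheaf Y t) q U s V' h) {..<1::nat}" if "q \<in> V'" for q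
    proof -
      have "finsum (Tp q) (\<lambda>j. germ_tensor X F Y (twisting_sheaf Y t) q U s V' h) {..<1::nat} = tzp q (\<Sum>j<1::nat. vs (Y.fr t V' h) (kap U s))"
        by (rule tzp_finsum_pure(1)[OF U(1) V'(1,4) U(3) h(1) that])
      also have "(\<Sum>j<1::nat. vs (Y.fr t V' h) (kap U s)) = z" unfolding h(2) U(4) z0(2) by (rule ext) simp
      finally show ?thesis using V(4) V'(6) that by auto
    qed
    hence "\<forall>q\<in>V'. \<sigma> q = finsum (Tp q) (\<lambda>j. germ_tensor X F Y (twisting_sheaf Y t) q U s V' h) {..<1::nat}"
      by (rule ballI)
    moreover have "\<forall>j<1::nat. s \<in> sec F U \<and> h \<in> sec (twisting_sheaf Y t) V'"
      using U(3) h(1) by (simp add: twisting_sheaf_def)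
    ultimately show ?thesis using U(1) V'(1,2,3)
      by (intro exI[of _ U] exI[of _ V'] exI[of _ 1] exI[of _ "\<lambda>_. s"] exI[of _ "\<lambda>_. h"] conjI)
  qed
  thus "\<sigma> \<in> sec TT W" using \<sigma> by (simp add: tensor_sheaf_def tsec_def)
qed

lemma tsec_point:
  assumes "\<sigma> \<in> tsec W" "p \<in> W" shows "\<exists>V z. zopen Y V \<and> p \<in> V \<and> V \<subseteq> W \<and> (\<forall>q\<in>V. z \<in> S.St t q \<and> \<sigma> q = tzp q z)"
  using assms unfolding tsec_def by blast

lemma add_TT: "\<sigma> \<oplus>[TT,W] \<tau> = (\<lambda>p\<in>W. \<sigma> p \<oplus>\<^bsub>Tp p\<^esub> \<tau> p)"
  and zero_TT: "\<zero>[TT,W] = (\<lambda>p\<in>W. \<zero>\<^bsub>Tp p\<^esub>)"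
  and smult_TT: "a \<odot>[TT,W] \<sigma> = (\<lambda>p\<in>W. germ Y (structure_sheaf Y) p W a \<odot>\<^bsub>Tp p\<^esub> \<sigma> p)"
  and res_TT: "res TT W V \<sigma> = restrict \<sigma> V"
  by (simp_all add: tensor_sheaf_def)

end

section \<open>First cohomology as a Cousin problem\<close>

text \<open>\<open>glue\<close> says that a vector lying in all stalks over \<open>U\<close> is the
  value of a section. The other assumptions describe the single section over the empty set, which
  \<open>kap\<close> does not see.\<close>

locale embsheaf = emb X J G kap vs
  for X :: "'k::{alg_closed_field, field_char_0} point set" and J and G :: "('k, 'm) mod_sheaf" and kap +
  assumes glue: "\<lbrakk>zopen X U; U \<noteq> {}; (\<And>p. p \<in> U \<Longrightarrow> z \<in> stk p)\<rbrakk> \<Longrightarrow> \<exists>s\<in>sec G U. kap U s = z"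
    and sec_empty: "sec G {} = {\<zero>[G,{}]}"
    and add_empty: "\<zero>[G,{}] \<oplus>[G,{}] \<zero>[G,{}] = \<zero>[G,{}]"
    and res_empty: "zopen X U \<Longrightarrow> s \<in> sec G U \<Longrightarrow> res G U {} s \<in> sec G {}"
begin

lemma stk_uminus: "p \<in> X \<Longrightarrow> z \<in> stk p \<Longrightarrow> - z \<in> stk p"
  using stk_sm[OF _ Oloc_uminus[OF Oloc_1]] by simp

text \<open>Value 0 over the empty set, so that additivity and injectivity hold for all open sets;
  only restriction keeps a case distinction.\<close>

definition kp where "kp U s = (if U = {} then 0 else kap U s)"

lemma kp_inj: "\<lbrakk>zopen X U; s \<in> sec G U; t \<in> sec G U; kp U s = kp U t\<rbrakk> \<Longrightarrow> s = t"
  using e_inj sec_empty by (cases "U = {}") (auto simp: kp_def)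

lemma kp_add: "\<lbrakk>zopen X U; s \<in> sec G U; t \<in> sec G U\<rbrakk> \<Longrightarrow>
    s \<oplus>[G,U] t \<in> sec G U \<and> kp U (s \<oplus>[G,U] t) = kp U s + kp U t"
  using e_add sec_empty add_empty by (cases "U = {}") (auto simp: kp_def)

lemma kp_zero: "zopen X U \<Longrightarrow> \<zero>[G,U] \<in> sec G U \<and> kp U \<zero>[G,U] = 0"
  using e_zero sec_empty by (cases "U = {}") (auto simp: kp_def)

lemma kp_res: "\<lbrakk>zopen X U; zopen X V; V \<subseteq> U; s \<in> sec G U\<rbrakk> \<Longrightarrow>
    res G U V s \<in> sec G V \<and> kp V (res G U V s) = (if V = {} then 0 else kp U s)"
  using e_res[of U V s] res_empty[of U s] by (cases "V = {}") (auto simp: kp_def)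

lemma kp_stk: "\<lbrakk>zopen X U; s \<in> sec G U; p \<in> U\<rbrakk> \<Longrightarrow> kp U s \<in> stk p"
  by (auto simp: kp_def stk_def)

lemma kp_glue: "zopen X U \<Longrightarrow> (\<And>p. p \<in> U \<Longrightarrow> z \<in> stk p) \<Longrightarrow> \<exists>s\<in>sec G U. U \<noteq> {} \<longrightarrow> kp U s = z"
  using glue[of U z] sec_empty by (cases "U = {}") (auto simp: kp_def)

lemma stk_diff: "\<lbrakk>p \<in> X; z \<in> stk p; w \<in> stk p\<rbrakk> \<Longrightarrow> z - w \<in> stk p"
  using stk_add[of z p "- w"] stk_uminus by simp

text \<open>Subtraction in \<open>sects G U\<close> goes through a definite description of an
  inverse. Gluing supplies a section of value \<open>- kp U t\<close>, and injectivity of values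
  makes it the only inverse.\<close>

lemma kp_minus:
  assumes U: "zopen X U" and s: "s \<in> sec G U" and t: "t \<in> sec G U"
  shows "s \<ominus>[G,U] t \<in> sec G U \<and> kp U (s \<ominus>[G,U] t) = kp U s - kp U t"
proof -
  have "- kp U t \<in> stk p" if "p \<in> U" for p
    using stk_uminus[OF _ kp_stk[OF U t that]] that zopen_subset[OF U] by blast
  from kp_glue[OF U this] obtain t' where t': "t' \<in> sec G U" "kp U t' = - kp U t" by (auto simp: kp_def)
  have "t \<oplus>[G,U] t' = \<zero>[G,U]" "t' \<oplus>[G,U] t = \<zero>[G,U]"
    using kp_add[OF U t t'(1)] kp_add[OF U t'(1) t] kp_zero[OF U] t'(2) by (auto intro!: kp_inj[OF U])
  moreover have "x = t'" if "x \<in> sec G U" "t \<oplus>[G,U] x = \<zero>[G,U]" for x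
  proof -
    have "kp U t + kp U x = 0" using kp_add[OF U t that(1)] that(2) kp_zero[OF U] by simp
    hence "kp U x = kp U t'" using t'(2) by (simp add: add_eq_0_iff)
    thus ?thesis using kp_inj[OF U that(1) t'(1)] by blast
  qed
  ultimately have "(THE x. x \<in> sec G U \<and> t \<oplus>[G,U] x = \<zero>[G,U] \<and> x \<oplus>[G,U] t = \<zero>[G,U]) = t'"
    using t'(1) by (intro the_equality conjI) blast+
  hence "\<ominus>\<^bsub>sects G U\<^esub> t = t'" by (simp add: a_inv_def m_inv_def)
  thus ?thesis using kp_add[OF U s t'(1)] t'(2) by (simp add: a_minus_def)
qed

lemma cocycles_iff:
  assumes "\<And>U. U \<in> \<U> \<Longrightarrow> zopen X U"
  shows "c \<in> cocycles G \<U> \<longleftrightarrow> (\<forall>U\<in>\<U>. \<forall>V\<in>\<U>. c U V \<in> sec G (U \<inter> V)) \<and>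
    (\<forall>U\<in>\<U>. \<forall>V\<in>\<U>. \<forall>W\<in>\<U>. U \<inter> V \<inter> W \<noteq> {} \<longrightarrow> kp (V \<inter> W) (c V W) - kp (U \<inter> W) (c U W) + kp (U \<inter> V) (c U V) = 0)"
proof -
  have "((res G (V \<inter> W) (U \<inter> V \<inter> W) (c V W) \<ominus>[G,U \<inter> V \<inter> W] res G (U \<inter> W) (U \<inter> V \<inter> W) (c U W))
        \<oplus>[G,U \<inter> V \<inter> W] res G (U \<inter> V) (U \<inter> V \<inter> W) (c U V) = \<zero>[G,U \<inter> V \<inter> W]) \<longleftrightarrow>
      (U \<inter> V \<inter> W \<noteq> {} \<longrightarrow> kp (V \<inter> W) (c V W) - kp (U \<inter> W) (c U W) + kp (U \<inter> V) (c U V) = 0)"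
    if UVW: "U \<in> \<U>" "V \<in> \<U>" "W \<in> \<U>" and c: "\<forall>U\<in>\<U>. \<forall>V\<in>\<U>. c U V \<in> sec G (U \<inter> V)" for U V W
  proof -
    let ?T = "U \<inter> V \<inter> W"
    have o: "zopen X U" "zopen X V" "zopen X W" using assms UVW by auto
    hence oo: "zopen X (V \<inter> W)" "zopen X (U \<inter> W)" "zopen X (U \<inter> V)" "zopen X ?T" by (auto intro: zopen_Int)
    have ss: "?T \<subseteq> V \<inter> W" "?T \<subseteq> U \<inter> W" "?T \<subseteq> U \<inter> V" by blast+
    have cs: "c V W \<in> sec G (V \<inter> W)" "c U W \<in> sec G (U \<inter> W)" "c U V \<in> sec G (U \<inter> V)" using c UVW by blast+
    note r1 = kp_res[OF oo(1,4) ss(1) cs(1)] and r2 = kp_res[OF oo(2,4) ss(2) cs(2)] and r3 = kp_res[OF oo(3,4) ss(3) cs(3)]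
    note m = kp_minus[OF oo(4) conjunct1[OF r1] conjunct1[OF r2]]
    note a = kp_add[OF oo(4) conjunct1[OF m] conjunct1[OF r3]]
    note z = kp_zero[OF oo(4)]
    have "((res G (V \<inter> W) ?T (c V W) \<ominus>[G,?T] res G (U \<inter> W) ?T (c U W)) \<oplus>[G,?T] res G (U \<inter> V) ?T (c U V) = \<zero>[G,?T])
      \<longleftrightarrow> kp ?T ((res G (V \<inter> W) ?T (c V W) \<ominus>[G,?T] res G (U \<inter> W) ?T (c U W)) \<oplus>[G,?T] res G (U \<inter> V) ?T (c U V)) = 0"
      using kp_inj[OF oo(4) conjunct1[OF a] conjunct1[OF z]] z by metis
    also have "\<dots> \<longleftrightarrow> (?T \<noteq> {} \<longrightarrow> kp (V \<inter> W) (c V W) - kp (U \<inter> W) (c U W) + kp (U \<inter> V) (c U V) = 0)"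
      using m a r1 r2 r3 by simp
    finally show ?thesis .
  qed
  thus ?thesis unfolding cocycles_def Let_def mem_Collect_eq by (intro conj_cong refl ball_cong) blast+
qed

lemma cohomologous_iff:
  assumes "\<And>U. U \<in> \<U> \<Longrightarrow> zopen X U"
    and "\<And>U V. U \<in> \<U> \<Longrightarrow> V \<in> \<U> \<Longrightarrow> c U V \<in> sec G (U \<inter> V) \<and> d U V \<in> sec G (U \<inter> V)"
  shows "cohomologous G \<U> c d \<longleftrightarrow> (\<exists>b. (\<forall>U\<in>\<U>. b U \<in> sec G U) \<and>
    (\<forall>U\<in>\<U>. \<forall>V\<in>\<U>. U \<inter> V \<noteq> {} \<longrightarrow> kp (U \<inter> V) (c U V) - kp (U \<inter> V) (d U V) = kp V (b V) - kp U (b U)))"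
proof -
  have "(c U V \<ominus>[G,U \<inter> V] d U V = res G V (U \<inter> V) (b V) \<ominus>[G,U \<inter> V] res G U (U \<inter> V) (b U)) \<longleftrightarrow>
      (U \<inter> V \<noteq> {} \<longrightarrow> kp (U \<inter> V) (c U V) - kp (U \<inter> V) (d U V) = kp V (b V) - kp U (b U))"
    if UV: "U \<in> \<U>" "V \<in> \<U>" and b: "\<forall>U\<in>\<U>. b U \<in> sec G U" for U V b
  proof -
    have o: "zopen X U" "zopen X V" "zopen X (U \<inter> V)" using assms(1) UV by (auto intro: zopen_Int)
    note m = kp_minus[OF o(3) conjunct1[OF assms(2)[OF UV]] conjunct2[OF assms(2)[OF UV]]]
    note r1 = kp_res[OF o(2,3) Int_lower2 b[rule_format, OF UV(2)]] and r2 = kp_res[OF o(1,3) Int_lower1 b[rule_format, OF UV(1)]]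
    note m' = kp_minus[OF o(3) conjunct1[OF r1] conjunct1[OF r2]]
    have "(c U V \<ominus>[G,U \<inter> V] d U V = res G V (U \<inter> V) (b V) \<ominus>[G,U \<inter> V] res G U (U \<inter> V) (b U)) \<longleftrightarrow>
      kp (U \<inter> V) (c U V \<ominus>[G,U \<inter> V] d U V) = kp (U \<inter> V) (res G V (U \<inter> V) (b V) \<ominus>[G,U \<inter> V] res G U (U \<inter> V) (b U))"
      using kp_inj[OF o(3) conjunct1[OF m] conjunct1[OF m']] by metis
    also have "\<dots> \<longleftrightarrow> (U \<inter> V \<noteq> {} \<longrightarrow> kp (U \<inter> V) (c U V) - kp (U \<inter> V) (d U V) = kp V (b V) - kp U (b U))"
      using m m' r1 r2 by (auto simp: kp_def)
    finally show ?thesis .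
  qed
  thus ?thesis unfolding cohomologous_def by (intro ex_cong1 conj_cong refl ball_cong) blast+
qed

lemma pull_sec:
  assumes "open_cover X \<U>" "open_cover X \<W>" "refinement \<W> \<U> \<rho>" "c \<in> cocycles G \<U>" "V \<in> \<W>" "W \<in> \<W>"
  shows "pull_cocycle G \<rho> c V W \<in> sec G (V \<inter> W)"
    "V \<inter> W \<noteq> {} \<Longrightarrow> kp (V \<inter> W) (pull_cocycle G \<rho> c V W) = kp (\<rho> V \<inter> \<rho> W) (c (\<rho> V) (\<rho> W))"
proof -
  have r: "\<rho> V \<in> \<U>" "\<rho> W \<in> \<U>" "V \<subseteq> \<rho> V" "W \<subseteq> \<rho> W" using assms(3,5,6) by (auto simp: refinement_def)
  have "zopen X (\<rho> V \<inter> \<rho> W)" "zopen X (V \<inter> W)" using assms(1,2,5,6) r by (auto simp: open_cover_def intro!: zopen_Int)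
  moreover have "c (\<rho> V) (\<rho> W) \<in> sec G (\<rho> V \<inter> \<rho> W)" using assms(4) r by (auto simp: cocycles_def)
  ultimately have "pull_cocycle G \<rho> c V W \<in> sec G (V \<inter> W) \<and>
      kp (V \<inter> W) (pull_cocycle G \<rho> c V W) = (if V \<inter> W = {} then 0 else kp (\<rho> V \<inter> \<rho> W) (c (\<rho> V) (\<rho> W)))"
    unfolding pull_cocycle_def using r by (intro kp_res) auto
  thus "pull_cocycle G \<rho> c V W \<in> sec G (V \<inter> W)"
    "V \<inter> W \<noteq> {} \<Longrightarrow> kp (V \<inter> W) (pull_cocycle G \<rho> c V W) = kp (\<rho> V \<inter> \<rho> W) (c (\<rho> V) (\<rho> W))" by auto
qed

definition splits where
  "splits \<U> c b \<longleftrightarrow> (\<forall>U\<in>\<U>. b U \<in> sec G U) \<and>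
    (\<forall>U\<in>\<U>. \<forall>V\<in>\<U>. U \<inter> V \<noteq> {} \<longrightarrow> kp (U \<inter> V) (c U V) = kp V (b V) - kp U (b U))"

text \<open>If both cocycles are coboundaries, then so is their difference on the common refinement
  by intersections; the splitting there is the difference of the two splittings.\<close>

lemma H1_class_memI:
  assumes U: "open_cover X \<U>" "c \<in> cocycles G \<U>" "splits \<U> c b" and V: "open_cover X \<V>" "d \<in> cocycles G \<V>" "splits \<V> d b'"
  shows "(\<V>, d) \<in> H1_class X G \<U> c"
proof -
  define \<W> where "\<W> = {A \<inter> B |A B. A \<in> \<U> \<and> B \<in> \<V>}"
  have "\<forall>W\<in>\<W>. \<exists>x. fst x \<in> \<U> \<and> snd x \<in> \<V> \<and> W = fst x \<inter> snd x" unfolding \<W>_def by auto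
  then obtain x where x: "\<forall>W\<in>\<W>. fst (x W) \<in> \<U> \<and> snd (x W) \<in> \<V> \<and> W = fst (x W) \<inter> snd (x W)" by (rule bchoice[THEN exE])
  define \<rho> \<tau> where "\<rho> W = fst (x W)" and "\<tau> W = snd (x W)" for W
  have rt: "\<rho> W \<in> \<U>" "\<tau> W \<in> \<V>" "W = \<rho> W \<inter> \<tau> W" if "W \<in> \<W>" for W using x that by (auto simp: \<rho>_def \<tau>_def)
  have W: "open_cover X \<W>"
    unfolding open_cover_def
  proof
    show "\<forall>W\<in>\<W>. zopen X W" using U(1) V(1) zopen_Int unfolding \<W>_def open_cover_def by blast
    show "\<Union>\<W> = X" using U(1) V(1) unfolding \<W>_def open_cover_def by blast
  qed
  have ref: "refinement \<W> \<U> \<rho>" "refinement \<W> \<V> \<tau>" using rt unfolding refinement_def by blast+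
  have o: "zopen X W" if "W \<in> \<W>" for W using W that by (auto simp: open_cover_def)
  have "\<exists>s. s \<in> sec G W \<and> (W \<noteq> {} \<longrightarrow> kp W s = kp (\<rho> W) (b (\<rho> W)) - kp (\<tau> W) (b' (\<tau> W)))" if Ww: "W \<in> \<W>" for W
  proof -
    have "kp (\<rho> W) (b (\<rho> W)) - kp (\<tau> W) (b' (\<tau> W)) \<in> stk p" if "p \<in> W" for p
    proof (rule stk_diff)
      show "p \<in> X" using zopen_subset[OF o[OF Ww]] that by blast
      have "p \<in> \<rho> W" "p \<in> \<tau> W" using that rt(3)[OF Ww] by blast+
      thus "kp (\<rho> W) (b (\<rho> W)) \<in> stk p" "kp (\<tau> W) (b' (\<tau> W)) \<in> stk p"
        using U(1,3) V(1,3) rt(1,2)[OF Ww] by (intro kp_stk; simp add: splits_def open_cover_def)+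
    qed
    from kp_glue[OF o[OF Ww] this] show ?thesis by blast
  qed
  then obtain s where s: "\<And>W. W \<in> \<W> \<Longrightarrow> s W \<in> sec G W"
    "\<And>W. W \<in> \<W> \<Longrightarrow> W \<noteq> {} \<Longrightarrow> kp W (s W) = kp (\<rho> W) (b (\<rho> W)) - kp (\<tau> W) (b' (\<tau> W))" by metis
  have "cohomologous G \<W> (pull_cocycle G \<rho> c) (pull_cocycle G \<tau> d)"
  proof (subst cohomologous_iff)
    show "\<exists>b. (\<forall>U\<in>\<W>. b U \<in> sec G U) \<and> (\<forall>U\<in>\<W>. \<forall>V\<in>\<W>. U \<inter> V \<noteq> {} \<longrightarrow>
        kp (U \<inter> V) (pull_cocycle G \<rho> c U V) - kp (U \<inter> V) (pull_cocycle G \<tau> d U V) = kp V (b V) - kp U (b U))"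
    proof (intro exI[of _ s] conjI ballI impI)
      fix A B assume AB: "A \<in> \<W>" "B \<in> \<W>" "A \<inter> B \<noteq> {}"
      have ne: "\<rho> A \<inter> \<rho> B \<noteq> {}" "\<tau> A \<inter> \<tau> B \<noteq> {}" "A \<noteq> {}" "B \<noteq> {}" using rt[OF AB(1)] rt[OF AB(2)] AB(3) by blast+
      have 1: "kp (A \<inter> B) (pull_cocycle G \<rho> c A B) = kp (\<rho> B) (b (\<rho> B)) - kp (\<rho> A) (b (\<rho> A))"
        using pull_sec(2)[OF U(1) W ref(1) U(2) AB] U(3) rt(1)[OF AB(1)] rt(1)[OF AB(2)] ne by (simp add: splits_def)
      have 2: "kp (A \<inter> B) (pull_cocycle G \<tau> d A B) = kp (\<tau> B) (b' (\<tau> B)) - kp (\<tau> A) (b' (\<tau> A))"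
        using pull_sec(2)[OF V(1) W ref(2) V(2) AB] V(3) rt(2)[OF AB(1)] rt(2)[OF AB(2)] ne by (simp add: splits_def)
      show "kp (A \<inter> B) (pull_cocycle G \<rho> c A B) - kp (A \<inter> B) (pull_cocycle G \<tau> d A B) = kp B (s B) - kp A (s A)"
        unfolding 1 2 s(2)[OF AB(1) ne(3)] s(2)[OF AB(2) ne(4)] by simp
    qed (use s in auto)
  qed (use o pull_sec(1)[OF U(1) W ref(1) U(2)] pull_sec(1)[OF V(1) W ref(2) V(2)] in auto)
  thus ?thesis unfolding H1_class_def using V(1,2) W ref by blast
qed

abbreviation "zc \<equiv> (\<lambda>U V. \<zero>[G,U \<inter> V])"

lemma zero_cocycle:
  shows "open_cover X {X}" "zc \<in> cocycles G {X}"
    "splits {X} zc (\<lambda>U. \<zero>[G,U])"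
proof -
  show "open_cover X {X}" by (simp add: open_cover_def zopen_X)
  show "zc \<in> cocycles G {X}"
    by (subst cocycles_iff) (use zopen_X kp_zero[OF zopen_X] in auto)
  show "splits {X} zc (\<lambda>U. \<zero>[G,U])"
    using kp_zero[OF zopen_X] by (simp add: splits_def)
qed

lemma X_ne: "X \<noteq> {}" using ex_nz[OF HP_1] by auto

text \<open>In the constant group every cocycle is a coboundary: \<open>c A B\<close> is the
  difference of the values of \<open>c U0 B\<close> and \<open>c U0 A\<close> for a fixed nonempty
  member \<open>U0\<close>, because \<open>U0\<close> meets every nonempty intersection. These
  values form a Cousin problem, and a solution \<open>z\<close> corrects them to sections.\<close>

lemma cousin_splits:
  assumes cous: "cousin X stk" and U: "open_cover X \<U>" and c: "c \<in> cocycles G \<U>"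
  shows "\<exists>b. splits \<U> c b"
proof -
  have o: "zopen X U" if "U \<in> \<U>" for U using U that by (auto simp: open_cover_def)
  have cov: "\<forall>p\<in>X. \<exists>U. U \<in> \<U> \<and> p \<in> U" using U by (auto simp: open_cover_def)
  then obtain u where u: "\<forall>p\<in>X. u p \<in> \<U> \<and> p \<in> u p" by (rule bchoice[THEN exE])
  obtain p0 where p0: "p0 \<in> X" using X_ne by blast
  define U0 where "U0 = u p0"
  have U0: "U0 \<in> \<U>" "U0 \<noteq> {}" using u p0 by (auto simp: U0_def)
  have cs: "c A B \<in> sec G (A \<inter> B)" if "A \<in> \<U>" "B \<in> \<U>" for A B using c that by (auto simp: cocycles_def)
  have cc: "kp (A \<inter> B) (c A B) = kp (U0 \<inter> B) (c U0 B) - kp (U0 \<inter> A) (c U0 A)"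
    if AB: "A \<in> \<U>" "B \<in> \<U>" "A \<inter> B \<noteq> {}" for A B
  proof -
    have "U0 \<inter> A \<inter> B \<noteq> {}" using zopen_irreducible[OF o[OF U0(1)] zopen_Int[OF o[OF AB(1)] o[OF AB(2)]] U0(2) AB(3)] by blast
    hence "kp (A \<inter> B) (c A B) - kp (U0 \<inter> B) (c U0 B) + kp (U0 \<inter> A) (c U0 A) = 0"
      using cocycles_iff[of \<U> c, OF o] c U0(1) AB(1,2) by blast
    thus ?thesis by (simp add: algebra_simps eq_diff_eq)
  qed
  define f where "f p = kp (U0 \<inter> u p) (c U0 (u p))" for p
  have key: "kp (U0 \<inter> A) (c U0 A) - f p \<in> stk p" if A: "A \<in> \<U>" "p \<in> A" for A p
  proof -
    have pX: "p \<in> X" using A o zopen_subset by blast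
    hence up: "u p \<in> \<U>" "p \<in> u p" using u by auto
    hence "kp (u p \<inter> A) (c (u p) A) = kp (U0 \<inter> A) (c U0 A) - f p" unfolding f_def using A by (intro cc) auto
    moreover have "kp (u p \<inter> A) (c (u p) A) \<in> stk p"
      using cs[OF up(1) A(1)] o up A by (intro kp_stk zopen_Int) auto
    ultimately show ?thesis by simp
  qed
  have "\<forall>p\<in>X. near X p (\<lambda>q. f q - f p \<in> stk q)"
  proof
    fix p assume p: "p \<in> X"
    have "f q - f p \<in> stk q" if q: "q \<in> u p" for q
    proof -
      have qX: "q \<in> X" using q u p o zopen_subset by blast
      have "f p - f q \<in> stk q" using key[of "u p" q] u p q by (simp add: f_def)
      from stk_uminus[OF qX this] show ?thesis by simp
    qed
    thus "near X p (\<lambda>q. f q - f p \<in> stk q)" using u p o by blast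
  qed
  from cousinD[OF cous this] obtain z where z: "\<forall>p\<in>X. z - f p \<in> stk p" by blast
  have "\<exists>s. s \<in> sec G A \<and> (A \<noteq> {} \<longrightarrow> kp A s = kp (U0 \<inter> A) (c U0 A) - z)" if A: "A \<in> \<U>" for A
  proof -
    have "kp (U0 \<inter> A) (c U0 A) - z \<in> stk p" if p: "p \<in> A" for p
    proof -
      have pX: "p \<in> X" using p A o zopen_subset by blast
      show ?thesis using stk_diff[OF pX key[OF A p] z[rule_format, OF pX]] by simp
    qed
    from kp_glue[OF o[OF A] this] show ?thesis by blast
  qed
  then obtain b where b: "\<And>A. A \<in> \<U> \<Longrightarrow> b A \<in> sec G A \<and> (A \<noteq> {} \<longrightarrow> kp A (b A) = kp (U0 \<inter> A) (c U0 A) - z)" by metis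
  have "splits \<U> c b" unfolding splits_def
  proof (intro conjI ballI impI)
    fix A B assume AB: "A \<in> \<U>" "B \<in> \<U>" "A \<inter> B \<noteq> {}"
    hence ne: "A \<noteq> {}" "B \<noteq> {}" by auto
    show "kp (A \<inter> B) (c A B) = kp B (b B) - kp A (b A)"
      using cc[OF AB] b[OF AB(1)] b[OF AB(2)] ne by simp
  qed (use b in blast)
  thus ?thesis by blast
qed

theorem H1_vanishes_iff: "H1_vanishes X G \<longleftrightarrow> cousin X stk"
proof
  assume cous: "cousin X stk"
  have "H1_class X G \<U> c = H1_class X G {X} zc"
    if U: "open_cover X \<U>" "c \<in> cocycles G \<U>" for \<U> c
  proof -
    \<comment> \<open>As all cocycles split, every class consists of all pairs of a cover and a
      cocycle, so there is only one class.\<close>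
    have "H1_class X G \<U> c = {(\<V>, d). open_cover X \<V> \<and> d \<in> cocycles G \<V>}"
      if "open_cover X \<U>" "c \<in> cocycles G \<U>" for \<U> c
    proof (intro subset_antisym subsetI)
      fix x assume "x \<in> {(\<V>, d). open_cover X \<V> \<and> d \<in> cocycles G \<V>}"
      then obtain \<V> d where x: "x = (\<V>, d)" "open_cover X \<V>" "d \<in> cocycles G \<V>" by blast
      show "x \<in> H1_class X G \<U> c" unfolding x(1)
        using H1_class_memI[OF that _ x(2,3)] cousin_splits[OF cous that] cousin_splits[OF cous x(2,3)] by blast
    qed (auto simp: H1_class_def)
    thus ?thesis using U zero_cocycle(1,2) by simp
  qed
  hence "x = H1_class X G {X} zc" if "x \<in> carrier (H1 X G)" for x
    using that unfolding H1_def by fastforce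
  moreover have "H1_class X G {X} zc \<in> carrier (H1 X G)"
    using zero_cocycle(1,2) by (simp only: H1_def partial_object.select_convs) blast
  ultimately have "carrier (H1 X G) = {H1_class X G {X} zc}" by blast
  thus "H1_vanishes X G" by (simp add: H1_vanishes_def H1_def)
next
  assume van: "H1_vanishes X G"
  show "cousin X stk" unfolding cousin_def
  proof (intro allI impI)
    fix f assume f: "\<forall>p\<in>X. near X p (\<lambda>q. f q - f p \<in> stk q)"
    then obtain v where v: "\<forall>p\<in>X. zopen X (v p) \<and> p \<in> v p \<and> (\<forall>q\<in>v p. f q - f p \<in> stk q)" by (rule bchoice[THEN exE])
    define \<U> where "\<U> = v ` X"
    have "\<forall>U\<in>\<U>. \<exists>p. p \<in> X \<and> v p = U" unfolding \<U>_def by blast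
    \<comment> \<open>One set may belong to several points; \<open>a\<close> chooses a centre for
      each member of the cover, and the differences of the data at the centres form a
      cocycle.\<close>
    then obtain a where a: "\<forall>U\<in>\<U>. a U \<in> X \<and> v (a U) = U" by (rule bchoice[THEN exE])
    have o: "zopen X U" "U \<noteq> {}" if "U \<in> \<U>" for U using v that unfolding \<U>_def by blast+
    have fa: "f q - f (a U) \<in> stk q" if "U \<in> \<U>" "q \<in> U" for U q
    proof -
      have "a U \<in> X" "v (a U) = U" using a that(1) by auto
      thus ?thesis using v that(2) by fastforce
    qed
    have ne: "U \<inter> V \<noteq> {}" if "U \<in> \<U>" "V \<in> \<U>" for U V using zopen_irreducible[OF o(1) o(1) o(2) o(2)] that by blast
    have U: "open_cover X \<U>" using v o zopen_subset unfolding open_cover_def \<U>_def by blast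
    have "\<exists>s\<in>sec G (U \<inter> V). U \<inter> V \<noteq> {} \<longrightarrow> kp (U \<inter> V) s = f (a V) - f (a U)" if UV: "U \<in> \<U>" "V \<in> \<U>" for U V
    proof (rule kp_glue)
      show "zopen X (U \<inter> V)" using o UV by (intro zopen_Int) auto
      fix q assume q: "q \<in> U \<inter> V"
      have qX: "q \<in> X" using q o(1)[OF UV(1)] zopen_subset by blast
      show "f (a V) - f (a U) \<in> stk q" using stk_diff[OF qX fa[OF UV(1)] fa[OF UV(2)]] q by simp
    qed
    hence "\<exists>s. s \<in> sec G (U \<inter> V) \<and> kp (U \<inter> V) s = f (a V) - f (a U)" if "U \<in> \<U>" "V \<in> \<U>" for U V
      using ne that by blast
    then obtain c where c: "\<And>U V. U \<in> \<U> \<Longrightarrow> V \<in> \<U> \<Longrightarrow> c U V \<in> sec G (U \<inter> V) \<and> kp (U \<inter> V) (c U V) = f (a V) - f (a U)"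
      by metis
    have cc: "c \<in> cocycles G \<U>" by (subst cocycles_iff) (use o c in auto)
    have "H1_class X G \<U> c = H1_class X G {X} zc"
    proof -
      have "H1_class X G \<U> c \<in> carrier (H1 X G)" using U cc by (simp only: H1_def partial_object.select_convs) blast
      hence "H1_class X G \<U> c \<in> {\<one>\<^bsub>H1 X G\<^esub>}" using van unfolding H1_vanishes_def by blast
      thus ?thesis by (simp add: H1_def)
    qed
    \<comment> \<open>The trivial class contains the zero cocycle on the cover \<open>{X}\<close>,
      so \<open>c\<close> becomes a coboundary on some refinement.\<close>
    hence "({X}, \<lambda>U V. \<zero>[G,U \<inter> V]) \<in> H1_class X G \<U> c"
      using H1_class_memI[OF zero_cocycle zero_cocycle] by simp
    then obtain \<W> \<rho> \<tau> where W: "open_cover X \<W>" "refinement \<W> \<U> \<rho>" "refinement \<W> {X} \<tau>"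
      "cohomologous G \<W> (pull_cocycle G \<rho> c) (pull_cocycle G \<tau> zc)"
      unfolding H1_class_def by blast
    have oW: "zopen X A" if "A \<in> \<W>" for A using W(1) that by (auto simp: open_cover_def)
    note p1 = pull_sec[OF U W(1,2) cc] and p2 = pull_sec[OF zero_cocycle(1) W(1,3) zero_cocycle(2)]
    obtain b where b: "\<forall>U\<in>\<W>. b U \<in> sec G U" "\<forall>U\<in>\<W>. \<forall>V\<in>\<W>. U \<inter> V \<noteq> {} \<longrightarrow>
        kp (U \<inter> V) (pull_cocycle G \<rho> c U V) - kp (U \<inter> V) (pull_cocycle G \<tau> zc U V) = kp V (b V) - kp U (b U)"
      using W(4) cohomologous_iff[of \<W> "pull_cocycle G \<rho> c" "pull_cocycle G \<tau> zc", OF oW]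
        p1(1) p2(1) by blast
    have rho: "\<rho> A \<in> \<U>" "A \<subseteq> \<rho> A" if "A \<in> \<W>" for A using W(2) that by (auto simp: refinement_def)
    have bb: "f (a (\<rho> B)) - f (a (\<rho> A)) = kp B (b B) - kp A (b A)" if AB: "A \<in> \<W>" "B \<in> \<W>" "A \<noteq> {}" "B \<noteq> {}" for A B
    proof -
      have ne: "A \<inter> B \<noteq> {}" using zopen_irreducible oW AB by blast
      have tX: "\<tau> A = X" "\<tau> B = X" using W(3) AB by (auto simp: refinement_def)
      have "kp (A \<inter> B) (pull_cocycle G \<tau> zc A B) = 0"
        using p2(2)[OF AB(1,2) ne] kp_zero[OF zopen_X] by (simp add: tX)
      moreover have "kp (A \<inter> B) (pull_cocycle G \<rho> c A B) = f (a (\<rho> B)) - f (a (\<rho> A))"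
        using p1(2)[OF AB(1,2) ne] c rho AB by simp
      ultimately show ?thesis using b(2) AB(1,2) ne by force
    qed
    obtain A0 where A0: "A0 \<in> \<W>" "A0 \<noteq> {}" using W(1) X_ne by (auto simp: open_cover_def)
    \<comment> \<open>By \<open>bb\<close> this difference is the same for every nonempty member of
      the refinement, which makes it a solution at all points.\<close>
    define z where "z = f (a (\<rho> A0)) - kp A0 (b A0)"
    have "z - f p \<in> stk p" if p: "p \<in> X" for p
    proof -
      obtain A where A: "A \<in> \<W>" "p \<in> A" using W(1) p by (auto simp: open_cover_def)
      hence Ane: "A \<noteq> {}" by blast
      have 1: "f p - f (a (\<rho> A)) \<in> stk p" using fa rho[OF A(1)] A(2) by blast
      have 2: "kp A (b A) \<in> stk p" using b(1) A oW by (intro kp_stk) auto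
      have "z = f (a (\<rho> A)) - kp A (b A)" using bb[OF A0(1) A(1) A0(2) Ane] by (simp add: z_def algebra_simps)
      hence "z - f p = - ((f p - f (a (\<rho> A))) + kp A (b A))" by simp
      thus ?thesis using stk_uminus[OF p stk_add[OF 1 2]] by (simp only:)
    qed
    thus "\<exists>z. \<forall>p\<in>X. z - f p \<in> stk p" by blast
  qed
qed

end

text \<open>The quotient of \<open>St t p\<close> by \<open>B p\<close> is realised as the image of \<open>rho\<close>.\<close>

locale tdescent = tsheaf X J F kap Y J' t rd B
  for X :: "'k::{alg_closed_field, field_char_0} point set" and J and F :: "('k, 'm) mod_sheaf"
    and kap :: "'k point set \<Rightarrow> 'm \<Rightarrow> nat \<Rightarrow> 'k rat" and Y :: "'k point set" and J' and t rd B +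
  fixes rho :: "(nat \<Rightarrow> 'k rat) \<Rightarrow> nat \<Rightarrow> 'k rat"
  assumes rho_eq: "\<lbrakk>p \<in> Y; z \<in> S.St t p; w \<in> S.St t p\<rbrakk> \<Longrightarrow> z - w \<in> B p \<longleftrightarrow> rho z = rho w"
    and rho_add: "\<lbrakk>p \<in> Y; z \<in> S.St t p; w \<in> S.St t p\<rbrakk> \<Longrightarrow> rho (z + w) = rho z + rho w"
    and rho_vs: "\<lbrakk>p \<in> Y; a \<in> Oloc J' 0 p; z \<in> S.St t p\<rbrakk> \<Longrightarrow> rho (vs a z) = vs a (rho z)"
begin

lemma tzp_rho: "\<lbrakk>p \<in> Y; z \<in> S.St t p; w \<in> S.St t p\<rbrakk> \<Longrightarrow> tzp p z = tzp p w \<longleftrightarrow> rho z = rho w"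
  using tzp_eq_iff rho_eq by metis

lemma rho_0: assumes "p \<in> Y" shows "rho 0 = 0"
  using rho_add[OF assms S.St_0 S.St_0] YinX[OF assms] by simp

definition stg :: "'k point set \<Rightarrow> ('k point \<Rightarrow> (('k point set \<times> 'm) set \<times> ('k point set \<times> 'k func) set \<Rightarrow>\<^sub>0 int) set) \<Rightarrow>
    (nat \<Rightarrow> 'k rat) \<Rightarrow> bool" where
  "stg W \<sigma> d \<longleftrightarrow> (\<forall>p\<in>W. \<exists>z\<in>S.St t p. \<sigma> p = tzp p z \<and> rho z = d)"

definition kt :: "'k point set \<Rightarrow> ('k point \<Rightarrow> (('k point set \<times> 'm) set \<times> ('k point set \<times> 'k func) set \<Rightarrow>\<^sub>0 int) set) \<Rightarrow> nat \<Rightarrow> 'k rat" where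
  "kt W \<sigma> = (THE d. stg W \<sigma> d)"

lemma stgD: "stg W \<sigma> d \<Longrightarrow> p \<in> W \<Longrightarrow> \<exists>z. z \<in> S.St t p \<and> \<sigma> p = tzp p z \<and> rho z = d"
  unfolding stg_def by blast

lemma kt_eq:
  assumes "zopen Y W" "W \<noteq> {}" "stg W \<sigma> d" shows "kt W \<sigma> = d"
  unfolding kt_def
proof (rule the_equality)
  show "stg W \<sigma> d" by fact
  fix e assume e: "stg W \<sigma> e"
  obtain p where p: "p \<in> W" using assms(2) by blast
  have pY: "p \<in> Y" using p Y.zopen_subset[OF assms(1)] by blast
  obtain z where z: "z \<in> S.St t p" "\<sigma> p = tzp p z" "rho z = d" using stgD[OF assms(3) p] by blast
  obtain w where w: "w \<in> S.St t p" "\<sigma> p = tzp p w" "rho w = e" using stgD[OF e p] by blast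
  show "e = d" using tzp_rho[OF pY z(1) w(1)] z w by simp
qed

text \<open>The value of \<open>rho\<close> on local representatives is locally constant, hence
  constant, as nonempty open sets of \<open>Y\<close> meet.\<close>

lemma stg_kt:
  assumes W: "zopen Y W" "W \<noteq> {}" and \<sigma>: "\<sigma> \<in> tsec W" shows "stg W \<sigma> (kt W \<sigma>)"
proof -
  obtain p0 where p0: "p0 \<in> W" using W(2) by blast
  obtain V0 z0 where V0: "zopen Y V0" "p0 \<in> V0" "\<forall>q\<in>V0. z0 \<in> S.St t q \<and> \<sigma> q = tzp q z0"
    using tsec_point[OF \<sigma> p0] by blast
  have "stg W \<sigma> (rho z0)" unfolding stg_def
  proof
    fix p assume p: "p \<in> W"
    obtain V z where V: "zopen Y V" "p \<in> V" "\<forall>q\<in>V. z \<in> S.St t q \<and> \<sigma> q = tzp q z"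
      using tsec_point[OF \<sigma> p] by blast
    obtain q where q: "q \<in> V" "q \<in> V0" using Y.zopen_irreducible[OF V(1) V0(1)] V(2) V0(2) by blast
    have "q \<in> Y" using q Y.zopen_subset[OF V(1)] by blast
    hence "rho z = rho z0" using bspec[OF V(3) q(1)] bspec[OF V0(3) q(2)] tzp_rho[of q z z0] by metis
    thus "\<exists>z\<in>S.St t p. \<sigma> p = tzp p z \<and> rho z = rho z0" using V(2,3) by blast
  qed
  from kt_eq[OF W this] this show ?thesis by simp
qed

lemma tsec_kt:
  assumes W: "zopen Y W" "W \<noteq> {}" and \<sigma>: "\<sigma> \<in> extensional W" "stg W \<sigma> d"
  shows "\<sigma> \<in> sec TT W \<and> kt W \<sigma> = d"
proof -
  have "\<exists>V z. zopen Y V \<and> p \<in> V \<and> V \<subseteq> W \<and> (\<forall>q\<in>V. z \<in> S.St t q \<and> \<sigma> q = tzp q z)" if p: "p \<in> W" for p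
  proof -
    obtain z where z: "z \<in> S.St t p" "\<sigma> p = tzp p z" "rho z = d" using stgD[OF \<sigma>(2) p] by blast
    have pY: "p \<in> Y" using p Y.zopen_subset[OF W(1)] by blast
    obtain V where V: "zopen X V" "p \<in> V" "\<forall>q\<in>V. z \<in> S.St t q" using S.St_open[OF YinX[OF pY] z(1)] by blast
    have o: "zopen Y (V \<inter> Y \<inter> W)" using Y.zopen_Int[OF open_Y[OF V(1)] W(1)] .
    have "z \<in> S.St t q \<and> \<sigma> q = tzp q z" if q: "q \<in> V \<inter> Y \<inter> W" for q
    proof -
      obtain w where w: "w \<in> S.St t q" "\<sigma> q = tzp q w" "rho w = d" using stgD[OF \<sigma>(2)] q by blast
      have "z \<in> S.St t q" using V(3) q by blast
      thus ?thesis using tzp_rho[of q z w] w z(3) q by simp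
    qed
    thus ?thesis using o V(2) pY p by (intro exI[of _ "V \<inter> Y \<inter> W"] exI[of _ z]) blast
  qed
  hence "\<sigma> \<in> tsec W" unfolding tsec_def using \<sigma>(1) by blast
  thus ?thesis using kt_eq[OF W \<sigma>(2)] sec_TT[OF W(1)] by simp
qed

lemma emb_TT: "emb Y J' TT kt vs"
proof
  fix U V \<sigma> assume *: "zopen Y U" "zopen Y V" "V \<subseteq> U" "V \<noteq> {}" "\<sigma> \<in> sec TT U"
  hence U: "U \<noteq> {}" by blast
  have "\<sigma> \<in> tsec U" using *(1,5) sec_TT by simp
  note ks = stg_kt[OF *(1) U this]
  show "res TT U V \<sigma> \<in> sec TT V \<and> kt V (res TT U V \<sigma>) = kt U \<sigma>"
    by (rule tsec_kt[OF *(2,4)]) (use ks *(3) in \<open>auto simp: res_TT stg_def\<close>)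
next
  fix U assume U: "zopen Y U" "U \<noteq> {}"
  have UY: "p \<in> Y" if "p \<in> U" for p using that Y.zopen_subset[OF U(1)] by blast
  show "\<zero>[TT,U] \<in> sec TT U \<and> kt U \<zero>[TT,U] = 0"
  proof (rule tsec_kt[OF U])
    show "stg U \<zero>[TT,U] 0" unfolding stg_def
    proof
      fix p assume p: "p \<in> U"
      show "\<exists>z\<in>S.St t p. \<zero>[TT,U] p = tzp p z \<and> rho z = 0"
        using tzp_zero[OF UY[OF p]] S.St_0[OF YinX[OF UY[OF p]]] rho_0[OF UY[OF p]] p
        by (intro bexI[of _ 0]) (simp_all add: zero_TT)
    qed
  qed (simp add: zero_TT)
  fix \<sigma> assume "\<sigma> \<in> sec TT U"
  hence s: "\<sigma> \<in> tsec U" using sec_TT[OF U(1)] by simp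
  note ks = stgD[OF stg_kt[OF U s]]
  have ext: "\<sigma> \<in> extensional U" using s by (simp add: tsec_def)
  {
    fix a assume a: "a \<in> twisting_sections Y 0 U"
    have fa: "Y.fr 0 U a \<in> Oloc J' 0 p" if "p \<in> U" for p using Y.fr_tw(1)[OF U a] that by (auto simp: Y.Osec_def)
    show "a \<odot>[TT,U] \<sigma> \<in> sec TT U \<and> kt U (a \<odot>[TT,U] \<sigma>) = vs (Y.fr 0 U a) (kt U \<sigma>)"
    proof (rule tsec_kt[OF U])
      show "a \<odot>[TT,U] \<sigma> \<in> extensional U" by (simp add: smult_TT)
      show "stg U (a \<odot>[TT,U] \<sigma>) (vs (Y.fr 0 U a) (kt U \<sigma>))" unfolding stg_def
      proof
        fix p assume p: "p \<in> U"
        obtain z where z: "z \<in> S.St t p" "\<sigma> p = tzp p z" "rho z = kt U \<sigma>" using ks[OF p] by blast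
        show "\<exists>z\<in>S.St t p. (a \<odot>[TT,U] \<sigma>) p = tzp p z \<and> rho z = vs (Y.fr 0 U a) (kt U \<sigma>)"
          using tzp_smult[OF UY[OF p] fa[OF p] z(1)] rho_vs[OF UY[OF p] fa[OF p] z(1)] p z(2,3) Y.germ_O[OF U(1) p a]
          by (intro bexI[of _ "vs (Y.fr 0 U a) z"]) (simp_all add: smult_TT)
      qed
    qed
  }
  fix \<tau> assume "\<tau> \<in> sec TT U"
  hence s': "\<tau> \<in> tsec U" using sec_TT[OF U(1)] by simp
  note ks' = stgD[OF stg_kt[OF U s']]
  have ext': "\<tau> \<in> extensional U" using s' by (simp add: tsec_def)
  show "\<sigma> = \<tau>" if k: "kt U \<sigma> = kt U \<tau>"
  proof (rule extensionalityI[OF ext ext'])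
    fix p assume p: "p \<in> U"
    obtain z where z: "z \<in> S.St t p" "\<sigma> p = tzp p z" "rho z = kt U \<sigma>" using ks[OF p] by blast
    obtain w where w: "w \<in> S.St t p" "\<tau> p = tzp p w" "rho w = kt U \<tau>" using ks'[OF p] by blast
    show "\<sigma> p = \<tau> p" using tzp_rho[OF UY[OF p] z(1) w(1)] z w k by simp
  qed
  show "\<sigma> \<oplus>[TT,U] \<tau> \<in> sec TT U \<and> kt U (\<sigma> \<oplus>[TT,U] \<tau>) = kt U \<sigma> + kt U \<tau>"
  proof (rule tsec_kt[OF U])
    show "\<sigma> \<oplus>[TT,U] \<tau> \<in> extensional U" by (simp add: add_TT)
    show "stg U (\<sigma> \<oplus>[TT,U] \<tau>) (kt U \<sigma> + kt U \<tau>)" unfolding stg_def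
    proof
      fix p assume p: "p \<in> U"
      obtain z where z: "z \<in> S.St t p" "\<sigma> p = tzp p z" "rho z = kt U \<sigma>" using ks[OF p] by blast
      obtain w where w: "w \<in> S.St t p" "\<tau> p = tzp p w" "rho w = kt U \<tau>" using ks'[OF p] by blast
      show "\<exists>z\<in>S.St t p. (\<sigma> \<oplus>[TT,U] \<tau>) p = tzp p z \<and> rho z = kt U \<sigma> + kt U \<tau>"
        using tzp_add[OF UY[OF p] z(1) w(1)] S.St_add[OF YinX[OF UY[OF p]] z(1) w(1)] rho_add[OF UY[OF p] z(1) w(1)]
          p z(2,3) w(2,3)
        by (intro bexI[of _ "z + w"]) (simp_all add: add_TT)
    qed
  qed
qed

lemma stk_TT: assumes "p \<in> Y" shows "emb.stk Y TT kt p = rho ` S.St t p"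
proof -
  interpret E: emb Y J' TT kt vs by (rule emb_TT)
  show ?thesis
  proof (intro subset_antisym subsetI)
    fix d assume "d \<in> E.stk p"
    then obtain U s where U: "zopen Y U" "p \<in> U" "s \<in> sec TT U" "kt U s = d" by (rule E.stkE)
    hence "U \<noteq> {}" "s \<in> tsec U" using sec_TT by auto
    from stgD[OF stg_kt[OF U(1) this] U(2)] obtain z where "z \<in> S.St t p" "rho z = kt U s" by blast
    thus "d \<in> rho ` S.St t p" using U(4) by (intro image_eqI[of _ _ z]) simp_all
  next
    fix d assume "d \<in> rho ` S.St t p"
    then obtain z where z: "z \<in> S.St t p" "d = rho z" by blast
    obtain V where V: "zopen X V" "p \<in> V" "\<forall>q\<in>V. z \<in> S.St t q" using S.St_open[OF YinX[OF assms] z(1)] by blast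
    have W: "zopen Y (V \<inter> Y)" "p \<in> V \<inter> Y" "V \<inter> Y \<noteq> {}" using open_Y[OF V(1)] V(2) assms by auto
    have "(\<lambda>q\<in>V \<inter> Y. tzp q z) \<in> sec TT (V \<inter> Y) \<and> kt (V \<inter> Y) (\<lambda>q\<in>V \<inter> Y. tzp q z) = d"
      by (rule tsec_kt[OF W(1,3)]) (use V(3) z(2) in \<open>auto simp: stg_def\<close>)
    thus "d \<in> E.stk p" unfolding E.stk_def using W(1,2)
      by (intro CollectI exI[of _ "V \<inter> Y"] exI[of _ "\<lambda>q\<in>V \<inter> Y. tzp q z"]) simp
  qed
qed

lemma embsheaf_TT: "embsheaf Y J' TT kt"
proof -
  interpret E: emb Y J' TT kt vs by (rule emb_TT)
  have e: "sec TT {} = {\<lambda>x. undefined}" "\<zero>[TT,{}] = (\<lambda>x. undefined)"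
  proof -
    have "tsec {} = {\<lambda>x. undefined}" unfolding tsec_def extensional_empty by blast
    thus "sec TT {} = {\<lambda>x. undefined}" using sec_TT[OF openin_empty] by simp
    show "\<zero>[TT,{}] = (\<lambda>x. undefined)" unfolding zero_TT by (rule ext) simp
  qed
  show ?thesis
  proof
    fix U d assume U: "zopen Y U" "U \<noteq> {}" and d: "\<And>p. p \<in> U \<Longrightarrow> d \<in> E.stk p"
    have "\<forall>p\<in>U. \<exists>z. z \<in> S.St t p \<and> rho z = d"
    proof
      fix p assume p: "p \<in> U"
      hence "p \<in> Y" using Y.zopen_subset[OF U(1)] by blast
      thus "\<exists>z. z \<in> S.St t p \<and> rho z = d" using d[OF p] stk_TT by auto
    qed
    then obtain z where z: "\<forall>p\<in>U. z p \<in> S.St t p \<and> rho (z p) = d" by (rule bchoice[THEN exE])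
    have "(\<lambda>q\<in>U. tzp q (z q)) \<in> sec TT U \<and> kt U (\<lambda>q\<in>U. tzp q (z q)) = d"
      by (rule tsec_kt[OF U]) (use z in \<open>auto simp: stg_def\<close>)
    thus "\<exists>s\<in>sec TT U. kt U s = d" by blast
  next
    show "\<zero>[TT,{}] \<oplus>[TT,{}] \<zero>[TT,{}] = \<zero>[TT,{}]"
      unfolding e(2) add_TT by (rule ext) simp
    show "res TT U {} s \<in> sec TT {}" for U s unfolding e(1) res_TT singleton_iff by (rule ext) simp
    show "sec TT {} = {\<zero>[TT,{}]}" unfolding e ..
  qed
qed

end

lemma (in linvar) cousin_cong:
  assumes eq: "\<And>p. p \<in> X \<Longrightarrow> S p = S' p" and c: "cousin X S" shows "cousin X S'"
  unfolding cousin_def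
proof (intro allI impI)
  fix f assume f: "\<forall>p\<in>X. near X p (\<lambda>q. f q - f p \<in> S' q)"
  have "\<forall>p\<in>X. near X p (\<lambda>q. f q - f p \<in> S q)"
  proof
    fix p assume "p \<in> X"
    with f obtain V where V: "zopen X V" "p \<in> V" "\<forall>q\<in>V. f q - f p \<in> S' q" by blast
    have "f q - f p \<in> S q" if "q \<in> V" for q
      using V(3) that eq[of q] zopen_subset[OF V(1)] by blast
    thus "near X p (\<lambda>q. f q - f p \<in> S q)" using V(1,2) by blast
  qed
  from cousinD[OF c this] obtain z where "\<forall>p\<in>X. z - f p \<in> S p" by blast
  thus "\<exists>z. \<forall>p\<in>X. z - f p \<in> S' p" using eq by blast
qed

text \<open>The twist is the tensor sheaf with \<open>Y = X\<close>, where nothing is divided out: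
  \<open>rd\<close> and \<open>rho\<close> are identities and \<open>B\<close> is zero.\<close>

theorem (in linvar) H1_twist:
  fixes F :: "('k, 'm) mod_sheaf" and kp :: "'k point set \<Rightarrow> 'm \<Rightarrow> nat \<Rightarrow> 'k rat"
  assumes "emb X J F kp vs"
  shows "H1_vanishes X (twist X F t) \<longleftrightarrow> cousin X (stalks.St J (emb.stk X F kp) t)"
proof -
  interpret F: emb X J F kp vs by fact
  interpret T: tsheaf X J F kp X J t "\<lambda>z. z" "\<lambda>_. {0}"
  proof
    show "zopen X (U \<inter> X)" if "zopen X U" for U
      using zopen_subset[OF that] that by (simp add: Int_absorb2)
    fix p i m assume *: "p \<in> X" "i \<in> J" "nz (pvar i :: 'k pfun) p" "m \<in> F.stk p" "vs (pf (pvar i) powi t) m \<in> {0}"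
    have "m = vs (inverse (pf (pvar i) powi t)) (vs (pf (pvar i) powi t) m)" by (simp add: nz_pf[OF *(3,1)])
    hence "m = 0" using *(5) by (metis singletonD vs_simps(3))
    hence "m = vs 0 0" by simp
    thus "\<exists>u\<in>Oloc J 0 p. \<exists>m'\<in>F.stk p. m = vs u m' \<and> u = 0" using Oloc_0[OF *(1)] F.stk_0[OF *(1)] by blast
  qed auto
  interpret T: tdescent X J F kp X J t "\<lambda>z. z" "\<lambda>_. {0}" "\<lambda>z. z"
    by unfold_locales auto
  interpret E: embsheaf X J T.TT T.kt by (rule T.embsheaf_TT)
  have "cousin X E.stk \<longleftrightarrow> cousin X (T.S.St t)"
    using cousin_cong[of E.stk "T.S.St t"] cousin_cong[of "T.S.St t" E.stk] T.stk_TT by (metis image_ident)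
  thus ?thesis using E.H1_vanishes_iff by simp
qed

section \<open>Isomorphisms with sums of twists\<close>

definition is_sheaf_iso :: "'k::field point set \<Rightarrow> ('k, 'm) mod_sheaf \<Rightarrow> ('k, 'n) mod_sheaf \<Rightarrow> ('k point set \<Rightarrow> 'm \<Rightarrow> 'n) \<Rightarrow> bool" where
  "is_sheaf_iso X F G \<phi> \<longleftrightarrow> (\<forall>U. zopen X U \<longrightarrow>
      bij_betw (\<phi> U) (sec F U) (sec G U) \<and>
      (\<forall>s\<in>sec F U. \<forall>t\<in>sec F U. \<phi> U (s \<oplus>[F,U] t) = \<phi> U s \<oplus>[G,U] \<phi> U t) \<and>
      (\<forall>a\<in>sec (structure_sheaf X) U. \<forall>s\<in>sec F U.
        \<phi> U (a \<odot>[F,U] s) = a \<odot>[G,U] \<phi> U s)) \<and>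
    (\<forall>U V. zopen X U \<and> zopen X V \<and> V \<subseteq> U \<longrightarrow>
      (\<forall>s\<in>sec F U. \<phi> V (res F U V s) = res G U V (\<phi> U s)))"

lemma sheaf_iso_iff: "sheaf_iso X F G \<longleftrightarrow> (\<exists>\<phi>. is_sheaf_iso X F G \<phi>)"
  unfolding sheaf_iso_def is_sheaf_iso_def ..

lemma
  assumes G: "emb X J G kap sm" and \<phi>: "is_sheaf_iso X F G \<phi>" and U: "zopen X U" "U \<noteq> {}"
  shows iso_bij: "bij_betw (\<phi> U) (sec F U) (sec G U)"
    and iso_res: "\<lbrakk>zopen X V; V \<subseteq> U; V \<noteq> {}; s \<in> sec F U\<rbrakk> \<Longrightarrow> kap V (\<phi> V (res F U V s)) = kap U (\<phi> U s)"
    and iso_add: "s \<in> sec F U \<Longrightarrow> t \<in> sec F U \<Longrightarrow> kap U (\<phi> U (s \<oplus>[F,U] t)) = kap U (\<phi> U s) + kap U (\<phi> U t)"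
    and iso_smult: "a \<in> twisting_sections X 0 U \<Longrightarrow> s \<in> sec F U \<Longrightarrow>
      kap U (\<phi> U (a \<odot>[F,U] s)) = sm (linvar.fr J 0 U a) (kap U (\<phi> U s))"
    and iso_inj: "\<lbrakk>s \<in> sec F U; t \<in> sec F U; kap U (\<phi> U s) = kap U (\<phi> U t)\<rbrakk> \<Longrightarrow> s = t"
proof -
  interpret G: emb X J G kap sm by fact
  note \<phi>U = \<phi>[unfolded is_sheaf_iso_def, THEN conjunct1, THEN spec[of _ U], THEN mp, OF U(1)]
  show bij: "bij_betw (\<phi> U) (sec F U) (sec G U)" using \<phi>U by blast
  have mem: "s \<in> sec F U \<Longrightarrow> \<phi> U s \<in> sec G U" for s using bij_betwE[OF bij] by blast
  show "kap V (\<phi> V (res F U V s)) = kap U (\<phi> U s)" if "zopen X V" "V \<subseteq> U" "V \<noteq> {}" "s \<in> sec F U"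
    using \<phi>[unfolded is_sheaf_iso_def, THEN conjunct2] G.e_res[OF U(1) that(1-3) mem[OF that(4)]] U(1) that by metis
  show "kap U (\<phi> U (s \<oplus>[F,U] t)) = kap U (\<phi> U s) + kap U (\<phi> U t)" if "s \<in> sec F U" "t \<in> sec F U"
    using \<phi>U G.e_add[OF U mem mem] that by simp
  show "kap U (\<phi> U (a \<odot>[F,U] s)) = sm (linvar.fr J 0 U a) (kap U (\<phi> U s))"
    if "a \<in> twisting_sections X 0 U" "s \<in> sec F U"
    using \<phi>U G.e_sm[OF U that(1) mem[OF that(2)]] that by (simp add: twisting_sheaf_def)
  show "s = t" if "s \<in> sec F U" "t \<in> sec F U" "kap U (\<phi> U s) = kap U (\<phi> U t)"
    using G.e_inj[OF U mem mem that(3)] bij that(1,2) by (auto simp: bij_betw_def dest: inj_onD)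
qed

text \<open>Sections correspond when they have the same value; equality of the stalks allows each
  value to be glued on the other side. Over the empty set each side has one section, which
  \<open>sme\<close> makes compatible with scalars.\<close>

lemma iso_emb:
  assumes F: "embsheaf X J F kap" and G: "embsheaf X J G kap'"
    and eq: "\<And>p. p \<in> X \<Longrightarrow> emb.stk X F kap p = emb.stk X G kap' p"
    and sme: "\<And>a. a \<in> twisting_sections X 0 {} \<Longrightarrow> a \<odot>[G,{}] \<zero>[G,{}] = \<zero>[G,{}]"
  shows "sheaf_iso X F G"
proof -
  interpret F: embsheaf X J F kap by fact
  interpret G: embsheaf X J G kap' by fact
  define \<phi> where "\<phi> U s = (if U = {} then \<zero>[G,{}] else SOME t. t \<in> sec G U \<and> kap' U t = kap U s)" for U s
  have stkF: "kap U s \<in> F.stk p" if "zopen X U" "p \<in> U" "s \<in> sec F U" for U s p unfolding F.stk_def using that by blast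
  have stkG: "kap' U s \<in> G.stk p" if "zopen X U" "p \<in> U" "s \<in> sec G U" for U s p unfolding G.stk_def using that by blast
  have phi: "\<phi> U s \<in> sec G U \<and> kap' U (\<phi> U s) = kap U s" if U: "zopen X U" "U \<noteq> {}" and s: "s \<in> sec F U" for U s
  proof -
    have "kap U s \<in> G.stk p" if "p \<in> U" for p using stkF[OF U(1) that s] eq that F.zopen_subset[OF U(1)] by blast
    from G.glue[OF U this] have "\<exists>t. t \<in> sec G U \<and> kap' U t = kap U s" by blast
    from someI_ex[OF this] show ?thesis using U(2) by (simp add: \<phi>_def)
  qed
  have phi0: "\<phi> {} s = \<zero>[G,{}]" for s by (simp add: \<phi>_def)
  have unique: "\<phi> U s = t" if U: "zopen X U" "U \<noteq> {}" and s: "s \<in> sec F U" and t: "t \<in> sec G U" "kap' U t = kap U s" for U s t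
    using phi[OF U s] t by (intro G.e_inj[OF U]) auto
  have "is_sheaf_iso X F G \<phi>" unfolding is_sheaf_iso_def
  proof (intro conjI allI impI ballI)
    fix U assume U: "zopen X U"
    show "bij_betw (\<phi> U) (sec F U) (sec G U)"
    proof (cases "U = {}")
      case True
      thus ?thesis by (simp add: F.sec_empty G.sec_empty bij_betw_def phi0)
    next
      case ne: False
      show ?thesis unfolding bij_betw_def
      proof (intro conjI subset_antisym subsetI inj_onI)
        fix s s' assume s: "s \<in> sec F U" "s' \<in> sec F U" "\<phi> U s = \<phi> U s'"
        hence "kap U s = kap U s'" using phi[OF U ne s(1)] phi[OF U ne s(2)] by simp
        thus "s = s'" by (rule F.e_inj[OF U ne s(1,2)])
      next
        fix t assume "t \<in> \<phi> U ` sec F U"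
        thus "t \<in> sec G U" using phi[OF U ne] by blast
      next
        fix t assume t: "t \<in> sec G U"
        have "kap' U t \<in> F.stk p" if "p \<in> U" for p using stkG[OF U that t] eq that F.zopen_subset[OF U] by blast
        from F.glue[OF U ne this] obtain s where s: "s \<in> sec F U" "kap U s = kap' U t" by blast
        hence "\<phi> U s = t" using unique[OF U ne s(1) t] by simp
        thus "t \<in> \<phi> U ` sec F U" using s(1) by blast
      qed
    qed
    fix s assume s: "s \<in> sec F U"
    {
      fix t assume t: "t \<in> sec F U"
      show "\<phi> U (s \<oplus>[F,U] t) = \<phi> U s \<oplus>[G,U] \<phi> U t"
      proof (cases "U = {}")
        case True
        thus ?thesis by (simp add: phi0 G.add_empty)
      next
        case ne: False
        have "\<phi> U s \<in> sec G U" "\<phi> U t \<in> sec G U" using phi[OF U ne] s t by blast+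
        from G.e_add[OF U ne this] F.e_add[OF U ne s t] phi[OF U ne s] phi[OF U ne t]
        show ?thesis by (intro unique[OF U ne]) simp_all
      qed
    }
    fix a assume "a \<in> sec (structure_sheaf X) U"
    hence a: "a \<in> twisting_sections X 0 U" by (simp add: twisting_sheaf_def)
    show "\<phi> U (a \<odot>[F,U] s) = a \<odot>[G,U] \<phi> U s"
    proof (cases "U = {}")
      case True
      thus ?thesis using sme a by (simp add: phi0)
    next
      case ne: False
      have "\<phi> U s \<in> sec G U" using phi[OF U ne s] by blast
      from G.e_sm[OF U ne a this] F.e_sm[OF U ne a s] phi[OF U ne s]
      show ?thesis by (intro unique[OF U ne]) simp_all
    qed
  next
    fix U V s assume "zopen X U \<and> zopen X V \<and> V \<subseteq> U" and s: "s \<in> sec F U"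
    hence UV: "zopen X U" "zopen X V" "V \<subseteq> U" by auto
    show "\<phi> V (res F U V s) = res G U V (\<phi> U s)"
    proof (cases "V = {}")
      case True
      have "\<phi> U s \<in> sec G U" using phi[OF UV(1) _ s] G.sec_empty by (cases "U = {}") (auto simp: phi0)
      from G.res_empty[OF UV(1) this] True show ?thesis by (simp add: phi0 G.sec_empty)
    next
      case ne: False
      hence "U \<noteq> {}" using UV(3) by blast
      note p = phi[OF UV(1) this s]
      show ?thesis using G.e_res[OF UV ne conjunct1[OF p]] F.e_res[OF UV ne s] p
        by (intro unique[OF UV(2) ne]) simp_all
    qed
  qed
  thus ?thesis unfolding sheaf_iso_iff by (rule exI[of "is_sheaf_iso X F G" \<phi>])
qed

section \<open>The sum of twists inside the vectors of rational functions\<close>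

context linvar begin

definition ks :: "int list \<Rightarrow> 'k point set \<Rightarrow> (nat \<Rightarrow> 'k func) \<Rightarrow> nat \<Rightarrow> 'k rat" where
  "ks b U s = (\<lambda>i. if i < length b then fr (b ! i) U (s i) else 0)"

definition OS :: "int list \<Rightarrow> 'k point \<Rightarrow> (nat \<Rightarrow> 'k rat) set" where
  "OS b p = {z. (\<forall>i<length b. z i \<in> Oloc J (b ! i) p) \<and> (\<forall>i\<ge>length b. z i = 0)}"

lemma sec_sum: "sec (sum_of_twists X b) U = (\<Pi>\<^sub>E i\<in>{..<length b}. sec (twisting_sheaf X (b ! i)) U)"
  and add_sum: "s \<oplus>[sum_of_twists X b,U] t = (\<lambda>i\<in>{..<length b}. s i \<oplus>[twisting_sheaf X (b ! i),U] t i)"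
  and zero_sum: "\<zero>[sum_of_twists X b,U] = (\<lambda>i\<in>{..<length b}. \<zero>[twisting_sheaf X (b ! i),U])"
  and smult_sum: "a \<odot>[sum_of_twists X b,U] s = (\<lambda>i\<in>{..<length b}. a \<odot>[twisting_sheaf X (b ! i),U] s i)"
  and res_sum: "res (sum_of_twists X b) U V s = (\<lambda>i\<in>{..<length b}. res (twisting_sheaf X (b ! i)) U V (s i))"
  by (simp_all add: sum_of_twists_def)

lemma sec_sumD: "s \<in> sec (sum_of_twists X b) U \<Longrightarrow> i < length b \<Longrightarrow> s i \<in> sec (twisting_sheaf X (b ! i)) U"
  unfolding sec_sum using PiE_mem[of s "{..<length b}" "\<lambda>i. sec (twisting_sheaf X (b ! i)) U" i] lessThan_iff[of i "length b"] by blast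

lemma sec_sumI: "(\<And>i. i < length b \<Longrightarrow> f i \<in> sec (twisting_sheaf X (b ! i)) U) \<Longrightarrow>
    (\<lambda>i\<in>{..<length b}. f i) \<in> sec (sum_of_twists X b) U"
  unfolding sec_sum by (rule restrict_PiE_iff[THEN iffD2]) (blast dest: lessThan_iff[THEN iffD1])

lemma emb_sum: "emb X J (sum_of_twists X b) (ks b) vs"
proof
  fix U V s assume *: "zopen X U" "zopen X V" "V \<subseteq> U" "V \<noteq> {}" "s \<in> sec (sum_of_twists X b) U"
  have "res (twisting_sheaf X (b ! i)) U V (s i) \<in> sec (twisting_sheaf X (b ! i)) V \<and>
      fr (b ! i) V (res (twisting_sheaf X (b ! i)) U V (s i)) = fr (b ! i) U (s i)" if "i < length b" for i
    using emb.e_res[OF emb_tw *(1-4) sec_sumD[OF *(5) that]] .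
  thus "res (sum_of_twists X b) U V s \<in> sec (sum_of_twists X b) V \<and> ks b V (res (sum_of_twists X b) U V s) = ks b U s"
    unfolding res_sum by (intro conjI sec_sumI) (auto simp: ks_def)
next
  fix U assume U: "zopen X U" "U \<noteq> {}"
  show "\<zero>[sum_of_twists X b,U] \<in> sec (sum_of_twists X b) U \<and> ks b U \<zero>[sum_of_twists X b,U] = 0"
    using emb.e_zero[OF emb_tw U] unfolding zero_sum by (intro conjI sec_sumI) (auto simp: ks_def fun_eq_iff)
  fix s assume s: "s \<in> sec (sum_of_twists X b) U"
  {
    fix a assume a: "a \<in> twisting_sections X 0 U"
    note * = emb.e_sm[OF emb_tw U a sec_sumD[OF s]]
    show "a \<odot>[sum_of_twists X b,U] s \<in> sec (sum_of_twists X b) U \<and>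
        ks b U (a \<odot>[sum_of_twists X b,U] s) = vs (fr 0 U a) (ks b U s)"
      using * unfolding smult_sum by (intro conjI sec_sumI) (auto simp: ks_def vs_def fun_eq_iff)
  }
  fix t assume t: "t \<in> sec (sum_of_twists X b) U"
  show "s = t" if k: "ks b U s = ks b U t"
  proof (rule PiE_ext[OF s[unfolded sec_sum] t[unfolded sec_sum]])
    fix i assume "i \<in> {..<length b}"
    hence i: "i < length b" by simp
    from fun_cong[OF k, of i] i have "fr (b ! i) U (s i) = fr (b ! i) U (t i)" by (simp add: ks_def)
    thus "s i = t i" by (rule emb.e_inj[OF emb_tw U sec_sumD[OF s i] sec_sumD[OF t i]])
  qed
  note * = emb.e_add[OF emb_tw U sec_sumD[OF s] sec_sumD[OF t]]
  show "s \<oplus>[sum_of_twists X b,U] t \<in> sec (sum_of_twists X b) U \<and>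
      ks b U (s \<oplus>[sum_of_twists X b,U] t) = ks b U s + ks b U t"
    using * unfolding add_sum by (intro conjI sec_sumI) (auto simp: ks_def fun_eq_iff)
qed

lemma ks_glue:
  assumes U: "zopen X U" "U \<noteq> {}" and z: "\<And>p. p \<in> U \<Longrightarrow> z \<in> OS b p"
  shows "\<exists>s\<in>sec (sum_of_twists X b) U. ks b U s = z"
proof
  have o: "z i \<in> Osec (b ! i) U" if "i < length b" for i using z that by (auto simp: OS_def Osec_def)
  have out: "z i = 0" if "\<not> i < length b" for i using z U(2) that by (auto simp: OS_def)
  let ?s = "\<lambda>i\<in>{..<length b}. fn U (z i)"
  show "?s \<in> sec (sum_of_twists X b) U" by (rule sec_sumI) (use fn_tw[OF U(1) o] in \<open>simp add: twisting_sheaf_def\<close>)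
  show "ks b U ?s = z" using fr_fn[OF U o] out by (auto simp: ks_def fun_eq_iff)
qed

lemma ks_OS:
  assumes U: "zopen X U" "p \<in> U" "s \<in> sec (sum_of_twists X b) U" shows "ks b U s \<in> OS b p"
proof -
  have ne: "U \<noteq> {}" using U(2) by blast
  have "fr (b ! i) U (s i) \<in> Oloc J (b ! i) p" if i: "i < length b" for i
    using fr_tw(1)[OF U(1) ne, of "s i" "b ! i"] sec_sumD[OF U(3) i] U(2) by (auto simp: twisting_sheaf_def Osec_def)
  thus ?thesis by (auto simp: OS_def ks_def)
qed

lemma stk_sum: assumes "p \<in> X" shows "emb.stk X (sum_of_twists X b) (ks b) p = OS b p"
proof -
  interpret E: emb X J "sum_of_twists X b" "ks b" vs by (rule emb_sum)
  show ?thesis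
  proof (intro subset_antisym subsetI)
    fix z assume "z \<in> E.stk p"
    then obtain U s where U: "zopen X U" "p \<in> U" "s \<in> sec (sum_of_twists X b) U" "ks b U s = z" by (rule E.stkE)
    thus "z \<in> OS b p" using ks_OS by blast
  next
    fix z assume z: "z \<in> OS b p"
    have "\<forall>i\<in>{..<length b}. near X p (\<lambda>q. z i \<in> Oloc J (b ! i) q)"
    proof
      fix i assume "i \<in> {..<length b}"
      hence "z i \<in> Oloc J (b ! i) p" using z by (auto simp: OS_def)
      from Oloc_open[OF this assms] obtain g c where "g \<in> HP J c" "nz g p" "\<And>q. q \<in> X \<Longrightarrow> nz g q \<Longrightarrow> z i \<in> Oloc J (b ! i) q" by blast
      thus "near X p (\<lambda>q. z i \<in> Oloc J (b ! i) q)"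
        using zopen_nz[of g c] assms by (intro exI[of _ "{q \<in> X. nz g q}"]) auto
    qed
    then obtain V where V: "\<forall>i\<in>{..<length b}. zopen X (V i) \<and> p \<in> V i \<and> (\<forall>q\<in>V i. z i \<in> Oloc J (b ! i) q)"
      by (rule bchoice[THEN exE])
    define W where "W = X \<inter> (\<Inter>i\<in>{..<length b}. V i)"
    have W: "zopen X W" "p \<in> W"
    proof -
      have "openin (zariski X) (\<Inter> (insert X (V ` {..<length b})))"
        by (rule openin_Inter) (use V zopen_X in auto)
      thus "zopen X W" by (simp add: W_def)
      show "p \<in> W" using V assms by (auto simp: W_def)
    qed
    have "z \<in> OS b q" if "q \<in> W" for q using V z that by (auto simp: OS_def W_def)
    from ks_glue[OF W(1) _ this] W(2) obtain s where "s \<in> sec (sum_of_twists X b) W" "ks b W s = z" by blast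
    thus "z \<in> E.stk p" unfolding E.stk_def using W by blast
  qed
qed

lemma tw_empty: "sec (twisting_sheaf X b) {} = {\<lambda>v. undefined}" "\<zero>[twisting_sheaf X b,{}] = (\<lambda>v. undefined)"
  "f \<oplus>[twisting_sheaf X b,{}] g = (\<lambda>v. undefined)" "f \<odot>[twisting_sheaf X b,{}] g = (\<lambda>v. undefined)"
  "res (twisting_sheaf X b) U {} g = (\<lambda>v. undefined)"
  by (auto simp: twisting_sheaf_def twisting_sections_def fun_eq_iff)

lemma embsheaf_sum: "embsheaf X J (sum_of_twists X b) (ks b)"
  and smult_sum_empty: "a \<odot>[sum_of_twists X b,{}] \<zero>[sum_of_twists X b,{}] = \<zero>[sum_of_twists X b,{}]"
proof -
  interpret E: emb X J "sum_of_twists X b" "ks b" vs by (rule emb_sum)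
  have e: "\<zero>[sum_of_twists X b,{}] = (\<lambda>i\<in>{..<length b}. \<lambda>v. undefined)" by (simp add: zero_sum tw_empty)
  have s: "sec (sum_of_twists X b) {} = {\<lambda>i\<in>{..<length b}. \<lambda>v. undefined}"
    unfolding sec_sum tw_empty
  proof (intro subset_antisym subsetI)
    fix x :: "nat \<Rightarrow> 'k func" assume x: "x \<in> {..<length b} \<rightarrow>\<^sub>E {\<lambda>v. undefined}"
    have "x = (\<lambda>i\<in>{..<length b}. \<lambda>v. undefined)"
      by (rule extensionalityI[of x "{..<length b}"]) (use x in \<open>auto simp: PiE_iff\<close>)
    thus "x \<in> {\<lambda>i\<in>{..<length b}. \<lambda>v. undefined}" by simp
  qed auto
  show "a \<odot>[sum_of_twists X b,{}] \<zero>[sum_of_twists X b,{}] = \<zero>[sum_of_twists X b,{}]"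
    unfolding smult_sum e tw_empty ..
  show "embsheaf X J (sum_of_twists X b) (ks b)"
  proof
    fix U z assume U: "zopen X U" "U \<noteq> {}" and z: "\<And>p. p \<in> U \<Longrightarrow> z \<in> E.stk p"
    show "\<exists>s\<in>sec (sum_of_twists X b) U. ks b U s = z"
      by (rule ks_glue[OF U]) (use z stk_sum zopen_subset[OF U(1)] in blast)
  qed (simp_all add: e s add_sum res_sum tw_empty)
qed

end

section \<open>Restriction to the hyperplane\<close>

locale hyper_sheaf = emb X J F kap vs + hyperplane_pair X J H j a
  for X :: "'k::{alg_closed_field, field_char_0} point set" and J and F :: "('k, 'm) mod_sheaf"
    and kap :: "'k point set \<Rightarrow> 'm \<Rightarrow> nat \<Rightarrow> 'k rat" and H j a
begin

sublocale stalks X J stk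
  by (rule emb_stalks) (rule emb_axioms)

text \<open>The stalk of the restriction is the stalk of \<open>F\<close> modulo the multiples of
  \<open>L\<close>. As \<open>L\<close> has degree one, these are \<open>L\<close> times elements of
  the twist by -1. \<open>red\<close> picks the representative of a function free of coordinate
  \<open>j\<close>.\<close>

sublocale T: tsheaf X J F kap H J' 0 red "\<lambda>p. vs (pf L) ` St (- 1) p"
proof
  show "H \<subseteq> X" using H_X by blast
  show "J' \<subseteq> J" by blast
  show "zopen H (U \<inter> H)" if "zopen X U" for U by (rule zopen_H[OF that])
  fix p assume p: "p \<in> H"
  note pX = H_X[OF p]
  show "red f \<in> Oloc J' 0 p" if "f \<in> Oloc J 0 p" for f by (rule red_Oloc[OF that p])
  show "ev (red f) v = ev f v" if f: "f \<in> Oloc J 0 p" "v \<in> p" for f v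
  proof -
    obtain P Q c where *: "Q \<in> HP J c" "nz Q p" "f = pf P / pf Q" "red f = pf (ps P) / pf (ps Q)"
      by (rule red_repr[OF f(1) p]) blast
    have q: "pev Q v \<noteq> 0" using *(1,2) nz_iff[OF *(1) pX f(2)] by simp
    thus ?thesis unfolding *(4) unfolding *(3) using ev_eq[of Q v P] ev_eq[of "ps Q" v "ps P"] pev_ps[OF p f(2)] by simp
  qed
  show "red f = f" if "f \<in> Oloc J' 0 p" for f by (rule red_id[OF that p])
  show "0 \<in> vs (pf L) ` St (- 1) p" using St_0[OF pX, of "- 1"] by (intro image_eqI[of _ _ 0]) auto
  show "z + w \<in> vs (pf L) ` St (- 1) p" if "z \<in> vs (pf L) ` St (- 1) p" "w \<in> vs (pf L) ` St (- 1) p" for z w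
  proof -
    obtain z' w' where *: "z = vs (pf L) z'" "z' \<in> St (- 1) p" "w = vs (pf L) w'" "w' \<in> St (- 1) p" using \<open>z \<in> _\<close> \<open>w \<in> _\<close> by blast
    show ?thesis unfolding *(1,3) vs_add[symmetric] using St_add[OF pX *(2,4)] by (rule imageI)
  qed
  show "- z \<in> vs (pf L) ` St (- 1) p" if "z \<in> vs (pf L) ` St (- 1) p" for z
  proof -
    obtain z' where *: "z = vs (pf L) z'" "z' \<in> St (- 1) p" using \<open>z \<in> _\<close> by blast
    show ?thesis unfolding *(1) vs_simps(6)[symmetric] using St_uminus[OF *(2)] by (rule imageI)
  qed
  show "vs ((c - red c) * g) z \<in> vs (pf L) ` St (- 1) p" if c: "c \<in> Oloc J 0 p" and g: "g \<in> Oloc J' 0 p" and z: "z \<in> stk p" for c g z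
  proof -
    obtain w where w: "w \<in> Oloc J (0 - 1) p" "c = red c + pf L * w" by (rule red_decomp[OF c p])
    have "c - red c = pf L * w" using w(2) by (metis add_diff_cancel_left')
    hence e: "vs ((c - red c) * g) z = vs (pf L) (vs (w * g) z)" by (simp add: mult.assoc)
    have "w * g \<in> Oloc J (- 1) p" using Oloc_mult[OF w(1) J'_J[OF g]] by simp
    hence "vs (w * g) z \<in> St (- 1) p" unfolding St_def using z by blast
    thus ?thesis unfolding e by (rule imageI)
  qed
  show "\<exists>u\<in>Oloc J 0 p. \<exists>m'\<in>stk p. m = vs u m' \<and> red u = 0"
    if "m \<in> stk p" "vs (pf (pvar i) powi 0) m \<in> vs (pf L) ` St (- 1) p" for i m
  proof -
    have "m \<in> vs (pf L) ` St (- 1) p" using that(2) by simp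
    then obtain w where w: "w \<in> St (- 1) p" "m = vs (pf L) w" by blast
    obtain f m' where f: "f \<in> Oloc J (- 1) p" "m' \<in> stk p" "w = vs f m'" using w(1) unfolding St_def by blast
    have L: "pf L \<in> Oloc J 1 p" by (rule Oloc_HP[OF HP_lform])
    have "pf L * f \<in> Oloc J 0 p" using Oloc_mult[OF L f(1)] by simp
    moreover have "red (pf L * f) = 0" using red_mult[OF L f(1) p] by simp
    moreover have "m = vs (pf L * f) m'" using w(2) f(3) by simp
    ultimately show ?thesis using f(2) by blast
  qed
qed

text \<open>When the stalks are sums of twists, componentwise reduction realises the quotient by the
  multiples of \<open>L\<close>.\<close>

theorem restrict_iso:
  assumes stk: "\<And>p. p \<in> X \<Longrightarrow> stk p = OS b p"
  shows "sheaf_iso H (restrict_sheaf X F H) (sum_of_twists H b)"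
proof -
  define rho :: "(nat \<Rightarrow> 'k rat) \<Rightarrow> nat \<Rightarrow> 'k rat" where "rho z = (\<lambda>i. red (z i))" for z
  \<comment> \<open>Beyond the length of \<open>b\<close> the components are 0, which lies in every
    \<open>Oloc\<close>; degree 0 is a filler that lets \<open>red_add\<close> and
    \<open>red_mult\<close> be applied to all components.\<close>
  define d where "d i = (if i < length b then b ! i else 0)" for i
  have red0: "red 0 = 0" using red_pf[of 0] by simp
  have cmp: "z i \<in> Oloc J (d i) p" if "p \<in> H" "z \<in> stk p" for z i p
    using that stk[OF H_X[OF that(1)]] Oloc_0[OF H_X[OF that(1)]] by (cases "i < length b") (auto simp: OS_def d_def)
  have S0: "St 0 p = stk p" if "p \<in> H" for p by (rule St_S[OF H_X[OF that]])
  have add: "rho (z + w) = rho z + rho w" if "p \<in> H" "z \<in> stk p" "w \<in> stk p" for z w p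
    unfolding rho_def using red_add[OF cmp[OF that(1,2)] cmp[OF that(1,3)] that(1)] by (simp add: fun_eq_iff)
  have rvs: "rho (vs c z) = vs c (rho z)" if "p \<in> H" "c \<in> Oloc J' 0 p" "z \<in> stk p" for c z p
    unfolding rho_def vs_def using red_mult[OF J'_J[OF that(2)] cmp[OF that(1,3)] that(1)] red_id[OF that(2,1)]
    by (simp add: fun_eq_iff)
  have ker: "z \<in> vs (pf L) ` St (- 1) p \<longleftrightarrow> rho z = 0" if p: "p \<in> H" and z: "z \<in> stk p" for z p
  proof
    assume "z \<in> vs (pf L) ` St (- 1) p"
    then obtain w where w: "w \<in> St (- 1) p" "z = vs (pf L) w" by blast
    obtain f m' where f: "f \<in> Oloc J (- 1) p" "m' \<in> stk p" "w = vs f m'" using w(1) unfolding St_def by blast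
    have L: "pf L \<in> Oloc J 1 p" by (rule Oloc_HP[OF HP_lform])
    have "red (z i) = 0" for i
      using red_mult[OF L Oloc_mult[OF f(1) cmp[OF p f(2), of i]] p] w(2) f(3) by (simp add: vs_def mult.assoc)
    thus "rho z = 0" by (simp add: rho_def fun_eq_iff)
  next
    assume r: "rho z = 0"
    have r0: "red (z i) = 0" for i using fun_cong[OF r, of i] by (simp add: rho_def)
    obtain i where i: "i \<in> J" "nz (pvar i :: 'k pfun) p" by (rule ex_pvar[OF H_X[OF p]])
    have "\<forall>i. \<exists>w. w \<in> Oloc J (d i - 1) p \<and> z i = pf L * w"
    proof
      fix i
      obtain w where "w \<in> Oloc J (d i - 1) p" "z i = red (z i) + pf L * w" by (rule red_decomp[OF cmp[OF p z] p])
      thus "\<exists>w. w \<in> Oloc J (d i - 1) p \<and> z i = pf L * w" using r0 by auto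
    qed
    then obtain w0 where w0: "\<And>i. w0 i \<in> Oloc J (d i - 1) p \<and> z i = pf L * w0 i" by metis
    define w where "w i = (if i < length b then w0 i else 0)" for i
    have out: "z i = 0" if "i \<ge> length b" for i using z stk[OF H_X[OF p]] that by (auto simp: OS_def)
    have zw: "z = vs (pf L) w" using w0 out by (auto simp: vs_def fun_eq_iff w_def)
    have y1: "pf (pvar i) powi 1 \<in> Oloc J 1 p" using Oloc_powi[OF HP_pvar[OF i(1)] i(2), of 1] .
    have "vs (pf (pvar i) powi (- (- 1))) w \<in> OS b p"
    proof -
      have "pf (pvar i) * w0 k \<in> Oloc J (b ! k) p" if "k < length b" for k
        using Oloc_mult[OF y1 conjunct1[OF w0[of k]]] that by (simp add: d_def)
      thus ?thesis by (simp add: OS_def vs_def w_def)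
    qed
    hence "w \<in> St (- 1) p" using St_iff[OF H_X[OF p] HP_pvar[OF i(1)] i(2), of w "- 1"] stk[OF H_X[OF p]] by simp
    thus "z \<in> vs (pf L) ` St (- 1) p" unfolding zw by (rule imageI)
  qed
  interpret D: tdescent X J F kap H J' 0 red "\<lambda>p. vs (pf L) ` St (- 1) p" rho
  proof
    fix p z assume p: "p \<in> H" and "z \<in> St 0 p"
    hence z: "z \<in> stk p" using S0 by simp
    show "rho (vs c z) = vs c (rho z)" if "c \<in> Oloc J' 0 p" for c by (rule rvs[OF p that z])
    fix w assume "w \<in> St 0 p"
    hence w: "w \<in> stk p" using S0[OF p] by simp
    show "rho (z + w) = rho z + rho w" by (rule add[OF p z w])
    have zw: "z - w \<in> stk p" using S_add[OF H_X[OF p] z S_uminus[OF H_X[OF p] w]] by simp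
    have "rho z = rho (z - w) + rho w" using add[OF p zw w] by simp
    thus "z - w \<in> vs (pf L) ` St (- 1) p \<longleftrightarrow> rho z = rho w" using ker[OF p zw] by simp
  qed
  have stkT: "emb.stk H T.TT D.kt p = emb.stk H (sum_of_twists H b) (H.ks b) p" if p: "p \<in> H" for p
  proof -
    have "rho ` stk p = H.OS b p"
    proof (intro subset_antisym subsetI)
      fix e assume "e \<in> rho ` stk p"
      then obtain z where z: "z \<in> stk p" "e = rho z" by blast
      thus "e \<in> H.OS b p" using stk[OF H_X[OF p]] red_Oloc[OF _ p] red0 by (auto simp: OS_def H.OS_def rho_def)
    next
      fix e assume e: "e \<in> H.OS b p"
      have "rho e = e"
      proof
        fix i show "rho e i = e i" using e red_id[OF _ p] red0 by (cases "i < length b") (auto simp: H.OS_def rho_def)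
      qed
      moreover have "e \<in> stk p" unfolding stk[OF H_X[OF p]] using e J'_J by (auto simp: OS_def H.OS_def)
      ultimately show "e \<in> rho ` stk p" by (metis imageI)
    qed
    thus ?thesis using D.stk_TT[OF p] H.stk_sum[OF p] S0[OF p] by simp
  qed
  show ?thesis by (rule iso_emb[OF D.embsheaf_TT H.embsheaf_sum stkT H.smult_sum_empty])
qed

lemma tz_add: "\<lbrakk>p \<in> H; z \<in> stk p; w \<in> stk p\<rbrakk> \<Longrightarrow> T.tzp p z \<oplus>\<^bsub>T.Tp p\<^esub> T.tzp p w = T.tzp p (z + w)"
  using T.tzp_add St_S[OF H_X] by blast

lemma tz_smult: "\<lbrakk>p \<in> H; c \<in> Oloc J' 0 p; z \<in> stk p\<rbrakk> \<Longrightarrow> H.gO 0 p c \<odot>\<^bsub>T.Tp p\<^esub> T.tzp p z = T.tzp p (vs c z)"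
  using T.tzp_smult(1) St_S[OF H_X] by blast

lemma smult_tsec:
  assumes "zopen H W" "W \<noteq> {}" "c \<in> twisting_sections H 0 W" "p \<in> W" "z \<in> stk p" "\<sigma> p = T.tzp p z"
  shows "(c \<odot>[T.TT,W] \<sigma>) p = T.tzp p (vs (H.fr 0 W c) z)" "vs (H.fr 0 W c) z \<in> stk p"
proof -
  have p: "p \<in> H" using assms(4) H.zopen_subset[OF assms(1)] by blast
  have o: "H.fr 0 W c \<in> Oloc J' 0 p" using H.fr_tw(1)[OF assms(1-3)] assms(4) by (auto simp: H.Osec_def)
  show "(c \<odot>[T.TT,W] \<sigma>) p = T.tzp p (vs (H.fr 0 W c) z)"
    using tz_smult[OF p o assms(5)] assms(4,6) H.germ_O[OF assms(1,4,3)] by (simp add: T.smult_TT)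
  show "vs (H.fr 0 W c) z \<in> stk p" by (rule S_vs[OF H_X[OF p] J'_J[OF o] assms(5)])
qed

text \<open>\<open>Psi z\<close> is the value, under the isomorphism, of the section represented
  everywhere by \<open>z\<close>, taken over the largest open subset \<open>U z\<close> of
  \<open>H\<close> where \<open>z\<close> lies in the stalks. Every smaller nonempty open set gives
  the same value, so rules can be checked on any of them.\<close>

theorem reduction_exists:
  assumes iso: "sheaf_iso H (restrict_sheaf X F H) (sum_of_twists H b)"
    and fin: "\<And>p. p \<in> X \<Longrightarrow> \<exists>V m T. zopen X V \<and> p \<in> V \<and> (\<forall>q\<in>V. \<forall>i<m. T i \<in> stk q) \<and>
      (\<forall>q\<in>V. \<forall>z\<in>stk q. \<exists>c. (\<forall>i<m. c i \<in> Oloc J 0 q) \<and> z = (\<Sum>i<m::nat. vs (c i) (T i)))"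
  shows "\<exists>Psi. reduction X J H j a stk (length b) (\<lambda>i. b ! i) Psi"
proof -
  obtain \<psi> where \<psi>: "is_sheaf_iso H T.TT (sum_of_twists H b) \<psi>" using iso unfolding sheaf_iso_iff by blast
  define kE where "kE U s = H.ks b U (\<psi> U s)" for U s
  note iso = iso_bij[OF H.emb_sum \<psi>] iso_res[OF H.emb_sum \<psi>, folded kE_def] iso_add[OF H.emb_sum \<psi>, folded kE_def]
    iso_smult[OF H.emb_sum \<psi>, folded kE_def] iso_inj[OF H.emb_sum \<psi>, folded kE_def]
  define sg where "sg W z = (\<lambda>q\<in>W. T.tzp q z)" for W z
  define U where "U z = {q \<in> H. z \<in> stk q}" for z
  have Uo: "zopen H (U z)" for z
  proof (subst openin_subopen, intro ballI)
    fix p assume "p \<in> U z"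
    hence p: "p \<in> H" "z \<in> stk p" by (auto simp: U_def)
    obtain V where V: "zopen X V" "p \<in> V" "\<forall>q\<in>V. z \<in> stk q" using stk_open[OF p(2)] by blast
    thus "\<exists>T. zopen H T \<and> p \<in> T \<and> T \<subseteq> U z" using zopen_H[OF V(1)] p by (intro exI[of _ "V \<inter> H"]) (auto simp: U_def)
  qed
  have sgT: "sg W z \<in> sec T.TT W" if W: "zopen H W" "W \<subseteq> U z" for W z
  proof -
    have "z \<in> St 0 q" if "q \<in> W" for q using that W(2) St_S[OF H_X] by (auto simp: U_def)
    thus ?thesis unfolding T.sec_TT[OF W(1)] T.tsec_def using W(1)
      by (intro CollectI conjI ballI exI[of _ W] exI[of _ z]) (auto simp: sg_def)
  qed
  define Psi where "Psi z = kE (U z) (sg (U z) z)" for z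
  have PsiW: "kE W (sg W z) = Psi z" if W: "zopen H W" "W \<noteq> {}" "W \<subseteq> U z" for W z
  proof -
    have "res T.TT (U z) W (sg (U z) z) = sg W z" using W(3) by (auto simp: T.res_TT sg_def fun_eq_iff restrict_def)
    thus ?thesis using iso(2)[OF Uo _ W(1,3,2) sgT[OF Uo subset_refl]] W(2,3) unfolding Psi_def by auto
  qed
  have Psi_stk: "Psi z \<in> H.OS b p" if p: "p \<in> H" "z \<in> stk p" for p z
    unfolding Psi_def kE_def
    using iso(1)[OF Uo, THEN bij_betwE] sgT[OF Uo subset_refl] p by (intro H.ks_OS[OF Uo]) (auto simp: U_def)
  have Psi_add: "Psi (z + w) = Psi z + Psi w" if p: "p \<in> H" and z: "z \<in> stk p" and w: "w \<in> stk p" for p z w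
  proof -
    define W where "W = U z \<inter> U w \<inter> U (z + w)"
    have W: "zopen H W" "W \<noteq> {}" "W \<subseteq> U z" "W \<subseteq> U w" "W \<subseteq> U (z + w)"
      using p z w stk_add[OF z w] Uo by (auto simp: W_def U_def intro!: H.zopen_Int)
    have "sg W (z + w) = sg W z \<oplus>[T.TT,W] sg W w"
    proof
      fix q show "sg W (z + w) q = (sg W z \<oplus>[T.TT,W] sg W w) q"
      proof (cases "q \<in> W")
        case True
        hence "q \<in> H" "z \<in> stk q" "w \<in> stk q" by (auto simp: W_def U_def)
        from tz_add[OF this] True show ?thesis by (simp add: sg_def T.add_TT)
      qed (simp add: sg_def T.add_TT)
    qed
    thus ?thesis
      using iso(3)[OF W(1,2) sgT[OF W(1,3)] sgT[OF W(1,4)]] PsiW[OF W(1,2,3)] PsiW[OF W(1,2,4)] PsiW[OF W(1,2,5)] by simp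
  qed
  have "reduction X J H j a stk (length b) (\<lambda>i. b ! i) Psi"
  proof
    fix p z assume p: "p \<in> H" and z: "z \<in> stk p"
    show "Psi z i \<in> Oloc J' (b ! i) p" if "i < length b" for i using Psi_stk[OF p z] that by (simp add: H.OS_def)
    show "Psi z i = 0" if "i \<ge> length b" for i using Psi_stk[OF p z] that by (simp add: H.OS_def)
    show "Psi (z + w) = Psi z + Psi w" if "w \<in> stk p" for w by (rule Psi_add[OF p z that])
    show "Psi (vs f z) = vs (red f) (Psi z)" if f: "f \<in> Oloc J 0 p" for f
    proof -
      obtain V where V: "zopen X V" "p \<in> V" "\<forall>q\<in>V. f \<in> Oloc J 0 q" using Oloc_zopen[OF H_X[OF p] f] by blast
      define W where "W = U z \<inter> (U (vs f z) \<inter> (V \<inter> H))"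
      have W: "zopen H W" "W \<noteq> {}" "W \<subseteq> U z" "W \<subseteq> U (vs f z)"
      proof -
        show "zopen H W" unfolding W_def by (intro H.zopen_Int Uo zopen_H V(1))
        have "p \<in> W" using p z V(2) S_vs[OF H_X[OF p] f z] by (simp add: W_def U_def)
        thus "W \<noteq> {}" by blast
      qed (auto simp: W_def)
      have fq: "f \<in> Oloc J 0 q" "q \<in> H" "z \<in> stk q" if "q \<in> W" for q using that V(3) by (auto simp: W_def U_def)
      have o: "red f \<in> H.Osec 0 W" using red_Oloc fq by (auto simp: H.Osec_def)
      define c where "c = H.fn W (red f)"
      have c: "c \<in> twisting_sections H 0 W" "H.fr 0 W c = red f" unfolding c_def by (rule H.fn_tw[OF W(1) o], rule H.fr_fn[OF W(1,2) o])
      have "sg W (vs f z) = c \<odot>[T.TT,W] sg W z"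
      proof
        fix q show "sg W (vs f z) q = (c \<odot>[T.TT,W] sg W z) q"
        proof (cases "q \<in> W")
          case True
          note q = fq[OF True]
          have s: "sg W z q = T.tzp q z" using True by (simp add: sg_def)
          note sm = smult_tsec[where \<sigma> = "sg W z", OF W(1,2) c(1) True q(3) s, unfolded c(2)]
          \<comment> \<open>\<open>f\<close> and its reduction act alike on the quotient by the
            multiples of \<open>L\<close>.\<close>
          have "vs f z - vs (red f) z = vs ((f - red f) * 1) z" by (simp add: vs_diff_left)
          also have "\<dots> \<in> vs (pf L) ` St (- 1) q" by (rule T.B_rd[OF q(2,1) H.Oloc_1 q(3)])
          finally have "T.tzp q (vs f z) = T.tzp q (vs (red f) z)"
            using T.tzp_eq_iff[OF q(2), of "vs f z" "vs (red f) z"] S_vs[OF H_X[OF q(2)] q(1,3)] sm(2) St_S[OF H_X[OF q(2)]] by simp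
          thus ?thesis using sm(1) True by (simp add: sg_def)
        qed (simp add: sg_def T.smult_TT)
      qed
      thus ?thesis using iso(4)[OF W(1,2) c(1) sgT[OF W(1,3)]] PsiW[OF W(1,2,3)] PsiW[OF W(1,2,4)] c(2) by simp
    qed
    show "\<exists>w\<in>St (- 1) p. z = vs (pf L) w" if P0: "Psi z = 0"
    proof -
      have pU: "p \<in> U z" using p z by (simp add: U_def)
      hence ne: "U z \<noteq> {}" by blast
      have 0: "0 \<in> stk q" if "q \<in> H" for q by (rule stk_0[OF H_X[OF that]])
      have U0: "U z \<subseteq> U 0" using 0 by (auto simp: U_def)
      \<comment> \<open>Comparison with the zero section over \<open>U z\<close>: equal values force
        equal sections, so the class of \<open>z\<close> at \<open>p\<close> is zero and
        \<open>z\<close> is a multiple of \<open>L\<close>.\<close>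
      have "Psi 0 = 0" using Psi_add[OF p 0 0] p by simp
      hence "kE (U z) (sg (U z) z) = kE (U z) (sg (U z) 0)" using PsiW[OF Uo ne U0] P0 by (simp add: Psi_def)
      from iso(5)[OF Uo ne sgT[OF Uo subset_refl] sgT[OF Uo U0] this] have "sg (U z) z = sg (U z) 0" .
      from fun_cong[OF this, of p] have "T.tzp p z = T.tzp p 0" using pU by (simp add: sg_def)
      hence "z \<in> vs (pf L) ` St (- 1) p"
        using T.tzp_eq_iff[OF p, of z 0] z stk_0[OF H_X[OF p]] St_S[OF H_X[OF p]] by simp
      thus ?thesis by blast
    qed
  next
    fix p d assume p: "p \<in> H" and d: "\<And>i. i < length b \<Longrightarrow> d i \<in> Oloc J' (b ! i) p" "\<And>i. i \<ge> length b \<Longrightarrow> d i = (0 :: 'k rat)"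
    hence "d \<in> emb.stk H (sum_of_twists H b) (H.ks b) p" using H.stk_sum[OF p] by (simp add: H.OS_def)
    then obtain W g where W: "zopen H W" "p \<in> W" "g \<in> sec (sum_of_twists H b) W" "H.ks b W g = d"
      by (rule emb.stkE[OF H.emb_sum])
    have neW: "W \<noteq> {}" using W(2) by blast
    have "g \<in> \<psi> W ` sec T.TT W" using bij_betw_imp_surj_on[OF iso(1)[OF W(1) neW]] W(3) by simp
    then obtain \<sigma> where s: "\<sigma> \<in> sec T.TT W" "kE W \<sigma> = d" using W(4) unfolding kE_def by blast
    have \<sigma>: "\<sigma> \<in> T.tsec W" using s(1) T.sec_TT[OF W(1)] by simp
    obtain V z where V: "zopen H V" "p \<in> V" "V \<subseteq> W" "\<forall>q\<in>V. z \<in> St 0 q \<and> \<sigma> q = T.tzp q z"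
      using T.tsec_point[OF \<sigma> W(2)] by blast
    have VH: "q \<in> H" if "q \<in> V" for q using that H.zopen_subset[OF V(1)] by blast
    have Vz: "z \<in> stk q" if "q \<in> V" for q using V(4) that St_S[OF H_X[OF VH[OF that]]] by blast
    have ne: "V \<noteq> {}" using V(2) by blast
    have "res T.TT W V \<sigma> = sg V z" using V(4) by (auto simp: T.res_TT sg_def fun_eq_iff restrict_def)
    hence "kE V (sg V z) = d" using iso(2)[OF W(1) neW V(1,3) ne s(1)] s(2) by simp
    moreover have "V \<subseteq> U z" using VH Vz by (auto simp: U_def)
    ultimately have "Psi z = d" using PsiW[OF V(1) ne] by simp
    thus "\<exists>z\<in>stk p. Psi z = d" using V(2) Vz by blast
  qed (rule fin)
  thus ?thesis by blast
qed

end

section \<open>Torsion free sheaves are subsheaves of a constant sheaf\<close>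

text \<open>Only the law for zero is assumed, so that the sum can be evaluated in the section
  records of a relation sheaf before any module structure on them is established; the fold is
  followed by hand.\<close>

lemma finsum_all_zero:
  fixes G (structure)
  assumes A: "finite A" "\<And>i. i \<in> A \<Longrightarrow> g i = \<zero>" and z: "\<zero> \<in> carrier G" "\<zero> \<oplus> \<zero> = \<zero>"
  shows "finsum G g A = \<zero>"
proof -
  let ?f = "\<lambda>i. (\<oplus>) (g i)"
  have ex: "(B, \<zero>) \<in> foldSetD (carrier G) ?f \<zero>" if "B \<subseteq> A" for B
    using finite_subset[OF that A(1)] that
  proof (induction B rule: finite_induct)
    case (insert x B)
    have "(insert x B, g x \<oplus> \<zero>) \<in> foldSetD (carrier G) ?f \<zero>"
      using insert A(2)[of x] z by (intro foldSetD.insertI) auto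
    thus ?case using A(2)[of x] insert.prems z by simp
  qed (rule foldSetD.emptyI[OF z(1)])
  have un: "x = \<zero>" if "(B, x) \<in> foldSetD (carrier G) ?f \<zero>" "B \<subseteq> A" for B x
    using that by (induction B x rule: foldSetD.induct) (use A(2) z in auto)
  have "foldD (carrier G) ?f \<zero> A = \<zero>"
    unfolding foldD_def by (rule the_equality) (use ex un in auto)
  thus ?thesis using A(1) by (simp add: finsum_def finprod_def comp_def)
qed

locale modsheaf = linvar X J for X :: "'k::{alg_closed_field, field_char_0} point set" and J +
  fixes F :: "('k, 'm) mod_sheaf"
  assumes sh: "sheaf_of_modules X F"
begin

lemmas sh_parts = sh[unfolded sheaf_of_modules_def, THEN conjunct1] sh[unfolded sheaf_of_modules_def, THEN conjunct2, THEN conjunct1]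
  sh[unfolded sheaf_of_modules_def, THEN conjunct2, THEN conjunct2, THEN conjunct1]
  sh[unfolded sheaf_of_modules_def, THEN conjunct2, THEN conjunct2, THEN conjunct2, THEN conjunct1]
  sh[unfolded sheaf_of_modules_def, THEN conjunct2, THEN conjunct2, THEN conjunct2, THEN conjunct2]

lemma mod_F: "zopen X U \<Longrightarrow> Module.module (sects (structure_sheaf X) U) (sects F U)"
  using sh_parts(1) by simp

lemma
  assumes "zopen X U" "zopen X V" "V \<subseteq> U" "s \<in> sec F U"
  shows res_cl: "res F U V s \<in> sec F V"
    and res_add: "t \<in> sec F U \<Longrightarrow> res F U V (s \<oplus>[F,U] t) = res F U V s \<oplus>[F,V] res F U V t"
    and res_smult: "a \<in> sec (structure_sheaf X) U \<Longrightarrow>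
      res F U V (a \<odot>[F,U] s) = res (structure_sheaf X) U V a \<odot>[F,V] res F U V s"
proof -
  note * = sh_parts(2)[THEN spec[of _ U], THEN spec[of _ V], THEN mp, OF conjI[OF assms(1) conjI[OF assms(2,3)]]]
  show "res F U V s \<in> sec F V" by (rule bspec[OF *[THEN conjunct1] assms(4)])
  show "t \<in> sec F U \<Longrightarrow> res F U V (s \<oplus>[F,U] t) = res F U V s \<oplus>[F,V] res F U V t"
    by (rule bspec[OF bspec[OF *[THEN conjunct2, THEN conjunct1] assms(4)]])
  show "a \<in> sec (structure_sheaf X) U \<Longrightarrow>
      res F U V (a \<odot>[F,U] s) = res (structure_sheaf X) U V a \<odot>[F,V] res F U V s"
    by (rule bspec[OF bspec[OF *[THEN conjunct2, THEN conjunct2]] assms(4)])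
qed

lemma res_res: "\<lbrakk>zopen X U; zopen X V; zopen X W; W \<subseteq> V; V \<subseteq> U; s \<in> sec F U\<rbrakk> \<Longrightarrow>
    res F V W (res F U V s) = res F U W s"
  by (rule bspec[OF sh_parts(4)[THEN spec[of _ U], THEN spec[of _ V], THEN spec[of _ W], THEN mp]]) simp_all

lemma glue_F:
  assumes "\<And>V. V \<in> \<C> \<Longrightarrow> zopen X V" "\<And>V. V \<in> \<C> \<Longrightarrow> s V \<in> sec F V"
    "\<And>V W. V \<in> \<C> \<Longrightarrow> W \<in> \<C> \<Longrightarrow> res F V (V \<inter> W) (s V) = res F W (V \<inter> W) (s W)"
  shows "\<exists>!t. t \<in> sec F (\<Union>\<C>) \<and> (\<forall>V\<in>\<C>. res F (\<Union>\<C>) V t = s V)"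
  by (rule sh_parts(5)[THEN spec[of _ \<C>], THEN spec[of _ s], THEN mp]) (intro conjI ballI assms)

lemma O_simps [simp]:
  "carrier (sects (twisting_sheaf X b) U) = twisting_sections X b U"
  "res (twisting_sheaf X b) U V f = restrict f (\<Union>V)"
  by (simp_all add: twisting_sheaf_def)

context fixes U assumes U: "zopen X U" begin

interpretation M: Module.module "sects (structure_sheaf X) U" "sects F U" by (rule mod_F[OF U])

lemma ab_F: "abelian_group (sects F U)" by (rule M.abelian_group_axioms)

lemma zero_F: "\<zero>[F,U] \<in> sec F U" "\<zero>[F,U] \<oplus>[F,U] \<zero>[F,U] = \<zero>[F,U]" by simp_all

lemma add_F: "s \<in> sec F U \<Longrightarrow> t \<in> sec F U \<Longrightarrow> s \<oplus>[F,U] t \<in> sec F U" by simp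

lemma smult_F: "a \<in> twisting_sections X 0 U \<Longrightarrow> s \<in> sec F U \<Longrightarrow> a \<odot>[F,U] s \<in> sec F U" using M.smult_closed by simp

lemma fn_mem: "c \<in> Osec 0 U \<Longrightarrow> fn U c \<in> sec (structure_sheaf X) U" using fn_tw[OF U] by simp

lemma sm_closed: "c \<in> Osec 0 U \<Longrightarrow> s \<in> sec F U \<Longrightarrow> fn U c \<odot>[F,U] s \<in> sec F U"
  by (rule M.smult_closed[OF fn_mem])

lemma sm_add: "\<lbrakk>c \<in> Osec 0 U; d \<in> Osec 0 U; s \<in> sec F U\<rbrakk> \<Longrightarrow>
    fn U (c + d) \<odot>[F,U] s = fn U c \<odot>[F,U] s \<oplus>[F,U] fn U d \<odot>[F,U] s"
  using M.smult_l_distr[OF fn_mem fn_mem] fn_add[OF zopen_subset[OF U]] by (simp add: twisting_sheaf_def)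

lemma sm_mult: "\<lbrakk>c \<in> Osec 0 U; d \<in> Osec 0 U; s \<in> sec F U\<rbrakk> \<Longrightarrow>
    fn U (c * d) \<odot>[F,U] s = fn U c \<odot>[F,U] (fn U d \<odot>[F,U] s)"
  using M.smult_assoc1[OF fn_mem fn_mem] fn_mult[OF zopen_subset[OF U]] by (simp add: twisting_sheaf_def)

lemma sm_0: "s \<in> sec F U \<Longrightarrow> fn U 0 \<odot>[F,U] s = \<zero>[F,U]"
  using M.smult_l_null fn_0[of U] by (simp add: twisting_sheaf_def)

lemma sm_1: "s \<in> sec F U \<Longrightarrow> fn U 1 \<odot>[F,U] s = s"
  using M.smult_one fn_1[of U] by (simp add: twisting_sheaf_def)

lemma sm_r0: "c \<in> Osec 0 U \<Longrightarrow> fn U c \<odot>[F,U] \<zero>[F,U] = \<zero>[F,U]"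
  by (rule M.smult_r_null[OF fn_mem])

end

lemma sm_res: "\<lbrakk>zopen X U; zopen X V; V \<subseteq> U; c \<in> Osec 0 U; s \<in> sec F U\<rbrakk> \<Longrightarrow>
    res F U V (fn U c \<odot>[F,U] s) = fn V c \<odot>[F,V] res F U V s"
  using res_smult[of U V s "fn U c"] fn_mem by (simp add: fn_res)

lemma res_zero: assumes "zopen X U" "zopen X V" "V \<subseteq> U" shows "res F U V \<zero>[F,U] = \<zero>[F,V]"
  using sm_res[OF assms Osec_0[OF zopen_subset[OF assms(1)]] zero_F(1)[OF assms(1)]]
    sm_0[OF assms(1) zero_F(1)[OF assms(1)]] sm_0[OF assms(2) res_cl[OF assms zero_F(1)[OF assms(1)]]] by simp

lemma emb_iso:
  assumes G: "emb X J G kap sm" and \<phi>: "is_sheaf_iso X F G \<phi>"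
  shows "emb X J F (\<lambda>U s. kap U (\<phi> U s)) sm"
    "emb.stk X F (\<lambda>U s. kap U (\<phi> U s)) p = emb.stk X G kap p"
proof -
  interpret G: emb X J G kap sm by fact
  note iso = iso_res[OF G \<phi>] iso_add[OF G \<phi>] iso_smult[OF G \<phi>]
  show E: "emb X J F (\<lambda>U s. kap U (\<phi> U s)) sm"
  proof
    fix U assume U: "zopen X U" "U \<noteq> {}"
    show "\<zero>[F,U] \<in> sec F U \<and> kap U (\<phi> U \<zero>[F,U]) = 0"
      using iso(2)[OF U zero_F(1,1)[OF U(1)]] zero_F[OF U(1)] by simp
  qed (use iso res_cl add_F smult_F iso_inj[OF G \<phi>] in auto)
  interpret E: emb X J F "\<lambda>U s. kap U (\<phi> U s)" sm by (rule E)
  have "(\<exists>s\<in>sec F U. kap U (\<phi> U s) = z) \<longleftrightarrow> (\<exists>s\<in>sec G U. kap U s = z)" if "zopen X U" "p \<in> U" for U z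
  proof -
    have "U \<noteq> {}" using that(2) by blast
    from bij_betw_imp_surj_on[OF iso_bij[OF G \<phi> that(1) this], symmetric] show ?thesis by simp
  qed
  hence "(\<exists>U s. zopen X U \<and> p \<in> U \<and> s \<in> sec F U \<and> kap U (\<phi> U s) = z) \<longleftrightarrow>
      (\<exists>U s. zopen X U \<and> p \<in> U \<and> s \<in> sec G U \<and> kap U s = z)" for z by blast
  thus "E.stk p = G.stk p" unfolding E.stk_def G.stk_def by (intro Collect_cong) metis
qed

lemma germ_eq:
  assumes U: "zopen X U" "s \<in> sec F U" and V: "zopen X V" "t \<in> sec F V"
    and W: "zopen X W" "p \<in> W" "W \<subseteq> U" "W \<subseteq> V" "res F U W s = res F V W t"
  shows "germ X F p U s = germ X F p V t"
proof -
  have "\<exists>W'. zopen X W' \<and> p \<in> W' \<and> W' \<subseteq> V \<inter> A \<and> res F V W' t = res F A W' x"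
    if U: "zopen X U" "s \<in> sec F U" and V: "zopen X V" "t \<in> sec F V"
      and W: "zopen X W" "p \<in> W" "W \<subseteq> U" "W \<subseteq> V" "res F U W s = res F V W t"
      and A: "zopen X A" "x \<in> sec F A"
      and W': "zopen X W'" "p \<in> W'" "W' \<subseteq> U" "W' \<subseteq> A" "res F U W' s = res F A W' x" for U s V t W A x W'
  proof -
    have o: "zopen X (W \<inter> W')" using zopen_Int W W' by blast
    have "res F V (W \<inter> W') t = res F W (W \<inter> W') (res F V W t)" using res_res[OF V(1) W(1) o _ W(4) V(2)] by simp
    also have "\<dots> = res F U (W \<inter> W') s" unfolding W(5)[symmetric] using res_res[OF U(1) W(1) o _ W(3) U(2)] by simp
    also have "\<dots> = res F W' (W \<inter> W') (res F U W' s)" using res_res[OF U(1) W'(1) o _ W'(3) U(2)] by simp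
    also have "\<dots> = res F A (W \<inter> W') x" unfolding W'(5) using res_res[OF A(1) W'(1) o _ W'(4) A(2)] by simp
    finally show ?thesis using o W W' by (intro exI[of _ "W \<inter> W'"]) auto
  qed
  note * = this[OF U V W] this[OF V U W(1,2,4,3) W(5)[symmetric]]
  show ?thesis unfolding germ_def using * by (intro Collect_cong) auto
qed

lemma germ_zeroD:
  assumes "zopen X U" "p \<in> U" "s \<in> sec F U" "germ X F p U s = \<zero>\<^bsub>stalk X F p\<^esub>"
  shows "\<exists>W. zopen X W \<and> p \<in> W \<and> W \<subseteq> U \<and> res F U W s = \<zero>[F,W]"
proof -
  have "(U, s) \<in> germ X F p U s" unfolding germ_def using assms(1-3) by auto
  hence "(U, s) \<in> germ X F p X \<zero>[F,X]" using assms(4) by (simp add: stalk_def)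
  then obtain W where W: "zopen X W" "p \<in> W" "W \<subseteq> X \<inter> U" "res F X W \<zero>[F,X] = res F U W s" unfolding germ_def by blast
  thus ?thesis using res_zero[OF zopen_X W(1)] zopen_subset[OF W(1)] by (intro exI[of _ W]) auto
qed

lemma smult_germ_zero:
  assumes V: "zopen X V" "p \<in> V" "c \<in> Osec 0 V" "s \<in> sec F V" "fn V c \<odot>[F,V] s = \<zero>[F,V]"
  shows "germ X (structure_sheaf X) p V (fn V c) \<odot>\<^bsub>stalk X F p\<^esub> germ X F p V s = \<zero>\<^bsub>stalk X F p\<^esub>"
proof -
  have p: "p \<in> X" using V zopen_subset by blast
  have ne: "V \<noteq> {}" using V(2) by blast
  have c: "germ X (structure_sheaf X) p V (fn V c) = gO 0 p c"
    using germ_O[OF V(1,2) fn_tw[OF V(1,3)]] fr_fn[OF V(1) ne V(3)] by simp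
  have "germ X F p (A \<inter> B) (res (structure_sheaf X) A (A \<inter> B) a \<odot>[F,A \<inter> B] res F B (A \<inter> B) t) =
      germ X F p X \<zero>[F,X]" if A: "(A, a) \<in> gO 0 p c" and B: "(B, t) \<in> germ X F p V s" for A a B t
  proof -
    have A: "zopen X A" "p \<in> A" "a \<in> twisting_sections X 0 A" "fr 0 A a = c" using A by (auto simp: gO_mem)
    have "A \<noteq> {}" using A(2) by blast
    hence a: "a = fn A c" "c \<in> Osec 0 A" using fr_tw[OF A(1) _ A(3)] A(4) by auto
    obtain W where B: "zopen X B" "p \<in> B" "t \<in> sec F B" and W: "zopen X W" "p \<in> W" "W \<subseteq> V" "W \<subseteq> B" "res F V W s = res F B W t"
      using B unfolding germ_def by blast
    have AB: "zopen X (A \<inter> B)" using zopen_Int A(1) B(1) by blast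
    have ra: "res (structure_sheaf X) A (A \<inter> B) a = fn (A \<inter> B) c" unfolding a(1) by (simp add: fn_res)
    have o: "c \<in> Osec 0 (A \<inter> B)" using Osec_mono[OF a(2)] by blast
    have t: "res F B (A \<inter> B) t \<in> sec F (A \<inter> B)" by (rule res_cl[OF B(1) AB _ B(3)]) blast
    define W' where "W' = W \<inter> (A \<inter> B)"
    have W': "zopen X W'" "p \<in> W'" "W' \<subseteq> A \<inter> B" "W' \<subseteq> V" "W' \<subseteq> W" "W' \<subseteq> B" "W' \<subseteq> X"
      using zopen_Int[OF W(1) AB] W A(2) B(2) zopen_subset[OF W(1)] by (auto simp: W'_def)
    have "res F (A \<inter> B) W' (fn (A \<inter> B) c \<odot>[F,A \<inter> B] res F B (A \<inter> B) t) = fn W' c \<odot>[F,W'] res F (A \<inter> B) W' (res F B (A \<inter> B) t)"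
      by (rule sm_res[OF AB W'(1,3) o t])
    also have "res F (A \<inter> B) W' (res F B (A \<inter> B) t) = res F B W' t" by (rule res_res[OF B(1) AB W'(1,3) _ B(3)]) blast
    also have "\<dots> = res F W W' (res F B W t)" using res_res[OF B(1) W(1) W'(1,5) W(4) B(3)] by simp
    also have "\<dots> = res F V W' s" unfolding W(5)[symmetric] by (rule res_res[OF V(1) W(1) W'(1,5) W(3) V(4)])
    also have "fn W' c \<odot>[F,W'] \<dots> = \<zero>[F,W']"
      using sm_res[OF V(1) W'(1,4) V(3,4)] V(5) res_zero[OF V(1) W'(1,4)] by simp
    also have "\<dots> = res F X W' \<zero>[F,X]" using res_zero[OF zopen_X W'(1,7)] by simp
    finally show ?thesis unfolding ra
      by (intro germ_eq[OF AB sm_closed[OF AB o t] zopen_X zero_F(1)[OF zopen_X] W'(1,2,3,7)])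
  qed
  moreover have "(V, fn V c) \<in> gO 0 p c" using V fn_tw[OF V(1,3)] fr_fn[OF V(1) ne V(3)] by (simp add: gO_mem)
  moreover have "(V, s) \<in> germ X F p V s" unfolding germ_def using V by auto
  ultimately have "(\<Union>(U, a)\<in>gO 0 p c. \<Union>(B, t)\<in>germ X F p V s. germ X F p (U \<inter> B)
        (res (structure_sheaf X) U (U \<inter> B) a \<odot>[F,U \<inter> B] res F B (U \<inter> B) t)) = germ X F p X \<zero>[F,X]"
    by (intro emb.UN_const2[OF emb_tw])
  thus ?thesis unfolding c stalk_def by simp
qed

text \<open>The relation sheaf of a section \<open>s\<close> vanishing somewhere contains a nonzero function at every point, since it is of
  finite type and contains \<open>1\<close> where \<open>s\<close> vanishes; so every germ of \<open>s\<close> is torsion.\<close>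

lemma vanish_generic:
  assumes tf: "torsion_free X F" and co: "coherent X F"
    and U: "zopen X U" "s \<in> sec F U" and W: "zopen X W" "W \<subseteq> U" "W \<noteq> {}" "res F U W s = \<zero>[F,W]"
  shows "s = \<zero>[F,U]"
proof -
  have loc: "\<exists>V. zopen X V \<and> p \<in> V \<and> V \<subseteq> U \<and> res F U V s = \<zero>[F,V]" if p: "p \<in> U" for p
  proof -
    let ?R = "relation_sheaf X F U 1 (\<lambda>_. s)"
    have "finite_type_on X U ?R"
      using co[unfolded coherent_def, THEN conjunct2, THEN conjunct2, THEN spec[of _ U], THEN spec[of _ 1], THEN spec[of _ "\<lambda>_. s"]] U
      by simp
    then obtain V n r where V: "zopen X V" "p \<in> V" "V \<subseteq> U" and r: "\<forall>i<n. r i \<in> sec ?R V"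
      and gen: "\<forall>W t q. zopen X W \<and> W \<subseteq> V \<and> t \<in> sec ?R W \<and> q \<in> W \<longrightarrow>
        (\<exists>W' a. zopen X W' \<and> q \<in> W' \<and> W' \<subseteq> W \<and> (\<forall>i<n. a i \<in> sec (structure_sheaf X) W') \<and>
          res ?R W W' t = linear_comb X ?R n W' a (\<lambda>i. res ?R V W' (r i)))"
      using p unfolding finite_type_on_def by (elim ballE[of U _ p] exE conjE) (assumption | simp)+
    have lc: "linear_comb X F 1 A f (\<lambda>i. x) = f 0 \<odot>[F,A] x"
      if A: "zopen X A" "f 0 \<in> twisting_sections X 0 A" "x \<in> sec F A" for A f x
    proof -
      interpret M: abelian_group "sects F A" by (rule ab_F[OF A(1)])
      have m: "f 0 \<odot>[F,A] x \<in> sec F A" by (rule smult_F[OF A])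
      have "finsum (sects F A) (\<lambda>i. f i \<odot>[F,A] x) {0::nat} = f 0 \<odot>[F,A] x"
        using M.finsum_insert[of "{}" "0::nat" "\<lambda>i. f i \<odot>[F,A] x"] m by simp
      moreover have "{..<1::nat} = {0}" by auto
      ultimately show ?thesis by (simp only: linear_comb_def)
    qed
    have memR: "t \<in> sec ?R A \<longleftrightarrow> t \<in> sec (sum_of_twists X (replicate 1 0)) A \<and> t 0 \<odot>[F,A] res F U A s = \<zero>[F,A]"
      if A: "zopen X A" "A \<subseteq> U" for A t
    proof -
      have "linear_comb X F 1 A t (\<lambda>i. res F U A s) = t 0 \<odot>[F,A] res F U A s"
        if "t \<in> sec (sum_of_twists X (replicate 1 0)) A"
      proof (rule lc[OF A(1)])
        show "t 0 \<in> twisting_sections X 0 A" using sec_sumD[OF that, of 0] by simp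
        show "res F U A s \<in> sec F A" by (rule res_cl[OF U(1) A U(2)])
      qed
      thus ?thesis by (auto simp: relation_sheaf_def)
    qed
    have zR: "\<zero>[?R,A] = (\<lambda>i\<in>{..<1}. \<zero>[structure_sheaf X,A])" for A
      by (auto simp: relation_sheaf_def sum_of_twists_def fun_eq_iff)
    \<comment> \<open>Otherwise all relations over subsets of \<open>V\<close> would vanish; but the
      constant 1 is a relation on the part of \<open>V\<close> inside \<open>W\<close>, where
      \<open>s\<close> is zero.\<close>
    have "\<exists>i<n. r i 0 \<noteq> fn V 0"
    proof (rule ccontr)
      assume "\<not> (\<exists>i<n. r i 0 \<noteq> fn V 0)"
      hence r0: "r i 0 = fn V 0" if "i < n" for i using that by blast
      have VW: "zopen X (V \<inter> W)" "V \<inter> W \<noteq> {}" using zopen_Int[OF V(1) W(1)] zopen_irreducible[OF V(1) W(1) _ W(3)] V(2) by auto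
      obtain q where q: "q \<in> V \<inter> W" using VW(2) by blast
      define e where "e = (\<lambda>i\<in>{..<1::nat}. fn (V \<inter> W) 1)"
      have VWU: "V \<inter> W \<subseteq> U" using W(2) by blast
      have rW: "res F U (V \<inter> W) s = \<zero>[F,V \<inter> W]"
        using res_res[OF U(1) W(1) VW(1) _ W(2) U(2)] W(4) res_zero[OF W(1) VW(1)] by simp
      have "e \<in> sec (sum_of_twists X (replicate 1 0)) (V \<inter> W)"
        using sec_sumI[of "replicate 1 0" "\<lambda>i. fn (V \<inter> W) 1"] fn_tw[OF VW(1) Osec_1] by (simp add: e_def)
      hence eR: "e \<in> sec ?R (V \<inter> W)" unfolding memR[OF VW(1) VWU] rW
        using sm_r0[OF VW(1) Osec_1] by (simp add: e_def)
      obtain W' a where W': "zopen X W'" "q \<in> W'" "W' \<subseteq> V \<inter> W" and a: "\<forall>i<n. a i \<in> sec (structure_sheaf X) W'"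
        and eq: "res ?R (V \<inter> W) W' e = linear_comb X ?R n W' a (\<lambda>i. res ?R V W' (r i))"
        using gen[rule_format, of "V \<inter> W" e q] VW(1) eR q by blast
      have W'U: "W' \<subseteq> U" "W' \<subseteq> V" using W'(3) VWU by auto
      have zW: "\<zero>[?R,W'] \<in> sec ?R W'" "\<zero>[?R,W'] \<oplus>[?R,W'] \<zero>[?R,W'] = \<zero>[?R,W']"
      proof -
        show "\<zero>[?R,W'] \<oplus>[?R,W'] \<zero>[?R,W'] = \<zero>[?R,W']"
          by (auto simp: relation_sheaf_def sum_of_twists_def twisting_sheaf_def fun_eq_iff)
        have "fn W' 0 \<in> twisting_sections X 0 W'" by (rule fn_tw[OF W'(1) Osec_0[OF zopen_subset[OF W'(1)]]])
        hence "(\<lambda>i\<in>{..<1::nat}. \<zero>[structure_sheaf X,W']) \<in> sec (sum_of_twists X (replicate 1 0)) W'"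
          using sec_sumI[of "replicate 1 0" "\<lambda>i. \<zero>[structure_sheaf X,W']" W'] by (simp add: twisting_sheaf_def fn_0)
        thus "\<zero>[?R,W'] \<in> sec ?R W'" unfolding memR[OF W'(1) W'U(1)] zR
          using sm_0[OF W'(1) res_cl[OF U(1) W'(1) W'U(1) U(2)]] by (simp add: twisting_sheaf_def fn_0)
      qed
      have "a i \<odot>[?R,W'] res ?R V W' (r i) = \<zero>[?R,W']" if i: "i < n" for i
        using r0[OF i] unfolding zR
        by (auto simp: relation_sheaf_def sum_of_twists_def twisting_sheaf_def fn_def restrict_def fun_eq_iff)
          (use W'U(2) in blast)+
      hence "linear_comb X ?R n W' a (\<lambda>i. res ?R V W' (r i)) = \<zero>[?R,W']"
        unfolding linear_comb_def by (intro finsum_all_zero zW) auto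
      from fun_cong[OF trans[OF eq this], of 0] have "restrict (fn (V \<inter> W) 1) (\<Union>W') = \<zero>[structure_sheaf X,W']"
        unfolding zR by (simp add: relation_sheaf_def sum_of_twists_def e_def)
      hence f10: "fn W' 1 = fn W' 0" using fn_res[OF W'(3), of 1] by (simp add: twisting_sheaf_def fn_0)
      have ne: "W' \<noteq> {}" using W'(2) by blast
      have "(1 :: 'k rat) = 0"
        using fr_fn[OF W'(1) ne Osec_1] fr_fn[OF W'(1) ne Osec_0[OF zopen_subset[OF W'(1)], of 0]] f10 by simp
      thus False by simp
    qed
    then obtain i where i: "i < n" "r i 0 \<noteq> fn V 0" by blast
    have ne: "V \<noteq> {}" using V(2) by blast
    have pX: "p \<in> X" using V zopen_subset by blast
    have ri: "r i 0 \<in> twisting_sections X 0 V" "r i 0 \<odot>[F,V] res F U V s = \<zero>[F,V]"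
      using r i(1) memR[OF V(1,3), of "r i"] sec_sumD[of "r i" "replicate 1 0" V 0] by auto
    define c where "c = fr 0 V (r i 0)"
    have c: "c \<in> Osec 0 V" "fn V c = r i 0" unfolding c_def by (rule fr_tw[OF V(1) ne ri(1)])+
    have c0: "c \<noteq> 0" using i(2) c(2) by auto
    have sV: "res F U V s \<in> sec F V" by (rule res_cl[OF U(1) V(1,3) U(2)])
    have "germ X (structure_sheaf X) p V (fn V c) \<odot>\<^bsub>stalk X F p\<^esub> germ X F p V (res F U V s) = \<zero>\<^bsub>stalk X F p\<^esub>"
      using smult_germ_zero[OF V(1,2) c(1) sV] ri(2) c(2) by simp
    moreover have "germ X (structure_sheaf X) p V (fn V c) \<in> carrier (stalk X (structure_sheaf X) p)"
      unfolding stalk_def using V fn_tw[OF V(1) c(1)] by auto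
    moreover have "germ X F p V (res F U V s) \<in> carrier (stalk X F p)" unfolding stalk_def using V sV by auto
    moreover have "germ X (structure_sheaf X) p V (fn V c) \<noteq> \<zero>\<^bsub>stalk X (structure_sheaf X) p\<^esub>"
    proof -
      have "germ X (structure_sheaf X) p V (fn V c) = gO 0 p c"
        using germ_O[OF V(1,2) fn_tw[OF V(1) c(1)]] fr_fn[OF V(1) ne c(1)] by simp
      moreover have "gO 0 p c \<noteq> gO 0 p 0" using gO_inj[OF pX, of c 0] c(1) V(2) c0 by (auto simp: Osec_def)
      ultimately show ?thesis using stalk_zero_O[OF pX] by simp
    qed
    ultimately have "germ X F p V (res F U V s) = \<zero>\<^bsub>stalk X F p\<^esub>" using tf pX unfolding torsion_free_def by blast
    from germ_zeroD[OF V(1,2) sV this] obtain V' where "zopen X V'" "p \<in> V'" "V' \<subseteq> V" "res F V V' (res F U V s) = \<zero>[F,V']" by blast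
    thus ?thesis using res_res[OF U(1) V(1) _ _ V(3) U(2)] V(3) by (intro exI[of _ V']) auto
  qed
  \<comment> \<open>Local vanishing implies vanishing by the uniqueness half of the gluing axiom,
    applied to the family of zero sections.\<close>
  define \<C> where "\<C> = {V. zopen X V \<and> V \<subseteq> U \<and> res F U V s = \<zero>[F,V]}"
  have un: "\<Union>\<C> = U" using loc unfolding \<C>_def by blast
  have "\<exists>!t. t \<in> sec F (\<Union>\<C>) \<and> (\<forall>V\<in>\<C>. res F (\<Union>\<C>) V t = \<zero>[F,V])"
  proof (rule glue_F)
    fix V W assume "V \<in> \<C>" "W \<in> \<C>"
    hence o: "zopen X V" "zopen X W" "zopen X (V \<inter> W)" using zopen_Int by (auto simp: \<C>_def)
    show "res F V (V \<inter> W) \<zero>[F,V] = res F W (V \<inter> W) \<zero>[F,W]"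
      using res_zero[OF o(1,3)] res_zero[OF o(2,3)] by simp
  qed (auto simp: \<C>_def zero_F)
  hence uniq: "x = y" if "x \<in> sec F U" "y \<in> sec F U" "\<forall>V\<in>\<C>. res F U V x = \<zero>[F,V]" "\<forall>V\<in>\<C>. res F U V y = \<zero>[F,V]" for x y
    using that unfolding un by (elim ex1E) metis
  show ?thesis
    by (rule uniq[OF U(2) zero_F(1)[OF U(1)]]) (use res_zero[OF U(1)] in \<open>auto simp: \<C>_def\<close>)
qed

end

lemma (in modsheaf) res_finsum:
  assumes W: "zopen X W" "zopen X W'" "W' \<subseteq> W" and A: "finite A" "\<And>i. i \<in> A \<Longrightarrow> f i \<in> sec F W"
  shows "res F W W' (finsum (sects F W) f A) = finsum (sects F W') (\<lambda>i. res F W W' (f i)) A"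
proof -
  interpret M: abelian_group "sects F W" by (rule ab_F[OF W(1)])
  interpret M': abelian_group "sects F W'" by (rule ab_F[OF W(2)])
  show ?thesis using A
  proof (induction A rule: finite_induct)
    case empty
    thus ?case using res_zero[OF W] by simp
  next
    case (insert x B)
    have c: "f x \<in> sec F W" "f \<in> B \<rightarrow> sec F W" using insert.prems by auto
    have "res F W W' (finsum (sects F W) f (insert x B)) = res F W W' (f x \<oplus>[F,W] finsum (sects F W) f B)"
      using M.finsum_insert[OF insert.hyps(1,2) c(2,1)] by simp
    also have "\<dots> = res F W W' (f x) \<oplus>[F,W'] res F W W' (finsum (sects F W) f B)"
      by (rule res_add[OF W c(1) M.finsum_closed[OF c(2)]])
    also have "res F W W' (finsum (sects F W) f B) = finsum (sects F W') (\<lambda>i. res F W W' (f i)) B"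
      using insert by simp
    also have "res F W W' (f x) \<oplus>[F,W'] \<dots> = finsum (sects F W') (\<lambda>i. res F W W' (f i)) (insert x B)"
      using M'.finsum_insert[OF insert.hyps(1,2), of "\<lambda>i. res F W W' (f i)"] res_cl[OF W] c by (auto simp: Pi_iff)
    finally show ?case .
  qed
qed

text \<open>A finite family of sections over an open set. The index set is arbitrary rather than an
  initial segment, so that one member can be removed in the minimality argument.\<close>

locale frame = modsheaf X J F for X :: "'k::{alg_closed_field, field_char_0} point set" and J and F :: "('k, 'm) mod_sheaf" +
  fixes V :: "'k point set" and I :: "nat set" and s :: "nat \<Rightarrow> 'm"
  assumes V: "zopen X V" "V \<noteq> {}" and I: "finite I" and s: "i \<in> I \<Longrightarrow> s i \<in> sec F V"
begin

definition OI :: "'k point set \<Rightarrow> (nat \<Rightarrow> 'k rat) set" where "OI W = {z. \<forall>i\<in>I. z i \<in> Osec 0 W}"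

definition LC :: "'k point set \<Rightarrow> (nat \<Rightarrow> 'k rat) \<Rightarrow> 'm" where
  "LC W z = finsum (sects F W) (\<lambda>i. fn W (z i) \<odot>[F,W] res F V W (s i)) I"

definition gen :: bool where
  "gen \<longleftrightarrow> (\<forall>W t q. zopen X W \<longrightarrow> W \<subseteq> V \<longrightarrow> t \<in> sec F W \<longrightarrow> q \<in> W \<longrightarrow>
    (\<exists>W' z. zopen X W' \<and> q \<in> W' \<and> W' \<subseteq> W \<and> z \<in> OI W' \<and> res F W W' t = LC W' z))"

context fixes W assumes W: "zopen X W" "W \<subseteq> V" begin

interpretation M: Module.module "sects (structure_sheaf X) W" "sects F W" by (rule mod_F[OF W(1)])

lemma rs: "i \<in> I \<Longrightarrow> res F V W (s i) \<in> sec F W" using res_cl[OF V(1) W s] .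

lemma term_cl: "z \<in> OI W \<Longrightarrow> i \<in> I \<Longrightarrow> fn W (z i) \<odot>[F,W] res F V W (s i) \<in> sec F W"
  by (rule sm_closed[OF W(1) _ rs]) (auto simp: OI_def)

lemma LC_cl: "z \<in> OI W \<Longrightarrow> LC W z \<in> sec F W"
  unfolding LC_def by (rule M.finsum_closed) (auto intro: term_cl)

lemma OI_add: "z \<in> OI W \<Longrightarrow> w \<in> OI W \<Longrightarrow> z + w \<in> OI W"
  using Osec_add[OF zopen_subset[OF W(1)]] by (auto simp: OI_def)

lemma OI_vs: "c \<in> Osec 0 W \<Longrightarrow> z \<in> OI W \<Longrightarrow> vs c z \<in> OI W"
  using Osec_mult[of c 0 W _ 0] by (auto simp: OI_def vs_def)

lemma OI_0: "0 \<in> OI W" using Osec_0[OF zopen_subset[OF W(1)]] by (auto simp: OI_def)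

lemma LC_add: assumes "z \<in> OI W" "w \<in> OI W" shows "LC W (z + w) = LC W z \<oplus>[F,W] LC W w"
proof -
  have "LC W (z + w) = finsum (sects F W) (\<lambda>i. fn W (z i) \<odot>[F,W] res F V W (s i) \<oplus>[F,W]
      fn W (w i) \<odot>[F,W] res F V W (s i)) I"
    unfolding LC_def
  proof (rule M.finsum_cong')
    fix i assume i: "i \<in> I"
    have "z i \<in> Osec 0 W" "w i \<in> Osec 0 W" using assms i by (auto simp: OI_def)
    from sm_add[OF W(1) this rs[OF i]] show "fn W ((z + w) i) \<odot>[F,W] res F V W (s i) =
      fn W (z i) \<odot>[F,W] res F V W (s i) \<oplus>[F,W] fn W (w i) \<odot>[F,W] res F V W (s i)" by simp
  qed (auto intro!: M.a_closed term_cl assms)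
  also have "\<dots> = LC W z \<oplus>[F,W] LC W w" unfolding LC_def
    by (rule M.finsum_addf) (auto intro: term_cl assms)
  finally show ?thesis .
qed

lemma LC_vs: assumes "c \<in> Osec 0 W" "z \<in> OI W" shows "LC W (vs c z) = fn W c \<odot>[F,W] LC W z"
proof -
  have "LC W (vs c z) = finsum (sects F W) (\<lambda>i. fn W c \<odot>[F,W] (fn W (z i) \<odot>[F,W] res F V W (s i))) I"
    unfolding LC_def
  proof (rule M.finsum_cong')
    fix i assume i: "i \<in> I"
    hence "z i \<in> Osec 0 W" using assms(2) by (auto simp: OI_def)
    from sm_mult[OF W(1) assms(1) this rs[OF i]] show "fn W (vs c z i) \<odot>[F,W] res F V W (s i) =
      fn W c \<odot>[F,W] (fn W (z i) \<odot>[F,W] res F V W (s i))" by (simp add: vs_def)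
  qed (auto intro!: sm_closed[OF W(1) assms(1)] term_cl assms(2))
  also have "\<dots> = fn W c \<odot>[F,W] LC W z" unfolding LC_def
    by (rule M.finsum_smult_ldistr[OF I fn_mem[OF W(1) assms(1)], symmetric]) (auto intro: term_cl assms(2))
  finally show ?thesis .
qed

lemma LC_0: "LC W 0 = \<zero>[F,W]"
  unfolding LC_def by (rule finsum_all_zero[OF I _ zero_F[OF W(1)]]) (use sm_0[OF W(1) rs] in simp)

lemma LC_diff: assumes "z \<in> OI W" "w \<in> OI W" "LC W z = LC W w" shows "z - w \<in> OI W \<and> LC W (z - w) = \<zero>[F,W]"
proof -
  have m: "- 1 \<in> Osec 0 W" using Oloc_uminus[OF Oloc_1] by (auto simp: Osec_def)
  have e: "z - w = z + vs (- 1) w" by simp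
  have "LC W (z - w) = LC W w \<oplus>[F,W] fn W (- 1) \<odot>[F,W] LC W w"
    unfolding e LC_add[OF assms(1) OI_vs[OF m assms(2)]] LC_vs[OF m assms(2)] assms(3) ..
  also have "\<dots> = fn W (1 + - 1) \<odot>[F,W] LC W w"
    unfolding sm_add[OF W(1) Osec_1 m LC_cl[OF assms(2)]] sm_1[OF W(1) LC_cl[OF assms(2)]] ..
  also have "\<dots> = \<zero>[F,W]" using sm_0[OF W(1) LC_cl[OF assms(2)]] by simp
  finally show ?thesis using OI_add[OF assms(1) OI_vs[OF m assms(2)]] by simp
qed

end

lemma OI_mono: "z \<in> OI W \<Longrightarrow> W' \<subseteq> W \<Longrightarrow> z \<in> OI W'"
  by (auto simp: OI_def intro: Osec_mono)

lemma LC_res: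
  assumes "zopen X W" "W \<subseteq> V" "zopen X W'" "W' \<subseteq> W" "z \<in> OI W" shows "res F W W' (LC W z) = LC W' z"
proof -
  interpret M': abelian_group "sects F W'" by (rule ab_F[OF assms(3)])
  have W'V: "W' \<subseteq> V" using assms(2,4) by blast
  have "res F W W' (LC W z) = finsum (sects F W') (\<lambda>i. res F W W' (fn W (z i) \<odot>[F,W] res F V W (s i))) I"
    unfolding LC_def by (rule res_finsum[OF assms(1,3,4) I term_cl[OF assms(1,2,5)]])
  also have "\<dots> = LC W' z" unfolding LC_def
  proof (rule M'.finsum_cong')
    fix i assume i: "i \<in> I"
    hence "z i \<in> Osec 0 W" using assms(5) by (auto simp: OI_def)
    from sm_res[OF assms(1,3,4) this rs[OF assms(1,2) i]] res_res[OF V(1) assms(1,3,4,2) s[OF i]]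
    show "res F W W' (fn W (z i) \<odot>[F,W] res F V W (s i)) = fn W' (z i) \<odot>[F,W'] res F V W' (s i)" by simp
  qed (auto intro: term_cl[OF assms(3) W'V OI_mono[OF assms(5,4)]])
  finally show ?thesis .
qed

end

locale generic_basis = frame X J F V I s
  for X :: "'k::{alg_closed_field, field_char_0} point set" and J and F :: "('k, 'm) mod_sheaf" and V I s +
  assumes g: gen and indep: "\<lbrakk>zopen X W; W \<subseteq> V; W \<noteq> {}; z \<in> OI W; LC W z = \<zero>[F,W]; i \<in> I\<rbrakk> \<Longrightarrow> z i = 0"
    and vanish: "\<lbrakk>zopen X U; t \<in> sec F U; zopen X W; W \<subseteq> U; W \<noteq> {}; res F U W t = \<zero>[F,W]\<rbrakk> \<Longrightarrow> t = \<zero>[F,U]"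
begin

text \<open>\<open>z\<close> lists the coordinates of \<open>t\<close> over some smaller nonempty
  open set. \<open>indep\<close> makes them unique, and \<open>vanish\<close> makes \<open>t\<close>
  recoverable from them. Entries outside \<open>I\<close> are fixed to 0.\<close>

definition rep :: "'k point set \<Rightarrow> 'm \<Rightarrow> (nat \<Rightarrow> 'k rat) \<Rightarrow> bool" where
  "rep U t z \<longleftrightarrow> (\<forall>i. i \<notin> I \<longrightarrow> z i = 0) \<and>
    (\<exists>W. zopen X W \<and> W \<noteq> {} \<and> W \<subseteq> U \<and> W \<subseteq> V \<and> z \<in> OI W \<and> res F U W t = LC W z)"

definition kap :: "'k point set \<Rightarrow> 'm \<Rightarrow> nat \<Rightarrow> 'k rat" where "kap U t = (THE z. rep U t z)"

lemma repE:
  assumes "rep U t z"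
  obtains W where "zopen X W" "W \<noteq> {}" "W \<subseteq> U" "W \<subseteq> V" "z \<in> OI W" "res F U W t = LC W z"
  using assms unfolding rep_def by blast

lemma rep_out: "rep U t z \<Longrightarrow> i \<notin> I \<Longrightarrow> z i = 0" unfolding rep_def by blast

lemma rep_shrink:
  assumes U: "zopen X U" "t \<in> sec F U" and W: "zopen X W" "W \<subseteq> U" "W \<subseteq> V" "z \<in> OI W" "res F U W t = LC W z"
    and W': "zopen X W'" "W' \<subseteq> W"
  shows "W' \<subseteq> U" "W' \<subseteq> V" "z \<in> OI W'" "res F U W' t = LC W' z"
proof -
  show "W' \<subseteq> U" "W' \<subseteq> V" using W W' by auto
  show "z \<in> OI W'" by (rule OI_mono[OF W(4) W'(2)])
  show "res F U W' t = LC W' z"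
    using LC_res[OF W(1,3) W' W(4)] W(5) res_res[OF U(1) W(1) W'(1) W'(2) W(2) U(2)] by simp
qed

lemma rep2:
  assumes U: "zopen X U" "t \<in> sec F U" "t' \<in> sec F U" "rep U t z" "rep U t' z'"
  obtains W where "zopen X W" "W \<noteq> {}" "W \<subseteq> U" "W \<subseteq> V" "z \<in> OI W" "res F U W t = LC W z" "z' \<in> OI W" "res F U W t' = LC W z'"
proof -
  obtain W1 where W1: "zopen X W1" "W1 \<noteq> {}" "W1 \<subseteq> U" "W1 \<subseteq> V" "z \<in> OI W1" "res F U W1 t = LC W1 z" by (rule repE[OF U(4)])
  obtain W2 where W2: "zopen X W2" "W2 \<noteq> {}" "W2 \<subseteq> U" "W2 \<subseteq> V" "z' \<in> OI W2" "res F U W2 t' = LC W2 z'" by (rule repE[OF U(5)])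
  have o: "zopen X (W1 \<inter> W2)" "W1 \<inter> W2 \<noteq> {}" using zopen_meet[OF W1(1) W2(1) W1(2) W2(2)] by auto
  show ?thesis
    by (rule that[OF o rep_shrink[OF U(1,2) W1(1,3-6) o(1) Int_lower1] rep_shrink(3,4)[OF U(1,3) W2(1,3-6) o(1) Int_lower2]])
qed

lemma rep_unique: assumes U: "zopen X U" "t \<in> sec F U" and r: "rep U t z" "rep U t w" shows "z = w"
proof -
  obtain W where W: "zopen X W" "W \<noteq> {}" "W \<subseteq> U" "W \<subseteq> V" "z \<in> OI W" "res F U W t = LC W z" "w \<in> OI W" "res F U W t = LC W w"
    by (rule rep2[OF U(1,2,2) r])
  have "LC W z = LC W w" using W(6,8) by simp
  note d = LC_diff[OF W(1,4,5,7) this]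
  have "(z - w) i = 0" for i
    using indep[OF W(1,4,2) conjunct1[OF d] conjunct2[OF d], of i] rep_out[OF r(1), of i] rep_out[OF r(2), of i] by (cases "i \<in> I") auto
  thus ?thesis by (auto simp: fun_eq_iff)
qed

lemma rep_ex: assumes U: "zopen X U" "U \<noteq> {}" "t \<in> sec F U" shows "\<exists>z. rep U t z"
proof -
  have UV: "zopen X (U \<inter> V)" "U \<inter> V \<noteq> {}" using zopen_meet[OF U(1) V(1) U(2) V(2)] by auto
  obtain q where q: "q \<in> U \<inter> V" using UV(2) by blast
  have r: "res F U (U \<inter> V) t \<in> sec F (U \<inter> V)" by (rule res_cl[OF U(1) UV(1) _ U(3)]) blast
  obtain W z where W: "zopen X W" "q \<in> W" "W \<subseteq> U \<inter> V" "z \<in> OI W" "res F (U \<inter> V) W (res F U (U \<inter> V) t) = LC W z"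
    using g[unfolded gen_def, rule_format, OF UV(1) _ r q] by blast
  define w where "w i = (if i \<in> I then z i else 0)" for i
  have "LC W w = LC W z" unfolding LC_def
  proof -
    interpret M: abelian_group "sects F W" by (rule ab_F[OF W(1)])
    have WV: "W \<subseteq> V" using W(3) by blast
    show "finsum (sects F W) (\<lambda>i. fn W (w i) \<odot>[F,W] res F V W (s i)) I =
      finsum (sects F W) (\<lambda>i. fn W (z i) \<odot>[F,W] res F V W (s i)) I"
      by (rule M.finsum_cong') (auto simp: w_def intro: term_cl[OF W(1) WV W(4)])
  qed
  moreover have "w \<in> OI W" using W(4) by (simp add: OI_def w_def)
  moreover have "res F U W t = LC W z" using W(5) res_res[OF U(1) UV(1) W(1,3) _ U(3)] by simp
  ultimately have "rep U t w" unfolding rep_def using W(1-3) by (intro conjI exI[of _ W]) (auto simp: w_def)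
  thus ?thesis by (rule exI[of "rep U t"])
qed

lemma kap_eq: "\<lbrakk>zopen X U; t \<in> sec F U; rep U t z\<rbrakk> \<Longrightarrow> kap U t = z"
  unfolding kap_def using rep_unique by (intro the_equality)

lemma rep_kap: assumes "zopen X U" "U \<noteq> {}" "t \<in> sec F U" shows "rep U t (kap U t)"
proof -
  obtain z where z: "rep U t z" using rep_ex[OF assms] by blast
  from kap_eq[OF assms(1,3) z] z show ?thesis by simp
qed

lemma emb_kap: "emb X J F kap vs"
proof
  fix U U' t assume U: "zopen X U" "zopen X U'" "U' \<subseteq> U" "U' \<noteq> {}" and t: "t \<in> sec F U"
  hence ne: "U \<noteq> {}" by blast
  note t' = res_cl[OF U(1-3) t]
  note r = rep_kap[OF U(1) ne t]
  obtain W where W: "zopen X W" "W \<noteq> {}" "W \<subseteq> U" "W \<subseteq> V" "kap U t \<in> OI W" "res F U W t = LC W (kap U t)" by (rule repE[OF r])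
  have o: "zopen X (W \<inter> U')" "W \<inter> U' \<noteq> {}" using zopen_meet[OF W(1) U(2) W(2) U(4)] by auto
  note sh = rep_shrink[OF U(1) t W(1,3-6) o(1) Int_lower1]
  have "res F U' (W \<inter> U') (res F U U' t) = LC (W \<inter> U') (kap U t)" using res_res[OF U(1,2) o(1) _ U(3) t] sh(4) by simp
  hence "rep U' (res F U U' t) (kap U t)" unfolding rep_def using o sh(2,3) rep_out[OF r] by (intro conjI exI[of _ "W \<inter> U'"]) auto
  from kap_eq[OF U(2) t' this] t' show "res F U U' t \<in> sec F U' \<and> kap U' (res F U U' t) = kap U t" by simp
next
  fix U assume U: "zopen X U" "U \<noteq> {}"
  have "rep U \<zero>[F,U] 0"
  proof -
    have UV: "zopen X (U \<inter> V)" "U \<inter> V \<noteq> {}" using zopen_meet[OF U(1) V(1) U(2) V(2)] by auto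
    show ?thesis unfolding rep_def using UV LC_0[OF UV(1)] OI_0[OF UV(1)] res_zero[OF U(1) UV(1)]
      by (intro conjI exI[of _ "U \<inter> V"]) auto
  qed
  thus "\<zero>[F,U] \<in> sec F U \<and> kap U \<zero>[F,U] = 0" using kap_eq[OF U(1)] zero_F[OF U(1)] by simp
  fix t assume t: "t \<in> sec F U"
  note r = rep_kap[OF U t]
  {
    fix a assume a: "a \<in> twisting_sections X 0 U"
    have a': "fr 0 U a \<in> Osec 0 U" "fn U (fr 0 U a) = a" by (rule fr_tw[OF U a])+
    obtain W where W: "zopen X W" "W \<noteq> {}" "W \<subseteq> U" "W \<subseteq> V" "kap U t \<in> OI W" "res F U W t = LC W (kap U t)" by (rule repE[OF r])
    note oW = Osec_mono[OF a'(1) W(3)]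
    have "res F U W (a \<odot>[F,U] t) = LC W (vs (fr 0 U a) (kap U t))"
      using sm_res[OF U(1) W(1,3) a'(1) t] LC_vs[OF W(1,4) oW W(5)] W(6) a'(2) by simp
    hence "rep U (a \<odot>[F,U] t) (vs (fr 0 U a) (kap U t))" unfolding rep_def
      using W(1-4) OI_vs[OF W(1,4) oW W(5)] rep_out[OF r] by (intro conjI exI[of _ W]) (auto simp: vs_def)
    from kap_eq[OF U(1) smult_F[OF U(1) a t] this] smult_F[OF U(1) a t]
    show "a \<odot>[F,U] t \<in> sec F U \<and> kap U (a \<odot>[F,U] t) = vs (fr 0 U a) (kap U t)" by simp
  }
  fix t' assume t': "t' \<in> sec F U"
  note r' = rep_kap[OF U t']
  obtain W where W: "zopen X W" "W \<noteq> {}" "W \<subseteq> U" "W \<subseteq> V" "kap U t \<in> OI W" "res F U W t = LC W (kap U t)"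
    "kap U t' \<in> OI W" "res F U W t' = LC W (kap U t')" by (rule rep2[OF U(1) t t' r r'])
  have "res F U W (t \<oplus>[F,U] t') = LC W (kap U t + kap U t')"
    using res_add[OF U(1) W(1,3) t t'] LC_add[OF W(1,4,5,7)] W(6,8) by simp
  hence "rep U (t \<oplus>[F,U] t') (kap U t + kap U t')" unfolding rep_def
    using W(1-4) OI_add[OF W(1,4,5,7)] rep_out[OF r] rep_out[OF r'] by (intro conjI exI[of _ W]) auto
  from kap_eq[OF U(1) add_F[OF U(1) t t'] this] add_F[OF U(1) t t']
  show "t \<oplus>[F,U] t' \<in> sec F U \<and> kap U (t \<oplus>[F,U] t') = kap U t + kap U t'" by simp
  show "t = t'" if k: "kap U t = kap U t'"
  proof -
    interpret M: abelian_group "sects F U" by (rule ab_F[OF U(1)])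
    have m: "- 1 \<in> Osec 0 A" for A using Oloc_uminus[OF Oloc_1] by (auto simp: Osec_def)
    let ?n = "\<lambda>A x. fn A (- 1) \<odot>[F,A] x"
    have cancel: "x \<oplus>[F,A] ?n A x = \<zero>[F,A]" if "zopen X A" "x \<in> sec F A" for A x
      using sm_add[OF that(1) Osec_1 m that(2)] sm_1[OF that] sm_0[OF that] by simp
    have n: "?n U t' \<in> sec F U" by (rule sm_closed[OF U(1) m t'])
    have eq: "res F U W t = res F U W t'" using W(6,8) k by simp
    have "res F U W (t \<oplus>[F,U] ?n U t') = \<zero>[F,W]"
      using res_add[OF U(1) W(1,3) t n] sm_res[OF U(1) W(1,3) m t'] cancel[OF W(1) res_cl[OF U(1) W(1,3) t']] eq by simp
    from vanish[OF U(1) add_F[OF U(1) t n] W(1,3,2) this] have "t \<oplus>[F,U] ?n U t' = t' \<oplus>[F,U] ?n U t'"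
      using cancel[OF U(1) t'] by simp
    thus "t = t'" using M.add.right_cancel[OF n t t'] by simp
  qed
qed

lemma embsheaf_kap: "embsheaf X J F kap"
proof -
  interpret E: emb X J F kap vs by (rule emb_kap)
  have "\<exists>!t. t \<in> sec F {}" using glue_F[of "{}" undefined] by simp
  hence e: "sec F {} = {\<zero>[F,{}]}" using zero_F(1)[of "{}"] by auto
  show ?thesis
  proof
    fix U z assume U: "zopen X U" "U \<noteq> {}" and z: "\<And>p. p \<in> U \<Longrightarrow> z \<in> E.stk p"
    define \<C> where "\<C> = {A. zopen X A \<and> A \<noteq> {} \<and> A \<subseteq> U \<and> (\<exists>t\<in>sec F A. kap A t = z)}"
    have un: "\<Union>\<C> = U"
    proof (intro subset_antisym subsetI)
      fix p assume p: "p \<in> U"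
      obtain A t where A: "zopen X A" "p \<in> A" "t \<in> sec F A" "kap A t = z" by (rule E.stkE[OF z[OF p]])
      have o: "zopen X (A \<inter> U)" "A \<inter> U \<noteq> {}" using zopen_Int[OF A(1) U(1)] A(2) p by auto
      have "A \<inter> U \<in> \<C>" unfolding \<C>_def using E.e_res[OF A(1) o(1) Int_lower1 o(2) A(3)] A(4) o by blast
      thus "p \<in> \<Union>\<C>" using p A(2) by blast
    qed (auto simp: \<C>_def)
    have "\<forall>A\<in>\<C>. \<exists>t. t \<in> sec F A \<and> kap A t = z" unfolding \<C>_def by blast
    then obtain st where st: "\<forall>A\<in>\<C>. st A \<in> sec F A \<and> kap A (st A) = z" by (rule bchoice[THEN exE])
    have C: "zopen X A" "A \<noteq> {}" "A \<subseteq> U" if "A \<in> \<C>" for A using that by (auto simp: \<C>_def)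
    have "\<exists>!t. t \<in> sec F (\<Union>\<C>) \<and> (\<forall>A\<in>\<C>. res F (\<Union>\<C>) A t = st A)"
    proof (rule glue_F)
      fix A B assume AB: "A \<in> \<C>" "B \<in> \<C>"
      have o: "zopen X (A \<inter> B)" "A \<inter> B \<noteq> {}"
        using zopen_meet[OF C(1,1,2,2)] AB by auto
      show "res F A (A \<inter> B) (st A) = res F B (A \<inter> B) (st B)"
        using E.e_res[OF C(1)[OF AB(1)] o(1) Int_lower1 o(2), of "st A"] E.e_res[OF C(1)[OF AB(2)] o(1) Int_lower2 o(2), of "st B"] st AB
        by (intro E.e_inj[OF o]) auto
    qed (use st C in auto)
    then obtain t where t: "t \<in> sec F U" "\<forall>A\<in>\<C>. res F U A t = st A" unfolding un by blast
    obtain p where "p \<in> U" using U(2) by blast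
    then obtain A where A: "A \<in> \<C>" using un by blast
    have "kap U t = z" using E.e_res[OF U(1) C(1,3,2)[OF A] t(1)] t(2) st A by simp
    thus "\<exists>t\<in>sec F U. kap U t = z" using t(1) by blast
  next
    show "\<zero>[F,{}] \<oplus>[F,{}] \<zero>[F,{}] = \<zero>[F,{}]" by (rule zero_F(2)) simp
    show "res F U {} t \<in> sec F {}" if "zopen X U" "t \<in> sec F U" for U t by (rule res_cl[OF that(1) _ _ that(2)]) auto
  qed (rule e)
qed

end

context modsheaf begin

lemma gen_at:
  assumes "finite_type_on X X F" "p \<in> X"
  obtains V n s where "frame X J F V {..<n::nat} s" "frame.gen X J F V {..<n} s" "p \<in> V"
proof -
  obtain V n s where Vp: "zopen X V" "p \<in> V" "V \<subseteq> X" and s: "\<forall>i<n. s i \<in> sec F V"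
    and gen: "\<forall>W t q. zopen X W \<and> W \<subseteq> V \<and> t \<in> sec F W \<and> q \<in> W \<longrightarrow>
      (\<exists>W' a. zopen X W' \<and> q \<in> W' \<and> W' \<subseteq> W \<and> (\<forall>i<n. a i \<in> sec (structure_sheaf X) W') \<and>
        res F W W' t = linear_comb X F n W' a (\<lambda>i. res F V W' (s i)))"
    using assms unfolding finite_type_on_def by (elim ballE[of X _ p] exE conjE) (assumption | simp)+
  interpret frame X J F V "{..<n}" s by unfold_locales (use Vp s in auto)
  have gen unfolding gen_def
  proof (intro allI impI)
    fix W t q assume W: "zopen X W" "W \<subseteq> V" "t \<in> sec F W" "q \<in> W"
    obtain W' a where W': "zopen X W'" "q \<in> W'" "W' \<subseteq> W" and a: "\<forall>i<n. a i \<in> sec (structure_sheaf X) W'"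
      and e: "res F W W' t = linear_comb X F n W' a (\<lambda>i. res F V W' (s i))"
      using gen[THEN spec[of _ W], THEN spec[of _ t], THEN spec[of _ q]] W by blast
    have ne: "W' \<noteq> {}" using W'(2) by blast
    have W'V: "W' \<subseteq> V" using W'(3) W(2) by blast
    define z where "z i = fr 0 W' (a i)" for i
    have z: "z i \<in> Osec 0 W'" "fn W' (z i) = a i" if "i < n" for i
      using fr_tw[OF W'(1) ne, of "a i" 0] a that by (auto simp: z_def)
    interpret M: abelian_group "sects F W'" by (rule ab_F[OF W'(1)])
    have zO: "z \<in> OI W'" using z(1) by (auto simp: OI_def)
    have "linear_comb X F n W' a (\<lambda>i. res F V W' (s i)) = LC W' z"
      unfolding linear_comb_def LC_def
      by (rule M.finsum_cong') (use z(2) term_cl[OF W'(1) W'V zO] in auto)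
    thus "\<exists>W' z. zopen X W' \<and> q \<in> W' \<and> W' \<subseteq> W \<and> z \<in> OI W' \<and> res F W W' t = LC W' z"
      using W' zO e by (intro exI[of _ W'] exI[of _ z]) simp
  qed
  thus ?thesis using that[of V n s] Vp(2) frame_axioms by blast
qed

lemma stk_finite:
  assumes ft: "finite_type_on X X F" and E: "emb X J F kp vs" and p: "p \<in> X"
  shows "\<exists>V m T. zopen X V \<and> p \<in> V \<and> (\<forall>q\<in>V. \<forall>i<m. T i \<in> emb.stk X F kp q) \<and>
      (\<forall>q\<in>V. \<forall>z\<in>emb.stk X F kp q. \<exists>c. (\<forall>i<m. c i \<in> Oloc J 0 q) \<and> z = (\<Sum>i<m::nat. vs (c i) (T i)))"
proof -
  interpret E: emb X J F kp vs by (rule E)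
  obtain V n s where fr: "frame X J F V {..<n} s" "frame.gen X J F V {..<n} s" "p \<in> V" by (rule gen_at[OF ft p])
  interpret frame X J F V "{..<n}" s by (rule fr(1))
  define T where "T i = kp V (s i)" for i
  have fs: "finsum (sects F W) f {..<m} \<in> sec F W \<and> kp W (finsum (sects F W) f {..<m}) = (\<Sum>i<m. kp W (f i))"
    if W: "zopen X W" "W \<noteq> {}" and f: "\<And>i. i < m \<Longrightarrow> f i \<in> sec F W" for W f and m :: nat
  proof -
    interpret M: abelian_group "sects F W" by (rule ab_F[OF W(1)])
    show ?thesis using f
    proof (induction m)
      case 0
      thus ?case using E.e_zero[OF W] by simp
    next
      case (Suc m)
      have c: "f \<in> {..<m} \<rightarrow> sec F W" "f m \<in> sec F W" using Suc.prems by auto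
      have "finsum (sects F W) f {..<Suc m} = f m \<oplus>[F,W] finsum (sects F W) f {..<m}"
        unfolding lessThan_Suc by (rule M.finsum_insert) (use c in auto)
      thus ?case using Suc E.e_add[OF W c(2), of "finsum (sects F W) f {..<m}"] by (simp add: add.commute)
    qed
  qed
  have "\<exists>c. (\<forall>i<n. c i \<in> Oloc J 0 q) \<and> z = (\<Sum>i<n. vs (c i) (T i))" if q: "q \<in> V" and z: "z \<in> E.stk q" for q z
  proof -
    obtain U t where U: "zopen X U" "q \<in> U" "t \<in> sec F U" "kp U t = z" by (rule E.stkE[OF z])
    have UV: "zopen X (U \<inter> V)" "U \<inter> V \<noteq> {}" "q \<in> U \<inter> V" using zopen_Int[OF U(1) V(1)] U(2) q by auto
    note r = E.e_res[OF U(1) UV(1) Int_lower1 UV(2) U(3)]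
    obtain W c where W: "zopen X W" "q \<in> W" "W \<subseteq> U \<inter> V" "c \<in> OI W" "res F (U \<inter> V) W (res F U (U \<inter> V) t) = LC W c"
      using fr(2)[unfolded gen_def, rule_format, OF UV(1) Int_lower2 conjunct1[OF r] UV(3)] by blast
    have ne: "W \<noteq> {}" and WV: "W \<subseteq> V" using W(2,3) by auto
    have tc: "fn W (c i) \<odot>[F,W] res F V W (s i) \<in> sec F W" if "i < n" for i using term_cl[OF W(1) WV W(4)] that by simp
    have "z = kp W (LC W c)" using r E.e_res[OF UV(1) W(1,3) ne conjunct1[OF r]] W(5) U(4) by simp
    also have "\<dots> = (\<Sum>i<n. kp W (fn W (c i) \<odot>[F,W] res F V W (s i)))"
      unfolding LC_def using fs[OF W(1) ne tc] by simp
    also have "\<dots> = (\<Sum>i<n. vs (c i) (T i))"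
    proof (rule sum.cong[OF refl])
      fix i assume "i \<in> {..<n}"
      hence i: "i < n" "i \<in> {..<n}" by auto
      hence o: "c i \<in> Osec 0 W" using W(4) by (auto simp: OI_def)
      note rr = E.e_res[OF V(1) W(1) WV ne s[OF i(2)]]
      show "kp W (fn W (c i) \<odot>[F,W] res F V W (s i)) = vs (c i) (T i)"
        using E.e_sm[OF W(1) ne fn_tw[OF W(1) o] conjunct1[OF rr]] rr fr_fn[OF W(1) ne o] by (simp add: T_def)
    qed
    finally show ?thesis using W(2,4) by (intro exI[of _ c]) (auto simp: OI_def Osec_def)
  qed
  moreover have "T i \<in> E.stk q" if "q \<in> V" "i < n" for q i
    unfolding E.stk_def T_def using V(1) that s by blast
  ultimately show ?thesis using V(1) fr(3) by (intro exI[of _ V] exI[of _ n] exI[of _ T]) blast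
qed

text \<open>A generating family of minimal size over some nonempty open set is linearly independent.\<close>

theorem generic_basis_exists:
  assumes tf: "torsion_free X F" and co: "coherent X F"
  shows "\<exists>V I s. generic_basis X J F V I s"
proof -
  have ft: "finite_type_on X X F" using co unfolding coherent_def by blast
  let ?P = "\<lambda>m. \<exists>V I s. frame X J F V I s \<and> frame.gen X J F V I s \<and> card I = m"
  have "\<exists>m. ?P m"
  proof -
    obtain p where p: "p \<in> X" using ex_nz[OF HP_1] by auto
    obtain V n s where "frame X J F V {..<n} s" "frame.gen X J F V {..<n} s" by (rule gen_at[OF ft p]) blast
    thus ?thesis by blast
  qed
  hence "?P (LEAST m. ?P m)" by (rule LeastI_ex)
  then obtain V I s where fr: "frame X J F V I s" "frame.gen X J F V I s" and least: "card I = (LEAST m. ?P m)" by blast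
  have min: "card I \<le> m" if "?P m" for m unfolding least using that by (rule Least_le)
  interpret frame X J F V I s by (rule fr(1))
  have "z k = 0" if W: "zopen X W" "W \<subseteq> V" "W \<noteq> {}" and z: "z \<in> OI W" "LC W z = \<zero>[F,W]" and k: "k \<in> I" for W z k
  proof (rule ccontr)
    assume zk: "z k \<noteq> 0"
    \<comment> \<open>On a smaller set the nonzero coefficient \<open>z k\<close> is invertible, so
      that the relation expresses \<open>s k\<close> through the other sections.\<close>
    obtain W1 where W1: "zopen X W1" "W1 \<noteq> {}" "W1 \<subseteq> W" "1 / z k \<in> Osec 0 W1"
    proof -
      obtain p where p: "p \<in> W" using W(3) by blast
      have pX: "p \<in> X" using p zopen_subset[OF W(1)] by blast
      have "z k \<in> Oloc J 0 p" using z(1) k p by (auto simp: OI_def Osec_def)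
      then obtain P Q d c where PQ: "P \<in> HP J d" "Q \<in> HP J c" "d - c = 0" "nz Q p" "z k = pf P / pf Q" by (rule OlocE)
      have "P \<noteq> 0" using PQ(5) zk by auto
      from ex_nz[OF PQ(1) this] obtain r where "r \<in> X" "nz P r" by blast
      hence o: "zopen X {q \<in> X. nz P q}" "{q \<in> X. nz P q} \<noteq> {}" using zopen_nz[OF PQ(1)] by auto
      have i: "zopen X (W \<inter> {q \<in> X. nz P q})" "W \<inter> {q \<in> X. nz P q} \<noteq> {}"
        using zopen_meet[OF W(1) o(1) W(3) o(2)] by auto
      have "1 / z k \<in> Oloc J 0 q" if "nz P q" for q
        by (rule OlocI[OF PQ(2,1) _ that]) (use PQ(3,5) in auto)
      hence "1 / z k \<in> Osec 0 (W \<inter> {q \<in> X. nz P q})" by (auto simp: Osec_def)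
      thus ?thesis using that[OF i] by blast
    qed
    have W1V: "W1 \<subseteq> V" using W1(3) W(2) by blast
    define s' where "s' i = res F V W1 (s i)" for i
    interpret G: frame X J F W1 "I - {k}" s'
      by unfold_locales (use W1 I rs[OF W1(1) W1V] in \<open>auto simp: s'_def\<close>)
    have LC': "LC A w = G.LC A w" if A: "zopen X A" "A \<subseteq> W1" and w: "w \<in> OI A" "w k = 0" for A w
    proof -
      interpret M: abelian_group "sects F A" by (rule ab_F[OF A(1)])
      have AV: "A \<subseteq> V" using A(2) W1V by blast
      note tc = term_cl[OF A(1) AV w(1)]
      have "LC A w = finsum (sects F A) (\<lambda>i. fn A (w i) \<odot>[F,A] res F V A (s i)) (insert k (I - {k}))"
        unfolding LC_def using k by (simp add: insert_absorb)
      also have "\<dots> = fn A (w k) \<odot>[F,A] res F V A (s k) \<oplus>[F,A]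
          finsum (sects F A) (\<lambda>i. fn A (w i) \<odot>[F,A] res F V A (s i)) (I - {k})"
        by (rule M.finsum_insert) (use I tc k in auto)
      also have "fn A (w k) \<odot>[F,A] res F V A (s k) = \<zero>[F,A]" using sm_0[OF A(1) rs[OF A(1) AV k]] w(2) by simp
      also have "finsum (sects F A) (\<lambda>i. fn A (w i) \<odot>[F,A] res F V A (s i)) (I - {k}) = G.LC A w"
        unfolding G.LC_def
        by (rule M.finsum_cong') (use tc res_res[OF V(1) W1(1) A W1V s] in \<open>auto simp: s'_def\<close>)
      finally have "LC A w = \<zero>[F,A] \<oplus>[F,A] G.LC A w" .
      moreover have "G.LC A w \<in> sec F A" by (rule G.LC_cl[OF A]) (use w(1) in \<open>auto simp: OI_def G.OI_def\<close>)
      ultimately show ?thesis by simp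
    qed
    have "G.gen" unfolding G.gen_def
    proof (intro allI impI)
      fix A t q assume A: "zopen X A" "A \<subseteq> W1" "t \<in> sec F A" "q \<in> A"
      have AV: "A \<subseteq> V" using A(2) W1V by blast
      obtain B w where B: "zopen X B" "q \<in> B" "B \<subseteq> A" "w \<in> OI B" "res F A B t = LC B w"
        using fr(2)[unfolded gen_def, rule_format, OF A(1) AV A(3,4)] by blast
      have BB: "B \<subseteq> V" "B \<subseteq> W1" "B \<subseteq> W" using B(3) A(2) AV W1(3) by auto
      \<comment> \<open>The multiple of the relation \<open>z\<close> that cancels the coefficient
        of \<open>w\<close> at \<open>k\<close>.\<close>
      define c where "c = - (w k / z k)"
      have "w k \<in> Osec 0 B" using B(4) k by (auto simp: OI_def)
      from Osec_mult[OF this Osec_mono[OF W1(4) BB(2)]] have "w k / z k \<in> Osec 0 B" by simp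
      hence c: "c \<in> Osec 0 B" unfolding c_def using Oloc_uminus by (auto simp: Osec_def)
      note zB = OI_mono[OF z(1) BB(3)]
      note czB = OI_vs[OF B(1) BB(1) c zB]
      have "LC B z = \<zero>[F,B]" using LC_res[OF W(1,2) B(1) BB(3) z(1)] z(2) res_zero[OF W(1) B(1) BB(3)] by simp
      hence "LC B (vs c z) = \<zero>[F,B]" using LC_vs[OF B(1) BB(1) c zB] sm_r0[OF B(1) c] by simp
      hence l: "LC B (w + vs c z) = LC B w"
        using LC_add[OF B(1) BB(1) B(4) czB] abelian_monoid.r_zero[OF abelian_group.axioms(1)[OF ab_F[OF B(1)]] LC_cl[OF B(1) BB(1) B(4)]] by simp
      have o: "w + vs c z \<in> OI B" by (rule OI_add[OF B(1) BB(1) B(4) czB])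
      have "(w + vs c z) k = 0" using zk by (simp add: vs_def c_def)
      have "LC B (w + vs c z) = G.LC B (w + vs c z)" by (rule LC'[OF B(1) BB(2) o]) fact
      hence "res F A B t = G.LC B (w + vs c z)" unfolding l B(5) .
      moreover have "w + vs c z \<in> G.OI B" using o by (auto simp: OI_def G.OI_def)
      ultimately show "\<exists>W' z. zopen X W' \<and> q \<in> W' \<and> W' \<subseteq> A \<and> z \<in> G.OI W' \<and> res F A W' t = G.LC W' z"
        using B(1-3) by blast
    qed
    hence "?P (card (I - {k}))" using G.frame_axioms by blast
    from min[OF this] show False using card_Diff1_less[OF I k] by simp
  qed
  hence "generic_basis X J F V I s"
    by (unfold_locales) (use fr(2) vanish_generic[OF tf co] in blast)+
  thus ?thesis by blast
qed

end

section \<open>The splitting criterion for sheaves\<close>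

text \<open>Multiplication by a power of a coordinate invertible at \<open>p\<close> shifts all
  degrees by the same amount.\<close>

lemma (in linvar) St_OS:
  assumes S: "stalks X J S" and eq: "S p = OS b p" and p: "p \<in> X"
  shows "stalks.St J S t p = OS (map (\<lambda>x. x + t) b) p"
proof -
  interpret S: stalks X J S by (rule S)
  obtain i where i: "i \<in> J" "nz (pvar i :: 'k pfun) p" by (rule ex_pvar[OF p])
  let ?y = "pf (pvar i :: 'k pfun)"
  have y: "?y powi k \<in> Oloc J k p" for k using Oloc_powi[OF HP_pvar[OF i(1)] i(2)] .
  have y0: "?y \<noteq> 0" using nz_pf[OF i(2) p] .
  have "?y powi (- t) * z \<in> Oloc J c p \<longleftrightarrow> z \<in> Oloc J (c + t) p" for z c
  proof
    assume "?y powi (- t) * z \<in> Oloc J c p"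
    from Oloc_mult[OF y[of t] this] have "(?y powi t * ?y powi (- t)) * z \<in> Oloc J (c + t) p" by (simp add: mult.assoc add.commute)
    moreover have "?y powi t * ?y powi (- t) = 1" using y0 by (simp add: power_int_minus)
    ultimately show "z \<in> Oloc J (c + t) p" by simp
  next
    assume "z \<in> Oloc J (c + t) p"
    from Oloc_mult[OF y[of "- t"] this] show "?y powi (- t) * z \<in> Oloc J c p" by simp
  qed
  hence "vs (?y powi (- t)) z \<in> OS b p \<longleftrightarrow> z \<in> OS (map (\<lambda>x. x + t) b) p" for z
    using y0 by (auto simp: OS_def vs_def)
  thus ?thesis using S.St_iff[OF p HP_pvar[OF i(1)] i(2), of _ t] unfolding eq by blast
qed

text \<open>The sum of twists is embedded a second time, through the lifted sections instead of
  componentwise. Its values then lie in the space that contains the stalks \<open>S p\<close>, and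
  it has these as its stalks, so that \<open>iso_emb\<close> becomes applicable.\<close>

lemma embsheaf_comb:
  assumes lb: "lifted_basis X J H j a S (length bs) (\<lambda>i. bs ! i) Psi s"
  shows "embsheaf X J (sum_of_twists X bs) (\<lambda>U g. lifted_basis.comb (length bs) s (linvar.ks J bs U g))"
    "p \<in> X \<Longrightarrow> emb.stk X (sum_of_twists X bs) (\<lambda>U g. lifted_basis.comb (length bs) s (linvar.ks J bs U g)) p = S p"
proof -
  interpret lifted_basis X J H j a S "length bs" "\<lambda>i. bs ! i" Psi s by (rule lb)
  let ?G = "sum_of_twists X bs"
  let ?k = "\<lambda>U g. comb (X.ks bs U g)"
  interpret K: embsheaf X J ?G "X.ks bs" by (rule X.embsheaf_sum)
  have E: "emb X J ?G ?k vs"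
  proof
    fix U V g assume *: "zopen X U" "zopen X V" "V \<subseteq> U" "V \<noteq> {}" "g \<in> sec ?G U"
    show "res ?G U V g \<in> sec ?G V \<and> ?k V (res ?G U V g) = ?k U g" using K.e_res[OF *] by simp
  next
    fix U assume U: "zopen X U" "U \<noteq> {}"
    have c0: "comb 0 = 0" using comb_vs[of 0 0] by (simp add: zero_fun_def)
    show "\<zero>[?G,U] \<in> sec ?G U \<and> ?k U \<zero>[?G,U] = 0" using K.e_zero[OF U] c0 by simp
    fix g assume g: "g \<in> sec ?G U"
    show "a \<odot>[?G,U] g \<in> sec ?G U \<and> ?k U (a \<odot>[?G,U] g) = vs (X.fr 0 U a) (?k U g)"
      if "a \<in> twisting_sections X 0 U" for a using K.e_sm[OF U that g] comb_vs[of "X.fr 0 U a" "X.ks bs U g"] by (simp add: vs_def)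
    fix h assume h: "h \<in> sec ?G U"
    show "g \<oplus>[?G,U] h \<in> sec ?G U \<and> ?k U (g \<oplus>[?G,U] h) = ?k U g + ?k U h"
      using K.e_add[OF U g h] comb_add[of "X.ks bs U g" "X.ks bs U h"] by (simp add: plus_fun_def)
    show "g = h" if k: "?k U g = ?k U h"
    proof (rule K.e_inj[OF U g h])
      obtain p where p: "p \<in> U" using U(2) by blast
      have pX: "p \<in> X" using p X.zopen_subset[OF U(1)] by blast
      note o = X.ks_OS[OF U(1) p g] X.ks_OS[OF U(1) p h]
      show "X.ks bs U g = X.ks bs U h"
      proof
        fix i show "X.ks bs U g i = X.ks bs U h i"
        proof (cases "i < length bs")
          case True
          show ?thesis by (rule comb_inj[OF pX pX _ _ k True]) (use o in \<open>auto simp: X.OS_def\<close>)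
        qed (simp add: X.ks_def)
      qed
    qed
  qed
  interpret E: emb X J ?G ?k vs by (rule E)
  have stk: "E.stk p = comb ` K.stk p" for p unfolding E.stk_def K.stk_def by blast
  have stkS: "E.stk p = S p" if p: "p \<in> X" for p
  proof -
    have "comb ` X.OS bs p = E p" unfolding E_def
    proof (intro subset_antisym subsetI)
      fix z assume "z \<in> {comb f |f. \<forall>i<length bs. f i \<in> Oloc J (bs ! i) p}"
      then obtain f where f: "\<forall>i<length bs. f i \<in> Oloc J (bs ! i) p" "z = comb f" by blast
      define g where "g i = (if i < length bs then f i else 0)" for i
      have "comb g = comb f" unfolding comb_def by (rule sum.cong) (simp_all add: g_def)
      hence "z = comb g" using f(2) by simp
      moreover have "g \<in> X.OS bs p" using f(1) by (simp add: X.OS_def g_def)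
      ultimately show "z \<in> comb ` X.OS bs p" by (rule image_eqI)
    next
      fix z assume "z \<in> comb ` X.OS bs p"
      then obtain f where "f \<in> X.OS bs p" "z = comb f" by blast
      thus "z \<in> {comb f |f. \<forall>i<length bs. f i \<in> Oloc J (bs ! i) p}"
        by (intro CollectI exI[of _ f]) (simp add: X.OS_def)
    qed
    thus ?thesis using S_eq_E[OF p] stk X.stk_sum[OF p] by simp
  qed
  thus "p \<in> X \<Longrightarrow> E.stk p = S p" .
  show "embsheaf X J ?G ?k"
  proof
    fix U z assume U: "zopen X U" "U \<noteq> {}" and z: "\<And>p. p \<in> U \<Longrightarrow> z \<in> E.stk p"
    have UX: "p \<in> X" if "p \<in> U" for p using that X.zopen_subset[OF U(1)] by blast
    obtain p where p: "p \<in> U" using U(2) by blast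
    obtain f where f: "f \<in> X.OS bs p" "z = comb f" using z[OF p] stk X.stk_sum[OF UX[OF p]] by auto
    \<comment> \<open>Coefficient vectors found at different points agree by
      \<open>comb_inj\<close>, so one vector \<open>f\<close> serves on all of
      \<open>U\<close>.\<close>
    have "f \<in> K.stk q" if q: "q \<in> U" for q
    proof -
      obtain g where g: "g \<in> X.OS bs q" "z = comb g" using z[OF q] stk X.stk_sum[OF UX[OF q]] by auto
      have "f = g"
      proof
        fix i show "f i = g i"
        proof (cases "i < length bs")
          case True
          show ?thesis by (rule comb_inj[OF UX[OF p] UX[OF q] _ _ _ True]) (use f g in \<open>auto simp: X.OS_def\<close>)
        qed (use f g in \<open>auto simp: X.OS_def\<close>)
      qed
      thus ?thesis using g(1) X.stk_sum[OF UX[OF q]] by simp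
    qed
    from K.glue[OF U this] show "\<exists>g\<in>sec ?G U. ?k U g = z" using f(2) by blast
  qed (use K.sec_empty K.add_empty K.res_empty in auto)
qed

theorem theoremA:
  fixes N :: nat
    and F :: "('k::{alg_closed_field, field_char_0}, 'm) mod_sheaf"
    and H :: "'k point set"
    and b :: "int list"
  assumes "N \<ge> 2"
    and "coherent (proj_space N) F"
    and "torsion_free (proj_space N) F"
    and "hyperplane N H"
    and "b \<noteq> []"
    and "sorted_wrt (\<ge>) b"
  shows "sheaf_iso (proj_space N) F (sum_of_twists (proj_space N) b) \<longleftrightarrow>
    sheaf_iso H (restrict_sheaf (proj_space N) F H) (sum_of_twists H b) \<and>
    (N = 2 \<and> (\<forall>t\<le>- last b. H1_vanishes (proj_space N) (twist (proj_space N) F t)) \<or>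
     N \<ge> 3 \<and> (\<exists>t0. \<forall>t\<le>t0. H1_vanishes (proj_space N) (twist (proj_space N) F t)))"
proof -
  let ?X = "proj_space N :: 'k point set"
  interpret linvar ?X "{..N}" by (rule linvar_proj_space)
  obtain j a where hp: "hyperplane_pair ?X {..N} H j a" using hyperplane_pair_exists[OF assms(4)] assms(1) by auto
  interpret hyperplane_pair ?X "{..N}" H j a by (rule hp)
  interpret modsheaf ?X "{..N}" F by unfold_locales (use assms(2) in \<open>simp add: coherent_def\<close>)
  have cJ': "card ({..N} - {j}) = N" using jJ by simp
  show ?thesis
  proof
    assume "sheaf_iso ?X F (sum_of_twists ?X b)"
    then obtain \<phi> where \<phi>: "is_sheaf_iso ?X F (sum_of_twists ?X b) \<phi>" unfolding sheaf_iso_iff by blast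
    define kp where "kp U t = ks b U (\<phi> U t)" for U t
    have kp: "(\<lambda>U t. ks b U (\<phi> U t)) = kp" by (simp add: kp_def fun_eq_iff)
    have E: "emb ?X {..N} F kp vs" using emb_iso(1)[OF emb_sum \<phi>] unfolding kp .
    have stk: "emb.stk ?X F kp p = OS b p" if "p \<in> ?X" for p
      using emb_iso(2)[OF emb_sum \<phi>] stk_sum[OF that] unfolding kp by metis
    interpret K: hyper_sheaf ?X "{..N}" F kp H j a
      unfolding hyper_sheaf_def using E hp by blast
    have iso: "sheaf_iso H (restrict_sheaf ?X F H) (sum_of_twists H b)" by (rule K.restrict_iso[OF stk])
    have van: "H1_vanishes ?X (twist ?X F t)" for t
    proof -
      \<comment> \<open>\<open>N >= 2\<close> gives at least three homogeneous coordinates, enough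
        for \<open>cousin_Oloc\<close>.\<close>
      have "cousin ?X (OS (map (\<lambda>x. x + t) b))"
        by (rule cousin_sum[where n = "length b" and c = "\<lambda>i. b ! i + t"]) (use assms(1) in \<open>auto simp: OS_def intro!: cousin_Oloc\<close>)
      hence "cousin ?X (K.St t)"
        by (rule cousin_cong[rotated]) (rule St_OS[OF emb_stalks[OF E] stk, symmetric])
      thus ?thesis using H1_twist[OF E] by blast
    qed
    show "sheaf_iso H (restrict_sheaf ?X F H) (sum_of_twists H b) \<and>
      (N = 2 \<and> (\<forall>t\<le>- last b. H1_vanishes ?X (twist ?X F t)) \<or> N \<ge> 3 \<and> (\<exists>t0. \<forall>t\<le>t0. H1_vanishes ?X (twist ?X F t)))"
      using iso van assms(1) by auto
  next
    assume A: "sheaf_iso H (restrict_sheaf ?X F H) (sum_of_twists H b) \<and>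
      (N = 2 \<and> (\<forall>t\<le>- last b. H1_vanishes ?X (twist ?X F t)) \<or> N \<ge> 3 \<and> (\<exists>t0. \<forall>t\<le>t0. H1_vanishes ?X (twist ?X F t)))"
    obtain V I s where "generic_basis ?X {..N} F V I s" using generic_basis_exists[OF assms(3,2)] by blast
    then interpret G: generic_basis ?X "{..N}" F V I s .
    note E = G.emb_kap
    interpret K: hyper_sheaf ?X "{..N}" F G.kap H j a
      unfolding hyper_sheaf_def using E hp by blast
    have ft: "finite_type_on ?X ?X F" using assms(2) unfolding coherent_def by blast
    obtain Psi where "reduction ?X {..N} H j a K.stk (length b) (\<lambda>i. b ! i) Psi"
      using K.reduction_exists[OF conjunct1[OF A] stk_finite[OF ft E]] by blast
    then interpret R: reduction ?X "{..N}" H j a K.stk "length b" "\<lambda>i. b ! i" Psi .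
    have H1: "H1_vanishes ?X (twist ?X F t) \<longleftrightarrow> cousin ?X (K.St t)" for t by (rule H1_twist[OF E])
    have "cousin ?X (K.St (- (b ! i) - 1))" if i: "i < length b" for i
    \<comment> \<open>For a plane the degrees \<open>- (b ! i) - 1\<close> are covered by the
      hypothesis, as \<open>last b\<close> is the least entry of \<open>b\<close>; otherwise
      vanishing is carried upwards from small degrees.\<close>
    proof (cases "N = 2")
      case True
      have "last b \<le> b ! i"
      proof (cases "i = length b - 1")
        case True
        thus ?thesis using assms(5) by (simp add: last_conv_nth)
      next
        case False
        thus ?thesis using sorted_wrt_nth_less[OF assms(6), of i "length b - 1"] i assms(5) by (simp add: last_conv_nth)
      qed
      thus ?thesis using A True H1 by auto
    next
      case False
      then obtain t0 where t0: "\<forall>t\<le>t0. cousin ?X (K.St t)" and N: "N \<ge> 3" using A H1 by auto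
      have "cousin ?X (K.St t)" if "t \<ge> t0" for t
        using that
      proof (induction t rule: int_ge_induct)
        case base
        thus ?case using t0 by blast
      next
        case (step t)
        \<comment> \<open>\<open>H\<close> has \<open>N\<close> homogeneous coordinates, so
          \<open>N >= 3\<close> provides the vanishing on \<open>H\<close> that carries the
          induction.\<close>
        thus ?case using R.cousin_up[of "t + 1"] R.cousin_OH[of "t + 1"] cJ' N by simp
      qed
      thus ?thesis using t0 linear by blast
    qed
    then obtain s' where lb: "lifted_basis ?X {..N} H j a K.stk (length b) (\<lambda>i. b ! i) Psi s'"
      using R.stalks_split cJ' assms(1) by metis
    show "sheaf_iso ?X F (sum_of_twists ?X b)"
      by (rule iso_emb[OF G.embsheaf_kap embsheaf_comb(1)[OF lb] embsheaf_comb(2)[OF lb, symmetric] smult_sum_empty])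
  qed
qed

end
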